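(* Let $n\ge 2$, let $\mathbb F_n$ be the free group on $n$ generators, and let $(P_t)_{t\ge 0}$ be the Poisson semigroup on its group von Neumann algebra $\widehat{\mathbb F_n}$, determined by $P_t(\lambda_g)=e^{-t|g|}\lambda_g$ for $g\in\mathbb F_n$. Let $1<p\le q<\infty$ and $t\ge 0$. Then $$\|P_t x\|_q\le \|x\|_p\qquad\text{for all } x\in L_p(\widehat{\mathbb F_n})$$ holds if and only if $$t\ge \frac12\log\frac{q-1}{p-1}.$$
   Context: $|g|$ denotes the reduced word length of $g\in\mathbb F_n$ with respect to the $n$ free generators and their inverses. $\lambda:\mathbb F_n\to B(\ell_2(\mathbb F_n))$ is the left regular representation, and $\widehat{\mathbb F_n}$ denotes the von Neumann algebra generated by $\{\lambda_g: g\in\mathbb F_n\}$, equipped with the canonical tracial state $\tau$ given by $\tau(\lambda_g)=\delta_{g,e}$. $L_p(\widehat{\mathbb F_n})$ is the associated noncommutative $L_p$-space, with norm $\|x\|_p=\tau(|x|^p)^{1/p}$ for $1\le p<\infty$. The maps $P_t$ (defined on the $\lambda_g$ as in the claim) form a symmetric, unital, trace-preserving, completely positive semigroup on $\widehat{\mathbb F_n}$, and extend to contractions on $L_p(\widehat{\mathbb F_n})$ for all $p\ge1$. The inequality $\|P_tx\|_q\le\|x\|_p$ includes the assertion that $P_tx\in L_q(\widehat{\mathbb F_n})$. *)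

theory Defs
  imports "HOL-Analysis.Analysis" "HOL-Computational_Algebra.Polynomial"
begin

section \<open>The free group on the generators \<open>'n\<close>\<close>

text \<open>The letter \<open>(a, True)\<close> stands for the generator \<open>a\<close>, and \<open>(a, False)\<close> for its inverse.\<close>

type_synonym 'n letter = "'n \<times> bool"

definition inv_letter :: "'n letter \<Rightarrow> 'n letter" where
  "inv_letter x = (fst x, \<not> snd x)"

definition reduced_word :: "'n letter list \<Rightarrow> bool" where
  "reduced_word w \<longleftrightarrow> successively (\<lambda>x y. y \<noteq> inv_letter x) w"

text \<open>The reduced form of \<open>x # w\<close>, for reduced \<open>w\<close>.\<close>

definition cons_red :: "'n letter \<Rightarrow> 'n letter list \<Rightarrow> 'n letter list" where
  "cons_red x w = (if w \<noteq> [] \<and> hd w = inv_letter x then tl w else x # w)"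

lemma inv_letter_inv [simp]: "inv_letter (inv_letter x) = x"
  by (simp add: inv_letter_def)

lemma reduced_Nil [simp]: "reduced_word []"
  by (simp add: reduced_word_def)

lemma reduced_tl: "reduced_word w \<Longrightarrow> reduced_word (tl w)"
  by (cases w) (auto simp: reduced_word_def successively_Cons)

lemma reduced_cons_red: "reduced_word w \<Longrightarrow> reduced_word (cons_red x w)"
  unfolding cons_red_def using reduced_tl[of w]
  by (auto simp: reduced_word_def successively_Cons)

lemma reduced_foldr: "reduced_word w \<Longrightarrow> reduced_word (foldr cons_red u w)"
  by (induction u) (auto intro: reduced_cons_red)

lemma cons_red_cancel: "reduced_word w \<Longrightarrow> cons_red x (cons_red (inv_letter x) w) = w"
  by (cases w) (auto simp: cons_red_def reduced_word_def successively_Cons)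

lemma foldr_cons_red:
  "reduced_word w \<Longrightarrow> foldr cons_red (cons_red x v) w = cons_red x (foldr cons_red v w)"
proof (cases "v \<noteq> [] \<and> hd v = inv_letter x")
  case True
  assume w: "reduced_word w"
  from True obtain ys where v: "v = inv_letter x # ys" by (cases v) auto
  show ?thesis
    using cons_red_cancel[OF reduced_foldr[OF w, of ys], of x]
    by (simp add: v cons_red_def[of x "inv_letter x # ys"])
next
  case False
  then have "cons_red x v = x # v" unfolding cons_red_def by (simp only: if_False)
  then show ?thesis by simp
qed

lemma foldr_cons_red_assoc:
  "reduced_word w \<Longrightarrow>
    foldr cons_red (foldr cons_red u v) w = foldr cons_red u (foldr cons_red v w)"
  by (induction u) (auto simp: foldr_cons_red)

lemma foldr_cons_red_Nil: "reduced_word w \<Longrightarrow> foldr cons_red w [] = w"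
  by (induction w) (auto simp: reduced_word_def successively_Cons cons_red_def)

lemma reduced_inverse: "reduced_word w \<Longrightarrow> reduced_word (rev (map inv_letter w))"
  unfolding reduced_word_def successively_rev successively_map
  by (erule successively_mono) (metis inv_letter_inv)

lemma foldr_inverse_left:
  "reduced_word w \<Longrightarrow> foldr cons_red (rev (map inv_letter w)) w = []"
proof (induction w)
  case (Cons x w)
  then have "reduced_word w" using reduced_tl by force
  moreover have "cons_red (inv_letter x) (x # w) = w" by (simp add: cons_red_def)
  ultimately show ?case using Cons.IH by simp
qed simp

typedef 'n free_group = "{w :: 'n letter list. reduced_word w}"
  morphisms word_of Abs_free_group
  by (rule exI[of _ "[]"]) simp

setup_lifting type_definition_free_group

instantiation free_group :: (type) "{monoid_mult, inverse}"
begin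

lift_definition one_free_group :: "'a free_group" is "[]" by simp

lift_definition times_free_group :: "'a free_group \<Rightarrow> 'a free_group \<Rightarrow> 'a free_group"
  is "foldr cons_red" by (rule reduced_foldr)

lift_definition inverse_free_group :: "'a free_group \<Rightarrow> 'a free_group"
  is "\<lambda>w. rev (map inv_letter w)" by (rule reduced_inverse)

definition divide_free_group :: "'a free_group \<Rightarrow> 'a free_group \<Rightarrow> 'a free_group" where
  "divide_free_group g h = g * inverse h"

instance
proof
  fix a b c :: "'a free_group"
  show "a * b * c = a * (b * c)" "1 * a = a" "a * 1 = a"
    by (transfer; simp add: foldr_cons_red_assoc foldr_cons_red_Nil)+
qed

end

lift_definition word_length :: "'n free_group \<Rightarrow> nat" is length .

lemma free_group_left_inverse [simp]: "inverse g * g = (1 :: 'n free_group)"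
  by transfer (rule foldr_inverse_left)

lemma free_group_inverse_inverse [simp]: "inverse (inverse g) = (g :: 'n free_group)"
  by transfer (simp add: rev_map comp_def)

lemma free_group_right_inverse [simp]: "g * inverse g = (1 :: 'n free_group)"
  using free_group_left_inverse[of "inverse g"] by simp

lemma free_group_cancel [simp]:
  "inverse g * (g * h) = (h :: 'n free_group)" "g * (inverse g * h) = (h :: 'n free_group)"
  by (simp_all flip: mult.assoc)

lemma bij_mult_left: "bij (\<lambda>h. (g :: 'n free_group) * h)"
  by (rule bij_betw_byWitness[where f' = "\<lambda>h. inverse g * h"]) auto

lemma bij_mult_right: "bij (\<lambda>h. h * (g :: 'n free_group))"
  by (rule bij_betw_byWitness[where f' = "\<lambda>h. h * inverse g"]) (auto simp: mult.assoc)


section \<open>The Hilbert space \<open>\<ell>\<^sub>2\<close>\<close>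

typedef 'a ell2 = "{f :: 'a \<Rightarrow> complex. (\<lambda>x. (cmod (f x))\<^sup>2) summable_on UNIV}"
  by (rule exI[of _ "\<lambda>_. 0"]) simp

setup_lifting type_definition_ell2

lemma ell2_prod_abs_summable:
  fixes f g :: "'a \<Rightarrow> complex"
  assumes "(\<lambda>x. (cmod (f x))\<^sup>2) summable_on UNIV" "(\<lambda>x. (cmod (g x))\<^sup>2) summable_on UNIV"
  shows "(\<lambda>x. cmod (f x * cnj (g x))) summable_on UNIV"
proof (rule Infinite_Sum.abs_summable_on_comparison_test')
  show "(\<lambda>x. (cmod (f x))\<^sup>2 + (cmod (g x))\<^sup>2) summable_on UNIV"
    by (intro summable_on_add assms)
  fix x
  have "0 \<le> (cmod (f x) - cmod (g x))\<^sup>2" by simp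
  moreover have "0 \<le> cmod (f x) * cmod (g x)" by simp
  ultimately show "cmod (f x * cnj (g x)) \<le> (cmod (f x))\<^sup>2 + (cmod (g x))\<^sup>2"
    unfolding norm_mult complex_mod_cnj power2_diff by linarith
qed

lemma ell2_add_summable:
  fixes f g :: "'a \<Rightarrow> complex"
  assumes "(\<lambda>x. (cmod (f x))\<^sup>2) summable_on UNIV" "(\<lambda>x. (cmod (g x))\<^sup>2) summable_on UNIV"
  shows "(\<lambda>x. (cmod (f x + g x))\<^sup>2) summable_on UNIV"
proof (rule summable_on_comparison_test)
  show "(\<lambda>x. 2 * (cmod (f x))\<^sup>2 + 2 * (cmod (g x))\<^sup>2) summable_on UNIV"
    by (intro summable_on_add summable_on_cmult_right assms)
  fix x
  have "(cmod (f x + g x))\<^sup>2 \<le> (cmod (f x) + cmod (g x))\<^sup>2"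
    by (intro power_mono norm_triangle_ineq) simp
  moreover have "0 \<le> (cmod (f x) - cmod (g x))\<^sup>2" by simp
  ultimately show "(cmod (f x + g x))\<^sup>2 \<le> 2 * (cmod (f x))\<^sup>2 + 2 * (cmod (g x))\<^sup>2"
    unfolding power2_diff power2_sum by linarith
qed simp

lemma ell2_scale_summable:
  fixes f :: "'a \<Rightarrow> complex"
  assumes "(\<lambda>x. (cmod (f x))\<^sup>2) summable_on UNIV"
  shows "(\<lambda>x. (cmod (c * f x))\<^sup>2) summable_on UNIV"
  unfolding norm_mult power_mult_distrib by (intro summable_on_cmult_right assms)

lemma Re_infsum_mult_cnj:
  fixes f :: "'a \<Rightarrow> complex"
  assumes "(\<lambda>x. (cmod (f x))\<^sup>2) summable_on UNIV"
  shows "Re (\<Sum>\<^sub>\<infinity>x. f x * cnj (f x)) = (\<Sum>\<^sub>\<infinity>x. (cmod (f x))\<^sup>2)"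
proof -
  have "(\<lambda>x. cmod (f x * cnj (f x))) summable_on UNIV"
    by (rule ell2_prod_abs_summable[OF assms assms])
  then have "(\<lambda>x. f x * cnj (f x)) summable_on UNIV" by (rule abs_summable_summable)
  then have "Re (\<Sum>\<^sub>\<infinity>x. f x * cnj (f x)) = (\<Sum>\<^sub>\<infinity>x. Re (f x * cnj (f x)))"
    by (rule infsum_Re[symmetric])
  also have "\<dots> = (\<Sum>\<^sub>\<infinity>x. (cmod (f x))\<^sup>2)"
    by (rule infsum_cong) (simp add: cmod_power2 flip: power2_eq_square)
  finally show ?thesis .
qed

lift_definition scaleC :: "complex \<Rightarrow> 'a ell2 \<Rightarrow> 'a ell2"
  is "\<lambda>c f x. c * f x" by (rule ell2_scale_summable)

lift_definition cinner :: "'a ell2 \<Rightarrow> 'a ell2 \<Rightarrow> complex"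
  is "\<lambda>f g. \<Sum>\<^sub>\<infinity>x. f x * cnj (g x)" .

lemma cinner_commute: "cinner v w = cnj (cinner w v)"
  by transfer (simp add: mult.commute flip: infsum_cnj)

instantiation ell2 :: (type) real_inner
begin

lift_definition zero_ell2 :: "'a ell2" is "\<lambda>_. 0" by simp

lift_definition uminus_ell2 :: "'a ell2 \<Rightarrow> 'a ell2" is "\<lambda>f x. - f x" by simp

lift_definition plus_ell2 :: "'a ell2 \<Rightarrow> 'a ell2 \<Rightarrow> 'a ell2" is "\<lambda>f g x. f x + g x"
  by (rule ell2_add_summable)

lift_definition minus_ell2 :: "'a ell2 \<Rightarrow> 'a ell2 \<Rightarrow> 'a ell2" is "\<lambda>f g x. f x - g x"
  using ell2_add_summable[where g = "\<lambda>x. - g x" for g] by simp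

lift_definition scaleR_ell2 :: "real \<Rightarrow> 'a ell2 \<Rightarrow> 'a ell2" is "\<lambda>r f x. of_real r * f x"
  by (rule ell2_scale_summable)

definition inner_ell2 :: "'a ell2 \<Rightarrow> 'a ell2 \<Rightarrow> real" where
  "inner_ell2 f g = Re (cinner f g)"

definition norm_ell2 :: "'a ell2 \<Rightarrow> real" where
  "norm_ell2 f = sqrt (inner f f)"

definition sgn_ell2 :: "'a ell2 \<Rightarrow> 'a ell2" where
  "sgn_ell2 f = scaleR (inverse (norm f)) f"

definition dist_ell2 :: "'a ell2 \<Rightarrow> 'a ell2 \<Rightarrow> real" where
  "dist_ell2 f g = norm (f - g)"

definition uniformity_ell2 :: "('a ell2 \<times> 'a ell2) filter" where
  "uniformity_ell2 = (INF e\<in>{0<..}. principal {(x, y). dist x y < e})"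

definition open_ell2 :: "'a ell2 set \<Rightarrow> bool" where
  "open_ell2 U \<longleftrightarrow> (\<forall>x\<in>U. eventually (\<lambda>(x', y). x' = x \<longrightarrow> y \<in> U) uniformity)"

instance
proof
  fix x y z :: "'a ell2" and r s :: real
  show "x + y + z = x + (y + z)" "x + y = y + x" "0 + x = x" "- x + x = 0" "x - y = x + - y"
    "r *\<^sub>R (x + y) = r *\<^sub>R x + r *\<^sub>R y" "(r + s) *\<^sub>R x = r *\<^sub>R x + s *\<^sub>R x"
    "r *\<^sub>R s *\<^sub>R x = (r * s) *\<^sub>R x" "1 *\<^sub>R x = x"
    by (transfer; simp add: algebra_simps)+
  show "sgn x = inverse (norm x) *\<^sub>R x" by (simp add: sgn_ell2_def)
  show "dist x y = norm (x - y)" by (simp add: dist_ell2_def)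
  show "uniformity = (INF e\<in>{0<..}. principal {(x :: 'a ell2, y). dist x y < e})"
    by (simp add: uniformity_ell2_def)
  show "open U \<longleftrightarrow> (\<forall>x\<in>U. eventually (\<lambda>(x', y). x' = x \<longrightarrow> y \<in> U) uniformity)"
    for U :: "'a ell2 set" by (simp add: open_ell2_def)
  show "norm x = sqrt (inner x x)" by (simp add: norm_ell2_def)
  show "inner x y = inner y x"
    unfolding inner_ell2_def by (subst cinner_commute) simp
  have "cinner (x + y) z = cinner x z + cinner y z"
  proof transfer
    fix f g h :: "'a \<Rightarrow> complex"
    assume "(\<lambda>x. (cmod (f x))\<^sup>2) summable_on UNIV" "(\<lambda>x. (cmod (g x))\<^sup>2) summable_on UNIV"
      "(\<lambda>x. (cmod (h x))\<^sup>2) summable_on UNIV"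
    then show "(\<Sum>\<^sub>\<infinity>x. (f x + g x) * cnj (h x)) =
        (\<Sum>\<^sub>\<infinity>x. f x * cnj (h x)) + (\<Sum>\<^sub>\<infinity>x. g x * cnj (h x))"
      unfolding ring_distribs
      by (intro infsum_add) (rule abs_summable_summable, rule ell2_prod_abs_summable; assumption)+
  qed
  then show "inner (x + y) z = inner x z + inner y z" by (simp add: inner_ell2_def)
  have "cinner (r *\<^sub>R x) y = of_real r * cinner x y"
    by transfer (simp add: mult.assoc infsum_cmult_right')
  then show "inner (r *\<^sub>R x) y = r * inner x y" by (simp add: inner_ell2_def)
  have sq: "inner x x = (\<Sum>\<^sub>\<infinity>a. (cmod (Rep_ell2 x a))\<^sup>2)"
    unfolding inner_ell2_def by transfer (rule Re_infsum_mult_cnj)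
  then show "0 \<le> inner x x" by (simp add: infsum_nonneg)
  have "Rep_ell2 x a = 0" if "inner x x = 0" for a
  proof -
    have "(cmod (Rep_ell2 x a))\<^sup>2 = 0"
      by (rule nonneg_infsum_le_0D[where A = UNIV]) (use that sq Rep_ell2[of x] in auto)
    then show ?thesis by simp
  qed
  moreover have "inner x x = 0" if "x = 0"
    unfolding sq using that by (simp add: zero_ell2.rep_eq)
  ultimately show "inner x x = 0 \<longleftrightarrow> x = 0"
    by (metis Rep_ell2_inject ext zero_ell2.rep_eq)
qed

end

lemma norm_ell2_sq: "(norm (x :: 'a ell2))\<^sup>2 = (\<Sum>\<^sub>\<infinity>a. (cmod (Rep_ell2 x a))\<^sup>2)"
  unfolding power2_norm_eq_inner[of x] inner_ell2_def by transfer (rule Re_infsum_mult_cnj)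

lift_definition delta :: "'a \<Rightarrow> 'a ell2" is "\<lambda>a x. if x = a then 1 else 0"
proof -
  fix a :: 'a
  have "(\<lambda>x. (cmod (if x = a then 1 else 0))\<^sup>2) summable_on {a}" by simp
  then show "(\<lambda>x. (cmod (if x = a then 1 else 0))\<^sup>2) summable_on UNIV"
    by (rule summable_on_cong_neutral[THEN iffD1, rotated -1]) auto
qed


lemma cinner_delta: "cinner v (delta a) = Rep_ell2 v a"
proof -
  have "cinner v (delta a) = (\<Sum>\<^sub>\<infinity>x\<in>{a}. Rep_ell2 v x)"
    unfolding cinner.rep_eq delta.rep_eq by (rule infsum_cong_neutral) auto
  then show ?thesis by simp
qed

lemma ell2_eqI: "(\<And>a. Rep_ell2 v a = Rep_ell2 w a) \<Longrightarrow> v = w"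
  by (metis Rep_ell2_inject ext)

lemma bounded_linear_Rep_ell2: "bounded_linear (\<lambda>v. Rep_ell2 v a)"
proof (rule bounded_linear_intro[where K = 1])
  fix v w :: "'a ell2" and r :: real
  show "Rep_ell2 (v + w) a = Rep_ell2 v a + Rep_ell2 w a"
    "Rep_ell2 (r *\<^sub>R v) a = r *\<^sub>R Rep_ell2 v a"
    by (simp_all add: plus_ell2.rep_eq scaleR_ell2.rep_eq scaleR_conv_of_real)
  have "(\<Sum>\<^sub>\<infinity>b\<in>{a}. (cmod (Rep_ell2 v b))\<^sup>2) \<le> (norm v)\<^sup>2"
    unfolding norm_ell2_sq
    by (rule infsum_mono_neutral) (use Rep_ell2[of v] in auto)
  then have "(cmod (Rep_ell2 v a))\<^sup>2 \<le> (norm v)\<^sup>2" by simp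
  then show "norm (Rep_ell2 v a) \<le> norm v * 1" using power2_le_imp_le by fastforce
qed

lemma Rep_ell2_sum: "Rep_ell2 (sum f F) a = (\<Sum>b\<in>F. Rep_ell2 (f b) a)"
  by (rule linear_sum) (simp add: bounded_linear_Rep_ell2 bounded_linear.linear)

lemma ell2_delta_tendsto:
  "((\<lambda>F. \<Sum>a\<in>F. scaleC (Rep_ell2 v a) (delta a)) \<longlongrightarrow> v) (finite_subsets_at_top UNIV)"
proof -
  let ?s = "\<lambda>F. \<Sum>a\<in>F. scaleC (Rep_ell2 v a) (delta a)"
  let ?f = "\<lambda>a. (cmod (Rep_ell2 v a))\<^sup>2"
  have sm: "?f summable_on UNIV" using Rep_ell2[of v] by simp
  have Rs: "Rep_ell2 (?s F) b = (if b \<in> F then Rep_ell2 v b else 0)" if "finite F" for F b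
    using that by (simp add: Rep_ell2_sum scaleC.rep_eq delta.rep_eq if_distrib cong: if_cong)
  have eq: "(norm (v - ?s F))\<^sup>2 = infsum ?f UNIV - sum ?f F" if F: "finite F" for F
  proof -
    have "(norm (v - ?s F))\<^sup>2 = infsum ?f (UNIV - F)"
      unfolding norm_ell2_sq minus_ell2.rep_eq Rs[OF F] by (rule infsum_cong_neutral) auto
    also have "\<dots> = infsum ?f UNIV - infsum ?f F"
      using F sm by (intro infsum_Diff) auto
    finally show ?thesis using F by simp
  qed
  have "((\<lambda>F. infsum ?f UNIV - sum ?f F) \<longlongrightarrow> infsum ?f UNIV - infsum ?f UNIV)
      (finite_subsets_at_top UNIV)"
    by (intro tendsto_diff tendsto_const infsum_tendsto sm)
  from tendsto_real_sqrt[OF this]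
  have "((\<lambda>F. sqrt (infsum ?f UNIV - sum ?f F)) \<longlongrightarrow> 0) (finite_subsets_at_top UNIV)" by simp
  then have "((\<lambda>F. dist (?s F) v) \<longlongrightarrow> 0) (finite_subsets_at_top UNIV)"
  proof (rule Lim_transform_eventually)
    have "sqrt (infsum ?f UNIV - sum ?f F) = dist (?s F) v" if "finite F" for F
      unfolding eq[OF that, symmetric] by (simp add: dist_norm norm_minus_commute)
    then show "\<forall>\<^sub>F F in finite_subsets_at_top UNIV.
        sqrt (infsum ?f UNIV - sum ?f F) = dist (?s F) v"
      by (intro eventually_finite_subsets_at_top_weakI)
  qed
  then show ?thesis by (rule tendsto_dist_iff[THEN iffD2])
qed


section \<open>Bounded operators\<close>

text \<open>The library's bounded linear maps \<open>\<Rightarrow>\<^sub>L\<close> are only real linear, so that \<open>B(\<ell>\<^sub>2)\<close> is the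
  set \<open>bounded_ops\<close> of the complex linear ones among them.\<close>

type_synonym 'a op = "'a ell2 \<Rightarrow>\<^sub>L 'a ell2"

definition bounded_ops :: "'a op set" where
  "bounded_ops = {T :: 'a op. \<forall>c v. T (scaleC c v) = scaleC c (T v)}"

lemma bounded_linear_scaleC: "bounded_linear (scaleC c)"
proof (rule bounded_linear_intro[where K = "cmod c"])
  fix x y :: "'a ell2" and r :: real
  show "scaleC c (x + y) = scaleC c x + scaleC c y" "scaleC c (r *\<^sub>R x) = r *\<^sub>R scaleC c x"
    by (transfer; simp add: algebra_simps)+
  have "(norm (scaleC c x))\<^sup>2 = (norm x * cmod c)\<^sup>2"
    unfolding power_mult_distrib norm_ell2_sq scaleC.rep_eq norm_mult infsum_cmult_right'
    by (rule mult.commute)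
  then show "norm (scaleC c x) \<le> norm x * cmod c" by (simp add: power2_eq_iff_nonneg)
qed

definition scaleC_op :: "complex \<Rightarrow> 'a op \<Rightarrow> 'a op" where
  "scaleC_op c T = Blinfun (\<lambda>v. scaleC c (T v))"

lemma scaleC_op_apply: "scaleC_op c T v = scaleC c (T v)"
  unfolding scaleC_op_def
  by (intro bounded_linear_Blinfun_apply[THEN fun_cong]
      bounded_linear_compose[OF bounded_linear_scaleC] blinfun.bounded_linear_right)

definition adj :: "'a op \<Rightarrow> 'a op" where
  "adj T = (THE S. S \<in> bounded_ops \<and> (\<forall>u v. cinner (T u) v = cinner u (S v)))"

lemma op_eqI_delta:
  fixes T S :: "'a op"
  assumes "T \<in> bounded_ops" "S \<in> bounded_ops" and eq: "\<And>a. T (delta a) = S (delta a)"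
  shows "T = S"
proof (rule blinfun_eqI)
  fix v :: "'a ell2"
  let ?s = "\<lambda>F. \<Sum>a\<in>F. scaleC (Rep_ell2 v a) (delta a)"
  have T: "((\<lambda>F. T (?s F)) \<longlongrightarrow> T v) (finite_subsets_at_top UNIV)"
    by (rule blinfun.tendsto[OF tendsto_const ell2_delta_tendsto])
  have S: "((\<lambda>F. S (?s F)) \<longlongrightarrow> S v) (finite_subsets_at_top UNIV)"
    by (rule blinfun.tendsto[OF tendsto_const ell2_delta_tendsto])
  have "T (?s F) = S (?s F)" for F
    unfolding blinfun.sum_right using assms by (simp add: bounded_ops_def)
  with T have "((\<lambda>F. S (?s F)) \<longlongrightarrow> T v) (finite_subsets_at_top UNIV)" by simp
  then show "T v = S v"
    by (rule tendsto_unique[OF finite_subsets_at_top_neq_bot _ S])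
qed

lemma adj_eqI:
  fixes T S :: "'a op"
  assumes "S \<in> bounded_ops" and S: "\<And>u v. cinner (T u) v = cinner u (S v)"
  shows "adj T = S"
  unfolding adj_def
proof (rule the_equality)
  show "S \<in> bounded_ops \<and> (\<forall>u v. cinner (T u) v = cinner u (S v))" using assms by blast
  fix S' assume S': "S' \<in> bounded_ops \<and> (\<forall>u v. cinner (T u) v = cinner u (S' v))"
  have "cnj (Rep_ell2 (S' v) a) = cnj (Rep_ell2 (S v) a)" for v a
  proof -
    have c: "cinner (delta a) w = cnj (Rep_ell2 w a)" for w :: "'a ell2"
      unfolding cinner_delta[symmetric] by (rule cinner_commute)
    have "cinner (delta a) (S' v) = cinner (delta a) (S v)"
      using S[of "delta a" v] S' by simp
    then show ?thesis unfolding c .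
  qed
  then show "S' = S" by (intro blinfun_eqI ell2_eqI) simp
qed

definition commutant :: "'a op set \<Rightarrow> 'a op set" where
  "commutant A = {T \<in> bounded_ops. \<forall>S\<in>A. T o\<^sub>L S = S o\<^sub>L T}"

definition op_poly :: "real poly \<Rightarrow> 'a op \<Rightarrow> 'a op" where
  "op_poly r T = (\<Sum>i\<le>degree r. coeff r i *\<^sub>R (((o\<^sub>L) T) ^^ i) id_blinfun)"

text \<open>Continuous functional calculus for a positive operator \<open>T\<close> (whose spectrum is contained in
  \<open>[0, \<parallel>T\<parallel>]\<close>) and a continuous \<open>f\<close>: the norm limit of \<open>r\<^sub>k(T)\<close> for polynomials \<open>r\<^sub>k\<close> that tend to
  \<open>f\<close> uniformly on that interval.\<close>

definition pos_calc :: "(real \<Rightarrow> real) \<Rightarrow> 'a op \<Rightarrow> 'a op" where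
  "pos_calc f T = (THE S. \<forall>r :: nat \<Rightarrow> real poly.
     uniform_limit {0..norm T} (\<lambda>k. poly (r k)) f sequentially \<longrightarrow>
     (\<lambda>k. op_poly (r k) T) \<longlonglongrightarrow> S)"

definition op_abs :: "'a op \<Rightarrow> 'a op" where
  "op_abs T = pos_calc sqrt (adj T o\<^sub>L T)"

text \<open>Used for \<open>p > 0\<close> only, where \<open>0 powr p = 0\<close> makes \<open>s \<mapsto> s powr p\<close> continuous on
  \<open>[0, \<infinity>)\<close>.\<close>

definition op_powr :: "'a op \<Rightarrow> real \<Rightarrow> 'a op" where
  "op_powr T p = pos_calc (\<lambda>s. s powr p) T"


section \<open>The von Neumann algebra of the free group\<close>

text \<open>Left regular representation: \<open>\<lambda>\<^sub>g \<delta>\<^sub>h = \<delta>\<^sub>g\<^sub>h\<close>.\<close>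

lift_definition translate_left :: "'n free_group \<Rightarrow> 'n free_group ell2 \<Rightarrow> 'n free_group ell2"
  is "\<lambda>(g :: 'n free_group) f h. f (inverse g * h)"
  by (subst summable_on_reindex_bij_betw[OF bij_mult_left, of "\<lambda>x. (cmod (f x))\<^sup>2" for f])

lift_definition lreg :: "'n free_group \<Rightarrow> 'n free_group op" is translate_left
proof (rule bounded_linear_intro[where K = 1])
  fix g and x y :: "'a free_group ell2" and r :: real
  show "translate_left g (x + y) = translate_left g x + translate_left g y"
    "translate_left g (r *\<^sub>R x) = r *\<^sub>R translate_left g x"
    by (transfer; simp)+
  have "(norm (translate_left g x))\<^sup>2 = (norm x)\<^sup>2"
    unfolding norm_ell2_sq translate_left.rep_eq
    by (rule infsum_reindex_bij_betw[OF bij_mult_left])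
  then show "norm (translate_left g x) \<le> norm x * 1" by (simp add: power2_eq_iff_nonneg)
qed

lemma lreg_apply: "Rep_ell2 (lreg g v) h = Rep_ell2 v (inverse g * h)"
  by (simp add: lreg.rep_eq translate_left.rep_eq)

lemma lreg_delta: "lreg g (delta h) = delta (g * h)"
proof (rule ell2_eqI)
  fix k
  have "inverse g * k = h \<longleftrightarrow> k = g * h" by auto
  then show "Rep_ell2 (lreg g (delta h)) k = Rep_ell2 (delta (g * h)) k"
    by (simp add: lreg_apply delta.rep_eq)
qed

lemma lreg_in_bounded_ops: "lreg g \<in> bounded_ops"
  unfolding bounded_ops_def by (auto intro!: ell2_eqI simp: lreg_apply scaleC.rep_eq)

lemma adj_lreg: "adj (lreg g) = lreg (inverse g)"
proof (rule adj_eqI[OF lreg_in_bounded_ops])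
  fix u v
  show "cinner (lreg g u) v = cinner u (lreg (inverse g) v)"
    unfolding cinner.rep_eq lreg_apply
    using infsum_reindex_bij_betw[OF bij_mult_left, of
        "\<lambda>h. Rep_ell2 u (inverse g * h) * cnj (Rep_ell2 v h)" g]
    by simp
qed

text \<open>The generating set is closed under adjoints (\<open>adj_lreg\<close>); hence the von Neumann
  algebra that it generates is its bicommutant.\<close>

definition group_vN :: "'n free_group op set" where
  "group_vN = commutant (commutant (range lreg))"

definition vN_trace :: "'n free_group op \<Rightarrow> complex" where
  "vN_trace x = cinner (x (delta 1)) (delta 1)"

text \<open>The Poisson semigroup on the von Neumann algebra: the Fourier multiplier
  \<open>\<Sum>\<^sub>g c\<^sub>g \<lambda>\<^sub>g \<mapsto> \<Sum>\<^sub>g e\<^bsup>-t|g|\<^esup> c\<^sub>g \<lambda>\<^sub>g\<close>, where \<open>c\<^sub>g = \<tau>(\<lambda>\<^sub>g\<^sup>* x)\<close>.\<close>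

definition fourier_coeff :: "'n free_group op \<Rightarrow> 'n free_group \<Rightarrow> complex" where
  "fourier_coeff x g = vN_trace (lreg (inverse g) o\<^sub>L x)"

definition poisson :: "real \<Rightarrow> 'n free_group op \<Rightarrow> 'n free_group op" where
  "poisson t x = (THE y. y \<in> group_vN \<and>
     (\<forall>g. fourier_coeff y g = of_real (exp (- t * real (word_length g))) * fourier_coeff x g))"


text \<open>Right translations lie in the commutant; hence an element of the algebra is determined by its
  Fourier coefficients, and \<open>poisson\<close> takes the expected value on each \<open>\<lambda>\<^sub>g\<close>
  (\<open>poisson_lreg\<close>).\<close>

lift_definition translate_right :: "'n free_group \<Rightarrow> 'n free_group ell2 \<Rightarrow> 'n free_group ell2"
  is "\<lambda>(g :: 'n free_group) f h. f (h * g)"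
  by (subst summable_on_reindex_bij_betw[OF bij_mult_right, of "\<lambda>x. (cmod (f x))\<^sup>2" for f])

lift_definition rreg :: "'n free_group \<Rightarrow> 'n free_group op" is translate_right
proof (rule bounded_linear_intro[where K = 1])
  fix g and x y :: "'a free_group ell2" and r :: real
  show "translate_right g (x + y) = translate_right g x + translate_right g y"
    "translate_right g (r *\<^sub>R x) = r *\<^sub>R translate_right g x"
    by (transfer; simp)+
  have "(norm (translate_right g x))\<^sup>2 = (norm x)\<^sup>2"
    unfolding norm_ell2_sq translate_right.rep_eq
    by (rule infsum_reindex_bij_betw[OF bij_mult_right])
  then show "norm (translate_right g x) \<le> norm x * 1" by (simp add: power2_eq_iff_nonneg)
qed

lemma rreg_in_commutant: "rreg g \<in> commutant (range lreg)"
  unfolding commutant_def bounded_ops_def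
  by (auto intro!: ell2_eqI blinfun_eqI
      simp: rreg.rep_eq translate_right.rep_eq lreg_apply scaleC.rep_eq mult.assoc)

lemma fourier_coeff_eq: "fourier_coeff x g = Rep_ell2 (x (delta 1)) g"
  by (simp add: fourier_coeff_def vN_trace_def cinner_delta lreg_apply)

lemma group_vN_eqI:
  fixes x y :: "'a free_group op"
  assumes x: "x \<in> group_vN" and y: "y \<in> group_vN"
    and eq: "\<And>g. fourier_coeff x g = fourier_coeff y g"
  shows "x = y"
proof (rule op_eqI_delta)
  show "x \<in> bounded_ops" "y \<in> bounded_ops" using x y by (auto simp: group_vN_def commutant_def)
  fix h
  have *: "z (delta h) = rreg (inverse h) (z (delta 1))" if "z \<in> group_vN" for z :: "'a free_group op"
  proof -
    have "z o\<^sub>L rreg (inverse h) = rreg (inverse h) o\<^sub>L z"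
      using that rreg_in_commutant by (auto simp: group_vN_def commutant_def[of "commutant _"])
    moreover have "rreg (inverse h) (delta 1) = delta h"
    proof (rule ell2_eqI)
      fix k
      have "k * inverse h = 1 \<longleftrightarrow> k = h"
        by (metis free_group_left_inverse free_group_right_inverse mult.assoc mult.right_neutral mult_1)
      then show "Rep_ell2 (rreg (inverse h) (delta 1)) k = Rep_ell2 (delta h) k"
        by (simp add: rreg.rep_eq translate_right.rep_eq delta.rep_eq)
    qed
    ultimately show ?thesis by (metis blinfun_apply_blinfun_compose)
  qed
  have "x (delta 1) = y (delta 1)" using eq by (intro ell2_eqI) (simp add: fourier_coeff_eq)
  then show "x (delta h) = y (delta h)" using *[OF x] *[OF y] by simp
qed

lemma scaleC_lreg_in_group_vN: "scaleC_op c (lreg g) \<in> (group_vN :: 'a free_group op set)"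
proof -
  have "scaleC_op c (lreg g) \<in> bounded_ops"
    unfolding bounded_ops_def
    by (auto intro!: ell2_eqI simp: scaleC_op_apply lreg_apply scaleC.rep_eq)
  moreover have "scaleC_op c (lreg g) o\<^sub>L S = S o\<^sub>L scaleC_op c (lreg g)"
    if "S \<in> commutant (range lreg)" for S :: "'a free_group op"
  proof (rule blinfun_eqI)
    fix v
    have S: "S \<in> bounded_ops" "S o\<^sub>L lreg g = lreg g o\<^sub>L S"
      using that by (auto simp: commutant_def)
    have "S (lreg g v) = lreg g (S v)" using S(2) by (metis blinfun_apply_blinfun_compose)
    moreover have "S (scaleC c w) = scaleC c (S w)" for w
      using S(1) by (simp add: bounded_ops_def)
    ultimately show "(scaleC_op c (lreg g) o\<^sub>L S) v = (S o\<^sub>L scaleC_op c (lreg g)) v"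
      by (simp add: scaleC_op_apply)
  qed
  ultimately show ?thesis by (simp add: group_vN_def commutant_def[of "commutant _"])
qed

lemma poisson_lreg:
  "poisson t (lreg g) = scaleC_op (of_real (exp (- t * real (word_length g)))) (lreg g)"
  unfolding poisson_def
proof (rule the_equality)
  let ?y = "scaleC_op (of_real (exp (- t * real (word_length g)))) (lreg g)"
  show *: "?y \<in> group_vN \<and> (\<forall>h. fourier_coeff ?y h =
      of_real (exp (- t * real (word_length h))) * fourier_coeff (lreg g) h)"
    by (auto simp: scaleC_lreg_in_group_vN fourier_coeff_eq scaleC_op_apply scaleC.rep_eq
        lreg_delta delta.rep_eq)
  fix y assume "y \<in> group_vN \<and> (\<forall>h. fourier_coeff y h =
      of_real (exp (- t * real (word_length h))) * fourier_coeff (lreg g) h)"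
  with * show "y = ?y" by (intro group_vN_eqI) auto
qed


section \<open>Noncommutative \<open>L\<^sub>p\<close> spaces\<close>

definition pnorm :: "real \<Rightarrow> 'n free_group op \<Rightarrow> real" where
  "pnorm p x = Re (vN_trace (op_powr (op_abs x) p)) powr (1 / p)"

text \<open>\<open>L\<^sub>p\<close> is the completion of the von Neumann algebra in the norm \<open>pnorm p\<close>, realised by
  equivalence classes of Cauchy sequences.\<close>

type_synonym 'n Lp_elem = "(nat \<Rightarrow> 'n free_group op) set"

definition Lp_Cauchy :: "real \<Rightarrow> (nat \<Rightarrow> 'n free_group op) set" where
  "Lp_Cauchy p = {X. range X \<subseteq> group_vN \<and>
     (\<forall>e>0. \<exists>N. \<forall>j\<ge>N. \<forall>k\<ge>N. pnorm p (X j - X k) < e)}"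

definition Lp_equiv :: "real \<Rightarrow> ((nat \<Rightarrow> 'n free_group op) \<times> (nat \<Rightarrow> 'n free_group op)) set" where
  "Lp_equiv p = {(X, Y). X \<in> Lp_Cauchy p \<and> Y \<in> Lp_Cauchy p \<and>
     (\<lambda>k. pnorm p (X k - Y k)) \<longlonglongrightarrow> 0}"

definition Lp :: "real \<Rightarrow> 'n Lp_elem set" where
  "Lp p = Lp_Cauchy p // Lp_equiv p"

definition Lp_norm :: "real \<Rightarrow> 'n Lp_elem \<Rightarrow> real" where
  "Lp_norm p x = (THE r. \<forall>X\<in>x. (\<lambda>k. pnorm p (X k)) \<longlonglongrightarrow> r)"

text \<open>The inclusion of \<open>L\<^sub>q\<close> into \<open>L\<^sub>p\<close> for \<open>p \<le> q\<close>. Since \<open>\<tau>\<close> is normalised, \<open>pnorm p \<le> pnorm q\<close>, so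
  that an \<open>L\<^sub>q\<close> class is contained in exactly one \<open>L\<^sub>p\<close> class.\<close>

definition Lp_incl :: "real \<Rightarrow> 'n Lp_elem \<Rightarrow> 'n Lp_elem" where
  "Lp_incl p y = (THE x. x \<in> Lp p \<and> y \<subseteq> x)"

text \<open>Extension of \<open>poisson t\<close> to \<open>L\<^sub>p\<close> by continuity.\<close>

definition Lp_poisson :: "real \<Rightarrow> real \<Rightarrow> 'n Lp_elem \<Rightarrow> 'n Lp_elem" where
  "Lp_poisson p t x = (THE y. y \<in> Lp p \<and> (\<forall>X\<in>x. (\<lambda>k. poisson t (X k)) \<in> y))"

end

theory Submission
  imports Defs "HOL-Real_Asymp.Real_Asymp"
begin

text \<open>
  Sufficiency rests on the logarithmic Sobolev inequality
  \<open>\<tau>(\<bar>x\<bar>\<^sup>2 ln \<bar>x\<bar>\<^sup>2) - \<parallel>x\<parallel>\<^sub>2\<^sup>2 ln \<parallel>x\<parallel>\<^sub>2\<^sup>2 \<le> 2 \<Sum> \<bar>g\<bar> \<bar>x(g)\<bar>\<^sup>2\<close> for \<open>x\<close> of finite support, proved by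
  induction on the maximal word length. Twisted derivations, which cut a word at one letter and embed
  the two pieces into a larger free group by two different homomorphisms, generate the word length
  Dirichlet form and lower the degree by one. Applied to \<open>x ln(\<bar>x\<bar>\<^sup>2)\<close> they
  produce divided differences in commuting left and right multiplications; these are dominated by an
  average of two logarithms, to which the induction hypothesis applies. Integrated
  along the flow \<open>x \<mapsto> \<Sum> s\<^sup>\<bar>\<^sup>g\<^sup>\<bar> x(g) \<lambda>\<^sub>g\<close> this gives the inequality one degree higher.

  A Stroock--Varopoulos inequality and the argument of Gross turn it into hypercontractivity for
  \<open>2 \<le> p \<le> q\<close>; duality and composition through \<open>L\<^sub>2\<close> give the remaining exponents, and truncation
  extends it from finite support to the whole algebra and to its completions. For necessity, compare
  both sides at \<open>1 + \<epsilon> (\<lambda>\<^sub>a + \<lambda>\<^sub>a\<^sup>*)\<close>, where \<open>\<parallel>\<cdot>\<parallel>\<^sub>p = 1 + (p - 1) \<epsilon>\<^sup>2 + O(\<epsilon>\<^sup>3)\<close>.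
\<close>

section \<open>Spectral calculus: commuting positive operators, polynomials, continuous
  functions\<close>

section \<open>Commuting positive operators\<close>

text \<open>The obstacle is the chain rule: a derivation of an odd function of \<open>x\<close> is a
  difference quotient in two commuting multiplications, not a derivative. For the logarithm this
  quotient is at most the logarithm of the mean of the two squares, plus 2. The 2 is affordable
  because every cut costs one letter: the averaged Dirichlet form of the derivatives is at most the
  sum of \<open>len g * (len g - 1)\<close> against the squared coefficients, and the missing
  \<open>len g\<close>, multiplied by the constant 2 of the inequality, cancels it exactly. So the
  constant does not deteriorate in the induction. For the induction hypothesis to apply, a
  derivative must again be a finite sum of words; therefore the two sides of a cut are multiplied
  inside one free group instead of being kept apart in a tensor product. Operator inequalities come
  from polynomial inequalities on a square, since derivations act exactly on polynomials. The shift
  \<open>a > 0\<close> in \<open>ln (u + a)\<close> keeps the logarithm continuous at 0 until it is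
  removed at the end of each induction step.\<close>

notation blinfun_compose (infixl "oL" 55)

abbreviation "vac == delta 1"

text \<open>Real inner products are used because products of copies of \<open>ell2\<close> carry
  only these. For a complex linear operator on \<open>ell2\<close> the condition is selfadjointness,
  as \<open>inner\<close> is the real part of \<open>cinner\<close>.\<close>

definition sym_op :: "('h::real_inner \<Rightarrow>\<^sub>L 'h) => bool" where
  "sym_op T \<longleftrightarrow> (\<forall>u v. inner (T u) v = inner u (T v))"

text \<open>Symmetry is demanded separately: on a real space a nonnegative quadratic form does not
  enforce it.\<close>

definition pos_op :: "('h::real_inner \<Rightarrow>\<^sub>L 'h) => bool" where
  "pos_op T \<longleftrightarrow> sym_op T & (\<forall>v. 0 <= inner (T v) v)"

lemma pos_op_sym: "pos_op T ==> sym_op T" by (simp add: pos_op_def)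

lemma pos_op_nonneg: "pos_op T ==> 0 <= inner (T v) v" by (simp add: pos_op_def)

lemma sym_opD: "sym_op T ==> inner (T u) v = inner u (T v)" by (simp add: sym_op_def)

lemma sym_op_id [simp]: "sym_op id_blinfun" by (simp add: sym_op_def)

lemma sym_op_0 [simp]: "sym_op 0" by (simp add: sym_op_def)

lemma sym_op_add: "sym_op S ==> sym_op T ==> sym_op (S + T)"
  by (simp add: sym_op_def blinfun.add_left inner_add_left inner_add_right)

lemma sym_op_diff: "sym_op S ==> sym_op T ==> sym_op (S - T)"
  by (simp add: sym_op_def blinfun.diff_left inner_diff_left inner_diff_right)

lemma sym_op_scaleR: "sym_op T ==> sym_op (c *\<^sub>R T)" by (simp add: sym_op_def blinfun.scaleR_left)

lemma sym_op_compose: "sym_op S ==> sym_op T ==> S oL T = T oL S ==> sym_op (S oL T)"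
  unfolding sym_op_def by (metis blinfun_apply_blinfun_compose)

lemma pos_op_id [simp]: "pos_op id_blinfun" by (simp add: pos_op_def)

lemma pos_op_0 [simp]: "pos_op 0" by (simp add: pos_op_def)

lemma pos_op_add: "pos_op S ==> pos_op T ==> pos_op (S + T)"
  by (simp add: pos_op_def sym_op_add blinfun.add_left inner_add_left)

lemma pos_op_scaleR: "pos_op T ==> 0 <= c ==> pos_op (c *\<^sub>R T)"
  by (simp add: pos_op_def sym_op_scaleR blinfun.scaleR_left)

lemma pos_op_square:
  assumes "sym_op T"
  shows "pos_op (T oL T)"
proof -
  have "inner ((T oL T) v) v = inner (T v) (T v)" for v using sym_opD[OF assms, of "T v" v] by simp
  thus ?thesis using assms by (simp add: pos_op_def sym_op_compose)
qed

lemma compose_add_left: "(S + T) oL U = (S oL U) + (T oL U)" by (rule blinfun_eqI) (simp add: blinfun.add_left)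

lemma compose_add_right: "U oL (S + T) = (U oL S) + (U oL T)"
  by (rule blinfun_eqI) (simp add: blinfun.add_left blinfun.add_right)

lemma compose_diff_left: "(S - T) oL U = (S oL U) - (T oL U)" by (rule blinfun_eqI) (simp add: blinfun.diff_left)

lemma compose_diff_right: "U oL (S - T) = (U oL S) - (U oL T)"
  by (rule blinfun_eqI) (simp add: blinfun.diff_left blinfun.diff_right)

lemma compose_scaleR_left: "(c *\<^sub>R T) oL U = c *\<^sub>R (T oL U)" by (rule blinfun_eqI) (simp add: blinfun.scaleR_left)

lemma compose_scaleR_right: "U oL (c *\<^sub>R T) = c *\<^sub>R (U oL T)"
  by (rule blinfun_eqI) (simp add: blinfun.scaleR_left blinfun.scaleR_right)

lemma compose_sum_left: "sum f A oL U = (\<Sum>a\<in>A. f a oL U)"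
  by (induction A rule: infinite_finite_induct) (auto simp: compose_add_left intro: blinfun_eqI)

lemma compose_sum_right: "U oL sum f A = (\<Sum>a\<in>A. U oL f a)"
  by (induction A rule: infinite_finite_induct) (auto simp: compose_add_right intro: blinfun_eqI)

lemma compose_id_left [simp]: "id_blinfun oL T = T" by (rule blinfun_eqI) simp

lemma compose_id_right [simp]: "T oL id_blinfun = T" by (rule blinfun_eqI) simp

lemma compose_assoc: "(S oL T) oL U = S oL (T oL U)" by (rule blinfun_eqI) simp

lemmas compose_linear = compose_add_left compose_add_right compose_diff_left compose_diff_right
  compose_scaleR_left compose_scaleR_right

lemma sum_blinfun_apply: "blinfun_apply (sum f A) v = (\<Sum>a\<in>A. f a v)"
  by (induction A rule: infinite_finite_induct) (auto simp: blinfun.add_left)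

text \<open>The proof of F. Riesz that the product of commuting positive operators is positive: for
  \<open>0 \<le> S \<le> 1\<close> the sequence \<open>S\<^sub>n\<^sub>+\<^sub>1 = S\<^sub>n - S\<^sub>n\<^sup>2\<close> starting at \<open>S\<close> satisfies \<open>S = \<Sum> S\<^sub>n\<^sup>2\<close> strongly, so that
  \<open>SR = \<Sum> S\<^sub>n R S\<^sub>n\<close>. No square roots are needed.\<close>

primrec riesz_seq :: "('h::real_inner \<Rightarrow>\<^sub>L 'h) => nat => 'h \<Rightarrow>\<^sub>L 'h" where
  "riesz_seq S 0 = S"
| "riesz_seq S (Suc n) = riesz_seq S n - (riesz_seq S n oL riesz_seq S n)"

text \<open>With \<open>t = 1 - s\<close>, the identities s - s^2 = s t s + t s t and 1 - (s - s^2)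
  = t + s^2 write both operators as sums of positive ones.\<close>

lemma riesz_seq_props:
  assumes "pos_op S" "pos_op (id_blinfun - S)"
  shows "pos_op (riesz_seq S n) & pos_op (id_blinfun - riesz_seq S n)"
proof (induction n)
  case 0
  thus ?case using assms by simp
next
  case (Suc n)
  let ?s = "riesz_seq S n" and ?t = "id_blinfun - riesz_seq S n"
  have s: "sym_op ?s" "sym_op ?t" "pos_op ?s" "pos_op ?t" using Suc by (auto simp: pos_op_def)
  have eq: "?s - (?s oL ?s) = (?s oL (?t oL ?s)) + (?t oL (?s oL ?t))" by (simp add: compose_linear compose_assoc)
  have "0 <= inner ((?s - (?s oL ?s)) v) v" for v unfolding eq blinfun.add_left inner_add_left blinfun_apply_blinfun_compose
    using pos_op_nonneg[OF s(4), of "?s v"] pos_op_nonneg[OF s(3), of "?t v"] by (simp add: sym_opD[OF s(1)] sym_opD[OF s(2)])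
  hence "pos_op (?s - (?s oL ?s))" using s by (simp add: pos_op_def sym_op_diff sym_op_compose)
  moreover have eq2: "id_blinfun - (?s - (?s oL ?s)) = ?t + (?s oL ?s)" by simp
  have "pos_op (id_blinfun - (?s - (?s oL ?s)))" unfolding eq2 by (rule pos_op_add[OF s(4) pos_op_square[OF s(1)]])
  ultimately show ?case by simp
qed

lemma riesz_seq_commute:
  assumes "S oL R = R oL S"
  shows "riesz_seq S n oL R = R oL riesz_seq S n"
proof (induction n)
  case (Suc n)
  hence "(riesz_seq S n oL riesz_seq S n) oL R = R oL (riesz_seq S n oL riesz_seq S n)" by (metis compose_assoc)
  thus ?case using Suc by (simp add: compose_linear)
qed (use assms in simp)

lemma riesz_seq_sum: "(\<Sum>k<n. riesz_seq S k oL riesz_seq S k) = S - riesz_seq S n" by (induction n) auto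

lemma pos_op_compose_aux:
  assumes S: "pos_op S" "pos_op (id_blinfun - S)" and R: "pos_op R" and c: "S oL R = R oL S"
  shows "0 <= inner (S (R v)) v"
proof -
  let ?s = "riesz_seq S"
  note p = riesz_seq_props[OF S]
  have sq: "inner ((?s k oL ?s k) w) w = (norm (?s k w))^2" for k w
    using p[of k] by (simp add: pos_op_def sym_op_def power2_norm_eq_inner)
  have "(\<Sum>k<n. (norm (?s k w))^2) <= inner (S w) w" for n w
  proof -
    have "(\<Sum>k<n. (norm (?s k w))^2) = inner ((\<Sum>k<n. ?s k oL ?s k) w) w"
      unfolding sum_blinfun_apply inner_sum_left sq ..
    also have "... = inner (S w) w - inner (?s n w) w" by (simp add: riesz_seq_sum blinfun.diff_left inner_diff_left)
    finally show ?thesis using p[of n] pos_op_nonneg[of "?s n" w] by linarith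
  qed
  \<comment> \<open>The squares telescope to \<open>S - riesz_seq S n\<close>, so the series is
    bounded by \<open>inner (S w) w\<close>; its terms tend to 0, which gives strong convergence of
    \<open>riesz_seq S n\<close> to 0.\<close>
  hence "summable (%k. (norm (?s k w))^2)" for w by (intro summableI_nonneg_bounded[where x = "inner (S w) w"]) auto
  hence "(%k. (norm (?s k w))^2) \<longlonglongrightarrow> 0" for w by (rule summable_LIMSEQ_zero)
  hence "(%k. sqrt ((norm (?s k w))^2)) \<longlonglongrightarrow> sqrt 0" for w by (rule tendsto_real_sqrt)
  hence "(%k. norm (?s k w)) \<longlonglongrightarrow> 0" for w by simp
  hence "(%k. ?s k (R v)) \<longlonglongrightarrow> 0" by (rule tendsto_norm_zero_cancel)
  hence lim: "(%n. inner (?s n (R v)) v) \<longlonglongrightarrow> inner 0 v" by (intro tendsto_inner tendsto_const)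
  have "inner (?s n (R v)) v <= inner (S (R v)) v" for n
  proof -
    have "inner (?s k (?s k (R v))) v = inner (R (?s k v)) (?s k v)" for k
    proof -
      have "?s k (R v) = R (?s k v)" using riesz_seq_commute[OF c, of k] by (metis blinfun_apply_blinfun_compose)
      thus ?thesis using p[of k] by (simp add: pos_op_def sym_op_def)
    qed
    hence "0 <= (\<Sum>k<n. inner ((?s k oL ?s k) (R v)) v)" using R by (intro sum_nonneg) (simp add: pos_op_def)
    also have "... = inner ((\<Sum>k<n. ?s k oL ?s k) (R v)) v" by (simp add: sum_blinfun_apply inner_sum_left)
    finally show ?thesis by (simp add: riesz_seq_sum blinfun.diff_left inner_diff_left)
  qed
  thus ?thesis using LIMSEQ_le_const2[OF lim, of "inner (S (R v)) v"] by simp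
qed

lemma pos_op_norm_diff:
  assumes "sym_op T" "norm T <= c"
  shows "pos_op (c *\<^sub>R id_blinfun - T)"
proof -
  have "inner (T v) v <= c * inner v v" for v
  proof -
    have "inner (T v) v <= norm (T v) * norm v" by (rule norm_cauchy_schwarz)
    also have "... <= (norm T * norm v) * norm v" by (intro mult_right_mono norm_blinfun) simp
    also have "... <= (c * norm v) * norm v" by (intro mult_right_mono assms) auto
    finally show ?thesis by (simp add: dot_square_norm power2_eq_square mult.assoc)
  qed
  thus ?thesis using assms(1) by (simp add: pos_op_def sym_op_diff sym_op_scaleR blinfun.diff_left blinfun.scaleR_left
        inner_diff_left)
qed

lemma pos_op_compose:
  assumes S: "pos_op S" and R: "pos_op R" and c: "S oL R = R oL S"
  shows "pos_op (S oL R)"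
proof -
  \<comment> \<open>Scaling puts \<open>S\<close> below the identity; the \<open>+ 1\<close> covers
    \<open>S = 0\<close>.\<close>
  define e where "e = 1 / (norm S + 1)"
  have e: "0 < e" unfolding e_def by (simp add: add_nonneg_pos)
  have "norm (e *\<^sub>R S) = norm S / (norm S + 1)" using e by (simp add: e_def)
  also have "... <= 1" using norm_ge_zero[of S] by (intro divide_le_eq_1[THEN iffD2] disjI1 conjI) linarith+
  finally have "norm (e *\<^sub>R S) <= 1" .
  hence "pos_op (1 *\<^sub>R id_blinfun - e *\<^sub>R S)" by (intro pos_op_norm_diff sym_op_scaleR pos_op_sym[OF S])
  hence "0 <= inner ((e *\<^sub>R S) (R v)) v" for v
    using c e by (intro pos_op_compose_aux pos_op_scaleR S R) (auto simp: compose_linear)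
  hence "0 <= inner (S (R v)) v" for v using e by (simp add: blinfun.scaleR_left zero_le_mult_iff)
  thus ?thesis unfolding pos_op_def using sym_op_compose[OF pos_op_sym[OF S] pos_op_sym[OF R] c] by simp
qed

section \<open>Polynomials of operators\<close>

definition op_pow :: "('h::real_normed_vector \<Rightarrow>\<^sub>L 'h) => nat => 'h \<Rightarrow>\<^sub>L 'h" where
  "op_pow T i = ((o\<^sub>L) T ^^ i) id_blinfun"

text \<open>\<open>op_poly\<close> on arbitrary real normed spaces: the operators on quadruples
  below are not of type \<open>op\<close>.\<close>

definition pev :: "real poly => ('h::real_normed_vector \<Rightarrow>\<^sub>L 'h) => 'h \<Rightarrow>\<^sub>L 'h" where
  "pev r T = (\<Sum>i\<le>degree r. coeff r i *\<^sub>R op_pow T i)"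

lemma op_poly_eq_pev: "op_poly r T = pev r T" by (simp add: op_poly_def pev_def op_pow_def)

lemma op_pow_0 [simp]: "op_pow T 0 = id_blinfun" by (simp add: op_pow_def)

lemma op_pow_Suc [simp]: "op_pow T (Suc i) = T oL op_pow T i" by (simp add: op_pow_def)

lemma op_pow_commute: "S oL T = T oL S ==> op_pow S i oL T = T oL op_pow S i"
  by (induction i) (simp_all add: compose_assoc, metis compose_assoc)

lemma op_pow_add: "op_pow T (i + j) = op_pow T i oL op_pow T j" by (induction i) (auto simp: compose_assoc)

lemma pev_eq_sum: "degree r <= n ==> pev r T = (\<Sum>i\<le>n. coeff r i *\<^sub>R op_pow T i)"
  unfolding pev_def by (rule sum.mono_neutral_left) (auto simp: coeff_eq_0)

lemma pev_0 [simp]: "pev 0 T = 0" by (simp add: pev_def)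

lemma pev_add: "pev (r + s) T = pev r T + pev s T"
proof -
  let ?n = "max (degree r) (degree s)"
  have "degree (r + s) <= ?n" by (rule degree_add_le_max)
  thus ?thesis by (simp add: pev_eq_sum[of _ ?n] scaleR_add_left sum.distrib)
qed

lemma pev_smult: "pev (smult c r) T = c *\<^sub>R pev r T"
  by (simp add: pev_eq_sum[of "smult c r" "degree r"] pev_def scaleR_sum_right degree_smult_le)

lemma pev_diff: "pev (r - s) T = pev r T - pev s T" using pev_add[of "r - s" s T] by simp

lemma pev_sum: "pev (sum f A) T = (\<Sum>a\<in>A. pev (f a) T)"
  by (induction A rule: infinite_finite_induct) (auto simp: pev_add)

lemma pev_pCons: "pev (pCons a r) T = a *\<^sub>R id_blinfun + (T oL pev r T)"
proof -
  have "pev (pCons a r) T = (\<Sum>i\<le>Suc (degree r). coeff (pCons a r) i *\<^sub>R op_pow T i)"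
    by (rule pev_eq_sum) (simp add: degree_pCons_le)
  also have "... = a *\<^sub>R id_blinfun + (T oL pev r T)"
    unfolding pev_def sum.atMost_Suc_shift by (simp add: compose_sum_right compose_scaleR_right)
  finally show ?thesis .
qed

lemma pev_const [simp]: "pev [:a:] T = a *\<^sub>R id_blinfun" by (simp add: pev_pCons)

lemma pev_1 [simp]: "pev 1 T = id_blinfun" using pev_const[of 1 T] by (simp add: one_pCons)

lemma pev_X [simp]: "pev [:0, 1:] T = T" by (simp add: pev_pCons)

lemma pev_mult: "pev (r * s) T = pev r T oL pev s T"
  by (induction r) (auto simp: pev_pCons pev_add pev_smult compose_linear compose_assoc)

lemma pev_power_X: "pev ([:0, 1:] ^ i) T = op_pow T i"
  by (induction i) (simp_all only: power_0 power_Suc pev_mult pev_1 pev_X op_pow_0 op_pow_Suc)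

lemma pev_commute: "S oL T = T oL S ==> pev r S oL T = T oL pev r S"
  unfolding pev_def by (simp add: compose_sum_left compose_sum_right compose_linear op_pow_commute)

lemma pev_commute2: "S oL T = T oL S ==> pev r S oL pev s T = pev s T oL pev r S"
  by (intro pev_commute sym[OF pev_commute]) simp

lemma sym_op_pev: "sym_op T ==> sym_op (pev r T)"
proof (induction r)
  case (pCons a r)
  thus ?case by (auto simp: pev_pCons intro!: sym_op_add sym_op_scaleR sym_op_compose pev_commute[symmetric])
qed simp

section \<open>Positivity of polynomials in two commuting operators\<close>

definition bern :: "nat => nat => real poly" where
  "bern N k = smult (real (N choose k)) ([:0, 1:] ^ k * [:1, -1:] ^ (N - k))"

text \<open>Multiply X^i by (X + (1 - X))^(N - i) = 1 and expand; the binomial identity (N choose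
  k)(k choose i) = (N choose i)(N - i choose k - i) turns the result into the Bernstein basis of
  degree N. The expansion is exact, so it survives the insertion of an operator.\<close>

lemma bern_sum:
  assumes "i <= N"
  shows "[:0, 1:] ^ i = (\<Sum>k\<le>N. smult (real (k choose i) / real (N choose i)) (bern N k))"
proof -
  let ?x = "[:0, 1:] :: real poly" and ?y = "[:1, -1:] :: real poly"
  have one: "?x + ?y = 1" by (simp add: one_pCons)
  have "?x ^ i = ?x ^ i * (?x + ?y) ^ (N - i)" by (simp only: one power_one mult_1_right)
  also have "... = (\<Sum>m\<le>N - i. ?x ^ i * (of_nat ((N - i) choose m) * ?x ^ m * ?y ^ (N - i - m)))"
    by (simp only: binomial_ring sum_distrib_left)
  also have "... = (\<Sum>m\<in>{0..N-i}. smult (real ((N - i) choose m)) (?x ^ (m + i) * ?y ^ (N - (m + i))))"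
    by (rule sum.cong)
      (auto simp: of_nat_poly power_add mult_ac, simp add: add.commute flip: diff_diff_left)
  also have "... = (\<Sum>k\<in>{0+i..(N-i)+i}. smult (real ((N - i) choose (k - i))) (?x ^ k * ?y ^ (N - k)))"
    by (subst sum.shift_bounds_cl_nat_ivl) simp
  also have "... = (\<Sum>k\<in>{i..N}. smult (real (k choose i) / real (N choose i)) (bern N k))"
  proof (rule sum.cong)
    fix k assume "k \<in> {i..N}"
    hence "real (N choose k) * real (k choose i) = real (N choose i) * real ((N - i) choose (k - i))"
      using choose_mult[of i k N] by (metis atLeastAtMost_iff of_nat_mult)
    moreover have "N choose i > 0" using assms by simp
    ultimately have "real (k choose i) / real (N choose i) * real (N choose k) = real ((N - i) choose (k - i))"
      by (simp add: field_simps)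
    thus "smult (real ((N - i) choose (k - i))) (?x ^ k * ?y ^ (N - k)) =
        smult (real (k choose i) / real (N choose i)) (bern N k)" unfolding bern_def by simp
  qed (use assms in auto)
  also have "... = (\<Sum>k\<le>N. smult (real (k choose i) / real (N choose i)) (bern N k))"
    by (rule sum.mono_neutral_left) (auto simp: binomial_eq_0)
  finally show ?thesis .
qed

text \<open>The ratio is the product of the factors (k - j) / (N - j) for j < i, each of which
  differs from k / N by at most j / (N - j).\<close>

lemma binomial_ratio_bound:
  assumes "k <= N" "i < N"
  shows "\<bar>real (k choose i) / real (N choose i) - (real k / real N) ^ i\<bar> <= real i * real i / (real N - real i)"
  using assms(2)
proof (induction i)
  case (Suc i)
  define p where "p = real (k choose i) / real (N choose i)"
  define f where "f = (if i <= k then (real k - real i) / (real N - real i) else 0)"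
  have iN: "i < N" "real i < real N" "real (Suc i) < real N" using Suc by auto
  have p1: "0 <= p" "p <= 1"
    using assms(1) iN unfolding p_def by (auto simp: binomial_right_mono zero_less_binomial divide_le_eq)
  have kN: "0 <= real k / real N" "real k / real N <= 1" using assms by auto
  have eq: "real (k choose Suc i) / real (N choose Suc i) = p * f"
  proof (cases "i <= k")
    case True
    have a: "real (n choose Suc i) * real (Suc i) = real (n choose i) * (real n - real i)" if "i <= n" for n
    proof -
      have "(n choose Suc i) * Suc i = (n choose i) * (n - i)" by (metis binomial_absorb_comp binomial_absorption mult.commute)
      thus ?thesis using that by (metis of_nat_diff of_nat_mult)
    qed
    have "real (k choose Suc i) / real (N choose Suc i) =
      (real (k choose Suc i) * real (Suc i)) / (real (N choose Suc i) * real (Suc i))" by simp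
    also have "... = (real (k choose i) * (real k - real i)) / (real (N choose i) * (real N - real i))"
      using True iN by (simp only: a less_imp_le)
    finally show ?thesis using True by (simp add: p_def f_def)
  qed (simp add: p_def f_def)
  have f: "\<bar>f - real k / real N\<bar> <= real i / (real N - real i)"
  proof (cases "i <= k")
    case True
    have "f - real k / real N = - (real i / (real N - real i)) * ((real N - real k) / real N)"
      using True iN by (simp add: f_def field_simps)
    moreover have "0 <= (real N - real k) / real N" "(real N - real k) / real N <= 1"
      using assms by (auto simp: divide_simps)
    ultimately have "\<bar>f - real k / real N\<bar> = (real i / (real N - real i)) * ((real N - real k) / real N)"
      using iN assms(1) by (simp only: abs_mult abs_minus_cancel) simp
    also have "... <= (real i / (real N - real i)) * 1"
      using iN \<open>(real N - real k) / real N <= 1\<close> by (intro mult_left_mono) auto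
    finally show ?thesis by simp
  next
    case False
    have "real k / real N <= real i / real N" using False by (intro divide_right_mono) auto
    also have "... <= real i / (real N - real i)" using iN by (intro divide_left_mono) auto
    finally show ?thesis using False kN by (simp add: f_def)
  qed
  have "\<bar>p * f - (real k / real N) ^ i * (real k / real N)\<bar> =
      \<bar>p * (f - real k / real N) + (p - (real k / real N) ^ i) * (real k / real N)\<bar>" by (simp add: algebra_simps)
  also have "... <= \<bar>p * (f - real k / real N)\<bar> + \<bar>(p - (real k / real N) ^ i) * (real k / real N)\<bar>"
    by (rule abs_triangle_ineq)
  also have "... <= 1 * (real i / (real N - real i)) + (real i * real i / (real N - real i)) * 1"
    unfolding abs_mult using Suc.IH[OF iN(1)] f p1 kN iN by (intro add_mono mult_mono) (auto simp: p_def[symmetric])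
  also have "... <= real (Suc i) * real (Suc i) / (real N - real (Suc i))"
  proof -
    have "1 * (real i / (real N - real i)) + (real i * real i / (real N - real i)) * 1
        = (real i + real i * real i) / (real N - real i)" by (simp add: add_divide_distrib)
    also have "... <= (real (Suc i) * real (Suc i)) / (real N - real (Suc i))"
      using iN by (intro frac_le) (auto simp: algebra_simps)
    finally show ?thesis .
  qed
  finally show ?case unfolding eq by (simp add: mult.commute)
qed simp

lemma binomial_ratio_tendsto:
  assumes "e > 0"
  shows "\<exists>N0. \<forall>N\<ge>N0. i <= N & (\<forall>k\<le>N. \<bar>real (k choose i) / real (N choose i) - (real k / real N) ^ i\<bar> <= e)"
proof -
  obtain m :: nat where m: "real i * real i / e < real m" using reals_Archimedean2 by blast
  have "\<bar>real (k choose i) / real (N choose i) - (real k / real N) ^ i\<bar> <= e" if "N >= Suc (i + m)" "k <= N" for N k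
  proof -
    have "\<bar>real (k choose i) / real (N choose i) - (real k / real N) ^ i\<bar> <= real i * real i / (real N - real i)"
      using that by (intro binomial_ratio_bound) auto
    also have "... <= e"
    proof -
      have "real m <= real N - real i" using that by linarith
      hence "real i * real i <= e * (real N - real i)"
        using m assms by (simp add: divide_less_eq) (smt (verit) mult.commute mult_left_mono)
      moreover have "0 < real N - real i" using that by linarith
      ultimately show ?thesis by (simp add: divide_le_eq)
    qed
    finally show ?thesis .
  qed
  thus ?thesis by (intro exI[of _ "Suc (i + m)"]) auto
qed

type_synonym bimono = "real \<times> nat \<times> nat"

definition mono_fun :: "bimono list => real => real => real" where
  "mono_fun xs s t = (\<Sum>(c, i, j)\<leftarrow>xs. c * s ^ i * t ^ j)"

definition mono_op :: "bimono list => ('h::real_normed_vector \<Rightarrow>\<^sub>L 'h) => ('h \<Rightarrow>\<^sub>L 'h) => 'h \<Rightarrow>\<^sub>L 'h" where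
  "mono_op xs L R = (\<Sum>(c, i, j)\<leftarrow>xs. c *\<^sub>R (op_pow L i oL op_pow R j))"

lemma mono_simps [simp]:
  "mono_fun [] s t = 0" "mono_fun ((c, i, j) # xs) s t = c * s ^ i * t ^ j + mono_fun xs s t"
  "mono_op [] L R = 0"
  "mono_op ((c, i, j) # xs) L R = c *\<^sub>R (op_pow L i oL op_pow R j) + mono_op xs L R"
  by (simp_all add: mono_fun_def mono_op_def)

lemma mono_append:
  "mono_fun (xs @ ys) s t = mono_fun xs s t + mono_fun ys s t"
  "mono_op (xs @ ys) L R = mono_op xs L R + mono_op ys L R" by (simp_all add: mono_fun_def mono_op_def)

text \<open>The Bernstein coefficients of a monomial are products of two binomial ratios, which
  approach the value of the monomial at (k/N, l/N) uniformly in k and l.\<close>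

lemma mono_op_bern:
  "\<exists>N0. \<forall>N\<ge>N0. \<exists>a. (\<forall>k\<le>N. \<forall>l\<le>N. \<bar>a k l - mono_fun xs (real k / real N) (real l / real N)\<bar> <= e)
    & mono_op xs L R = (\<Sum>k\<le>N. \<Sum>l\<le>N. a k l *\<^sub>R (pev (bern N k) L oL pev (bern N l) R))"
  if "e > 0" for e using that
proof (induction xs arbitrary: e)
  case Nil
  thus ?case by (intro exI[of _ 0] allI impI exI[of _ "%_ _. 0"]) auto
next
  case (Cons x xs)
  obtain c i j where x: "x = (c, i, j)" by (cases x) auto
  \<comment> \<open>Error budget: two ratios, each off by \<open>d\<close>, multiplied by
    \<open>c\<close> use up one half of \<open>e\<close>; the induction hypothesis uses the other
    half.\<close>
  define d where "d = e / 2 / (2 * (\<bar>c\<bar> + 1))"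
  have d: "d > 0" using Cons.prems by (simp add: d_def add_nonneg_pos)
  have "0 < e / 2" using Cons.prems by simp
  from Cons.IH[OF this] obtain N1 where N1: "\<forall>N\<ge>N1. \<exists>a.
      (\<forall>k\<le>N. \<forall>l\<le>N. \<bar>a k l - mono_fun xs (real k / real N) (real l / real N)\<bar> <= e / 2)
    & mono_op xs L R = (\<Sum>k\<le>N. \<Sum>l\<le>N. a k l *\<^sub>R (pev (bern N k) L oL pev (bern N l) R))" by (elim exE)
  define q where "q i N k = real (k choose i) / real (N choose i)" for i N k :: nat
  obtain Ni where Ni: "\<forall>N\<ge>Ni. i <= N & (\<forall>k\<le>N. \<bar>q i N k - (real k / real N) ^ i\<bar> <= d)"
    using binomial_ratio_tendsto[OF d, of i] unfolding q_def by auto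
  obtain Nj where Nj: "\<forall>N\<ge>Nj. j <= N & (\<forall>k\<le>N. \<bar>q j N k - (real k / real N) ^ j\<bar> <= d)"
    using binomial_ratio_tendsto[OF d, of j] unfolding q_def by auto
  show ?case
  proof (intro exI[of _ "max 1 (max N1 (max Ni Nj))"] allI impI)
    fix N assume N: "max 1 (max N1 (max Ni Nj)) <= N"
    have "N1 <= N" using N by simp
    from mp[OF spec[OF N1] this] obtain a where a1: "\<forall>k\<le>N. \<forall>l\<le>N.
        \<bar>a k l - mono_fun xs (real k / real N) (real l / real N)\<bar> <= e / 2" and a2:
      "mono_op xs L R = (\<Sum>k\<le>N. \<Sum>l\<le>N. a k l *\<^sub>R (pev (bern N k) L oL pev (bern N l) R))"
      by (elim exE conjE)
    have ij: "i <= N" "j <= N" using N Ni Nj by auto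
    define b where "b k l = c * q i N k * q j N l + a k l" for k l
    have pw: "op_pow T m = (\<Sum>k\<le>N. q m N k *\<^sub>R pev (bern N k) T)" if "m <= N" for m and T :: "'a \<Rightarrow>\<^sub>L 'a"
      unfolding pev_power_X[symmetric] bern_sum[OF that] by (simp add: pev_sum pev_smult q_def)
    have "mono_op (x # xs) L R = (\<Sum>k\<le>N. \<Sum>l\<le>N. b k l *\<^sub>R (pev (bern N k) L oL pev (bern N l) R))"
      unfolding x mono_simps a2 b_def pw[OF ij(1)] pw[OF ij(2)]
      by (simp add: compose_sum_left compose_sum_right compose_linear scaleR_sum_right sum.distrib
          scaleR_add_left mult_ac)
        (subst sum.swap, simp)
    moreover have "\<bar>b k l - mono_fun (x # xs) (real k / real N) (real l / real N)\<bar> <= e"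
      if kl: "k <= N" "l <= N" for k l
    proof -
      let ?s = "real k / real N" and ?t = "real l / real N"
      have "0 <= ?s" "?s <= 1" using kl N by (simp_all add: divide_le_eq_1)
      hence s: "0 <= ?s ^ i" "?s ^ i <= 1" by (simp_all add: power_le_one)
      have q1: "\<bar>q i N k - ?s ^ i\<bar> <= d" "\<bar>q j N l - ?t ^ j\<bar> <= d"
        using Ni[rule_format, of N] Nj[rule_format, of N] N kl by simp_all
      have q0: "0 <= q j N l" "q j N l <= 1"
        using kl ij unfolding q_def by (auto simp: binomial_right_mono zero_less_binomial divide_le_eq)
      have "\<bar>q i N k * q j N l - ?s ^ i * ?t ^ j\<bar> =
          \<bar>(q i N k - ?s ^ i) * q j N l + ?s ^ i * (q j N l - ?t ^ j)\<bar>" by (simp add: algebra_simps)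
      also have "... <= \<bar>(q i N k - ?s ^ i) * q j N l\<bar> + \<bar>?s ^ i * (q j N l - ?t ^ j)\<bar>"
        by (rule abs_triangle_ineq)
      also have "... <= d * 1 + 1 * d" unfolding abs_mult using q1 q0 s d by (intro add_mono mult_mono) auto
      finally have 1: "\<bar>q i N k * q j N l - ?s ^ i * ?t ^ j\<bar> <= 2 * d" by simp
      have "\<bar>b k l - mono_fun (x # xs) ?s ?t\<bar> =
          \<bar>c * (q i N k * q j N l - ?s ^ i * ?t ^ j) + (a k l - mono_fun xs ?s ?t)\<bar>"
        unfolding x by (simp add: b_def algebra_simps)
      also have "... <= \<bar>c\<bar> * (2 * d) + e / 2"
        using 1 a1[rule_format, OF kl] by (intro abs_triangle_ineq[THEN order_trans] add_mono)
          (auto simp: abs_mult mult_left_mono)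
      also have "\<bar>c\<bar> * (2 * d) <= (\<bar>c\<bar> + 1) * (2 * d)" using d by (intro mult_right_mono) auto
      also have "... = e / 2" unfolding d_def by (simp add: field_simps add_nonneg_eq_0_iff)
      finally show ?thesis by simp
    qed
    ultimately show "\<exists>a. (\<forall>k\<le>N. \<forall>l\<le>N. \<bar>a k l - mono_fun (x # xs) (real k / real N) (real l / real N)\<bar> <= e)
      & mono_op (x # xs) L R = (\<Sum>k\<le>N. \<Sum>l\<le>N. a k l *\<^sub>R (pev (bern N k) L oL pev (bern N l) R))"
      by blast
  qed
qed

lemma pos_op_pow: "pos_op T ==> pos_op (op_pow T i)"
proof (induction i)
  case (Suc i)
  thus ?case using pos_op_compose[of T "op_pow T i"] op_pow_commute[of T T i] by simp
qed simp

lemma pev_power: "pev (r ^ i) T = op_pow (pev r T) i" by (induction i) (simp_all add: pev_mult)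

lemma pos_op_bern:
  assumes "pos_op L" "pos_op (id_blinfun - L)"
  shows "pos_op (pev (bern N k) L)"
proof -
  have eq: "pev [:1, -1:] L = id_blinfun - L" using pev_diff[of 1 "[:0, 1:]" L] by (simp add: one_pCons)
  have "pev [:1, -1:] L oL L = L oL pev [:1, -1:] L" by (simp add: eq compose_linear)
  thus ?thesis unfolding bern_def pev_smult pev_mult pev_power eq
    using assms by (intro pos_op_scaleR pos_op_compose pos_op_pow op_pow_commute[symmetric])
      (auto simp: eq op_pow_commute compose_linear)
qed

lemma sym_op_mono: "sym_op L ==> sym_op R ==> L oL R = R oL L ==> sym_op (mono_op xs L R)"
proof (induction xs)
  case (Cons x xs)
  have p: "sym_op (op_pow T i)" if "sym_op T" for T :: "'a \<Rightarrow>\<^sub>L 'a" and i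
    unfolding pev_power_X[symmetric] by (rule sym_op_pev[OF that])
  show ?case using Cons
    by (cases x) (auto intro!: sym_op_add sym_op_scaleR sym_op_compose p op_pow_commute op_pow_commute[symmetric])
qed simp

text \<open>The products of Bernstein operators are positive and add up to the identity, and for
  large N all their coefficients are at least \<open>-e\<close>, because they are close to values of
  the polynomial on the unit square.\<close>

lemma mono_op_pos_unit:
  assumes L: "pos_op L" "pos_op (id_blinfun - L)" and R: "pos_op R" "pos_op (id_blinfun - R)"
    and c: "L oL R = R oL L"
    and F: "!!s t. 0 <= s ==> s <= 1 ==> 0 <= t ==> t <= 1 ==> 0 <= mono_fun xs s t"
  shows "pos_op (mono_op xs L R)"
proof -
  have "0 <= inner (mono_op xs L R v) v" for v
  proof (rule field_le_epsilon)
    fix e' :: real assume "0 < e'"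
    define e where "e = e' / (inner v v + 1)"
    have e: "e > 0" using \<open>0 < e'\<close> by (simp add: e_def add_nonneg_pos)
    from mono_op_bern[OF e, of xs L R] obtain N0 where N0: "!!N. N >= N0 ==> \<exists>a.
        (\<forall>k\<le>N. \<forall>l\<le>N. \<bar>a k l - mono_fun xs (real k / real N) (real l / real N)\<bar> <= e)
      & mono_op xs L R = (\<Sum>k\<le>N. \<Sum>l\<le>N. a k l *\<^sub>R (pev (bern N k) L oL pev (bern N l) R))" by blast
    define N where "N = max 1 N0"
    from N0[of N] obtain a where a: "!!k l. k <= N ==> l <= N ==>
        \<bar>a k l - mono_fun xs (real k / real N) (real l / real N)\<bar> <= e"
      "mono_op xs L R = (\<Sum>k\<le>N. \<Sum>l\<le>N. a k l *\<^sub>R (pev (bern N k) L oL pev (bern N l) R))"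
      unfolding N_def by auto
    let ?B = "%k l. pev (bern N k) L oL pev (bern N l) R"
    have B: "0 <= inner (?B k l v) v" for k l by (intro pos_op_nonneg pos_op_compose pos_op_bern L R pev_commute2 c)
    have one: "(\<Sum>k\<le>N. pev (bern N k) T) = id_blinfun" for T :: "'a \<Rightarrow>\<^sub>L 'a"
      using bern_sum[of 0 N, THEN arg_cong[where f = "%r. pev r T"]] by (simp add: pev_sum)
    have "(\<Sum>k\<le>N. \<Sum>l\<le>N. ?B k l) = id_blinfun" by (simp flip: compose_sum_left compose_sum_right add: one)
    hence "inner ((\<Sum>k\<le>N. \<Sum>l\<le>N. ?B k l) v) v = inner v v" by simp
    hence "(\<Sum>k\<le>N. \<Sum>l\<le>N. inner (?B k l v) v) = inner v v" unfolding sum_blinfun_apply inner_sum_left .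
    moreover have "(\<Sum>k\<le>N. \<Sum>l\<le>N. - e * inner (?B k l v) v) <= (\<Sum>k\<le>N. \<Sum>l\<le>N. a k l * inner (?B k l v) v)"
    proof (intro sum_mono mult_right_mono B)
      fix k l assume kl: "k \<in> {..N}" "l \<in> {..N}"
      have "0 <= mono_fun xs (real k / real N) (real l / real N)" using kl by (intro F) (auto simp: divide_simps N_def)
      thus "- e <= a k l" using a(1)[of k l] kl by auto
    qed
    moreover have "(\<Sum>k\<le>N. \<Sum>l\<le>N. a k l * inner (?B k l v) v) = inner (mono_op xs L R v) v"
      unfolding a(2) by (simp add: sum_blinfun_apply blinfun.scaleR_left inner_sum_left)
    ultimately have "- e * inner v v <= inner (mono_op xs L R v) v" by (simp only: flip: sum_distrib_left)
    moreover have "e * inner v v <= e'"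
      using \<open>0 < e'\<close> unfolding e_def by (simp add: divide_simps add_nonneg_eq_0_iff mult_left_mono add_nonneg_pos)
    ultimately show "0 <= inner (mono_op xs L R v) v + e'" by linarith
  qed
  thus ?thesis using assms by (simp add: pos_op_def sym_op_mono)
qed

text \<open>A calculus given as a relation: one list of monomials produces both the function and the
  operator. The closure rules build such pairs along the structure of the function, and
  \<open>bip_pos\<close> turns pointwise positivity into operator positivity.\<close>

definition bip :: "('h::real_normed_vector \<Rightarrow>\<^sub>L 'h) => ('h \<Rightarrow>\<^sub>L 'h) => (real => real => real) => ('h \<Rightarrow>\<^sub>L 'h) => bool" where
  "bip L R F \<Phi> \<longleftrightarrow> (\<exists>xs. F = mono_fun xs & \<Phi> = mono_op xs L R)"

lemma bip_const: "bip L R (%s t. c) (c *\<^sub>R id_blinfun)"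
  unfolding bip_def by (rule exI[of _ "[(c, 0, 0)]"]) (simp add: fun_eq_iff)

lemma bip_fst: "bip L R (%s t. s) L" unfolding bip_def by (rule exI[of _ "[(1, 1, 0)]"]) (simp add: fun_eq_iff)

lemma bip_snd: "bip L R (%s t. t) R" unfolding bip_def by (rule exI[of _ "[(1, 0, 1)]"]) (simp add: fun_eq_iff)

lemma bip_add:
  assumes "bip L R F \<Phi>" "bip L R G \<Psi>"
  shows "bip L R (%s t. F s t + G s t) (\<Phi> + \<Psi>)"
proof -
  from assms obtain xs ys where "F = mono_fun xs" "\<Phi> = mono_op xs L R" "G = mono_fun ys" "\<Psi> = mono_op ys L R"
    unfolding bip_def by blast
  thus ?thesis unfolding bip_def by (intro exI[of _ "xs @ ys"]) (simp add: fun_eq_iff mono_append)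
qed

lemma bip_mult:
  assumes "bip L R F \<Phi>" "bip L R G \<Psi>" and c: "L oL R = R oL L"
  shows "bip L R (%s t. F s t * G s t) (\<Phi> oL \<Psi>)"
proof -
  define m :: "bimono => bimono => bimono" where
    "m = (%(c, i, j) (d, k, l). (c * d, i + k, j + l))"
  have 1: "mono_fun (map (m (c, i, j)) ys) s t = c * s ^ i * t ^ j * mono_fun ys s t" for c i j ys s t
    by (induction ys) (auto simp: m_def power_add algebra_simps)
  have cc: "op_pow R j oL op_pow L k = op_pow L k oL op_pow R j" for j k by (intro op_pow_commute op_pow_commute[symmetric] c)
  have "op_pow L (i + k) oL op_pow R (j + l) = (op_pow L i oL op_pow R j) oL (op_pow L k oL op_pow R l)" for i j k l
  proof -
    have "(op_pow L i oL op_pow R j) oL (op_pow L k oL op_pow R l) =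
      op_pow L i oL ((op_pow R j oL op_pow L k) oL op_pow R l)" by (simp only: compose_assoc)
    thus ?thesis by (simp only: cc op_pow_add compose_assoc)
  qed
  hence 2: "mono_op (map (m (c, i, j)) ys) L R = c *\<^sub>R (op_pow L i oL op_pow R j) oL mono_op ys L R" for c i j ys
    by (induction ys) (auto simp: m_def compose_linear scaleR_add_right mult.commute)
  have 3: "mono_fun (concat (map (%x. map (m x) ys) xs)) s t = mono_fun xs s t * mono_fun ys s t" for xs ys s t
    by (induction xs) (auto simp: mono_append 1 algebra_simps)
  have 4: "mono_op (concat (map (%x. map (m x) ys) xs)) L R = mono_op xs L R oL mono_op ys L R" for xs ys
    by (induction xs) (auto simp: mono_append 2 compose_linear)
  from assms obtain xs ys where "F = mono_fun xs" "\<Phi> = mono_op xs L R" "G = mono_fun ys" "\<Psi> = mono_op ys L R"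
    unfolding bip_def by blast
  thus ?thesis unfolding bip_def by (intro exI[of _ "concat (map (%x. map (m x) ys) xs)"]) (simp add: fun_eq_iff 3 4)
qed

lemma bip_scaleR: "bip L R F \<Phi> ==> bip L R (%s t. c * F s t) (c *\<^sub>R \<Phi>)"
proof -
  assume "bip L R F \<Phi>"
  then obtain xs where xs: "F = mono_fun xs" "\<Phi> = mono_op xs L R" unfolding bip_def by blast
  have "mono_fun (map (%(d, i, j). (c * d, i, j)) xs) s t = c * mono_fun xs s t"
    "mono_op (map (%(d, i, j). (c * d, i, j)) xs) L R = c *\<^sub>R mono_op xs L R" for s t
    by (induction xs) (auto simp: algebra_simps)
  thus ?thesis unfolding bip_def xs by (intro exI[of _ "map (%(d, i, j). (c * d, i, j)) xs"]) (simp add: fun_eq_iff)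
qed

lemma bip_diff: "bip L R F \<Phi> ==> bip L R G \<Psi> ==> bip L R (%s t. F s t - G s t) (\<Phi> - \<Psi>)"
  using bip_add[of L R F \<Phi> "%s t. -1 * G s t" "(-1) *\<^sub>R \<Psi>"] bip_scaleR[of L R G \<Psi> "-1"] by simp

lemma bip_power: "L oL R = R oL L ==> bip L R F \<Phi> ==> bip L R (%s t. F s t ^ n) (op_pow \<Phi> n)"
proof (induction n)
  case 0
  thus ?case using bip_const[of L R 1] by simp
next
  case (Suc n)
  thus ?case using bip_mult[of L R F \<Phi> "%s t. F s t ^ n" "op_pow \<Phi> n"] by simp
qed

lemma bip_pev: "L oL R = R oL L ==> bip L R F \<Phi> ==> bip L R (%s t. poly r (F s t)) (pev r \<Phi>)"
proof (induction r)
  case 0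
  thus ?case using bip_const[of L R 0] by simp
next
  case (pCons a r)
  hence "bip L R (%s t. F s t * poly r (F s t)) (\<Phi> oL pev r \<Phi>)" by (intro bip_mult) auto
  from bip_add[OF bip_const[of L R a] this] show ?case by (simp add: pev_pCons)
qed

lemma bip_affine:
  assumes "bip (a *\<^sub>R id_blinfun + b *\<^sub>R L) (a' *\<^sub>R id_blinfun + b' *\<^sub>R R) F \<Phi>" and c: "L oL R = R oL L"
  shows "bip L R (%s t. F (a + b * s) (a' + b' * t)) \<Phi>"
proof -
  obtain xs where xs: "F = mono_fun xs" "\<Phi> = mono_op xs (a *\<^sub>R id_blinfun + b *\<^sub>R L) (a' *\<^sub>R id_blinfun + b' *\<^sub>R R)"
    using assms unfolding bip_def by blast
  show ?thesis unfolding xs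
  proof (induction xs)
    case Nil
    thus ?case using bip_const[of L R 0] by simp
  next
    case (Cons x xs)
    have "bip L R (%s t. e * (a + b * s) ^ i * (a' + b' * t) ^ j)
      (e *\<^sub>R (op_pow (a *\<^sub>R id_blinfun + b *\<^sub>R L) i oL op_pow (a' *\<^sub>R id_blinfun + b' *\<^sub>R R) j))" for e i j
      unfolding mult.assoc by (intro bip_scaleR bip_mult bip_power bip_add bip_const bip_fst bip_snd c)
    from bip_add[OF this Cons] show ?case by (cases x) simp
  qed
qed

lemma bip_sym: "bip L R F \<Phi> ==> sym_op L ==> sym_op R ==> L oL R = R oL L ==> sym_op \<Phi>"
  unfolding bip_def by (elim exE conjE) (simp only: sym_op_mono)

text \<open>An affine change of variables reduces this to the unit square. It plays the part of a
  joint spectral theorem for the pair \<open>L\<close>, \<open>R\<close>: scalar inequalities on a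
  rectangle containing the spectra become operator inequalities.\<close>

theorem bip_pos:
  assumes c: "L oL R = R oL L" and "a < b" "a' < b'"
    and L: "pos_op (L - a *\<^sub>R id_blinfun)" "pos_op (b *\<^sub>R id_blinfun - L)"
    and R: "pos_op (R - a' *\<^sub>R id_blinfun)" "pos_op (b' *\<^sub>R id_blinfun - R)"
    and b: "bip L R F \<Phi>"
    and F: "!!s t. a <= s ==> s <= b ==> a' <= t ==> t <= b' ==> 0 <= F s t"
  shows "pos_op \<Phi>"
proof -
  define L' where "L' = (1 / (b - a)) *\<^sub>R (L - a *\<^sub>R id_blinfun)"
  define R' where "R' = (1 / (b' - a')) *\<^sub>R (R - a' *\<^sub>R id_blinfun)"
  have LL: "L = a *\<^sub>R id_blinfun + (b - a) *\<^sub>R L'" "R = a' *\<^sub>R id_blinfun + (b' - a') *\<^sub>R R'"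
    using assms by (simp_all add: L'_def R'_def)
  have "(L - a *\<^sub>R id_blinfun) oL (R - a' *\<^sub>R id_blinfun) = (R - a' *\<^sub>R id_blinfun) oL (L - a *\<^sub>R id_blinfun)"
    by (simp add: compose_linear c algebra_simps)
  hence cc: "L' oL R' = R' oL L'" unfolding L'_def R'_def compose_scaleR_left compose_scaleR_right by (simp add: mult.commute)
  have p: "pos_op ((1 / (y - x)) *\<^sub>R (T - x *\<^sub>R id_blinfun))" "pos_op (id_blinfun - (1 / (y - x)) *\<^sub>R (T - x *\<^sub>R id_blinfun))"
    if "x < y" "pos_op (T - x *\<^sub>R id_blinfun)" "pos_op (y *\<^sub>R id_blinfun - T)" for x y and T :: "'a \<Rightarrow>\<^sub>L 'a"
  proof -
    show "pos_op ((1 / (y - x)) *\<^sub>R (T - x *\<^sub>R id_blinfun))" using that by (intro pos_op_scaleR) auto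
    have "id_blinfun - (1 / (y - x)) *\<^sub>R (T - x *\<^sub>R id_blinfun) = (1 / (y - x)) *\<^sub>R ((y - x) *\<^sub>R id_blinfun - (T - x *\<^sub>R id_blinfun))"
      unfolding scaleR_diff_right[of "1 / (y - x)" "(y - x) *\<^sub>R id_blinfun"] using that by simp
    also have "... = (1 / (y - x)) *\<^sub>R (y *\<^sub>R id_blinfun - T)" by (simp add: scaleR_diff_left)
    finally show "pos_op (id_blinfun - (1 / (y - x)) *\<^sub>R (T - x *\<^sub>R id_blinfun))"
      using that pos_op_scaleR[of "y *\<^sub>R id_blinfun - T" "1 / (y - x)"] by simp
  qed
  have "bip L' R' (%s t. F (a + (b - a) * s) (a' + (b' - a') * t)) \<Phi>"
    using b cc by (intro bip_affine) (simp_all flip: LL)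
  then obtain xs where xs: "(%s t. F (a + (b - a) * s) (a' + (b' - a') * t)) = mono_fun xs" "\<Phi> = mono_op xs L' R'"
    unfolding bip_def by blast
  have range: "x <= x + (y - x) * s" "x + (y - x) * s <= y" if "x < y" "0 <= s" "s <= 1" for x y s :: real
  proof -
    have "0 <= (y - x) * s" "(y - x) * s <= y - x" using that by (auto intro: mult_left_le)
    thus "x <= x + (y - x) * s" "x + (y - x) * s <= y" by linarith+
  qed
  have "0 <= mono_fun xs s t" if "0 <= s" "s <= 1" "0 <= t" "t <= 1" for s t
    unfolding xs(1)[symmetric] using that assms(2,3) by (intro F range) simp_all
  thus ?thesis unfolding xs(2)
    using p[OF assms(2) L, folded L'_def] p[OF assms(3) R, folded R'_def] cc by (intro mono_op_pos_unit)
qed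

lemma norm_le_if_square_le:
  assumes "sym_op \<Phi>" "0 <= M" "pos_op ((M * M) *\<^sub>R id_blinfun - (\<Phi> oL \<Phi>))"
  shows "norm \<Phi> <= M"
proof (rule norm_blinfun_bound[OF assms(2)])
  fix v
  have "inner (\<Phi> v) (\<Phi> v) <= M * M * inner v v"
    using pos_op_nonneg[OF assms(3), of v] sym_opD[OF assms(1), of "\<Phi> v" v]
    by (simp add: blinfun.diff_left blinfun.scaleR_left inner_diff_left)
  hence "(norm (\<Phi> v))^2 <= (M * norm v)^2"
    by (simp add: dot_square_norm power_mult_distrib) (simp add: power2_eq_square)
  thus "norm (\<Phi> v) <= M * norm v" by (rule power2_le_imp_le) (use assms(2) in simp)
qed

lemma pev_zero: "pev r 0 = coeff r 0 *\<^sub>R id_blinfun" by (cases r) (simp add: pev_pCons)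

text \<open>The one variable case of \<open>bip_pos\<close>, with the zero operator as a dummy
  second variable. \<open>T = 0\<close> is split off because there the interval degenerates to a
  point.\<close>

lemma pev_pos:
  assumes T: "pos_op T" and r: "!!s. 0 <= s ==> s <= norm T ==> 0 <= poly r s"
  shows "pos_op (pev r T)"
proof (cases "T = 0")
  case True
  thus ?thesis using r[of 0] by (auto simp: pev_zero poly_0_coeff_0 intro: pos_op_scaleR)
next
  case False
  show ?thesis
  proof (rule bip_pos[where L = T and R = 0 and a = 0 and b = "norm T" and a' = 0 and b' = 1])
    show "bip T 0 (%s t. poly r s) (pev r T)" by (intro bip_pev bip_fst) simp
  qed (use False T r in \<open>auto intro: pos_op_norm_diff pos_op_sym\<close>)
qed

text \<open>Positivity of M^2 - r^2 on the interval bounds the square of the symmetric operator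
  \<open>pev r T\<close>.\<close>

lemma pev_norm_le:
  assumes T: "pos_op T" and r: "!!s. 0 <= s ==> s <= norm T ==> \<bar>poly r s\<bar> <= M"
  shows "norm (pev r T) <= M"
proof (rule norm_le_if_square_le)
  show "sym_op (pev r T)" using T by (intro sym_op_pev pos_op_sym)
  show M: "0 <= M" using r[of 0] by simp
  have "pos_op (pev ([:M * M:] - r * r) T)"
  proof (rule pev_pos[OF T])
    fix s assume "0 <= s" "s <= norm T"
    hence "\<bar>poly r s\<bar> * \<bar>poly r s\<bar> <= M * M" using r[of s] by (intro mult_mono) auto
    thus "0 <= poly ([:M * M:] - r * r) s" by simp
  qed
  thus "pos_op ((M * M) *\<^sub>R id_blinfun - (pev r T oL pev r T))" by (simp add: pev_diff pev_mult)
qed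

section \<open>Completeness of \<open>\<ell>\<^sub>2\<close> and the continuous functional calculus\<close>

lemma ell2_partial_le: "finite F ==> (\<Sum>a\<in>F. (cmod (Rep_ell2 v a))^2) <= (norm v)^2" unfolding norm_ell2_sq
  by (rule finite_sum_le_infsum) (use Rep_ell2[of v] in auto)

lemma ell2_of_bounded:
  assumes "!!F. finite F ==> (\<Sum>a\<in>F. (cmod (f a))^2) <= C^2" "0 <= C"
  obtains v where "Rep_ell2 v = f" "norm v <= C"
proof -
  have s: "(%a. (cmod (f a))^2) summable_on UNIV"
    using assms by (intro nonneg_bdd_above_summable_on) (auto intro!: bdd_aboveI)
  hence f: "Rep_ell2 (Abs_ell2 f) = f" by (intro Abs_ell2_inverse) simp
  have "(norm (Abs_ell2 f))^2 <= C^2" unfolding norm_ell2_sq f using s assms by (intro infsum_le_finite_sums) auto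
  hence "norm (Abs_ell2 f) <= C" using assms(2) by (rule power2_le_imp_le)
  with f show ?thesis using that by blast
qed

text \<open>The coordinates converge, and finite sums of squared differences pass to the limit; this
  puts the limit in \<open>ell2\<close> and gives convergence in norm. Completeness of the
  operators, on which the functional calculus relies, follows from it.\<close>

instance ell2 :: (type) banach
proof
  fix X :: "nat => 'a ell2"
  assume X: "Cauchy X"
  have "convergent (%n. Rep_ell2 (X n) a)" for a
    using bounded_linear.Cauchy[OF bounded_linear_Rep_ell2 X] by (rule Cauchy_convergent)
  then obtain f where f: "!!a. (%n. Rep_ell2 (X n) a) \<longlonglongrightarrow> f a"
    unfolding convergent_def by metis
  have fin: "(\<Sum>a\<in>F. (cmod (f a - Rep_ell2 (X n) a))^2) <= e^2"
    if "finite F" "n >= N" "!!m n. m >= N ==> n >= N ==> norm (X m - X n) < e" for F n N e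
  proof (rule LIMSEQ_le_const2)
    show "(%m. \<Sum>a\<in>F. (cmod (Rep_ell2 (X m) a - Rep_ell2 (X n) a))^2) \<longlonglongrightarrow> (\<Sum>a\<in>F. (cmod (f a - Rep_ell2 (X n) a))^2)"
      by (intro tendsto_intros f)
    have "(\<Sum>a\<in>F. (cmod (Rep_ell2 (X m) a - Rep_ell2 (X n) a))^2) <= e^2" if "m >= N" for m
    proof -
      have "(\<Sum>a\<in>F. (cmod (Rep_ell2 (X m) a - Rep_ell2 (X n) a))^2) = (\<Sum>a\<in>F. (cmod (Rep_ell2 (X m - X n) a))^2)"
        by (simp add: minus_ell2.rep_eq)
      also have "... <= (norm (X m - X n))^2" using \<open>finite F\<close> by (rule ell2_partial_le)
      also have "... <= e^2" using that \<open>n >= N\<close> \<open>!!m n. m >= N ==> n >= N ==> norm (X m - X n) < e\<close>[of m n]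
        by (intro power_mono) auto
      finally show ?thesis .
    qed
    thus "\<exists>N. \<forall>m\<ge>N. (\<Sum>a\<in>F. (cmod (Rep_ell2 (X m) a - Rep_ell2 (X n) a))^2) <= e^2" by blast
  qed
  have lim: "\<exists>v. Rep_ell2 v = f & norm (v - X n) <= e"
    if "n >= N" "!!m n. m >= N ==> n >= N ==> norm (X m - X n) < e" for n N e
  proof -
    have "0 <= e" using that(2)[OF that(1) that(1)] by simp
    from fin[OF _ that] obtain w where w: "Rep_ell2 w = (%a. f a - Rep_ell2 (X n) a)" "norm w <= e"
      by (rule ell2_of_bounded[OF _ \<open>0 <= e\<close>])
    have "Rep_ell2 (w + X n) = f" by (simp add: plus_ell2.rep_eq w)
    with w show ?thesis by (intro exI[of _ "w + X n"]) simp
  qed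
  have C: "\<exists>N. \<forall>m\<ge>N. \<forall>n\<ge>N. norm (X m - X n) < e" if "e > 0" for e
    using X that unfolding Cauchy_def dist_norm by blast
  obtain N1 where "!!m n. m >= N1 ==> n >= N1 ==> norm (X m - X n) < 1" using C[of 1] by auto
  from lim[OF order_refl this] obtain v where v: "Rep_ell2 v = f" by blast
  have "X \<longlonglongrightarrow> v"
  proof (rule LIMSEQ_I)
    fix e :: real assume "e > 0"
    then obtain N where N: "!!m n. m >= N ==> n >= N ==> norm (X m - X n) < e / 2" using C[of "e / 2"] by auto
    have "norm (X n - v) < e" if "n >= N" for n
    proof -
      from lim[OF that N] obtain v' where "Rep_ell2 v' = f" "norm (v' - X n) <= e / 2" by blast
      with v have "norm (v - X n) <= e / 2" by (metis Rep_ell2_inject)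
      thus ?thesis using \<open>e > 0\<close> by (simp add: norm_minus_commute)
    qed
    thus "\<exists>N. \<forall>n\<ge>N. norm (X n - v) < e" by blast
  qed
  thus "convergent X" unfolding convergent_def by blast
qed

lemma poly_approx:
  fixes f :: "real => real"
  assumes "continuous_on {a..b} f" "e > 0"
  obtains r :: "real poly" where "!!s. a <= s ==> s <= b ==> \<bar>poly r s - f s\<bar> <= e"
proof -
  obtain g where g: "real_polynomial_function g" "!!x. x \<in> {a..b} ==> \<bar>f x - g x\<bar> < e"
    using Stone_Weierstrass_real_polynomial_function[OF compact_Icc assms] by blast
  obtain c n where gc: "g = (%x. \<Sum>i\<le>n. c i * x ^ i)"
    using g(1) unfolding real_polynomial_function_iff_sum by blast
  have "\<bar>poly (\<Sum>i\<le>n. monom (c i) i) s - f s\<bar> <= e" if "a <= s" "s <= b" for s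
    using g(2)[of s] that by (simp add: poly_sum poly_monom gc abs_minus_commute less_imp_le)
  thus ?thesis using that by blast
qed

lemma poly_approx_seq:
  fixes f :: "real => real"
  assumes "continuous_on {a..b} f"
  obtains r :: "nat => real poly" where "!!k s. a <= s ==> s <= b ==> \<bar>poly (r k) s - f s\<bar> <= 1 / (real k + 1)"
    "uniform_limit {a..b} (%k. poly (r k)) f sequentially"
proof -
  have "\<exists>r. \<forall>s. a <= s --> s <= b --> \<bar>poly r s - f s\<bar> <= 1 / (real k + 1)" for k :: nat
    by (rule poly_approx[OF assms, of "1 / (real k + 1)"]) auto
  then obtain r where r: "!!k s. a <= s ==> s <= b ==> \<bar>poly (r k) s - f s\<bar> <= 1 / (real k + 1)" by metis
  have "uniform_limit {a..b} (%k. poly (r k)) f sequentially"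
  proof (rule uniform_limitI)
    fix e :: real assume "e > 0"
    then obtain n where n: "n > 0" "inverse (real n) < e" using ex_inverse_of_nat_less by blast
    have "\<bar>poly (r k) s - f s\<bar> < e" if "k >= n" "s \<in> {a..b}" for k s
    proof -
      have "1 / (real k + 1) <= 1 / real n" using that n by (intro divide_left_mono) auto
      thus ?thesis using r[of s k] that n by (simp add: inverse_eq_divide)
    qed
    thus "\<forall>\<^sub>F k in sequentially. \<forall>s\<in>{a..b}. dist (poly (r k) s) (f s) < e"
      unfolding eventually_sequentially dist_real_def by blast
  qed
  with r show ?thesis using that by blast
qed

text \<open>By \<open>pev_norm_le\<close> the map from polynomials to operators is contractive for
  the supremum norm. Hence approximating sequences give Cauchy sequences of operators with one
  common limit, and the definite description in \<open>pos_calc\<close> denotes it.\<close>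

lemma pos_calc_limit:
  fixes T :: "'a op"
  assumes T: "pos_op T" and f: "continuous_on {0..norm T} f"
    and r: "uniform_limit {0..norm T} (%k. poly (r k)) f sequentially"
  shows "(%k. pev (r k) T) \<longlonglongrightarrow> pos_calc f T"
proof -
  let ?U = "%r. uniform_limit {0..norm T} (%k. poly (r k)) f sequentially"
  have close: "norm (pev p T - pev q T) <= e" if "!!s. s \<in> {0..norm T} ==> \<bar>poly p s - poly q s\<bar> <= e" for p q e
    unfolding pev_diff[symmetric] by (rule pev_norm_le[OF T]) (use that in auto)
  have diff0: "(%k. pev (r k) T - pev (r' k) T) \<longlonglongrightarrow> 0" if "?U r" "?U r'" for r r'
  proof (rule LIMSEQ_I)
    fix e :: real assume "e > 0"
    hence "\<forall>\<^sub>F k in sequentially. \<forall>s\<in>{0..norm T}. dist (poly (r k) s) (f s) < e / 3"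
      "\<forall>\<^sub>F k in sequentially. \<forall>s\<in>{0..norm T}. dist (poly (r' k) s) (f s) < e / 3"
      using that by (auto dest!: uniform_limitD[where e = "e / 3"])
    hence "\<forall>\<^sub>F k in sequentially. norm (pev (r k) T - pev (r' k) T) < e"
    proof eventually_elim
      case (elim k)
      have "norm (pev (r k) T - pev (r' k) T) <= 2 * (e / 3)"
      proof (rule close)
        fix s assume "s \<in> {0..norm T}"
        with elim have "\<bar>poly (r k) s - f s\<bar> < e / 3" "\<bar>poly (r' k) s - f s\<bar> < e / 3"
          by (auto simp: dist_real_def)
        thus "\<bar>poly (r k) s - poly (r' k) s\<bar> <= 2 * (e / 3)" by linarith
      qed
      with \<open>e > 0\<close> show ?case by linarith
    qed
    thus "\<exists>N. \<forall>n\<ge>N. norm (pev (r n) T - pev (r' n) T - 0) < e" by (simp add: eventually_sequentially)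
  qed
  obtain r0 where r0: "?U r0" by (rule poly_approx_seq[OF f])
  have "Cauchy (%k. pev (r0 k) T)"
  proof (rule CauchyI)
    fix e :: real assume "e > 0"
    hence "\<forall>\<^sub>F k in sequentially. \<forall>s\<in>{0..norm T}. dist (poly (r0 k) s) (f s) < e / 3"
      using r0 by (auto dest!: uniform_limitD[where e = "e / 3"])
    then obtain N where N: "!!k s. k >= N ==> s \<in> {0..norm T} ==> dist (poly (r0 k) s) (f s) < e / 3"
      unfolding eventually_sequentially by blast
    have "norm (pev (r0 m) T - pev (r0 n) T) < e" if "m >= N" "n >= N" for m n
    proof -
      have "norm (pev (r0 m) T - pev (r0 n) T) <= 2 * (e / 3)"
      proof (rule close)
        fix s assume "s \<in> {0..norm T}"
        with N[OF that(1) this] N[OF that(2) this] show "\<bar>poly (r0 m) s - poly (r0 n) s\<bar> <= 2 * (e / 3)"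
          unfolding dist_real_def by linarith
      qed
      with \<open>e > 0\<close> show ?thesis by linarith
    qed
    thus "\<exists>M. \<forall>m\<ge>M. \<forall>n\<ge>M. norm (pev (r0 m) T - pev (r0 n) T) < e" by blast
  qed
  then obtain S where S: "(%k. pev (r0 k) T) \<longlonglongrightarrow> S"
    using Cauchy_convergent convergent_def by blast
  have lim: "(%k. pev (r' k) T) \<longlonglongrightarrow> S" if "?U r'" for r'
    using tendsto_add[OF diff0[OF that r0] S] by simp
  have "pos_calc f T = S" unfolding pos_calc_def op_poly_eq_pev
    by (rule the_equality) (use lim r0 in \<open>auto intro: LIMSEQ_unique\<close>)
  with lim[OF r] show ?thesis by simp
qed

text \<open>Continuity on the whole half line, rather than on the spectrum, lets one condition serve
  all positive operators.\<close>

abbreviation cont0 :: "(real => real) => bool" where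
  "cont0 f \<equiv> continuous_on {0..} f"

lemma cont0_Icc: "cont0 f ==> continuous_on {0..c} f" by (rule continuous_on_subset) auto

text \<open>The bound \<open>c\<close> is independent of any operator, so that one sequence can be
  applied to several operators at once.\<close>

definition approx_seq :: "real => (real => real) => (nat => real poly) => bool" where
  "approx_seq c f r \<longleftrightarrow> uniform_limit {0..c} (%k. poly (r k)) f sequentially"

lemma approx_seq_ex:
  assumes "cont0 f"
  shows "\<exists>r. approx_seq c f r"
proof -
  obtain r where "uniform_limit {0..c} (%k. poly (r k)) f sequentially"
    by (rule poly_approx_seq[OF cont0_Icc[OF assms]])
  thus ?thesis unfolding approx_seq_def by blast
qed

lemma approx_seqD:
  "approx_seq c f r ==> e > 0 ==> \<forall>\<^sub>F k in sequentially. \<forall>s\<in>{0..c}. \<bar>poly (r k) s - f s\<bar> <= e"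
  unfolding approx_seq_def by (drule (1) uniform_limitD) (auto elim!: eventually_mono simp: dist_real_def less_imp_le)

lemma approx_seq_calc:
  assumes "approx_seq c f r" "cont0 f" "pos_op T" "norm T <= c"
  shows "(%k. pev (r k) T) \<longlonglongrightarrow> pos_calc f T" by (rule pos_calc_limit)
    (use assms in \<open>auto simp: approx_seq_def intro: cont0_Icc uniform_limit_on_subset\<close>)

lemma approx_seq_add: "approx_seq c f r ==> approx_seq c g s ==> approx_seq c (%x. f x + g x) (%k. r k + s k)"
  unfolding approx_seq_def poly_add by (rule uniform_limit_add)

lemma approx_seq_smult: "approx_seq c f r ==> approx_seq c (%x. a * f x) (%k. smult a (r k))"
  unfolding approx_seq_def poly_smult using bounded_linear.uniform_limit[OF bounded_linear_mult_right] .

lemma approx_seq_mult: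
  assumes "approx_seq c f r" "approx_seq c g s" "cont0 f" "cont0 g"
  shows "approx_seq c (%x. f x * g x) (%k. r k * s k)" unfolding approx_seq_def poly_mult
  by (rule uniform_lim_mult)
    (use assms in \<open>auto simp: approx_seq_def intro!: compact_imp_bounded compact_continuous_image cont0_Icc\<close>)

lemma cf_poly: "pos_op T ==> pos_calc (poly r) T = pev r T"
proof -
  assume T: "pos_op T"
  have "approx_seq (norm T) (poly r) (%_. r)" by (simp add: approx_seq_def uniform_limit_const)
  moreover have "cont0 (poly r)" using continuous_on_poly[of "{0..}" "%x. x" r] by simp
  ultimately have "(%k. pev r T) \<longlonglongrightarrow> pos_calc (poly r) T" using T by (intro approx_seq_calc) auto
  thus ?thesis by (rule LIMSEQ_unique[OF _ tendsto_const])
qed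

lemma cf_cong:
  assumes "!!s. 0 <= s ==> s <= norm T ==> f s = g s"
  shows "pos_calc f T = pos_calc g T"
proof -
  have "uniform_limit {0..norm T} F f sequentially = uniform_limit {0..norm T} F g sequentially" for F
    using assms by (intro uniform_limit_cong') auto
  thus ?thesis by (simp add: pos_calc_def)
qed

lemma cf_const: "pos_op T ==> pos_calc (%_. a) T = a *\<^sub>R id_blinfun"
  using cf_poly[of T "[:a:]"] cf_cong[of T "poly [:a:]" "%_. a"] by simp

lemma cf_id: "pos_op T ==> pos_calc (%s. s) T = T"
  using cf_poly[of T "[:0, 1:]"] cf_cong[of T "poly [:0, 1:]" "%s. s"] by simp

lemma cf_add:
  assumes "pos_op T" "cont0 f" "cont0 g"
  shows "pos_calc (%s. f s + g s) T = pos_calc f T + pos_calc g T"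
proof -
  obtain r s where rs: "approx_seq (norm T) f r" "approx_seq (norm T) g s" using approx_seq_ex assms by metis
  have "(%k. pev (r k + s k) T) \<longlonglongrightarrow> pos_calc (%s. f s + g s) T"
    by (rule approx_seq_calc[OF approx_seq_add[OF rs]]) (use assms in \<open>(intro continuous_intros | simp)+\<close>)
  moreover have "(%k. pev (r k + s k) T) \<longlonglongrightarrow> pos_calc f T + pos_calc g T"
    unfolding pev_add using assms rs by (intro tendsto_add approx_seq_calc) auto
  ultimately show ?thesis by (rule LIMSEQ_unique)
qed

lemma cf_scale:
  assumes "pos_op T" "cont0 f"
  shows "pos_calc (%s. a * f s) T = a *\<^sub>R pos_calc f T"
proof -
  obtain r where r: "approx_seq (norm T) f r" using approx_seq_ex assms by metis
  have "(%k. pev (smult a (r k)) T) \<longlonglongrightarrow> pos_calc (%s. a * f s) T"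
    by (rule approx_seq_calc[OF approx_seq_smult[OF r]]) (use assms in \<open>(intro continuous_intros | simp)+\<close>)
  moreover have "(%k. pev (smult a (r k)) T) \<longlonglongrightarrow> a *\<^sub>R pos_calc f T"
    unfolding pev_smult using assms r by (intro tendsto_scaleR tendsto_const approx_seq_calc) auto
  ultimately show ?thesis by (rule LIMSEQ_unique)
qed

lemma cf_mult:
  assumes "pos_op T" "cont0 f" "cont0 g"
  shows "pos_calc (%s. f s * g s) T = pos_calc f T oL pos_calc g T"
proof -
  obtain r s where rs: "approx_seq (norm T) f r" "approx_seq (norm T) g s" using approx_seq_ex assms by metis
  have "(%k. pev (r k * s k) T) \<longlonglongrightarrow> pos_calc (%s. f s * g s) T"
    by (rule approx_seq_calc[OF approx_seq_mult[OF rs]]) (use assms in \<open>(intro continuous_intros | simp)+\<close>)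
  moreover have "(%k. pev (r k * s k) T) \<longlonglongrightarrow> (pos_calc f T oL pos_calc g T)" unfolding pev_mult
    by (rule bounded_bilinear.tendsto[OF bounded_bilinear_blinfun_compose]) (use assms rs in \<open>auto intro: approx_seq_calc\<close>)
  ultimately show ?thesis by (rule LIMSEQ_unique)
qed

lemma cf_closed:
  assumes "pos_op T" "cont0 f" "closed C" "!!r. pev r T \<in> C"
  shows "pos_calc f T \<in> C"
proof -
  obtain r where r: "approx_seq (norm T) f r" using approx_seq_ex assms by metis
  show ?thesis using closed_sequentially[OF assms(3) _ approx_seq_calc[OF r]] assms by auto
qed

lemma closed_sym_op: "closed {T. sym_op T}"
proof -
  have "{T :: 'a \<Rightarrow>\<^sub>L 'a. sym_op T} = (\<Inter>u. \<Inter>v. {T. inner (blinfun_apply T u) v = inner u (blinfun_apply T v)})"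
    by (auto simp: sym_op_def)
  also have "closed ..." by (intro closed_INT ballI closed_Collect_eq continuous_intros)
  finally show ?thesis .
qed

lemma cf_sym: "pos_op T ==> cont0 f ==> sym_op (pos_calc f T)"
  using cf_closed[of T f "{T. sym_op T}"] closed_sym_op by (auto simp: sym_op_pev pos_op_sym)

text \<open>\<open>f\<close> agrees on the interval with the square of
  \<open>sqrt \<bar>f\<bar>\<close>, and the square of a symmetric operator is positive.\<close>

lemma cf_pos:
  assumes "pos_op T" "cont0 f" "!!s. 0 <= s ==> s <= norm T ==> 0 <= f s"
  shows "pos_op (pos_calc f T)"
proof -
  let ?g = "%s. sqrt \<bar>f s\<bar>"
  have g: "cont0 ?g" using assms by (intro continuous_intros)
  have "pos_calc f T = pos_calc (%s. ?g s * ?g s) T" using assms by (intro cf_cong) auto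
  also have "... = pos_calc ?g T oL pos_calc ?g T" using assms g by (intro cf_mult)
  also have "pos_op ..." using assms g by (intro pos_op_square cf_sym)
  finally show ?thesis .
qed

lemma cf_diff: "pos_op T ==> cont0 f ==> cont0 g ==> pos_calc (%s. f s - g s) T = pos_calc f T - pos_calc g T"
  using cf_add[of T f "%s. -1 * g s"] cf_scale[of T g "-1"] by (simp add: continuous_intros)

lemma cf_norm_le:
  assumes "pos_op T" "cont0 f" "!!s. 0 <= s ==> s <= norm T ==> \<bar>f s\<bar> <= M"
  shows "norm (pos_calc f T) <= M"
proof (rule norm_le_if_square_le)
  have "pos_op (pos_calc (%s. M * M - f s * f s) T)"
  proof (rule cf_pos)
    fix s assume "0 <= s" "s <= norm T"
    from assms(3)[OF this] have "\<bar>f s\<bar> * \<bar>f s\<bar> <= M * M" by (intro mult_mono) auto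
    thus "0 <= M * M - f s * f s" by simp
  qed (use assms in \<open>(intro continuous_intros | simp)+\<close>)
  also have "pos_calc (%s. M * M - f s * f s) T = (M * M) *\<^sub>R id_blinfun - (pos_calc f T oL pos_calc f T)"
    using assms cf_diff[of T "%_. M * M" "%s. f s * f s"] by (simp add: cf_const cf_mult continuous_intros)
  finally show "pos_op ((M * M) *\<^sub>R id_blinfun - (pos_calc f T oL pos_calc f T))" .
  show "0 <= M" using assms(3)[of 0] by simp
qed (use assms in \<open>auto intro: cf_sym\<close>)

lemma cf_compose:
  assumes T: "pos_op T" and f: "cont0 f" and g: "cont0 g" "!!s. 0 <= s ==> 0 <= g s"
  shows "pos_calc f (pos_calc g T) = pos_calc (%s. f (g s)) T"
proof -
  have "bounded (g ` {0..norm T})" using g by (intro compact_imp_bounded compact_continuous_image cont0_Icc) auto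
  then obtain M where M: "!!s. 0 <= s ==> s <= norm T ==> \<bar>g s\<bar> <= M" by (fastforce simp: bounded_iff)
  have gT: "pos_op (pos_calc g T)" "norm (pos_calc g T) <= M" using T g M by (auto intro!: cf_pos cf_norm_le)
  obtain r where r: "approx_seq M f r" using approx_seq_ex[OF f] by blast
  have 1: "(%k. pev (r k) (pos_calc g T)) \<longlonglongrightarrow> pos_calc f (pos_calc g T)"
    by (rule approx_seq_calc[OF r f gT])
  have fg: "cont0 (%s. f (g s))" by (rule continuous_on_compose2[OF f g(1)]) (use g(2) in auto)
  have pv: "pev p (pos_calc g T) = pos_calc (%s. poly p (g s)) T" for p
  proof (induction p)
    case 0
    thus ?case using cf_const[OF T, of 0] by simp
  next
    case (pCons a p)
    have c: "cont0 (%s. poly p (g s))" using g by (intro continuous_intros)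
    have "pos_calc (%s. poly (pCons a p) (g s)) T = pos_calc (%_. a) T + pos_calc (%s. g s * poly p (g s)) T"
      unfolding poly_pCons using c g by (intro cf_add T continuous_intros)
    also have "... = a *\<^sub>R id_blinfun + (pos_calc g T oL pos_calc (%s. poly p (g s)) T)"
      using c g T by (simp add: cf_mult cf_const)
    finally show ?case using pCons by (simp add: pev_pCons)
  qed
  have "(%k. pev (r k) (pos_calc g T)) \<longlonglongrightarrow> pos_calc (%s. f (g s)) T"
  proof (rule LIMSEQ_I)
    fix e :: real assume "e > 0"
    hence "\<forall>\<^sub>F k in sequentially. \<forall>s\<in>{0..M}. \<bar>poly (r k) s - f s\<bar> <= e / 2"
      by (intro approx_seqD[OF r]) auto
    hence "\<forall>\<^sub>F k in sequentially. norm (pev (r k) (pos_calc g T) - pos_calc (%s. f (g s)) T) < e"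
    proof eventually_elim
      case (elim k)
      have c: "cont0 (%s. poly (r k) (g s))" using g by (intro continuous_intros)
      have "pev (r k) (pos_calc g T) - pos_calc (%s. f (g s)) T = pos_calc (%s. poly (r k) (g s) - f (g s)) T"
        unfolding pv by (rule cf_diff[OF T c fg, symmetric])
      moreover have "norm (pos_calc (%s. poly (r k) (g s) - f (g s)) T) <= e / 2"
      proof (rule cf_norm_le[OF T])
        fix s assume "0 <= s" "s <= norm T"
        with M[OF this] g(2) have "g s \<in> {0..M}" by auto
        with elim show "\<bar>poly (r k) (g s) - f (g s)\<bar> <= e / 2" by blast
      qed (rule continuous_on_diff[OF c fg])
      ultimately show ?case using \<open>e > 0\<close> by simp
    qed
    thus "\<exists>N. \<forall>k\<ge>N. norm (pev (r k) (pos_calc g T) - pos_calc (%s. f (g s)) T) < e"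
      by (simp add: eventually_sequentially)
  qed
  with 1 show ?thesis by (rule LIMSEQ_unique)
qed

lemma pev_intertwine: "S oL Y = Y oL T ==> pev r S oL Y = Y oL pev r T"
proof (induction r)
  case (pCons a r)
  hence "S oL (pev r S oL Y) = Y oL (T oL pev r T)" by (metis compose_assoc)
  thus ?case by (simp add: pev_pCons compose_linear compose_assoc)
qed simp

text \<open>Exact for polynomials, hence in the limit. With \<open>Y = x\<close> it says f(x adj x)
  x = x f(adj x x), the commutation behind the polar decomposition.\<close>

lemma cf_intertwine:
  assumes "pos_op S" "pos_op T" "cont0 f" "S oL Y = Y oL T"
  shows "pos_calc f S oL Y = Y oL pos_calc f T"
proof -
  obtain r where r: "approx_seq (max (norm S) (norm T)) f r" using approx_seq_ex assms by metis
  have "(%k. pev (r k) S oL Y) \<longlonglongrightarrow> (pos_calc f S oL Y)"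
    by (rule bounded_bilinear.tendsto[OF bounded_bilinear_blinfun_compose])
      (use assms in \<open>auto intro: approx_seq_calc[OF r]\<close>)
  moreover have "(%k. Y oL pev (r k) T) \<longlonglongrightarrow> (Y oL pos_calc f T)"
    by (rule bounded_bilinear.tendsto[OF bounded_bilinear_blinfun_compose])
      (use assms in \<open>auto intro: approx_seq_calc[OF r]\<close>)
  ultimately show ?thesis unfolding pev_intertwine[OF assms(4)] by (rule LIMSEQ_unique)
qed

subsection \<open>Spectral functionals\<close>

text \<open>The integral of \<open>f\<close> against the spectral measure of \<open>T\<close> at the
  vector \<open>v\<close>.\<close>

definition spf :: "'a op => 'a ell2 => (real => real) => real" where
  "spf T v f = inner (pos_calc f T v) v"

lemma spf_add: "pos_op T ==> cont0 f ==> cont0 g ==> spf T v (%s. f s + g s) = spf T v f + spf T v g"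
  by (simp add: spf_def cf_add blinfun.add_left inner_add_left)

lemma spf_diff: "pos_op T ==> cont0 f ==> cont0 g ==> spf T v (%s. f s - g s) = spf T v f - spf T v g"
  by (simp add: spf_def cf_diff blinfun.diff_left inner_diff_left)

lemma spf_scale: "pos_op T ==> cont0 f ==> spf T v (%s. a * f s) = a * spf T v f"
  by (simp add: spf_def cf_scale blinfun.scaleR_left)

lemma spf_const: "pos_op T ==> spf T v (%_. a) = a * (norm v)^2"
  by (simp add: spf_def cf_const blinfun.scaleR_left dot_square_norm)

lemma spf_cong: "(!!s. 0 <= s ==> s <= norm T ==> f s = g s) ==> spf T v f = spf T v g"
  unfolding spf_def by (subst cf_cong[of T f g]) auto

lemma spf_nonneg: "pos_op T ==> cont0 f ==> (!!s. 0 <= s ==> s <= norm T ==> 0 <= f s) ==> 0 <= spf T v f"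
  unfolding spf_def by (rule pos_op_nonneg[OF cf_pos])

lemma spf_mono:
  "pos_op T ==> cont0 f ==> cont0 g ==> (!!s. 0 <= s ==> s <= norm T ==> f s <= g s) ==> spf T v f <= spf T v g"
  using spf_nonneg[of T "%s. g s - f s" v] by (simp add: spf_diff continuous_intros)

lemma spf_abs_le:
  assumes "pos_op T" "cont0 f" "!!s. 0 <= s ==> s <= norm T ==> \<bar>f s\<bar> <= M"
  shows "\<bar>spf T v f\<bar> <= M * (norm v)^2"
proof -
  have "spf T v f <= spf T v (%_. M)" using assms by (intro spf_mono) (auto simp: abs_le_iff)
  moreover have "spf T v (%_. - M) <= spf T v f" using assms by (intro spf_mono) (auto simp: abs_le_iff minus_le_iff)
  ultimately show ?thesis using assms by (simp add: spf_const abs_le_iff)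
qed

lemma spf_scaleR_vec: "spf T (c *\<^sub>R v) f = c^2 * spf T v f" by (simp add: spf_def blinfun.scaleR_right power2_eq_square)

lemma spf_approx_seq:
  assumes "approx_seq c f r" "cont0 f" "pos_op T" "norm T <= c"
  shows "(%k. inner (pev (r k) T v) v) \<longlonglongrightarrow> spf T v f" unfolding spf_def
  by (intro tendsto_inner tendsto_const bounded_bilinear.tendsto[OF bounded_bilinear_blinfun_apply]
      approx_seq_calc[OF assms])

section \<open>Adjoints, the group von Neumann algebra and its trace\<close>

section \<open>Adjoints\<close>

lemma cinner_scaleC_right: "cinner u (scaleC c v) = cnj c * cinner u v"
proof transfer
  fix u v :: "'a => complex" and c
  have "(\<Sum>\<^sub>\<infinity>x. u x * cnj (c * v x)) = (\<Sum>\<^sub>\<infinity>x. cnj c * (u x * cnj (v x)))"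
    by (rule infsum_cong) simp
  thus "(\<Sum>\<^sub>\<infinity>x. u x * cnj (c * v x)) = cnj c * (\<Sum>\<^sub>\<infinity>x. u x * cnj (v x))"
    by (simp add: infsum_cmult_right')
qed

lemma cinner_scaleC_left: "cinner (scaleC c u) v = c * cinner u v"
  by (metis cinner_commute cinner_scaleC_right complex_cnj_cnj complex_cnj_mult)

lemma cinner_eq_inner: "cinner u v = Complex (inner u v) (inner u (scaleC \<i> v))"
  by (simp add: complex_eq_iff inner_ell2_def cinner_scaleC_right)

lemma cinner_add_right: "cinner u (v + w) = cinner u v + cinner u w"
proof -
  have "scaleC \<i> (v + w) = scaleC \<i> v + scaleC \<i> w"
    by (rule linear_add[OF bounded_linear.linear[OF bounded_linear_scaleC]])
  thus ?thesis by (simp add: cinner_eq_inner inner_add_right complex_add)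
qed

lemma cinner_add_left: "cinner (u + v) w = cinner u w + cinner v w" by (metis cinner_add_right cinner_commute complex_cnj_add)

lemma scaleC_linear:
  fixes u v :: "'a ell2"
  shows
  "scaleC c (u + v) = scaleC c u + scaleC c v" "scaleC c (u - v) = scaleC c u - scaleC c v"
  "scaleC c (0 :: 'a ell2) = 0" "scaleC c (r *\<^sub>R u) = r *\<^sub>R scaleC c u"
proof -
  have "linear (scaleC c :: 'a ell2 => _)" by (rule bounded_linear.linear[OF bounded_linear_scaleC])
  thus "scaleC c (u + v) = scaleC c u + scaleC c v" "scaleC c (u - v) = scaleC c u - scaleC c v"
    "scaleC c (0 :: 'a ell2) = 0" "scaleC c (r *\<^sub>R u) = r *\<^sub>R scaleC c u"
    by (simp_all add: linear_add linear_diff linear_0 linear_scale)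
qed

lemma scaleC_of_real: "scaleC (of_real r) v = r *\<^sub>R v" by (rule ell2_eqI) (simp add: scaleC.rep_eq scaleR_ell2.rep_eq)

lemma scaleC_1 [simp]: "scaleC 1 v = v" using scaleC_of_real[of 1 v] by simp

lemma scaleC_scaleC: "scaleC c (scaleC d v) = scaleC (c * d) v" by (rule ell2_eqI) (simp add: scaleC.rep_eq)

lemma norm_scaleC: "norm (scaleC c v) = cmod c * norm v"
proof -
  have "(norm (scaleC c v))^2 = (cmod c * norm v)^2"
    by (simp add: power_mult_distrib norm_ell2_sq scaleC.rep_eq norm_mult infsum_cmult_right')
  thus ?thesis by (simp add: power2_eq_iff_nonneg)
qed

lemma cinner_sum_right: "cinner u (sum f A) = (\<Sum>a\<in>A. cinner u (f a))"
proof (induction A rule: infinite_finite_induct)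
  case empty
  thus ?case using cinner_scaleC_right[of u 0 0] by (simp add: scaleC_linear)
next
  case (infinite A)
  thus ?case using cinner_scaleC_right[of u 0 0] by (simp add: scaleC_linear)
qed (auto simp: cinner_add_right)

lemma Rep_ell2_delta_sum: "finite F ==> Rep_ell2 (\<Sum>a\<in>F. scaleC (c a) (delta a)) b = (if b \<in> F then c b else 0)"
  by (simp add: Rep_ell2_sum scaleC.rep_eq delta.rep_eq if_distrib[where f = "%x. _ * x"] eq_commute[of b] cong: if_cong)

lemma norm_finite_sq:
  assumes "finite F" "!!a. a \<notin> F ==> Rep_ell2 v a = 0"
  shows "(norm v)^2 = (\<Sum>a\<in>F. (cmod (Rep_ell2 v a))^2)"
proof -
  have "(norm v)^2 = (\<Sum>\<^sub>\<infinity>a\<in>F. (cmod (Rep_ell2 v a))^2)"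
    unfolding norm_ell2_sq by (rule infsum_cong_neutral) (use assms in auto)
  thus ?thesis using assms(1) by simp
qed

lemma norm_delta_sum: "finite F ==> (norm (\<Sum>a\<in>F. scaleC (c a) (delta a)))^2 = (\<Sum>a\<in>F. (cmod (c a))^2)"
  by (subst norm_finite_sq[of F]) (auto simp: Rep_ell2_delta_sum)

lemma norm_delta [simp]: "norm (delta a) = 1"
  using norm_delta_sum[of "{a}" "%_. 1"] by (simp add: power2_eq_1_iff) (smt (verit) norm_ge_zero)

lemma ell2_functional_eqI:
  fixes f g :: "'a ell2 => real"
  assumes f: "bounded_linear f" and g: "bounded_linear g"
    and eq: "!!c a. f (scaleC c (delta a)) = g (scaleC c (delta a))"
  shows "f v = g v"
proof -
  let ?s = "%F. \<Sum>a\<in>F. scaleC (Rep_ell2 v a) (delta a)"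
  have 1: "((%F. h (?s F)) \<longlongrightarrow> h v) (finite_subsets_at_top UNIV)" if "bounded_linear h" for h :: "'a ell2 => real"
    by (rule bounded_linear.tendsto[OF that ell2_delta_tendsto])
  have "f (?s F) = g (?s F)" for F
    using eq by (simp add: linear_sum[OF bounded_linear.linear[OF f]] linear_sum[OF bounded_linear.linear[OF g]])
  with 1[OF f] have "((%F. g (?s F)) \<longlongrightarrow> f v) (finite_subsets_at_top UNIV)" by simp
  thus ?thesis by (rule tendsto_unique[OF finite_subsets_at_top_neq_bot _ 1[OF g]])
qed

text \<open>The hypothesis bounds the synthesis map c |-> sum of c(g) row(g), and \<open>T\<close>
  is its adjoint. Taking c(g) = <v, row g> makes the sum S of their squares satisfy S <= norm v * C
  * sqrt S.\<close>

lemma op_of_rows: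
  fixes row :: "'a => 'a ell2"
  assumes C: "0 <= C" and row: "!!G c. finite G ==>
    norm (\<Sum>g\<in>G. scaleC (c g) (row g)) <= C * sqrt (\<Sum>g\<in>G. (cmod (c g))^2)"
  obtains T where "T \<in> bounded_ops" "!!v g. Rep_ell2 (T v) g = cinner v (row g)"
proof -
  have b: "(\<Sum>g\<in>G. (cmod (cinner v (row g)))^2) <= (C * norm v)^2" if G: "finite G" for v G
  proof -
    define S where "S = (\<Sum>g\<in>G. (cmod (cinner v (row g)))^2)"
    have S0: "0 <= S" unfolding S_def by (rule sum_nonneg) simp
    have "cinner v (\<Sum>g\<in>G. scaleC (cinner v (row g)) (row g)) = of_real S"
      unfolding cinner_sum_right cinner_scaleC_right S_def of_real_sum
      by (rule sum.cong) (simp_all add: complex_norm_square mult.commute flip: of_real_power)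
    hence "S = inner v (\<Sum>g\<in>G. scaleC (cinner v (row g)) (row g))" by (simp add: inner_ell2_def)
    also have "... <= norm v * norm (\<Sum>g\<in>G. scaleC (cinner v (row g)) (row g))" by (rule norm_cauchy_schwarz)
    also have "... <= norm v * (C * sqrt S)" unfolding S_def by (intro mult_left_mono row G) simp
    finally have *: "sqrt S * sqrt S <= (C * norm v) * sqrt S" using S0 by (simp add: mult_ac)
    have "sqrt S <= C * norm v"
    proof (cases "S = 0")
      case False
      hence "0 < sqrt S" using S0 by simp
      thus ?thesis using * by (simp only: mult_le_cancel_right_pos)
    qed (use C in simp)
    hence "(sqrt S)^2 <= (C * norm v)^2" using S0 by (intro power_mono) auto
    thus ?thesis using S0 by (simp add: S_def)
  qed
  have "\<exists>w. Rep_ell2 w = (%g. cinner v (row g)) & norm w <= C * norm v" for v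
    by (rule ell2_of_bounded[OF b, of v]) (use C in auto)
  then obtain t where t: "!!v. Rep_ell2 (t v) = (%g. cinner v (row g))" "!!v. norm (t v) <= C * norm v"
    by metis
  have "bounded_linear t"
  proof (rule bounded_linear_intro[where K = C])
    fix x y :: "'a ell2" and r :: real
    show "t (x + y) = t x + t y" by (rule ell2_eqI) (simp add: t plus_ell2.rep_eq cinner_add_left)
    show "t (r *\<^sub>R x) = r *\<^sub>R t x"
      by (rule ell2_eqI) (simp add: t scaleC.rep_eq cinner_scaleC_left flip: scaleC_of_real)
    show "norm (t x) <= norm x * C" using t(2)[of x] by (simp add: mult.commute)
  qed
  hence T: "blinfun_apply (Blinfun t) = t" by (rule bounded_linear_Blinfun_apply)
  show ?thesis
  proof
    show "Blinfun t \<in> bounded_ops" unfolding bounded_ops_def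
      by (auto intro!: ell2_eqI simp: T t scaleC.rep_eq cinner_scaleC_left)
  qed (simp add: T t)
qed

lemma bounded_opsD: "T \<in> bounded_ops ==> T (scaleC c v) = scaleC c (T v)" by (simp add: bounded_ops_def)

text \<open>The adjoint has the matrix rows \<open>T (delta g)\<close>, whose synthesis map is
  \<open>T\<close> itself on finite sums.\<close>

lemma adj_ex:
  fixes T :: "'a op"
  assumes T: "T \<in> bounded_ops"
  shows "\<exists>S\<in>bounded_ops. \<forall>u v. cinner (T u) v = cinner u (S v)"
proof -
  have "norm (\<Sum>g\<in>G. scaleC (c g) (T (delta g))) <= norm T * sqrt (\<Sum>g\<in>G. (cmod (c g))^2)" if "finite G" for G c
  proof -
    have "(\<Sum>g\<in>G. scaleC (c g) (T (delta g))) = T (\<Sum>g\<in>G. scaleC (c g) (delta g))"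
      by (simp add: blinfun.sum_right bounded_opsD[OF T])
    also have "norm ... <= norm T * norm (\<Sum>g\<in>G. scaleC (c g) (delta g))" by (rule norm_blinfun)
    also have "norm (\<Sum>g\<in>G. scaleC (c g) (delta g)) = sqrt (\<Sum>g\<in>G. (cmod (c g))^2)"
      unfolding norm_delta_sum[OF that, symmetric] by simp
    finally show ?thesis .
  qed
  then obtain S where S: "S \<in> bounded_ops" "!!v g. Rep_ell2 (S v) g = cinner v (T (delta g))"
    by (rule op_of_rows[rotated]) auto
  have r: "inner (T u) v = inner u (S v)" for u v
  proof (rule ell2_functional_eqI[of "%u. inner (T u) v" "%u. inner u (S v)"])
    show "inner (T (scaleC c (delta a))) v = inner (scaleC c (delta a)) (S v)" for c a
      unfolding bounded_opsD[OF T] inner_ell2_def cinner_scaleC_left using S(2)[of v a] by (metis cinner_commute cinner_delta)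
  qed (intro bounded_linear_intros blinfun.bounded_linear_right bounded_linear_inner_left_comp bounded_linear_inner_left)+
  have "cinner (T u) v = cinner u (S v)" for u v unfolding cinner_eq_inner by (simp add: r bounded_opsD[OF S(1)])
  with S show ?thesis by blast
qed

lemma adj_props:
  assumes "T \<in> bounded_ops"
  shows "adj T \<in> bounded_ops" "cinner (T u) v = cinner u (adj T v)"
proof -
  obtain S where S: "S \<in> bounded_ops" "\<forall>u v. cinner (T u) v = cinner u (S v)" using adj_ex[OF assms] by blast
  hence "adj T = S" by (intro adj_eqI) auto
  with S show "adj T \<in> bounded_ops" "cinner (T u) v = cinner u (adj T v)" by auto
qed

lemma adj_inner: "T \<in> bounded_ops ==> inner (T u) v = inner u (adj T v)" by (simp add: inner_ell2_def adj_props(2))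

lemma adj_inner2: "T \<in> bounded_ops ==> inner (adj T u) v = inner u (T v)" by (metis adj_inner inner_commute)

lemma adj_eqI_real:
  assumes "T \<in> bounded_ops" "S \<in> bounded_ops" "!!u v. inner (T u) v = inner u (S v)"
  shows "adj T = S"
proof (rule blinfun_eqI)
  fix v
  have "inner u (adj T v) = inner u (S v)" for u using assms adj_inner[OF assms(1)] by metis
  hence "inner (adj T v - S v) (adj T v - S v) = 0" by (simp add: inner_diff_right)
  thus "adj T v = S v" by simp
qed

lemma bounded_ops_compose: "S \<in> bounded_ops ==> T \<in> bounded_ops ==> S oL T \<in> bounded_ops"
  by (simp add: bounded_ops_def)

lemma bounded_ops_add: "S \<in> bounded_ops ==> T \<in> bounded_ops ==> S + T \<in> bounded_ops"
  by (simp add: bounded_ops_def blinfun.add_left scaleC_linear)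

lemma bounded_ops_scaleR: "T \<in> bounded_ops ==> r *\<^sub>R T \<in> bounded_ops"
  by (simp add: bounded_ops_def blinfun.scaleR_left scaleC_linear)

lemma bounded_ops_id: "id_blinfun \<in> bounded_ops" by (simp add: bounded_ops_def)

lemma bounded_ops_0: "0 \<in> bounded_ops" by (simp add: bounded_ops_def scaleC_linear)

lemma bounded_ops_scaleC: "T \<in> bounded_ops ==> scaleC_op c T \<in> bounded_ops"
  by (simp add: bounded_ops_def scaleC_op_apply scaleC_scaleC mult.commute)

lemma closed_bounded_ops: "closed (bounded_ops :: 'a op set)"
proof -
  have "(bounded_ops :: 'a op set) = (\<Inter>c. \<Inter>v. {T. blinfun_apply T (scaleC c v) = scaleC c (blinfun_apply T v)})"
    by (auto simp: bounded_ops_def)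
  also have "closed ..." by (intro closed_INT ballI closed_Collect_eq continuous_intros
        bounded_linear.continuous_on[OF bounded_linear_scaleC])
  finally show ?thesis .
qed

lemma adj_adj: "T \<in> bounded_ops ==> adj (adj T) = T" by (intro adj_eqI_real adj_props) (simp_all add: adj_inner2)

lemma adj_compose: "S \<in> bounded_ops ==> T \<in> bounded_ops ==> adj (S oL T) = adj T oL adj S"
  by (intro adj_eqI_real bounded_ops_compose adj_props) (simp_all add: adj_inner)

lemma adj_add: "S \<in> bounded_ops ==> T \<in> bounded_ops ==> adj (S + T) = adj S + adj T"
  by (intro adj_eqI_real bounded_ops_add adj_props)
    (simp_all add: adj_inner blinfun.add_left inner_add_left inner_add_right)

lemma adj_scaleR: "T \<in> bounded_ops ==> adj (r *\<^sub>R T) = r *\<^sub>R adj T"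
  by (intro adj_eqI_real bounded_ops_scaleR adj_props) (simp_all add: adj_inner blinfun.scaleR_left)

lemma adj_scaleC: "T \<in> bounded_ops ==> adj (scaleC_op c T) = scaleC_op (cnj c) (adj T)"
  by (intro adj_eqI bounded_ops_scaleC adj_props)
    (simp_all add: adj_props scaleC_op_apply cinner_scaleC_left cinner_scaleC_right)

lemma adj_id [simp]: "adj id_blinfun = id_blinfun" by (intro adj_eqI_real bounded_ops_id) simp

lemma adj_sym: "T \<in> bounded_ops ==> sym_op T ==> adj T = T" by (intro adj_eqI_real) (auto simp: sym_op_def)

lemma pos_op_adj_self: "T \<in> bounded_ops ==> pos_op (adj T oL T)"
  by (simp add: pos_op_def sym_op_def adj_inner2) (simp add: adj_inner)

lemma pos_op_self_adj: "T \<in> bounded_ops ==> pos_op (T oL adj T)"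
  using pos_op_adj_self[of "adj T"] by (simp add: adj_adj adj_props)

section \<open>The algebra \<open>group_vN\<close>\<close>

lemma commutant_iff: "T \<in> commutant A \<longleftrightarrow> T \<in> bounded_ops & (\<forall>S\<in>A. T oL S = S oL T)"
  by (auto simp: commutant_def)

lemma vN_bounded: "x \<in> group_vN ==> x \<in> bounded_ops" by (simp add: group_vN_def commutant_iff)

lemma commutant_compose: "S \<in> commutant A ==> T \<in> commutant A ==> S oL T \<in> commutant A"
  unfolding commutant_iff by (metis bounded_ops_compose compose_assoc)

lemma commutant_add: "S \<in> commutant A ==> T \<in> commutant A ==> S + T \<in> commutant A"
  unfolding commutant_iff by (simp add: bounded_ops_add compose_linear)

lemma commutant_scaleR: "T \<in> commutant A ==> r *\<^sub>R T \<in> commutant A"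
  unfolding commutant_iff by (simp add: bounded_ops_scaleR compose_linear)

lemma commutant_scaleC:
  assumes T: "T \<in> commutant A" and A: "A \<subseteq> bounded_ops"
  shows "scaleC_op c T \<in> commutant A" unfolding commutant_iff
proof (intro conjI ballI)
  show "scaleC_op c T \<in> bounded_ops" using T by (simp add: commutant_iff bounded_ops_scaleC)
  fix S assume S: "S \<in> A"
  hence "T oL S = S oL T" using T by (simp add: commutant_iff)
  hence "T (S v) = S (T v)" for v by (metis blinfun_apply_blinfun_compose)
  moreover have "S \<in> bounded_ops" using S A by blast
  ultimately show "scaleC_op c T oL S = S oL scaleC_op c T" by (intro blinfun_eqI) (simp add: scaleC_op_apply bounded_opsD)
qed

lemma closed_commutant: "closed (commutant A :: 'a op set)"
proof -
  have "(commutant A :: 'a op set) = bounded_ops \<inter> (\<Inter>S\<in>A. {T. T oL S = S oL T})" by (auto simp: commutant_def)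
  also have "closed ..." by (intro closed_Int closed_bounded_ops closed_INT ballI closed_Collect_eq
        bounded_linear.continuous_on[OF bounded_bilinear.bounded_linear_left[OF bounded_bilinear_blinfun_compose]]
        bounded_linear.continuous_on[OF bounded_bilinear.bounded_linear_right[OF bounded_bilinear_blinfun_compose]]
        continuous_on_id)
  finally show ?thesis .
qed

lemma commutant_adj:
  assumes "A \<subseteq> bounded_ops" "!!S. S \<in> A ==> adj S \<in> A" "T \<in> commutant A"
  shows "adj T \<in> commutant A" unfolding commutant_iff
proof (intro conjI ballI)
  have T: "T \<in> bounded_ops" using assms by (simp add: commutant_iff)
  thus "adj T \<in> bounded_ops" by (rule adj_props)
  fix S assume S: "S \<in> A"
  hence "T oL adj S = adj S oL T" using assms by (simp add: commutant_iff)
  hence "adj (T oL adj S) = adj (adj S oL T)" by simp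
  thus "adj T oL S = S oL adj T" using assms(1) S T by (simp add: adj_compose adj_props adj_adj subset_iff)
qed

lemma lreg_comm_adj: "T \<in> commutant (range lreg) ==> adj T \<in> commutant (range lreg)"
  by (rule commutant_adj) (auto simp: adj_lreg lreg_in_bounded_ops)

lemma commutant_subset: "commutant A \<subseteq> bounded_ops" by (auto simp: commutant_def)

lemma vN_adj: "x \<in> group_vN ==> adj x \<in> group_vN"
  unfolding group_vN_def by (rule commutant_adj) (use lreg_comm_adj commutant_subset in auto)

lemma vN_compose: "x \<in> group_vN ==> y \<in> group_vN ==> x oL y \<in> group_vN"
  unfolding group_vN_def by (rule commutant_compose)

lemma vN_add: "x \<in> group_vN ==> y \<in> group_vN ==> x + y \<in> group_vN" unfolding group_vN_def by (rule commutant_add)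

lemma vN_scaleR: "x \<in> group_vN ==> r *\<^sub>R x \<in> group_vN" unfolding group_vN_def by (rule commutant_scaleR)

lemma vN_diff: "x \<in> group_vN ==> y \<in> group_vN ==> x - y \<in> group_vN"
  using vN_add[of x "(-1) *\<^sub>R y"] vN_scaleR[of y "-1"] by simp

lemma vN_scaleC: "x \<in> group_vN ==> scaleC_op c x \<in> group_vN"
  unfolding group_vN_def by (rule commutant_scaleC) (use commutant_subset in auto)

lemma vN_id: "id_blinfun \<in> group_vN" by (simp add: group_vN_def commutant_iff[of id_blinfun] bounded_ops_id)

lemma vN_0: "0 \<in> group_vN" using vN_scaleR[OF vN_id, of 0] by simp

lemma vN_sum: "(!!a. a \<in> A ==> f a \<in> group_vN) ==> sum f A \<in> group_vN"
  by (induction A rule: infinite_finite_induct) (auto simp: vN_0 vN_add)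

lemma vN_lreg: "lreg g \<in> group_vN" using lreg_in_bounded_ops by (auto simp: group_vN_def commutant_iff)

lemma vN_pev: "x \<in> group_vN ==> pev r x \<in> group_vN"
  by (induction r) (auto simp: pev_pCons vN_0 vN_add vN_scaleR vN_id vN_compose)

lemma vN_closed: "closed group_vN" unfolding group_vN_def by (rule closed_commutant)

lemma vN_calc: "pos_op x ==> x \<in> group_vN ==> cont0 f ==> pos_calc f x \<in> group_vN"
  by (rule cf_closed[OF _ _ vN_closed]) (auto intro: vN_pev)

subsection \<open>Right multiplication and the trace\<close>

text \<open>The modular conjugation of the trace: it sends \<open>x vac\<close> to
  \<open>adj x vac\<close> (\<open>Jop_vN\<close>). It is antilinear, hence only real linear, which
  the type of bounded real linear maps admits.\<close>

lift_definition conj_inv :: "'n free_group ell2 => 'n free_group ell2" is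
  "%f (g :: 'n free_group). cnj (f (inverse g))"
proof -
  fix f :: "'n free_group => complex"
  assume "(%x. (cmod (f x))^2) summable_on UNIV"
  moreover have "bij (inverse :: 'n free_group => 'n free_group)" by (rule bij_betw_byWitness[where f' = inverse]) auto
  ultimately show "(%x. (cmod (cnj (f (inverse x))))^2) summable_on UNIV"
    using summable_on_reindex_bij_betw[of inverse UNIV UNIV "%x. (cmod (f x))^2"] by simp
qed

lemma norm_conj_inv: "norm (conj_inv v) = norm v"
proof -
  have "bij (inverse :: 'a free_group => 'a free_group)" by (rule bij_betw_byWitness[where f' = inverse]) auto
  hence "(norm (conj_inv v))^2 = (norm v)^2" unfolding norm_ell2_sq conj_inv.rep_eq
    using infsum_reindex_bij_betw[of inverse UNIV UNIV "%x. (cmod (Rep_ell2 v x))^2"] by simp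
  thus ?thesis by (simp add: power2_eq_iff_nonneg)
qed

lift_definition Jop :: "'n free_group op" is conj_inv
proof (rule bounded_linear_intro[where K = 1])
  fix x y :: "'n free_group ell2" and r :: real
  show "conj_inv (x + y) = conj_inv x + conj_inv y" "conj_inv (r *\<^sub>R x) = r *\<^sub>R conj_inv x" by (transfer; simp)+
qed (simp add: norm_conj_inv)

lemma Jop_Rep: "Rep_ell2 (Jop v) g = cnj (Rep_ell2 v (inverse g))" by (simp add: Jop.rep_eq conj_inv.rep_eq)

lemma Jop_Jop [simp]: "Jop (Jop v) = v" by (rule ell2_eqI) (simp add: Jop_Rep)

lemma Jop_inner: "inner (Jop u) (Jop v) = inner u v"
proof -
  have "norm (Jop w) = norm w" for w :: "'a free_group ell2" by (simp add: Jop.rep_eq norm_conj_inv)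
  thus ?thesis unfolding dot_norm[of "Jop u"] dot_norm[of u] by (simp flip: blinfun.add_right)
qed

lemma Jop_inner2: "inner (Jop u) v = inner u (Jop v)" using Jop_inner[of u "Jop v"] by simp

lemma Jop_scaleC: "Jop (scaleC c v) = scaleC (cnj c) (Jop v)" by (rule ell2_eqI) (simp add: Jop_Rep scaleC.rep_eq)

lemma free_inverse_mult: "inverse (g * h) = inverse h * inverse (g :: 'n free_group)"
proof -
  have "g * h * (inverse h * inverse g) = 1" by (simp add: mult.assoc)
  thus ?thesis by (metis free_group_cancel(1) mult.right_neutral)
qed

lemma Jop_lreg: "Jop (lreg g (Jop v)) = rreg g v"
  by (rule ell2_eqI) (simp add: Jop_Rep lreg_apply rreg.rep_eq translate_right.rep_eq free_inverse_mult)

text \<open>Right multiplication by \<open>x\<close>: on vectors \<open>y vac\<close> it gives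
  \<open>(y oL x) vac\<close> (\<open>Rop_vN\<close>). Written as J \<open>adj x\<close> J it is
  bounded on all of \<open>ell2\<close>.\<close>

definition Rop :: "'n free_group op => 'n free_group op" where
  "Rop x = Jop oL adj x oL Jop"

lemma Rop_apply: "Rop x v = Jop (adj x (Jop v))" by (simp add: Rop_def)

lemma vN_rreg: "x \<in> group_vN ==> x (rreg g v) = rreg g (x v)"
  using rreg_in_commutant[of g] unfolding group_vN_def commutant_iff[of x] by (metis blinfun_apply_blinfun_compose)

lemma Rop_bounded: "x \<in> bounded_ops ==> Rop x \<in> bounded_ops"
proof -
  assume "x \<in> bounded_ops"
  hence "adj x \<in> bounded_ops" by (rule adj_props)
  thus ?thesis unfolding bounded_ops_def mem_Collect_eq Rop_apply Jop_scaleC by (simp add: bounded_opsD Jop_scaleC)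
qed

text \<open>Conjugation with \<open>Jop\<close> exchanges \<open>lreg\<close> and
  \<open>rreg\<close>, and \<open>adj x\<close> commutes with every \<open>rreg g\<close>.\<close>

lemma Rop_commutant:
  assumes x: "x \<in> group_vN"
  shows "Rop x \<in> commutant (range lreg)" unfolding commutant_iff
proof (intro conjI ballI Rop_bounded[OF vN_bounded[OF x]])
  fix S :: "'a free_group op" assume "S \<in> range lreg"
  then obtain g where S: "S = lreg g" by blast
  show "Rop x oL S = S oL Rop x"
  proof (rule blinfun_eqI)
    fix v
    have l: "lreg g v = Jop (rreg g (Jop v))" for v :: "'a free_group ell2" using Jop_lreg[of g "Jop v"] by (metis Jop_Jop)
    show "(Rop x oL S) v = (S oL Rop x) v" by (simp add: S l Rop_apply vN_rreg[OF vN_adj[OF x]])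
  qed
qed

lemma Rop_comm: "x \<in> group_vN ==> y \<in> group_vN ==> Rop x oL y = y oL Rop x"
  using Rop_commutant[of x] unfolding group_vN_def commutant_iff[of y] by auto

lemma vN_delta: "x \<in> group_vN ==> x (delta h) = rreg (inverse h) (x vac)"
proof -
  assume x: "x \<in> group_vN"
  have "rreg (inverse h) vac = delta h"
  proof (rule ell2_eqI)
    fix k
    have "k * inverse h = 1 \<longleftrightarrow> k = h"
      by (metis free_group_left_inverse free_group_right_inverse mult.assoc mult.right_neutral mult_1)
    thus "Rep_ell2 (rreg (inverse h) vac) k = Rep_ell2 (delta h) k"
      by (simp add: rreg.rep_eq translate_right.rep_eq delta.rep_eq)
  qed
  thus ?thesis using vN_rreg[OF x, of "inverse h" "delta 1"] by simp
qed

lemma Jop_vN: "x \<in> group_vN ==> Jop (x vac) = adj x vac"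
proof (rule ell2_eqI)
  fix g assume x: "x \<in> group_vN"
  have "Rep_ell2 (adj x vac) g = cinner (adj x vac) (delta g)" by (simp add: cinner_delta)
  also have "... = cinner vac (x (delta g))"
    using adj_props(2)[of "adj x" "delta 1" "delta g"] vN_bounded[OF x] by (simp add: adj_adj adj_props)
  also have "... = cnj (Rep_ell2 (x (delta g)) 1)" by (metis cinner_commute cinner_delta)
  finally show "Rep_ell2 (Jop (x vac)) g = Rep_ell2 (adj x vac) g"
    unfolding vN_delta[OF x, of g] by (simp add: Jop_Rep rreg.rep_eq translate_right.rep_eq)
qed

lemma Rop_vN: "x \<in> group_vN ==> y \<in> group_vN ==> Rop x (y vac) = y (x vac)"
proof -
  assume x: "x \<in> group_vN" and y: "y \<in> group_vN"
  have "Rop x (y vac) = Jop ((adj x oL adj y) vac)" by (simp add: Rop_apply Jop_vN y)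
  also have "adj x oL adj y = adj (y oL x)" using x y by (simp add: adj_compose vN_bounded)
  also have "Jop (adj (y oL x) vac) = (y oL x) vac" using Jop_vN[OF vN_compose[OF y x]] by (metis Jop_Jop)
  finally show ?thesis by simp
qed

lemma vN_eqI_delta: "x \<in> group_vN ==> y \<in> group_vN ==> x vac = y vac ==> x = y"
  by (rule group_vN_eqI) (simp_all add: fourier_coeff_eq)

definition tr :: "'n free_group op => real" where
  "tr x = inner (x vac) vac"

lemma tr_eq: "tr x = Re (vN_trace x)" by (simp add: tr_def vN_trace_def inner_ell2_def)

lemma tr_adj_compose: "x \<in> group_vN ==> tr (adj x oL y) = inner (y vac) (x vac)" by (simp add: tr_def adj_inner2 vN_bounded)

text \<open>\<open>Jop\<close> preserves \<open>inner\<close> and sends \<open>z vac\<close> to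
  \<open>adj z vac\<close>, which moves the factors around.\<close>

lemma tr_commute: "x \<in> group_vN ==> y \<in> group_vN ==> tr (x oL y) = tr (y oL x)"
proof -
  assume x: "x \<in> group_vN" and y: "y \<in> group_vN"
  have "tr (x oL y) = inner (y vac) (adj x vac)" using x by (simp add: tr_def adj_inner vN_bounded)
  also have "... = inner (Jop (y vac)) (Jop (adj x vac))" by (simp add: Jop_inner)
  also have "... = inner (adj y vac) (x vac)" using x y by (simp add: Jop_vN vN_adj adj_adj vN_bounded)
  also have "... = tr (y oL x)"
    using adj_inner2[OF vN_bounded[OF y], of "delta 1" "x vac"] by (simp add: tr_def inner_commute)
  finally show ?thesis .
qed

lemma Rop_add: "x \<in> bounded_ops ==> y \<in> bounded_ops ==> Rop (x + y) = Rop x + Rop y"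
  by (rule blinfun_eqI) (simp add: Rop_apply adj_add blinfun.add_left blinfun.add_right)

lemma Rop_scaleR: "x \<in> bounded_ops ==> Rop (r *\<^sub>R x) = r *\<^sub>R Rop x"
  by (rule blinfun_eqI) (simp add: Rop_apply adj_scaleR blinfun.scaleR_left blinfun.scaleR_right)

lemma Rop_compose: "x \<in> bounded_ops ==> y \<in> bounded_ops ==> Rop (x oL y) = Rop y oL Rop x"
  by (rule blinfun_eqI) (simp add: Rop_apply adj_compose)

lemma Rop_id [simp]: "Rop id_blinfun = id_blinfun" by (rule blinfun_eqI) (simp add: Rop_apply)

lemma Rop_inner: "x \<in> bounded_ops ==> inner (Rop x u) v = inner u (Rop (adj x) v)"
  by (simp add: Rop_apply Jop_inner2 adj_inner2 adj_adj)

lemma norm_Rop_le: "norm (Rop x v) = norm (adj x (Jop v))" by (simp add: Rop_apply Jop.rep_eq norm_conj_inv)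

lemma sym_op_Rop: "x \<in> bounded_ops ==> sym_op x ==> sym_op (Rop x)" by (simp add: sym_op_def[of "Rop x"] Rop_inner adj_sym)

lemma pos_op_Rop: "x \<in> bounded_ops ==> pos_op x ==> pos_op (Rop x)"
  by (simp add: pos_op_def[of "Rop x"] sym_op_Rop pos_op_sym)
    (simp add: Rop_apply Jop_inner2 adj_sym pos_op_sym pos_op_nonneg)

section \<open>Noncommutative L_p norms, Hoelder inequality and duality\<close>

section \<open>Noncommutative \<open>L\<^sub>p\<close> norms\<close>

text \<open>The trace of f(\<bar>x\<bar>^2). Functions of the square are used because
  \<bar>x\<bar>^2 is algebraic in \<open>x\<close>, so that polynomial \<open>f\<close> stay inside
  the group algebra; this is why exponents appear as \<open>p / 2\<close>.\<close>

definition phi :: "'n free_group op => (real => real) => real" where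
  "phi x f = spf (adj x oL x) vac f"

lemma vN_pos_self: "x \<in> group_vN ==> pos_op (adj x oL x)" by (simp add: pos_op_adj_self vN_bounded)

lemma vN_pos_self2: "x \<in> group_vN ==> pos_op (x oL adj x)" by (simp add: pos_op_self_adj vN_bounded)

lemma vN_self: "x \<in> group_vN ==> adj x oL x \<in> group_vN" by (simp add: vN_compose vN_adj)

lemma phi_add: "x \<in> group_vN ==> cont0 f ==> cont0 g ==> phi x (%s. f s + g s) = phi x f + phi x g"
  by (simp add: phi_def spf_add vN_pos_self)

lemma phi_diff: "x \<in> group_vN ==> cont0 f ==> cont0 g ==> phi x (%s. f s - g s) = phi x f - phi x g"
  by (simp add: phi_def spf_diff vN_pos_self)

lemma phi_scale: "x \<in> group_vN ==> cont0 f ==> phi x (%s. a * f s) = a * phi x f"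
  by (simp add: phi_def spf_scale vN_pos_self)

lemma phi_const: "x \<in> group_vN ==> phi x (%_. a) = a" by (simp add: phi_def spf_const vN_pos_self)

lemma phi_cong: "(!!s. 0 <= s ==> f s = g s) ==> phi x f = phi x g" unfolding phi_def by (rule spf_cong)

lemma phi_mono: "x \<in> group_vN ==> cont0 f ==> cont0 g ==> (!!s. 0 <= s ==> f s <= g s) ==> phi x f <= phi x g"
  unfolding phi_def by (rule spf_mono) (auto simp: vN_pos_self)

lemma phi_nonneg: "x \<in> group_vN ==> cont0 f ==> (!!s. 0 <= s ==> 0 <= f s) ==> 0 <= phi x f"
  unfolding phi_def by (rule spf_nonneg) (auto simp: vN_pos_self)

lemma phi_close:
  assumes "x \<in> group_vN" "cont0 f" "cont0 g"
    "!!s. 0 <= s ==> s <= norm (adj x oL x) ==> \<bar>f s - g s\<bar> <= e"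
  shows "\<bar>phi x f - phi x g\<bar> <= e"
  using spf_abs_le[OF vN_pos_self[OF assms(1)], of "%s. f s - g s" e "delta 1"] assms
  by (simp add: phi_def spf_diff vN_pos_self continuous_on_diff)

lemma phi_poly: "x \<in> group_vN ==> phi x (poly r) = tr (pev r (adj x oL x))"
  by (simp add: phi_def spf_def cf_poly vN_pos_self tr_def)

text \<open>The distribution of \<bar>x\<bar>^2 under the trace is determined by its
  moments.\<close>

lemma phi_eqI:
  assumes x: "x \<in> group_vN" and y: "y \<in> group_vN" and f: "cont0 f"
    and eq: "!!r. tr (pev r (adj x oL x)) = tr (pev r (adj y oL y))"
  shows "phi x f = phi y f"
proof -
  let ?c = "max (norm (adj x oL x)) (norm (adj y oL y))"
  obtain r where r: "approx_seq ?c f r" using approx_seq_ex[OF f] by blast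
  have "(%k. inner (pev (r k) (adj x oL x) vac) vac) \<longlonglongrightarrow> phi x f"
    unfolding phi_def by (rule spf_approx_seq[OF r f vN_pos_self[OF x]]) simp
  moreover have "(%k. inner (pev (r k) (adj y oL y) vac) vac) \<longlonglongrightarrow> phi y f"
    unfolding phi_def by (rule spf_approx_seq[OF r f vN_pos_self[OF y]]) simp
  ultimately show ?thesis unfolding eq[unfolded tr_def] by (rule LIMSEQ_unique)
qed

text \<open>The powers satisfy (x adj x)^(i + 1) = x (adj x x)^i adj x, and the trace lets the last
  factor move to the front.\<close>

lemma phi_adj: "x \<in> group_vN ==> cont0 f ==> phi (adj x) f = phi x f"
proof (rule phi_eqI)
  fix r assume x: "x \<in> group_vN"
  have p: "op_pow (x oL adj x) (Suc i) = x oL (op_pow (adj x oL x) i oL adj x)" for i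
    by (induction i) (simp_all add: compose_assoc)
  have "tr (op_pow (x oL adj x) i) = tr (op_pow (adj x oL x) i)" for i
  proof (cases i)
    case (Suc j)
    have v: "op_pow (adj x oL x) j \<in> group_vN" unfolding pev_power_X[symmetric] using x by (intro vN_pev vN_self)
    have "tr (op_pow (x oL adj x) i) = tr ((op_pow (adj x oL x) j oL adj x) oL x)"
      unfolding Suc p using x v by (intro tr_commute vN_compose vN_adj)
    also have "... = tr (op_pow (adj x oL x) i)"
      unfolding Suc op_pow_Suc using op_pow_commute[of "adj x oL x" "adj x oL x" j] by (simp add: compose_assoc)
    finally show ?thesis .
  qed simp
  thus "tr (pev r (adj (adj x) oL adj x)) = tr (pev r (adj x oL x))"
    using x by (simp add: adj_adj vN_bounded pev_def tr_def sum_blinfun_apply blinfun.scaleR_left inner_sum_left)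
qed (auto simp: vN_adj)

text \<open>For y = x r(\<bar>x\<bar>^2) with real continuous \<open>r\<close> one has
  \<bar>y\<bar>^2 = \<bar>x\<bar>^2 r(\<bar>x\<bar>^2)^2. This computes the norms of the test
  elements used for duality.\<close>

lemma phi_compose_poly:
  assumes x: "x \<in> group_vN" and f: "cont0 f" and r: "cont0 r"
  shows "x oL pos_calc r (adj x oL x) \<in> group_vN"
    and "phi (x oL pos_calc r (adj x oL x)) f = phi x (%s. f (s * (r s)^2))"
    and "inner (x vac) ((x oL pos_calc r (adj x oL x)) vac) = phi x (%s. s * r s)"
proof -
  let ?a = "adj x oL x"
  let ?r = "pos_calc r ?a"
  have a: "pos_op ?a" "?a \<in> group_vN" by (simp_all add: x vN_pos_self vN_self)
  have r': "?r \<in> group_vN" "sym_op ?r" using a r by (auto intro: vN_calc cf_sym)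
  show y: "x oL ?r \<in> group_vN" using x r' by (intro vN_compose)
  have "adj (x oL ?r) oL (x oL ?r) = ?r oL (?a oL ?r)" using x r' by (simp add: adj_compose vN_bounded adj_sym compose_assoc)
  also have "... = pos_calc (%s. r s * (s * r s)) ?a" using a r by (simp add: cf_mult cf_id continuous_intros)
  also have "... = pos_calc (%s. s * (r s)^2) ?a" by (rule cf_cong) (simp add: power2_eq_square)
  finally have eq: "adj (x oL ?r) oL (x oL ?r) = pos_calc (%s. s * (r s)^2) ?a" .
  have "pos_calc f (pos_calc (%s. s * (r s)^2) ?a) = pos_calc (%s. f (s * (r s)^2)) ?a"
    using a f r by (intro cf_compose continuous_intros) auto
  thus "phi (x oL ?r) f = phi x (%s. f (s * (r s)^2))" unfolding phi_def spf_def eq by simp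
  have "inner (x vac) ((x oL ?r) vac) = inner (?a vac) (?r vac)" using x by (simp add: adj_inner2 vN_bounded)
  also have "... = inner ((?r oL ?a) vac) vac" using r'(2) by (simp add: sym_opD)
  also have "?r oL ?a = pos_calc (%s. r s * s) ?a" using a r by (simp add: cf_mult cf_id continuous_intros)
  finally show "inner (x vac) ((x oL ?r) vac) = phi x (%s. s * r s)" by (simp add: phi_def spf_def mult.commute)
qed

lemma cont0_powr: "p > 0 ==> cont0 (%s. s powr p)" by (intro continuous_on_powr' continuous_intros) auto

lemma cont0_powr_shift: "a > 0 ==> cont0 (%s. (s + a) powr p)" by (intro continuous_intros) auto

lemma pnorm_eq:
  assumes x: "x \<in> group_vN" and p: "p > 0"
  shows "pnorm p x = phi x (%s. s powr (p / 2)) powr (1 / p)"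
proof -
  let ?a = "adj x oL x"
  have a: "pos_op ?a" by (simp add: x vN_pos_self)
  have "op_powr (op_abs x) p = pos_calc (%s. sqrt s powr p) ?a" unfolding op_powr_def op_abs_def
    by (rule cf_compose[OF a cont0_powr[OF p]]) (auto intro: continuous_intros)
  also have "... = pos_calc (%s. s powr (p / 2)) ?a"
    by (rule cf_cong) (simp add: powr_half_sqrt[symmetric] powr_powr)
  finally show ?thesis by (simp add: pnorm_def phi_def spf_def tr_eq[symmetric] tr_def)
qed

lemma phi_powr_nonneg: "x \<in> group_vN ==> p > 0 ==> 0 <= phi x (%s. s powr p)"
  by (rule phi_nonneg) (auto intro: cont0_powr)

lemma pnorm_nonneg: "x \<in> group_vN ==> p > 0 ==> 0 <= pnorm p x" by (simp add: pnorm_eq)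

lemma pnorm_powr: "x \<in> group_vN ==> p > 0 ==> pnorm p x powr p = phi x (%s. s powr (p / 2))"
  by (simp add: pnorm_eq powr_powr phi_powr_nonneg)

lemma pnorm_leI: "x \<in> group_vN ==> p > 0 ==> 0 <= C ==> phi x (%s. s powr (p / 2)) <= C powr p ==> pnorm p x <= C"
  using powr_mono2[of "1 / p" "phi x (%s. s powr (p / 2))" "C powr p"] by (simp add: pnorm_eq powr_powr phi_powr_nonneg)

lemma pnorm_2: "x \<in> group_vN ==> pnorm 2 x = norm (x vac)"
proof -
  assume x: "x \<in> group_vN"
  have "phi x (%s. s powr (2 / 2)) = phi x (%s. s)" by (rule phi_cong) simp
  also have "... = (norm (x vac))^2"
    using x by (simp add: phi_def spf_def cf_id vN_pos_self adj_inner2 vN_bounded dot_square_norm)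
  finally show ?thesis using x by (simp add: pnorm_eq powr_half_sqrt)
qed

lemma phi_scaleR: "x \<in> group_vN ==> cont0 f ==> phi (a *\<^sub>R x) f = phi x (%s. f (a^2 * s))"
  using phi_compose_poly(2)[of x f "%_. a"] by (simp add: cf_const vN_pos_self compose_linear mult.commute continuous_intros)

lemma pnorm_scaleR: "x \<in> group_vN ==> p > 0 ==> pnorm p (a *\<^sub>R x) = \<bar>a\<bar> * pnorm p x"
proof -
  assume x: "x \<in> group_vN" and p: "p > 0"
  have "phi (a *\<^sub>R x) (%s. s powr (p / 2)) = phi x (%s. \<bar>a\<bar> powr p * s powr (p / 2))"
    unfolding phi_scaleR[OF x cont0_powr[OF half_gt_zero[OF p]]]
  proof (rule phi_cong)
    fix s :: real assume "0 <= s"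
    have "(a^2) powr (p / 2) = \<bar>a\<bar> powr p"
    proof (cases "a = 0")
      case False
      hence "a^2 = \<bar>a\<bar> powr 2" by (simp add: powr_numeral)
      hence "(a^2) powr (p / 2) = (\<bar>a\<bar> powr 2) powr (p / 2)" by (simp only:)
      thus ?thesis unfolding powr_powr by simp
    qed (use p in simp)
    thus "(a^2 * s) powr (p / 2) = \<bar>a\<bar> powr p * s powr (p / 2)"
      using \<open>0 <= s\<close> by (simp add: powr_mult)
  qed
  thus ?thesis using x p by (simp add: pnorm_eq vN_scaleR phi_scale cont0_powr powr_mult phi_powr_nonneg powr_powr)
qed

lemma pnorm_diff_commute: "x \<in> group_vN ==> y \<in> group_vN ==> p > 0 ==> pnorm p (x - y) = pnorm p (y - x)"
  using pnorm_scaleR[of "y - x" p "-1"] by (simp add: vN_diff)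

lemma pnorm_0 [simp]: "p > 0 ==> pnorm p 0 = 0" using pnorm_scaleR[OF vN_0, of p 0] by simp

lemma pnorm_mono:
  assumes x: "x \<in> group_vN" and p: "0 < p" "p <= q"
  shows "pnorm p x <= pnorm q x"
proof (rule field_le_epsilon)
  fix e :: real assume e: "e > 0"
  \<comment> \<open>The margin \<open>e\<close> makes N positive, so that dividing by it and
    applying the weighted mean inequality is possible even when the norm vanishes.\<close>
  define N where "N = pnorm q x + e"
  have N: "N > 0" using e pnorm_nonneg[OF x, of q] p by (simp add: N_def)
  have q: "q > 0" using p by simp
  have "phi x (%s. s powr (p / 2)) <= phi x (%s. N powr p * (p / q * (N powr (- q) * s powr (q / 2)) + (1 - p / q)))"
  proof (rule phi_mono[OF x])
    show "cont0 (%s. N powr p * (p / q * (N powr (- q) * s powr (q / 2)) + (1 - p / q)))"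
      using q by (intro continuous_intros cont0_powr) auto
    fix s :: real assume s: "0 <= s"
    define u where "u = N powr (- q) * s powr (q / 2)"
    have u: "0 <= u" by (simp add: u_def)
    have "u powr (p / q) * 1 powr (1 - p / q) <= p / q * u + (1 - p / q) * 1"
    proof (cases "u = 0")
      case False
      thus ?thesis using p q u by (intro Youngs_inequality_0) auto
    qed (use p q in auto)
    moreover have "u powr (p / q) = N powr (- p) * s powr (p / 2)" using p q s by (simp add: u_def powr_mult powr_powr)
    ultimately have "N powr p * (N powr (- p) * s powr (p / 2)) <= N powr p * (p / q * u + (1 - p / q))"
      by (intro mult_left_mono) auto
    thus "s powr (p / 2) <= N powr p * (p / q * (N powr (- q) * s powr (q / 2)) + (1 - p / q))"
      using N by (simp add: u_def powr_minus mult.assoc[symmetric])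
  qed (use p in \<open>auto intro: cont0_powr\<close>)
  also have "... = N powr p * (p / q * (N powr (- q) * phi x (%s. s powr (q / 2))) + (1 - p / q))"
  proof -
    have "phi x (%s. p / q * (N powr (- q) * s powr (q / 2)) + (1 - p / q)) =
        phi x (%s. (p / q * N powr (- q)) * s powr (q / 2)) + phi x (%_. 1 - p / q)"
      unfolding mult.assoc[symmetric] using q x by (intro phi_add continuous_intros cont0_powr) auto
    also have "... = p / q * (N powr (- q) * phi x (%s. s powr (q / 2))) + (1 - p / q)"
      using phi_scale[OF x cont0_powr[OF half_gt_zero[OF q]], of "p / q * N powr (- q)"] x by (simp only: phi_const mult.assoc)
    finally show ?thesis using q x by (subst phi_scale) (auto intro!: continuous_intros cont0_powr)
  qed
  also have "... <= N powr p * (p / q * 1 + (1 - p / q))"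
  proof (intro mult_left_mono add_right_mono)
    have "phi x (%s. s powr (q / 2)) = pnorm q x powr q" using x q by (simp add: pnorm_powr)
    also have "... <= N powr q" using q e pnorm_nonneg[OF x q] by (intro powr_mono2) (auto simp: N_def)
    finally show "N powr (- q) * phi x (%s. s powr (q / 2)) <= 1" using N by (simp add: powr_minus field_simps)
  qed (use p in auto)
  finally have "phi x (%s. s powr (p / 2)) <= N powr p" by simp
  thus "pnorm p x <= pnorm q x + e" using N p x unfolding N_def[symmetric] by (intro pnorm_leI) auto
qed

subsection \<open>Two by two matrices\<close>

text \<open>A quadruple \<open>((a, b), (c, d))\<close> stands for the matrix with rows \<open>(c, a)\<close> and \<open>(b, d)\<close>. \<open>Lhat x\<close>
  and \<open>Rhat y\<close> are the left and right multiplications by the selfadjoint matrices with zero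
  diagonal and upper right entries \<open>x\<close> and \<open>y\<close>.\<close>

type_synonym 'n quad = "('n free_group ell2 \<times> 'n free_group ell2) \<times> ('n free_group ell2 \<times> 'n free_group ell2)"

definition Lhat :: "'n free_group op => 'n quad \<Rightarrow>\<^sub>L 'n quad" where
  "Lhat x = Blinfun (%q. ((x (snd (snd q)), adj x (fst (snd q))), (x (snd (fst q)), adj x (fst (fst q)))))"

definition Rhat :: "'n free_group op => 'n quad \<Rightarrow>\<^sub>L 'n quad" where
  "Rhat y = Blinfun (%q. ((Rop y (fst (snd q)), Rop (adj y) (snd (snd q))), (Rop (adj y) (fst (fst q)), Rop y (snd (fst q)))))"

lemma Lhat_apply: "Lhat x ((a, b), (c, d)) = ((x d, adj x c), (x b, adj x a))" unfolding Lhat_def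
  by (subst bounded_linear_Blinfun_apply)
    (auto intro!: bounded_linear_Pair bounded_linear_compose[OF blinfun.bounded_linear_right]
      bounded_linear_compose[OF bounded_linear_fst] bounded_linear_compose[OF bounded_linear_snd]
      bounded_linear_fst bounded_linear_snd)

lemma Rhat_apply: "Rhat y ((a, b), (c, d)) = ((Rop y c, Rop (adj y) d), (Rop (adj y) a, Rop y b))" unfolding Rhat_def
  by (subst bounded_linear_Blinfun_apply)
    (auto intro!: bounded_linear_Pair bounded_linear_compose[OF blinfun.bounded_linear_right]
      bounded_linear_compose[OF bounded_linear_fst] bounded_linear_compose[OF bounded_linear_snd]
      bounded_linear_fst bounded_linear_snd)

lemma sym_op_Lhat: "x \<in> bounded_ops ==> sym_op (Lhat x)"
  by (auto simp: sym_op_def Lhat_apply inner_prod_def adj_inner adj_adj adj_props)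

lemma sym_op_Rhat: "y \<in> bounded_ops ==> sym_op (Rhat y)"
  by (auto simp: sym_op_def Rhat_apply inner_prod_def Rop_inner adj_adj adj_props)

lemma hat_commute: "x \<in> group_vN ==> y \<in> group_vN ==> Lhat x oL Rhat y = Rhat y oL Lhat x"
proof (rule blinfun_eqI)
  fix q :: "'a quad" assume xy: "x \<in> group_vN" "y \<in> group_vN"
  have "Rop z (w v) = w (Rop z v)" if "z \<in> group_vN" "w \<in> group_vN" for z w :: "'a free_group op" and v
    using Rop_comm[OF that] by (metis blinfun_apply_blinfun_compose)
  thus "(Lhat x oL Rhat y) q = (Rhat y oL Lhat x) q" using xy by (cases q) (auto simp: Lhat_apply Rhat_apply vN_adj)
qed

text \<open>The matrices turn arbitrary \<open>x\<close>, \<open>y\<close> into selfadjoint ones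
  whose multiplications commute. Their spectra lie symmetrically in [-c, c], so scalar inequalities
  are required for negative arguments too; odd functions of them have off-diagonal entries of the
  form x r(adj x x).\<close>

theorem hat_pos:
  assumes x: "x \<in> group_vN" and y: "y \<in> group_vN" and c: "norm (Lhat x) <= c" "norm (Rhat y) <= c" "0 < c"
    and b: "bip (Lhat x) (Rhat y) F \<Phi>"
    and F: "!!s t. \<bar>s\<bar> <= c ==> \<bar>t\<bar> <= c ==> 0 <= F s t"
  shows "pos_op \<Phi>"
proof (rule bip_pos[OF hat_commute[OF x y] _ _ _ _ _ _ b, of "-c" c "-c" c])
  have *: "pos_op (T - (- c) *\<^sub>R id_blinfun)" if "sym_op T" "norm T <= c" for T :: "'a quad \<Rightarrow>\<^sub>L 'a quad"
    using pos_op_norm_diff[of "(-1) *\<^sub>R T" c] that sym_op_scaleR[of T "-1"] by (simp add: add.commute)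
  show "pos_op (Lhat x - (- c) *\<^sub>R id_blinfun)" "pos_op (Rhat y - (- c) *\<^sub>R id_blinfun)"
    using * c sym_op_Lhat[OF vN_bounded[OF x]] sym_op_Rhat[OF vN_bounded[OF y]] by blast+
qed (use c F sym_op_Lhat[OF vN_bounded[OF x]] sym_op_Rhat[OF vN_bounded[OF y]] in \<open>auto intro: pos_op_norm_diff\<close>)

lemma pev_block:
  fixes A B C D :: "'n free_group op" and T :: "'n quad \<Rightarrow>\<^sub>L 'n quad"
  assumes "!!a b c d. T ((a, b), (c, d)) = ((A a, B b), (C c, D d))"
  shows "pev r T ((a, b), (c, d)) = ((pev r A a, pev r B b), (pev r C c, pev r D d))"
proof (induction r)
  case 0
  thus ?case by (simp add: zero_prod_def)
next
  case (pCons e r)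
  thus ?case by (simp add: pev_pCons blinfun.add_left blinfun.scaleR_left assms)
qed

lemma Lhat_sq:
  "(Lhat x oL Lhat x) ((a, b), (c, d)) = (((x oL adj x) a, (adj x oL x) b), ((x oL adj x) c, (adj x oL x) d))"
  by (simp add: Lhat_apply)

lemma Rhat_sq:
  "y \<in> bounded_ops ==> (Rhat y oL Rhat y) ((a, b), (c, d)) =
    ((Rop (adj y oL y) a, Rop (y oL adj y) b), (Rop (y oL adj y) c, Rop (adj y oL y) d))"
  by (simp add: Rhat_apply Rop_compose adj_props)

lemma pev_Rop: "x \<in> bounded_ops ==> sym_op x ==> pev r (Rop x) = Rop (pev r x)"
proof (induction r)
  case 0
  thus ?case using Rop_scaleR[OF bounded_ops_0, of 0] by simp
next
  case (pCons a r)
  have b: "pev r x \<in> bounded_ops"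
    using pCons.prems(1) by (induction r) (auto simp: pev_pCons bounded_ops_0 bounded_ops_add bounded_ops_scaleR bounded_ops_id bounded_ops_compose)
  have "pev (pCons a r) (Rop x) = a *\<^sub>R id_blinfun + (Rop x oL Rop (pev r x))" using pCons by (simp add: pev_pCons)
  also have "... = Rop (a *\<^sub>R id_blinfun) + Rop (pev r x oL x)"
    using b pCons.prems by (simp add: Rop_compose Rop_scaleR bounded_ops_id)
  also have "pev r x oL x = x oL pev r x" by (rule pev_commute) simp
  finally show ?case using b pCons.prems by (simp add: pev_pCons Rop_add bounded_ops_scaleR bounded_ops_id bounded_ops_compose)
qed

lemma pev_Rop_delta: "x \<in> group_vN ==> sym_op x ==> pev r (Rop x) vac = pev r x vac"
  using Rop_vN[OF vN_pev[of x r] vN_id] by (simp add: pev_Rop vN_bounded)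

text \<open>The scalar inequality is applied to the commuting left and right multiplications and
  evaluated at one vector. The left side becomes twice the pairing; the right side contains
  \<open>x\<close>, \<open>y\<close> and their adjoints, which \<open>phi_adj\<close>
  identifies.\<close>

theorem young_trace:
  assumes x: "x \<in> group_vN" and y: "y \<in> group_vN" and f: "cont0 f" and g: "cont0 g"
    and st: "!!s t. 0 <= s ==> 0 <= t ==> s * t <= f (s^2) + g (t^2)"
  shows "inner (y vac) (x vac) <= phi x f + phi y g"
proof (rule field_le_epsilon)
  fix e :: real assume e: "e > 0"
  let ?d = "delta 1 :: 'a free_group ell2"
  let ?L = "Lhat x" and ?R = "Rhat y"
  \<comment> \<open>The identity matrix: the entries \<open>c\<close> and \<open>d\<close> of a
    quadruple are the diagonal ones.\<close>
  let ?v = "((0, 0), (?d, ?d)) :: 'a quad"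
  define c where "c = norm ?L + norm ?R + 1"
  have c: "norm ?L <= c" "norm ?R <= c" "0 < c" unfolding c_def using norm_ge_zero[of ?L] norm_ge_zero[of ?R] by linarith+
  define C where "C = max (c^2) (max (norm (adj x oL x)) (norm (adj y oL y)))"
  obtain r where r: "!!s. 0 <= s ==> s <= C ==> \<bar>poly r s - f s\<bar> <= e / 4"
    using poly_approx[OF cont0_Icc[OF f], of "e / 4" C] e by (metis zero_less_divide_iff zero_less_numeral)
  obtain q where q: "!!s. 0 <= s ==> s <= C ==> \<bar>poly q s - g s\<bar> <= e / 4"
    using poly_approx[OF cont0_Icc[OF g], of "e / 4" C] e by (metis zero_less_divide_iff zero_less_numeral)
  note lr = hat_commute[OF x y]
  have "pos_op ((pev r (?L oL ?L) + pev q (?R oL ?R) + (e / 2) *\<^sub>R id_blinfun) - (?L oL ?R))"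
  proof (rule hat_pos[OF x y c])
    show "bip ?L ?R (%s t. (poly r (s * s) + poly q (t * t) + e / 2) - s * t)
      ((pev r (?L oL ?L) + pev q (?R oL ?R) + (e / 2) *\<^sub>R id_blinfun) - (?L oL ?R))"
      by (intro bip_diff bip_add bip_const bip_pev bip_mult bip_fst bip_snd lr)
    fix s t :: real assume *: "\<bar>s\<bar> <= c" "\<bar>t\<bar> <= c"
    have "s^2 <= c^2" "t^2 <= c^2" using * by (auto simp: abs_le_square_iff[symmetric])
    hence "s^2 <= C" "t^2 <= C" by (auto simp: C_def)
    hence "f (s^2) <= poly r (s^2) + e / 4" "g (t^2) <= poly q (t^2) + e / 4"
      using r[of "s^2"] q[of "t^2"] unfolding abs_le_iff by simp_all
    moreover have "s * t <= \<bar>s\<bar> * \<bar>t\<bar>" by (simp flip: abs_mult)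
    moreover have "\<bar>s\<bar> * \<bar>t\<bar> <= f (s^2) + g (t^2)" using st[of "\<bar>s\<bar>" "\<bar>t\<bar>"] by simp
    ultimately have "s * t <= poly r (s^2) + poly q (t^2) + e / 2" by linarith
    thus "0 <= (poly r (s * s) + poly q (t * t) + e / 2) - s * t" by (simp add: power2_eq_square)
  qed
  hence "0 <= inner (((pev r (?L oL ?L) + pev q (?R oL ?R) + (e / 2) *\<^sub>R id_blinfun) - (?L oL ?R)) ?v) ?v"
    by (rule pos_op_nonneg)
  hence "inner ((?L oL ?R) ?v) ?v <= inner (pev r (?L oL ?L) ?v) ?v + inner (pev q (?R oL ?R) ?v) ?v + e / 2 * inner ?v ?v"
    by (simp only: blinfun.add_left blinfun.diff_left blinfun.scaleR_left inner_diff_left inner_add_left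
        blinfun_apply_id_blinfun inner_scaleR_left)
  moreover have "inner ?v ?v = 2" by (simp add: inner_prod_def dot_square_norm)
  moreover have "inner ((?L oL ?R) ?v) ?v = 2 * inner (y ?d) (x ?d)"
  proof -
    have rd: "Rop z ?d = z ?d" if "z \<in> group_vN" for z using Rop_vN[OF that vN_id] by simp
    have "inner ((?L oL ?R) ?v) ?v = inner (x (adj y ?d)) ?d + inner (adj x (y ?d)) ?d"
      using y by (simp add: Lhat_apply Rhat_apply inner_prod_def rd vN_adj)
    also have "inner (x (adj y ?d)) ?d = tr (x oL adj y)" by (simp add: tr_def)
    also have "... = tr (adj y oL x)" using x y by (intro tr_commute vN_adj)
    also have "... = inner (x ?d) (y ?d)" using y by (rule tr_adj_compose)
    also have "inner (adj x (y ?d)) ?d = inner (y ?d) (x ?d)" using x by (simp add: adj_inner2 vN_bounded)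
    finally show ?thesis by (simp add: inner_commute)
  qed
  moreover have "inner (pev r (?L oL ?L) ?v) ?v = phi (adj x) (poly r) + phi x (poly r)"
    using x by (subst pev_block[OF Lhat_sq]) (simp add: inner_prod_def phi_poly vN_adj adj_adj vN_bounded tr_def)
  moreover have "inner (pev q (?R oL ?R) ?v) ?v = phi (adj y) (poly q) + phi y (poly q)"
    using y by (subst pev_block[OF Rhat_sq[OF vN_bounded[OF y]]])
      (simp add: inner_prod_def phi_poly vN_adj adj_adj vN_bounded tr_def pev_Rop_delta vN_compose
        pos_op_sym vN_pos_self vN_pos_self2)
  moreover have cp: "cont0 (poly h)" for h using continuous_on_poly[of "{0..}" "%x. x" h] by simp
  moreover have "\<bar>phi x (poly r) - phi x f\<bar> <= e / 4" by (rule phi_close[OF x cp f]) (rule r, simp_all add: C_def)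
  moreover have "\<bar>phi y (poly q) - phi y g\<bar> <= e / 4" by (rule phi_close[OF y cp g]) (rule q, simp_all add: C_def)
  ultimately show "inner (y ?d) (x ?d) <= phi x f + phi y g + e" using x y unfolding abs_le_iff by (simp add: phi_adj)
qed

subsection \<open>Hoelder inequality and duality\<close>

lemma cont0_poly: "cont0 (poly r)" using continuous_on_poly[of "{0..}" "%x. x" r] by simp

lemma phi_uniform_limit:
  assumes x: "x \<in> group_vN" and F: "cont0 F" "!!k. cont0 (G k)"
    and u: "uniform_limit {0..norm (adj x oL x)} G F sequentially"
  shows "(%k. phi x (G k)) \<longlonglongrightarrow> phi x F"
proof (rule LIMSEQ_I)
  fix e :: real assume e: "e > 0"
  hence "\<forall>\<^sub>F k in sequentially. \<forall>s\<in>{0..norm (adj x oL x)}. dist (G k s) (F s) < e / 2"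
    by (intro uniform_limitD[OF u]) auto
  hence "\<forall>\<^sub>F k in sequentially. norm (phi x (G k) - phi x F) < e"
  proof eventually_elim
    case (elim k)
    have "\<bar>phi x (G k) - phi x F\<bar> <= e / 2"
      by (rule phi_close[OF x F(2) F(1)]) (use elim in \<open>auto simp: dist_real_def less_imp_le\<close>)
    thus ?case using e by simp
  qed
  thus "\<exists>N. \<forall>k\<ge>N. norm (phi x (G k) - phi x F) < e" by (simp add: eventually_sequentially)
qed

lemma uniform_compose_cont0:
  assumes u: "uniform_limit {0..c} G g sequentially" and h: "cont0 h" and g: "cont0 g"
    and G0: "!!k s. 0 <= s ==> 0 <= G k s"
  shows "uniform_limit {0..c} (%k s. h (G k s)) (%s. h (g s)) sequentially"
proof -
  have "bounded (g ` {0..c})" using g by (intro compact_imp_bounded compact_continuous_image cont0_Icc) auto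
  then obtain b where b: "!!s. s \<in> {0..c} ==> \<bar>g s\<bar> <= b" by (fastforce simp: bounded_iff)
  show ?thesis
  proof (rule uniform_limit_compose_uniformly_continuous_on[OF u, where B = "{0..b + 1}"])
    show "uniformly_continuous_on {0..b + 1} h" using cont0_Icc[OF h] by (rule compact_uniformly_continuous) auto
    have "\<forall>\<^sub>F k in sequentially. \<forall>s\<in>{0..c}. dist (G k s) (g s) < 1" by (rule uniform_limitD[OF u]) simp
    thus "\<forall>\<^sub>F k in sequentially. \<forall>s\<in>{0..c}. G k s \<in> {0..b + 1}"
    proof eventually_elim
      case (elim k)
      show ?case
      proof
        fix s assume s: "s \<in> {0..c}"
        have "\<bar>G k s - g s\<bar> < 1" using elim s by (simp add: dist_real_def)
        thus "G k s \<in> {0..b + 1}" using b[OF s] G0[of s k] s by auto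
      qed
    qed
  qed simp
qed

text \<open>The scalar Young inequality for s/N and t/M, with N and M slightly above the two norms
  so that they are positive, is fed into \<open>young_trace\<close>; then the margin tends to
  0.\<close>

theorem holder:
  assumes x: "x \<in> group_vN" and y: "y \<in> group_vN" and pq: "p > 1" "q > 1" "1 / p + 1 / q = 1"
  shows "inner (y vac) (x vac) <= pnorm p x * pnorm q y"
proof (rule tendsto_lowerbound[where F = "at_right 0"])
  show "((%e. (pnorm p x + e) * (pnorm q y + e)) \<longlongrightarrow> pnorm p x * pnorm q y) (at_right 0)"
    by (auto intro!: tendsto_eq_intros)
  have "inner (y vac) (x vac) <= (pnorm p x + e) * (pnorm q y + e)" if e: "e > 0" for e
  proof -
    define N M where "N = pnorm p x + e" and "M = pnorm q y + e"
    have NM: "N > 0" "M > 0" using e pnorm_nonneg[OF x, of p] pnorm_nonneg[OF y, of q] pq by (auto simp: N_def M_def)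
    define f where "f = (%s. (N * M / p * N powr (- p)) * s powr (p / 2))"
    define g where "g = (%s. (N * M / q * M powr (- q)) * s powr (q / 2))"
    have c: "cont0 (%s. s powr (p / 2))" "cont0 (%s. s powr (q / 2))" using pq by (auto intro: cont0_powr)
    have "inner (y vac) (x vac) <= phi x f + phi y g"
    proof (rule young_trace[OF x y])
      show "cont0 f" unfolding f_def by (rule continuous_on_mult_left[OF c(1)])
      show "cont0 g" unfolding g_def by (rule continuous_on_mult_left[OF c(2)])
      fix s t :: real assume st: "0 <= s" "0 <= t"
      have "(s / N) * (t / M) <= (s / N) powr p / p + (t / M) powr q / q" using pq st NM by (intro Youngs_inequality) auto
      hence "N * M * ((s / N) * (t / M)) <= N * M * ((s / N) powr p / p + (t / M) powr q / q)"
        using NM by (intro mult_left_mono) auto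
      also have "... = f (s^2) + g (t^2)"
      proof -
        have sq: "(u^2) powr (r / 2) = u powr r" if "0 <= u" "r > 1" for u r :: real
          using that powr_powr[of u 2 "r / 2"] by (cases "u = 0") (auto simp: powr_numeral)
        show ?thesis using st NM pq by (simp add: f_def g_def sq powr_divide powr_minus field_simps)
      qed
      finally show "s * t <= f (s^2) + g (t^2)" using NM by simp
    qed
    also have "phi x f = N * M / p * (N powr (- p) * pnorm p x powr p)"
      unfolding f_def phi_scale[OF x c(1)] using x pq by (simp add: pnorm_powr)
    also have "phi y g = N * M / q * (M powr (- q) * pnorm q y powr q)"
      unfolding g_def phi_scale[OF y c(2)] using y pq by (simp add: pnorm_powr)
    also have "N * M / p * (N powr (- p) * pnorm p x powr p) + N * M / q * (M powr (- q) * pnorm q y powr q)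
      <= N * M / p * 1 + N * M / q * 1"
    proof (intro add_mono mult_left_mono)
      have "pnorm p x powr p <= N powr p" using x pq e pnorm_nonneg[OF x, of p] by (intro powr_mono2) (auto simp: N_def)
      thus "N powr (- p) * pnorm p x powr p <= 1" using NM by (simp add: powr_minus field_simps)
      have "pnorm q y powr q <= M powr q" using y pq e pnorm_nonneg[OF y, of q] by (intro powr_mono2) (auto simp: M_def)
      thus "M powr (- q) * pnorm q y powr q <= 1" using NM by (simp add: powr_minus field_simps)
    qed (use NM pq in auto)
    also have "... = N * M * (1 / p + 1 / q)" by (simp add: algebra_simps)
    finally show ?thesis using pq by (simp add: N_def M_def)
  qed
  thus "\<forall>\<^sub>F e in at_right 0. inner (y vac) (x vac) <= (pnorm p x + e) * (pnorm q y + e)"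
    by (auto simp: eventually_at_right_field intro: exI[of _ 1])
qed simp

lemma conj_exp:
  fixes p q :: real
  assumes "p > 1" "q > 1" "1 / p + 1 / q = 1"
  shows "(p - 1) * q = p" "q = p / (p - 1)" "(p - 1) * (q - 1) = 1"
proof -
  have "q + p = p * q" using assms by (simp add: field_simps)
  thus "(p - 1) * q = p" "q = p / (p - 1)" "(p - 1) * (q - 1) = 1" using assms by (simp_all add: field_simps)
qed

text \<open>The norming element is x \<bar>x\<bar>^(p - 2). Testing only with x r(\<bar>x\<bar>^2)
  for polynomials \<open>r\<close> is enough by approximation, and it keeps the test elements
  finitely supported when \<open>x\<close> is, which the dual form of hypercontractivity
  uses.\<close>

theorem dual_pnorm:
  assumes x: "x \<in> group_vN" and pq: "p > 1" "q > 1" "1 / p + 1 / q = 1" and C: "0 <= C"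
    and h: "!!r. inner (x vac) ((x oL pev r (adj x oL x)) vac) <= C * pnorm q (x oL pev r (adj x oL x))"
  shows "pnorm p x <= C"
proof -
  let ?a = "adj x oL x"
  let ?c = "norm ?a"
  have a: "pos_op ?a" by (simp add: x vN_pos_self)
  have q0: "q / 2 > 0" "p / 2 > 0" using pq by auto
  have step1: "phi x (%s. s * f s) <= C * phi x (%s. (s * (f s)^2) powr (q / 2)) powr (1 / q)"
    if f: "cont0 f" for f
  proof -
    obtain r where r: "approx_seq ?c f r" using approx_seq_ex[OF f] by blast
    have "poly [:0, 1:] = (%s :: real. s)" by (simp add: fun_eq_iff)
    hence X: "approx_seq ?c (%s. s) (%_. [:0, 1:])" by (simp only: approx_seq_def uniform_limit_const)
    have cs: "cont0 (%s. s)" "cont0 (%s. f s * f s)" using f by (auto intro: continuous_intros)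
    have 1: "approx_seq ?c (%s. s * f s) (%k. [:0, 1:] * r k)" by (rule approx_seq_mult[OF X r cs(1) f])
    have 2: "approx_seq ?c (%s. s * (f s * f s)) (%k. [:0, 1:] * (r k * r k))"
      by (intro approx_seq_mult X r cs f)
    have p2: "poly ([:0, 1:] * (r k * r k)) s = s * (poly (r k) s)^2" for k s by (simp add: power2_eq_square)
    have f2: "s * (f s * f s) = s * (f s)^2" for s by (simp add: power2_eq_square)
    have "uniform_limit {0..?c} (%k s. poly ([:0, 1:] * (r k * r k)) s powr (q / 2)) (%s. (s * (f s * f s)) powr (q / 2)) sequentially"
      using 2 unfolding approx_seq_def
      by (rule uniform_compose_cont0[OF _ cont0_powr[OF q0(1)]]) (use f in \<open>auto intro!: continuous_intros mult_nonneg_nonneg\<close>)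
    hence L2: "(%k. phi x (%s. (s * (poly (r k) s)^2) powr (q / 2))) \<longlonglongrightarrow> phi x (%s. (s * (f s)^2) powr (q / 2))"
      unfolding p2 f2 by (rule phi_uniform_limit[OF x, rotated -1])
        (use q0 in \<open>auto intro!: continuous_on_compose2[OF cont0_powr[OF q0(1)]] continuous_intros f\<close>)
    have L1: "(%k. phi x (poly ([:0, 1:] * r k))) \<longlonglongrightarrow> phi x (%s. s * f s)"
      by (rule phi_uniform_limit[OF x _ _ 1[unfolded approx_seq_def]]) (auto intro!: continuous_intros f cont0_poly)
    have "phi x (poly ([:0, 1:] * r k)) <= C * phi x (%s. (s * (poly (r k) s)^2) powr (q / 2)) powr (1 / q)" for k
    proof -
      have "phi x (poly ([:0, 1:] * r k)) = phi x (%s. s * poly (r k) s)" by (rule phi_cong) simp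
      also have "... = inner (x vac) ((x oL pev (r k) ?a) vac)"
        using phi_compose_poly(3)[OF x cont0_powr[OF q0(1)] cont0_poly, of "r k"] by (simp add: cf_poly a)
      also have "... <= C * pnorm q (x oL pev (r k) ?a)" by (rule h)
      also have "pnorm q (x oL pev (r k) ?a) = phi x (%s. (s * (poly (r k) s)^2) powr (q / 2)) powr (1 / q)"
        using phi_compose_poly(1,2)[OF x cont0_powr[OF q0(1)] cont0_poly, of "r k"] pq by (simp add: cf_poly a pnorm_eq)
      finally show ?thesis .
    qed
    thus ?thesis using pq by (intro LIMSEQ_le[OF L1 tendsto_mult[OF tendsto_const tendsto_powr'[OF L2 tendsto_const]]])
        (auto intro!: always_eventually phi_nonneg x continuous_on_compose2[OF cont0_powr[OF q0(1)]] continuous_intros cont0_poly)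
  qed
  define N where "N = phi x (%s. s powr (p / 2))"
  have N0: "0 <= N" unfolding N_def using x q0 by (intro phi_powr_nonneg)
  have step2: "N - d <= C * (N + d) powr (1 / q)" if d: "d > 0" for d
  proof -
    have "uniformly_continuous_on {0..?c + 1} (%s. s powr (p / 2))"
      using cont0_Icc[OF cont0_powr[OF q0(2)]] by (rule compact_uniformly_continuous) auto
    then obtain e1 where e1: "e1 > 0" "!!s t. s \<in> {0..?c + 1} ==> t \<in> {0..?c + 1} ==> dist t s < e1 ==>
        dist (t powr (p / 2)) (s powr (p / 2)) < d" using d unfolding uniformly_continuous_on_def by metis
    have "((%e. e * (?c + 1) powr (p / 2) + e powr (p / 2)) \<longlongrightarrow> 0 * (?c + 1) powr (p / 2) + 0 powr (p / 2)) (at_right 0)"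
      using q0 by (intro tendsto_intros tendsto_powr') (auto simp: eventually_at_right_less less_imp_le eventually_mono[OF eventually_at_right_less])
    hence "\<forall>\<^sub>F e in at_right 0. e * (?c + 1) powr (p / 2) + e powr (p / 2) < d"
      using d by (auto dest: order_tendstoD(2))
    moreover have "\<forall>\<^sub>F e in at_right 0. e < e1" "\<forall>\<^sub>F e in at_right (0::real). e < 1"
      using eventually_at_right_real[OF e1(1)] eventually_at_right_real[of 0 1] by (auto elim: eventually_mono)
    moreover have "\<forall>\<^sub>F e in at_right (0::real). 0 < e" by (rule eventually_at_right_less)
    ultimately have "\<forall>\<^sub>F e in at_right 0. e * (?c + 1) powr (p / 2) + e powr (p / 2) < d & e < e1 & e < 1 & 0 < e"
      by eventually_elim auto
    then obtain e where e: "e * (?c + 1) powr (p / 2) + e powr (p / 2) < d" "e < e1" "e < 1" "0 < e"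
      using eventually_happens'[OF trivial_limit_at_right_real] by blast
    \<comment> \<open>The function s^(p/2 - 1) of s = \<bar>x\<bar>^2, shifted by \<open>e\<close>
      because for p < 2 it is singular at 0.\<close>
    define f where "f = (%s. (s + e) powr (p / 2 - 1))"
    have f: "cont0 f" unfolding f_def by (rule cont0_powr_shift[OF e(4)])
    have "\<bar>phi x (%s. s * f s) - N\<bar> <= d" unfolding N_def
    proof (rule phi_close[OF x])
      show "cont0 (%s. s * f s)" "cont0 (%s. s powr (p / 2))"
        using f q0 by (auto intro!: continuous_intros cont0_powr)
      fix s assume s: "0 <= s" "s <= ?c"
      have eq: "s * f s = (s + e) powr (p / 2) - e * (s + e) powr (p / 2 - 1)"
      proof -
        have "(s + e) powr (p / 2) = (s + e) * (s + e) powr (p / 2 - 1)" using s e by (simp add: powr_diff)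
        thus ?thesis by (simp add: f_def algebra_simps)
      qed
      have 1: "e * (s + e) powr (p / 2 - 1) <= e * (?c + 1) powr (p / 2) + e powr (p / 2)"
      proof (cases "p / 2 >= 1")
        case True
        have "(s + e) powr (p / 2 - 1) <= (?c + 1) powr (p / 2 - 1)" using s e True by (intro powr_mono2) auto
        also have "... <= (?c + 1) powr (p / 2)" by (intro powr_mono) auto
        finally show ?thesis using e by (simp add: mult_left_mono add_increasing2)
      next
        case False
        have "(s + e) powr (p / 2 - 1) <= e powr (p / 2 - 1)" using s e False by (intro powr_mono2') auto
        hence "e * (s + e) powr (p / 2 - 1) <= e * e powr (p / 2 - 1)" using e by (intro mult_left_mono) auto
        also have "... = e powr (p / 2)" using e by (simp add: powr_diff)
        finally show ?thesis using e by (simp add: add_increasing)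
      qed
      have 2: "\<bar>(s + e) powr (p / 2) - s powr (p / 2)\<bar> < d" using e1(2)[of s "s + e"] s e by (simp add: dist_real_def)
      have 3: "s powr (p / 2) <= (s + e) powr (p / 2)" using s e q0 by (intro powr_mono2) auto
      have 4: "0 <= e * (s + e) powr (p / 2 - 1)" using e by simp
      show "\<bar>s * f s - s powr (p / 2)\<bar> <= d" unfolding eq using 1 2 3 4 e(1) by (simp add: abs_le_iff)
    qed
    moreover have "phi x (%s. (s * (f s)^2) powr (q / 2)) <= N + d"
    proof -
      have "phi x (%s. (s * (f s)^2) powr (q / 2)) <= phi x (%s. (s + e) powr (p / 2))"
      proof (rule phi_mono[OF x])
        show "cont0 (%s. (s * (f s)^2) powr (q / 2))"
          by (rule continuous_on_compose2[OF cont0_powr[OF q0(1)]]) (auto intro!: continuous_intros f)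
        show "cont0 (%s. (s + e) powr (p / 2))" by (rule cont0_powr_shift[OF e(4)])
        fix s :: real assume s: "0 <= s"
        have "s * (f s)^2 <= (s + e) * (f s)^2" using e by (intro mult_right_mono) auto
        also have "... = (s + e) powr (p - 1)"
        proof -
          have "(s + e) powr (p - 1) = (s + e) powr (1 + ((p / 2 - 1) + (p / 2 - 1)))" by simp
          also have "... = (s + e) powr 1 * ((s + e) powr (p / 2 - 1) * (s + e) powr (p / 2 - 1))" by (simp only: powr_add)
          finally show ?thesis using s e by (simp add: f_def power2_eq_square)
        qed
        finally have "(s * (f s)^2) powr (q / 2) <= ((s + e) powr (p - 1)) powr (q / 2)"
          using s q0 by (intro powr_mono2) auto
        also have "... = (s + e) powr (p / 2)" using conj_exp(1)[OF pq] by (simp add: powr_powr)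
        finally show "(s * (f s)^2) powr (q / 2) <= (s + e) powr (p / 2)" .
      qed
      moreover have "\<bar>phi x (%s. (s + e) powr (p / 2)) - N\<bar> <= d" unfolding N_def
      proof (rule phi_close[OF x])
        fix s assume s: "0 <= s" "s <= ?c"
        show "\<bar>(s + e) powr (p / 2) - s powr (p / 2)\<bar> <= d"
          using e1(2)[of s "s + e"] s e by (simp add: dist_real_def)
      qed (use e q0 in \<open>auto intro: cont0_powr cont0_powr_shift\<close>)
      ultimately show ?thesis by simp
    qed
    hence "phi x (%s. (s * (f s)^2) powr (q / 2)) powr (1 / q) <= (N + d) powr (1 / q)"
      using pq x f q0 by (intro powr_mono2 phi_nonneg continuous_on_compose2[OF cont0_powr[OF q0(1)]] continuous_intros) auto
    hence "C * phi x (%s. (s * (f s)^2) powr (q / 2)) powr (1 / q) <= C * (N + d) powr (1 / q)"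
      using C by (rule mult_left_mono)
    ultimately show ?thesis using step1[OF f] by linarith
  qed
  \<comment> \<open>Since 1/p + 1/q = 1, cancelling N^(1/q) leaves N^(1/p), the norm, at most
    C.\<close>
  have "N <= C * N powr (1 / q)"
  proof (rule tendsto_le[where F = "at_right 0"])
    show "((%d. N - d) \<longlongrightarrow> N) (at_right 0)" by (auto intro!: tendsto_eq_intros)
    show "((%d. C * (N + d) powr (1 / q)) \<longlongrightarrow> C * N powr (1 / q)) (at_right 0)"
      using pq N0 by (intro tendsto_mult tendsto_const tendsto_powr')
        (auto intro!: tendsto_eq_intros eventually_mono[OF eventually_at_right_less])
    show "\<forall>\<^sub>F d in at_right 0. N - d <= C * (N + d) powr (1 / q)"
      by (rule eventually_mono[OF eventually_at_right_less]) (rule step2)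
  qed simp
  moreover have "pnorm p x = N powr (1 / p)" using x pq by (simp add: pnorm_eq N_def)
  moreover have "N = N powr (1 / p) * N powr (1 / q)" using pq N0 by (cases "N = 0") (auto simp flip: powr_add)
  moreover have "N powr (1 / p) <= C" if "N ~= 0"
  proof (rule mult_right_le_imp_le)
    show "N powr (1 / p) * N powr (1 / q) <= C * N powr (1 / q)" using calculation by simp
    show "0 < N powr (1 / q)" using that by simp
  qed
  ultimately show ?thesis using C by (cases "N = 0") auto
qed

lemma vN_x_pev: "x \<in> group_vN ==> x oL pev r (adj x oL x) \<in> group_vN" by (intro vN_compose vN_pev vN_self)

lemma dual_pnorm_vN:
  assumes x: "x \<in> group_vN" and pq: "p > 1" "q > 1" "1 / p + 1 / q = 1" and C: "0 <= C"
    and h: "!!y. y \<in> group_vN ==> inner (x vac) (y vac) <= C * pnorm q y"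
  shows "pnorm p x <= C" by (rule dual_pnorm[OF x pq C]) (rule h[OF vN_x_pev[OF x]])

lemma conj_exp_ex:
  fixes p :: real
  assumes "p > 1"
  obtains q :: real where "q > 1" "1 / p + 1 / q = 1"
proof
  show "p / (p - 1) > 1" "1 / p + 1 / (p / (p - 1)) = 1" using assms by (simp_all add: field_simps)
qed

text \<open>By duality the norm is governed by linear functionals, each of which
  \<open>holder\<close> bounds on the two summands.\<close>

theorem pnorm_triangle:
  assumes x: "x \<in> group_vN" and y: "y \<in> group_vN" and p: "p > 1"
  shows "pnorm p (x + y) <= pnorm p x + pnorm p y"
proof -
  obtain q where q: "q > 1" "1 / p + 1 / q = 1" using conj_exp_ex[OF p] .
  show ?thesis
  proof (rule dual_pnorm_vN[OF vN_add[OF x y] p q])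
    show "0 <= pnorm p x + pnorm p y" using x y p by (simp add: pnorm_nonneg)
    fix z :: "'a free_group op" assume z: "z \<in> group_vN"
    have "inner (z vac) (x vac) <= pnorm p x * pnorm q z"
      "inner (z vac) (y vac) <= pnorm p y * pnorm q z" using x y z p q by (auto intro: holder)
    thus "inner ((x + y) vac) (z vac) <= (pnorm p x + pnorm p y) * pnorm q z"
      by (simp add: blinfun.add_left inner_add_left inner_commute algebra_simps)
  qed
qed

lemma pnorm_triangle_diff:
  "x \<in> group_vN ==> y \<in> group_vN ==> p > 1 ==> \<bar>pnorm p x - pnorm p y\<bar> <= pnorm p (x - y)"
  using pnorm_triangle[of y "x - y" p] pnorm_triangle[of x "y - x" p] pnorm_diff_commute[of x y p]
  by (simp add: vN_diff abs_le_iff)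

section \<open>The group algebra, words and twisted derivations\<close>

subsection \<open>Elements of finite support\<close>

definition coef :: "'n free_group op => 'n free_group => complex" where
  "coef x g = Rep_ell2 (x vac) g"

definition supp :: "'n free_group op => 'n free_group set" where
  "supp x = {g. coef x g ~= 0}"

definition fin_vN :: "'n free_group op set" where
  "fin_vN = {x \<in> group_vN. finite (supp x)}"

lemma fin_vN [intro]: "x \<in> fin_vN ==> x \<in> group_vN" and finite_supp [intro]: "x \<in> fin_vN ==> finite (supp x)"
  by (auto simp: fin_vN_def)

lemma coef_add: "coef (x + y) g = coef x g + coef y g" by (simp add: coef_def blinfun.add_left plus_ell2.rep_eq)

lemma coef_scaleC: "coef (scaleC_op c x) g = c * coef x g" by (simp add: coef_def scaleC_op_apply scaleC.rep_eq)

lemma coef_scaleR: "coef (r *\<^sub>R x) g = of_real r * coef x g"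
  by (simp add: coef_def blinfun.scaleR_left scaleR_ell2.rep_eq)

lemma coef_sum: "coef (sum f A) g = (\<Sum>a\<in>A. coef (f a) g)" by (simp add: coef_def blinfun.sum_left Rep_ell2_sum)

lemma coef_lreg: "coef (lreg h) g = (if g = h then 1 else 0)" by (simp add: coef_def lreg_delta delta.rep_eq)

lemma coef_adj: "x \<in> group_vN ==> coef (adj x) g = cnj (coef x (inverse g))"
  by (simp add: coef_def Jop_vN[symmetric] Jop_Rep)

lemma vN_eqI_coef: "x \<in> group_vN ==> y \<in> group_vN ==> (!!g. coef x g = coef y g) ==> x = y"
  by (intro vN_eqI_delta ell2_eqI) (simp_all add: coef_def)

lemma supp_scaleC_lreg: "supp (scaleC_op c (lreg g)) \<subseteq> {g}"
  by (auto simp: supp_def coef_scaleC coef_lreg split: if_splits)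

lemma fin_lreg: "scaleC_op c (lreg g) \<in> fin_vN"
  using finite_subset[OF supp_scaleC_lreg[of c g]] by (simp add: fin_vN_def vN_scaleC vN_lreg)

lemma fin_add: "x \<in> fin_vN ==> y \<in> fin_vN ==> x + y \<in> fin_vN"
proof -
  assume xy: "x \<in> fin_vN" "y \<in> fin_vN"
  have "supp (x + y) \<subseteq> supp x \<union> supp y" by (auto simp: supp_def coef_add)
  hence "finite (supp (x + y))" by (rule finite_subset) (use xy in auto)
  thus "x + y \<in> fin_vN" using xy by (simp add: fin_vN_def vN_add)
qed

lemma supp_0 [simp]: "supp 0 = {}" by (simp add: supp_def coef_def zero_ell2.rep_eq)

lemma fin_0: "0 \<in> fin_vN" by (simp add: fin_vN_def vN_0)

lemma fin_sum: "(!!a. a \<in> A ==> f a \<in> fin_vN) ==> sum f A \<in> fin_vN"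
  by (induction A rule: infinite_finite_induct) (auto simp: fin_0 fin_add)

lemma fin_eq_sum:
  assumes x: "x \<in> fin_vN" and S: "finite S" "supp x \<subseteq> S"
  shows "x = (\<Sum>g\<in>S. scaleC_op (coef x g) (lreg g))"
proof (rule vN_eqI_coef)
  fix g
  have "(\<Sum>h\<in>S. coef x h * (if g = h then 1 else 0)) = (if g \<in> S then coef x g else 0)"
    using S by (simp add: if_distrib sum.delta cong: if_cong)
  thus "coef x g = coef (\<Sum>g\<in>S. scaleC_op (coef x g) (lreg g)) g"
    using S by (auto simp: coef_sum coef_scaleC coef_lreg supp_def)
qed (use x in \<open>auto intro: vN_sum vN_scaleC vN_lreg\<close>)

lemma fin_induct [consumes 1, case_names lreg add]:
  fixes x :: "'a free_group op"
  assumes x: "x \<in> fin_vN" and l: "!!c g. P (scaleC_op c (lreg g))"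
    and a: "!!x y. x \<in> fin_vN ==> y \<in> fin_vN ==> P x ==> P y ==> P (x + y)"
  shows "P x"
proof -
  have "P (\<Sum>g\<in>S. scaleC_op (coef x g) (lreg g))" if "finite S" for S using that
  proof (induction S rule: finite_induct)
    case empty
    have "scaleC_op 0 (lreg 1) = (0 :: 'a free_group op)"
      by (auto intro!: blinfun_eqI ell2_eqI simp: scaleC_op_apply scaleC.rep_eq zero_ell2.rep_eq)
    thus ?case using l[of 0 1] by simp
  next
    case (insert g S)
    thus ?case by (simp add: a l fin_sum fin_lreg)
  qed
  thus ?thesis using fin_eq_sum[OF x finite_supp[OF x] order_refl] by (metis finite_supp[OF x])
qed

lemma scaleC_op_simps:
  "scaleC_op c (x + y) = scaleC_op c x + scaleC_op c y"
  "scaleC_op c (scaleC_op d x) = scaleC_op (c * d) x"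
  "scaleC_op (c + d) x = scaleC_op c x + scaleC_op d x"
  "scaleC_op 1 x = x" "scaleC_op 0 x = 0" "scaleC_op c 0 = 0"
  "scaleC_op c x oL y = scaleC_op c (x oL y)"
  by (auto intro!: blinfun_eqI ell2_eqI simp: scaleC_op_apply blinfun.add_left scaleC.rep_eq plus_ell2.rep_eq algebra_simps zero_ell2.rep_eq)

lemma scaleC_op_compose: "x \<in> bounded_ops ==> x oL scaleC_op c y = scaleC_op c (x oL y)"
  by (rule blinfun_eqI) (simp add: scaleC_op_apply bounded_opsD)

lemma bounded_ops_sum: "(!!a. a \<in> A ==> f a \<in> bounded_ops) ==> sum f A \<in> bounded_ops"
  by (induction A rule: infinite_finite_induct) (auto simp: bounded_ops_0 bounded_ops_add)

lemma scaleC_op_of_real: "scaleC_op (of_real r) x = r *\<^sub>R x"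
  by (rule blinfun_eqI) (simp add: scaleC_op_apply scaleC_of_real blinfun.scaleR_left)

lemma lreg_mult: "lreg (g * h) = lreg g oL lreg h"
  by (rule op_eqI_delta) (simp_all add: lreg_in_bounded_ops bounded_ops_compose lreg_delta mult.assoc)

lemma lreg_1 [simp]: "lreg 1 = id_blinfun" by (rule op_eqI_delta) (simp_all add: lreg_in_bounded_ops bounded_ops_id lreg_delta)

lemma fin_scaleC: "x \<in> fin_vN ==> scaleC_op c x \<in> fin_vN"
  by (induction rule: fin_induct) (simp_all add: scaleC_op_simps fin_lreg fin_add)

lemma fin_scaleR: "x \<in> fin_vN ==> r *\<^sub>R x \<in> fin_vN"
  using fin_scaleC[of x "of_real r"] by (simp add: scaleC_op_of_real)

lemma fin_compose: "x \<in> fin_vN ==> y \<in> fin_vN ==> x oL y \<in> fin_vN"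
proof (induction arbitrary: y rule: fin_induct)
  case (lreg c g)
  from this show ?case
  proof (induction rule: fin_induct)
    case (lreg d h)
    show ?case by (simp add: scaleC_op_simps scaleC_op_compose lreg_in_bounded_ops lreg_mult[symmetric] fin_lreg)
  qed (simp add: compose_linear fin_add)
qed (simp add: compose_linear fin_add)

lemma fin_adj: "x \<in> fin_vN ==> adj x \<in> fin_vN" by (induction rule: fin_induct)
    (simp_all add: adj_scaleC lreg_in_bounded_ops adj_lreg fin_lreg adj_add fin_add fin_vN vN_bounded)

lemma fin_id: "id_blinfun \<in> fin_vN" using fin_lreg[of 1 1] by (simp add: scaleC_op_simps)

lemma fin_pev: "x \<in> fin_vN ==> pev r x \<in> fin_vN"
proof (induction r)
  case 0
  thus ?case by (simp add: fin_0)
next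
  case (pCons a r)
  thus ?case by (simp add: pev_pCons fin_add fin_scaleR fin_id fin_compose)
qed

lemma fin_self: "x \<in> fin_vN ==> adj x oL x \<in> fin_vN" by (intro fin_compose fin_adj)

subsection \<open>Linear extension\<close>

definition lext :: "('a free_group => 'b op) => 'a free_group op => 'b op" where
  "lext \<phi> x = (\<Sum>g\<in>supp x. scaleC_op (coef x g) (\<phi> g))"

lemma lext_eq: "finite S ==> supp x \<subseteq> S ==> lext \<phi> x = (\<Sum>g\<in>S. scaleC_op (coef x g) (\<phi> g))"
  unfolding lext_def by (rule sum.mono_neutral_left) (auto simp: supp_def scaleC_op_simps)

lemma lext_lreg: "lext \<phi> (scaleC_op c (lreg g)) = scaleC_op c (\<phi> g)"
  using lext_eq[of "{g}" "scaleC_op c (lreg g)" \<phi>] supp_scaleC_lreg[of c g] by (simp add: coef_scaleC coef_lreg)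

lemma lext_lreg1: "lext \<phi> (lreg g) = \<phi> g" using lext_lreg[of \<phi> 1 g] by (simp add: scaleC_op_simps)

lemma lext_add:
  assumes "x \<in> fin_vN" "y \<in> fin_vN"
  shows "lext \<phi> (x + y) = lext \<phi> x + lext \<phi> y"
proof -
  let ?S = "supp x \<union> supp y"
  have "finite ?S" "supp x \<subseteq> ?S" "supp y \<subseteq> ?S" "supp (x + y) \<subseteq> ?S"
    using assms by (auto simp: supp_def coef_add fin_vN_def)
  thus ?thesis by (simp add: lext_eq[of ?S] coef_add scaleC_op_simps sum.distrib)
qed

lemma lext_scaleC: "x \<in> fin_vN ==> lext \<phi> (scaleC_op c x) = scaleC_op c (lext \<phi> x)"
  by (induction rule: fin_induct) (simp_all add: lext_lreg scaleC_op_simps lext_add fin_scaleC)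

lemma lext_scaleR: "x \<in> fin_vN ==> lext \<phi> (r *\<^sub>R x) = r *\<^sub>R lext \<phi> x"
  using lext_scaleC[of x \<phi> "of_real r"] by (simp add: scaleC_op_of_real)

lemma lext_0 [simp]: "lext \<phi> 0 = 0" by (simp add: lext_def)

lemma lext_vN: "(!!g. \<phi> g \<in> group_vN) ==> lext \<phi> x \<in> group_vN"
  unfolding lext_def by (intro vN_sum vN_scaleC)

lemma lext_fin: "(!!g. \<phi> g \<in> fin_vN) ==> lext \<phi> x \<in> fin_vN"
  unfolding lext_def by (intro fin_sum fin_scaleC)

lemma lext_derivation:
  assumes D: "!!g h. D (g * h) = (\<alpha> g oL D h) + (D g oL \<beta> h)"
    and b: "!!g. \<alpha> g \<in> bounded_ops" "!!g. D g \<in> bounded_ops"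
    and xy: "x \<in> fin_vN" "y \<in> fin_vN"
  shows "lext D (x oL y) = (lext \<alpha> x oL lext D y) + (lext D x oL lext \<beta> y)" using xy
proof (induction arbitrary: y rule: fin_induct)
  case (lreg c g)
  from this show ?case
  proof (induction rule: fin_induct)
    case (lreg d h)
    show ?case
      by (simp add: scaleC_op_simps scaleC_op_compose lreg_in_bounded_ops lreg_mult[symmetric] lext_lreg D b bounded_ops_scaleC mult.commute)
  next
    case (add x y)
    thus ?case by (simp add: compose_linear lext_add fin_compose fin_lreg)
  qed
next
  case (add x1 x2)
  thus ?case by (simp add: compose_linear lext_add fin_compose)
qed

text \<open>A homomorphism is the case of the derivation rule in which the left map is 0 and the
  right map is the homomorphism itself.\<close>

lemma lext_hom:
  assumes h: "!!g h. \<phi> (g * h) = \<phi> g oL \<phi> h" and b: "!!g. \<phi> g \<in> bounded_ops"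
    and xy: "x \<in> fin_vN" "y \<in> fin_vN"
  shows "lext \<phi> (x oL y) = lext \<phi> x oL lext \<phi> y"
proof -
  have "lext \<phi> (x oL y) = (lext (%_. 0) x oL lext \<phi> y) + (lext \<phi> x oL lext \<phi> y)"
    by (rule lext_derivation[OF _ bounded_ops_0 b xy]) (simp add: h compose_linear)
  thus ?thesis by (simp add: lext_def scaleC_op_simps compose_linear)
qed

lemma lext_pev:
  assumes h: "!!g h. \<phi> (g * h) = \<phi> g oL \<phi> h" and b: "!!g. \<phi> g \<in> bounded_ops" and 1: "\<phi> 1 = id_blinfun"
    and x: "x \<in> fin_vN"
  shows "lext \<phi> (pev r x) = pev r (lext \<phi> x)"
proof (induction r)
  case (pCons a r)
  have "lext \<phi> id_blinfun = id_blinfun" using lext_lreg1[of \<phi> 1] 1 by simp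
  thus ?case using pCons x by (simp add: pev_pCons lext_add lext_scaleR lext_hom[OF h b] fin_scaleR fin_id fin_compose fin_pev)
qed simp

lemma lext_adj:
  assumes a: "!!g. \<phi> (inverse g) = adj (\<phi> g)" and b: "!!g. \<phi> g \<in> bounded_ops" and x: "x \<in> fin_vN"
  shows "lext \<phi> (adj x) = adj (lext \<phi> x)"
proof -
  have bl: "lext \<phi> y \<in> bounded_ops" for y unfolding lext_def by (rule bounded_ops_sum) (intro bounded_ops_scaleC b)
  from x show ?thesis by (induction rule: fin_induct)
      (simp_all add: lext_lreg adj_scaleC lreg_in_bounded_ops adj_lreg a b lext_add adj_add fin_adj fin_vN vN_bounded bl)
qed

lemma coef_lext: "coef (lext \<phi> x) g = (\<Sum>h\<in>supp x. coef x h * coef (\<phi> h) g)"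
  by (simp add: lext_def coef_sum coef_scaleC)

lemma tr_coef: "tr x = Re (coef x 1)" by (simp add: tr_eq vN_trace_def coef_def cinner_delta)

text \<open>A trace preserving homomorphism that respects adjoints preserves all moments of
  \<bar>x\<bar>^2, hence its distribution.\<close>

lemma phi_lext:
  assumes h: "!!g h. \<phi> (g * h) = \<phi> g oL \<phi> h" and v: "!!g. \<phi> g \<in> group_vN"
    and a: "!!g. \<phi> (inverse g) = adj (\<phi> g)" and t: "!!g. coef (\<phi> g) 1 = (if g = 1 then 1 else 0)"
    and 1: "\<phi> 1 = id_blinfun" and x: "x \<in> fin_vN" and f: "cont0 f"
  shows "phi (lext \<phi> x) f = phi x f"
proof (rule phi_eqI[OF lext_vN fin_vN f])
  fix r
  have b: "\<phi> g \<in> bounded_ops" for g by (rule vN_bounded[OF v])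
  have "pev r (adj (lext \<phi> x) oL lext \<phi> x) = lext \<phi> (pev r (adj x oL x))"
    using x by (simp add: lext_pev[OF h b 1] lext_hom[OF h b] lext_adj[of \<phi>, OF a b] fin_self fin_adj)
  moreover have "coef (lext \<phi> y) 1 = coef y 1" if "y \<in> fin_vN" for y
    using finite_supp[OF that] by (simp add: coef_lext t if_distrib sum.delta' cong: if_cong) (simp add: supp_def)
  ultimately show "tr (pev r (adj (lext \<phi> x) oL lext \<phi> x)) = tr (pev r (adj x oL x))"
    using x by (simp add: tr_coef fin_pev fin_self)
qed (use v x in auto)

text \<open>The weight 1 gives the inner product, the weight \<open>len\<close> the Dirichlet form
  of the semigroup, and the weight \<open>len g * len g\<close> the form of the squared
  generator.\<close>

definition lform :: "('a free_group => real) => 'a free_group op => 'a free_group op => real" where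
  "lform c x y = (\<Sum>g\<in>supp x. c g * Re (coef x g * cnj (coef y g)))"

lemma lform_eq: "finite S ==> supp x \<subseteq> S ==> lform c x y = (\<Sum>g\<in>S. c g * Re (coef x g * cnj (coef y g)))"
  unfolding lform_def by (rule sum.mono_neutral_left) (auto simp: supp_def)

lemma inner_lform:
  assumes x: "x \<in> fin_vN"
  shows "inner (x vac) (blinfun_apply y vac) = lform (%_. 1) x y"
proof -
  have "x vac = (\<Sum>g\<in>supp x. scaleC_op (coef x g) (lreg g)) vac"
    using fin_eq_sum[OF x finite_supp[OF x] order_refl] by simp
  also have "... = (\<Sum>g\<in>supp x. scaleC (coef x g) (delta g))"
    by (simp add: blinfun.sum_left scaleC_op_apply lreg_delta)
  finally have "inner (x vac) (y vac) = (\<Sum>g\<in>supp x. inner (scaleC (coef x g) (delta g)) (y vac))"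
    by (simp add: inner_sum_left)
  moreover have "inner (scaleC c (delta g)) (y vac) = Re (c * cnj (coef y g))" for c g
    using cinner_commute[of "delta g" "y vac"] by (simp add: inner_ell2_def cinner_scaleC_left cinner_delta coef_def)
  ultimately show ?thesis by (simp add: lform_def)
qed

subsection \<open>Words\<close>

definition fg :: "'n letter list => 'n free_group" where
  "fg ws = Abs_free_group (foldr cons_red ws [])"

lemma word_of_fg: "word_of (fg ws) = foldr cons_red ws []"
  unfolding fg_def by (rule Abs_free_group_inverse) (simp add: reduced_foldr)

lemma reduced_word_of: "reduced_word (word_of g)" using word_of[of g] by simp

lemma word_of_fg_reduced: "reduced_word ws ==> word_of (fg ws) = ws" by (simp add: word_of_fg foldr_cons_red_Nil)

lemma fg_word_of [simp]: "fg (word_of g) = g" by (simp add: word_of_inject[symmetric] word_of_fg_reduced reduced_word_of)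

lemma word_of_mult: "word_of (g * h) = foldr cons_red (word_of g) (word_of h)" by (rule times_free_group.rep_eq)

lemma fg_append: "fg (u @ v) = fg u * fg v"
  by (simp add: word_of_inject[symmetric] word_of_fg word_of_mult foldr_cons_red_assoc reduced_foldr)

lemma fg_Nil [simp]: "fg [] = 1" by (simp add: word_of_inject[symmetric] word_of_fg one_free_group.rep_eq)

lemma fg_Cons: "fg (l # w) = fg [l] * fg w" using fg_append[of "[l]" w] by simp

lemma fg_cancel: "fg (l # inv_letter l # w) = fg w"
  by (simp add: word_of_inject[symmetric] word_of_fg cons_red_cancel reduced_foldr)

lemma fg_inv_letter: "fg [l] * fg [inv_letter l] = 1" using fg_cancel[of l "[]"] by (simp add: fg_append[symmetric])

lemma word_length_word_of: "word_length g = length (word_of g)" by (simp add: word_length.rep_eq)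

lemma length_cons_red: "length (cons_red l w) <= Suc (length w)" by (cases w) (auto simp: cons_red_def)

lemma length_foldr_cons_red: "length (foldr cons_red u v) <= length u + length v"
  by (induction u) (auto intro: order_trans[OF length_cons_red])

lemma word_length_mult: "word_length (g * h) <= word_length g + word_length h"
  by (simp add: word_length_word_of word_of_mult length_foldr_cons_red)

lemma word_length_fg: "word_length (fg ws) <= length ws"
  using length_foldr_cons_red[of ws "[]"] by (simp add: word_length_word_of word_of_fg)

lemma word_length_inverse: "word_length (inverse g) = word_length g" by transfer simp

text \<open>Reduction only deletes pairs of a letter and its inverse. Anything compatible with
  prepending a letter and with one such deletion therefore descends from words to the group; this is
  how homomorphisms, exponent sums and derivatives are shown to be well defined.\<close>

lemma reduction_invariant:
  assumes cong: "!!l w w'. F w = F w' ==> F (l # w) = F (l # w')"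
    and cancel: "!!l w. F (l # inv_letter l # w) = F w"
  shows "F (foldr cons_red u v) = F (u @ v)"
proof (induction u)
  case (Cons l u)
  have "F (cons_red l w) = F (l # w)" for w using cancel[of l "tl w"] by (cases w) (auto simp: cons_red_def)
  thus ?case using cong[OF Cons] by simp
qed simp

definition lmap :: "('a letter => 'b letter) => 'a free_group => 'b free_group" where
  "lmap f g = fg (map f (word_of g))"

locale letter_map =
  fixes f :: "'a letter => 'b letter"
  assumes f_inv: "f (inv_letter l) = inv_letter (f l)" and inj_f: "inj f"
begin

lemma lmap_fg: "lmap f (fg ws) = fg (map f ws)"
proof -
  have "fg (map f (foldr cons_red ws [])) = fg (map f (ws @ []))"
    by (rule reduction_invariant) (metis list.simps(9) fg_Cons, simp add: f_inv fg_cancel)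
  thus ?thesis by (simp add: lmap_def word_of_fg)
qed

lemma lmap_mult: "lmap f (g * h) = lmap f g * lmap f h"
  using lmap_fg[of "word_of g @ word_of h"] by (simp add: fg_append lmap_def)

lemma lmap_1 [simp]: "lmap f 1 = 1" by (simp add: lmap_def one_free_group.rep_eq)

lemma lmap_inverse: "lmap f (inverse g) = inverse (lmap f g)"
proof -
  have "lmap f (inverse g) * lmap f g = 1" by (simp add: lmap_mult[symmetric])
  thus ?thesis by (metis free_group_cancel(1) free_group_left_inverse free_group_inverse_inverse mult.assoc mult.right_neutral)
qed

lemma word_of_lmap: "word_of (lmap f g) = map f (word_of g)"
proof -
  have "reduced_word (map f (word_of g))" using reduced_word_of[of g] unfolding reduced_word_def successively_map
    by (rule successively_mono) (metis f_inv inj_f injD)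
  thus ?thesis by (simp add: lmap_def word_of_fg_reduced)
qed

lemma lmap_eq_iff: "lmap f g = lmap f h \<longleftrightarrow> g = h"
  using inj_f by (simp add: word_of_inject[symmetric] word_of_lmap inj_map_eq_map)

lemma word_length_lmap: "word_length (lmap f g) = word_length g" by (simp add: word_length_word_of word_of_lmap)

end

text \<open>Summed over a word this is the exponent sum of the generator \<open>i\<close>, a
  homomorphism to the integers.\<close>

definition lexp :: "nat => nat letter => int" where
  "lexp i l = (if fst l = i then if snd l then 1 else -1 else 0)"

definition expo :: "nat => nat free_group => int" where
  "expo i g = (\<Sum>l\<leftarrow>word_of g. lexp i l)"

lemma expo_fg: "expo i (fg ws) = (\<Sum>l\<leftarrow>ws. lexp i l)"
proof -
  have "sum_list (map (lexp i) (foldr cons_red ws [])) = sum_list (map (lexp i) (ws @ []))"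
    by (rule reduction_invariant) (auto simp: lexp_def inv_letter_def)
  thus ?thesis by (simp add: expo_def word_of_fg)
qed

lemma expo_mult: "expo i (g * h) = expo i g + expo i h"
  using expo_fg[of i "word_of g @ word_of h"] by (simp add: fg_append expo_def)

lemma expo_1 [simp]: "expo i 1 = 0" by (simp add: expo_def one_free_group.rep_eq)

lemma expo_inverse: "expo i (inverse g) = - expo i g" using expo_mult[of i "inverse g" g] by simp

lemma sum_list_abs_le: "\<bar>\<Sum>l\<leftarrow>ws. lexp i l\<bar> <= int (length ws)"
  by (induction ws) (auto simp: lexp_def)

definition let1 :: "nat letter => nat letter" where
  "let1 l = (2 * fst l, snd l)"

text \<open>The generator \<open>i\<close> goes to the inverse of its image under
  \<open>let1\<close>. With this choice a cut at an inverse letter, which keeps the letter on both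
  sides, cancels the two copies, so every cut shortens the word. The price is that the two images
  meet in the powers of one generator.\<close>

definition let2 :: "nat => nat letter => nat letter" where
  "let2 i l = (if fst l = i then (2 * i, \<not> snd l) else (2 * fst l + 1, snd l))"

interpretation e1: letter_map let1 by standard (auto simp: let1_def inv_letter_def inj_def prod_eq_iff)

interpretation e2: letter_map "let2 i" for i
proof
  show "inj (let2 i)"
  proof (rule injI)
    fix l l' assume "let2 i l = let2 i l'"
    moreover have "2 * a ~= Suc (2 * b)" "Suc (2 * b) ~= 2 * a" for a b :: nat by presburger+
    ultimately show "l = l'" by (auto simp: let2_def prod_eq_iff split: if_splits)
  qed
qed (auto simp: let2_def inv_letter_def)

text \<open>Adjacent letters cannot be inverse to each other, so the word is a power of one letter
  and nothing cancels in the exponent sum.\<close>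

lemma reduced_one_letter:
  assumes "reduced_word ws" "!!l. l \<in> set ws ==> fst l = i"
  shows "\<bar>\<Sum>l\<leftarrow>ws. lexp i l\<bar> = int (length ws)"
proof -
  have "\<exists>b. ws = replicate (length ws) (i, b)" using assms
  proof (induction ws)
    case (Cons l ws)
    then obtain b where b: "ws = replicate (length ws) (i, b)" using reduced_tl[OF Cons.prems(1)] by auto
    show ?case
    proof (cases ws)
      case Nil
      thus ?thesis using Cons.prems(2)[of l] by (auto simp: prod_eq_iff)
    next
      case (Cons l' ws')
      hence "l' = (i, b)" using b by (metis length_Cons replicate_Suc list.inject)
      moreover have "l' ~= inv_letter l" "fst l = i"
        using Cons.prems Cons by (auto simp: reduced_word_def successively_Cons)
      ultimately have "l = (i, b)" by (auto simp: inv_letter_def prod_eq_iff)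
      thus ?thesis using b by (metis length_Cons replicate_Suc)
    qed
  qed simp
  then obtain b where "ws = replicate (length ws) (i, b)" ..
  moreover have "\<bar>\<Sum>l\<leftarrow>replicate n (i, b). lexp i l\<bar> = int n" for n by (simp add: sum_list_replicate lexp_def)
  ultimately show ?thesis by metis
qed

text \<open>\<open>let1\<close> uses even generators only, while \<open>let2 i\<close> produces an
  even one only from \<open>i\<close>. A common element is therefore a power of the generator
  \<open>i\<close>, and the exponent condition makes it trivial.\<close>

lemma lmap1_eq_lmap2:
  assumes eq: "lmap let1 s = lmap (let2 i) t" and e: "expo i t = 0"
  shows "s = 1 & t = 1"
proof -
  have m: "map let1 (word_of s) = map (let2 i) (word_of t)"
    using eq by (simp add: word_of_inject[symmetric] e1.word_of_lmap e2.word_of_lmap)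
  have "fst l = i" if "l \<in> set (word_of t)" for l
  proof -
    have "let2 i l \<in> let1 ` set (word_of s)" using that m by (metis list.set_map imageI)
    moreover have "Suc (2 * b) ~= 2 * a" for a b :: nat by presburger
    ultimately show ?thesis by (auto simp: let1_def let2_def split: if_splits)
  qed
  hence "int (length (word_of t)) = \<bar>expo i t\<bar>"
    unfolding expo_def by (rule reduced_one_letter[OF reduced_word_of, symmetric])
  hence t: "t = 1" using e by (simp add: word_of_inject[symmetric] one_free_group.rep_eq)
  hence "s = 1" using m by (simp add: word_of_inject[symmetric] one_free_group.rep_eq)
  thus ?thesis using t by simp
qed

subsection \<open>The twisted derivations\<close>

text \<open>\<open>let1\<close> and \<open>let2 i\<close> embed the free group into a larger one and differ only in the image of the
  generator \<open>i\<close>. The derivation from \<open>hom2 i w\<close> to \<open>hom1\<close> sums over the occurrences of the letter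
  \<open>i\<close> in a word: what stands before the cut is mapped by \<open>hom1\<close>, what stands behind it by
  \<open>hom2 i w\<close>. The scalar twist \<open>w\<close> makes the cuts orthogonal on average.\<close>

definition hom1 :: "nat free_group => nat free_group op" where
  "hom1 g = lreg (lmap let1 g)"

definition hom2 :: "nat => complex => nat free_group => nat free_group op" where
  "hom2 i w g = scaleC_op (w powi expo i g) (lreg (lmap (let2 i) g))"

lemma hom1_mult: "hom1 (g * h) = hom1 g oL hom1 h" by (simp add: hom1_def e1.lmap_mult lreg_mult)

lemma hom2_mult: "w ~= 0 ==> hom2 i w (g * h) = hom2 i w g oL hom2 i w h"
  by (simp add: hom2_def e2.lmap_mult lreg_mult expo_mult power_int_add scaleC_op_simps scaleC_op_compose lreg_in_bounded_ops)

lemma hom_1 [simp]: "hom1 1 = id_blinfun" "hom2 i w 1 = id_blinfun" by (simp_all add: hom1_def hom2_def scaleC_op_simps)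

lemma hom_fin: "hom1 g \<in> fin_vN" "hom2 i w g \<in> fin_vN"
  using fin_lreg[of 1 "lmap let1 g"] by (simp_all add: hom1_def hom2_def fin_lreg scaleC_op_simps)

lemma hom_vN: "hom1 g \<in> group_vN" "hom2 i w g \<in> group_vN" using hom_fin by auto

lemma hom_bounded: "hom1 g \<in> bounded_ops" "hom2 i w g \<in> bounded_ops" by (simp_all add: hom_vN vN_bounded)

lemma fin_minus: "x \<in> fin_vN ==> - x \<in> fin_vN" using fin_scaleR[of x "-1"] by simp

lemma compose_sum: "S oL (\<Sum>a\<in>A. T a) = (\<Sum>a\<in>A. S oL T a)"
  by (rule blinfun_eqI) (simp add: blinfun.sum_left blinfun.sum_right)

lemma compose_minus: "(- S) oL T = - (S oL T)" "S oL (- T) = - (S oL T)"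
  by (auto intro!: blinfun_eqI simp: blinfun.minus_left blinfun.minus_right)

lemma hom_inverse:
  "hom1 (inverse g) = adj (hom1 g)" "cmod w = 1 ==> hom2 i w (inverse g) = adj (hom2 i w g)"
proof -
  assume w: "cmod w = 1"
  have "w powi - e = cnj (w powi e)" for e
    using complex_div_cnj[of 1 "w powi e"] by (simp add: power_int_minus norm_power_int w field_simps)
  thus "hom2 i w (inverse g) = adj (hom2 i w g)"
    by (simp add: hom2_def e2.lmap_inverse expo_inverse adj_scaleC lreg_in_bounded_ops adj_lreg)
qed (simp add: hom1_def e1.lmap_inverse adj_lreg)

lemma hom_coef1: "coef (hom1 g) 1 = (if g = 1 then 1 else 0)" "coef (hom2 i w g) 1 = (if g = 1 then 1 else 0)"
  using e1.lmap_eq_iff[of 1 g] e2.lmap_eq_iff[of i 1 g] by (auto simp: hom1_def hom2_def coef_lreg coef_scaleC)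

text \<open>A positive letter is dropped from both pieces, an inverse letter is kept in both. This
  is forced by the Leibniz rule: if the derivative of a generator is 1, that of its inverse is minus
  the product of its two images.\<close>

definition cut_l :: "nat letter list => nat => nat letter list" where
  "cut_l ws k = (if snd (ws ! k) then take k ws else take (Suc k) ws)"

definition cut_r :: "nat letter list => nat => nat letter list" where
  "cut_r ws k = (if snd (ws ! k) then drop (Suc k) ws else drop k ws)"

text \<open>The noncommutative difference quotient with respect to the generator \<open>i\<close>,
  whose two tensor factors are mapped by \<open>hom1\<close> and \<open>hom2 i w\<close> and
  multiplied. It is defined on unreduced words so that the Leibniz rule for concatenation is a plain
  induction.\<close>

definition dword :: "nat => complex => nat letter list => nat free_group op" where
  "dword i w ws = (\<Sum>k<length ws. if fst (ws ! k) = i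
     then (if snd (ws ! k) then 1 else -1) *\<^sub>R (hom1 (fg (cut_l ws k)) oL hom2 i w (fg (cut_r ws k))) else 0)"

definition dletter :: "nat => complex => nat letter => nat free_group op" where
  "dletter i w l = (if fst l = i then if snd l then id_blinfun
     else (-1) *\<^sub>R (hom1 (fg [l]) oL hom2 i w (fg [l])) else 0)"

lemma dword_Cons:
  assumes w: "w ~= 0"
  shows "dword i w (l # ws) = (dletter i w l oL hom2 i w (fg ws)) + (hom1 (fg [l]) oL dword i w ws)"
proof -
  have 0: "(if fst l = i then (if snd l then 1 else -1) *\<^sub>R
      (hom1 (fg (cut_l (l # ws) 0)) oL hom2 i w (fg (cut_r (l # ws) 0))) else 0)
    = (dletter i w l oL hom2 i w (fg ws))"
    by (auto simp: cut_l_def cut_r_def dletter_def fg_Cons[of l ws] hom2_mult[OF w] compose_linear compose_assoc compose_minus)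
  have S: "hom1 (fg (cut_l (l # ws) (Suc k))) = hom1 (fg [l]) oL hom1 (fg (cut_l ws k))"
    "cut_r (l # ws) (Suc k) = cut_r ws k" for k by (auto simp: cut_l_def cut_r_def fg_Cons[of l "take _ _"] hom1_mult)
  show ?thesis unfolding dword_def list.size(4) add_0_right add_Suc_right sum.lessThan_Suc_shift nth_Cons_0 nth_Cons_Suc 0 S
    by (auto simp: compose_sum compose_linear compose_assoc compose_minus intro!: sum.cong)
qed

lemma dword_append:
  assumes w: "w ~= 0"
  shows "dword i w (u @ v) = (hom1 (fg u) oL dword i w v) + (dword i w u oL hom2 i w (fg v))"
proof (induction u)
  case Nil
  thus ?case by (simp add: dword_def)
next
  case (Cons l u)
  thus ?case by (simp add: dword_Cons[OF w] fg_append hom2_mult[OF w] fg_Cons[of l u] hom1_mult compose_linear compose_assoc)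
qed

lemma dword_cancel:
  assumes w: "w ~= 0"
  shows "dword i w (l # inv_letter l # ws) = dword i w ws"
proof -
  have h: "hom1 (fg [l]) oL hom1 (fg [inv_letter l]) = id_blinfun"
    "hom2 i w (fg [l]) oL hom2 i w (fg [inv_letter l]) = id_blinfun"
    by (simp_all add: hom1_mult[symmetric] hom2_mult[OF w, symmetric] fg_inv_letter)
  hence h': "hom1 (fg [l]) oL (hom1 (fg [inv_letter l]) oL T) = T" for T :: "nat free_group op"
    by (simp add: compose_assoc[symmetric])
  have "(dletter i w l oL hom2 i w (fg [inv_letter l])) + (hom1 (fg [l]) oL dletter i w (inv_letter l)) = 0"
    using h h' by (auto simp: dletter_def inv_letter_def compose_linear compose_assoc compose_minus)
  moreover have "dword i w (l # inv_letter l # ws) = (((dletter i w l oL hom2 i w (fg [inv_letter l])) + (hom1 (fg [l]) oL dletter i w (inv_letter l))) oL hom2 i w (fg ws))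
    + ((hom1 (fg [l]) oL hom1 (fg [inv_letter l])) oL dword i w ws)"
    by (simp add: dword_Cons[OF w] fg_Cons[of "inv_letter l" ws] hom2_mult[OF w] compose_linear compose_assoc)
  ultimately show ?thesis using h by simp
qed

lemma dword_mult:
  assumes w: "w ~= 0"
  shows "dword i w (word_of (g * h)) = (hom1 g oL dword i w (word_of h)) + (dword i w (word_of g) oL hom2 i w h)"
proof -
  \<comment> \<open>The invariant is the pair with the group element: prepending a letter changes
    \<open>dword\<close> by a term that depends on \<open>fg ws\<close>.\<close>
  have "(dword i w (foldr cons_red (word_of g) (word_of h)), fg (foldr cons_red (word_of g) (word_of h)))
    = (dword i w (word_of g @ word_of h), fg (word_of g @ word_of h))"
  proof (rule reduction_invariant)
    fix l ws ws' assume "(dword i w ws, fg ws) = (dword i w ws', fg ws')"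
    thus "(dword i w (l # ws), fg (l # ws)) = (dword i w (l # ws'), fg (l # ws'))"
      using fg_Cons[of l ws] fg_Cons[of l ws'] by (simp add: dword_Cons[OF w])
  qed (simp add: dword_cancel[OF w] fg_cancel)
  thus ?thesis by (simp add: word_of_mult dword_append[OF w])
qed

definition deriv_x :: "nat => complex => nat free_group op => nat free_group op" where
  "deriv_x i w = lext (%g. dword i w (word_of g))"

lemma dword_fin: "dword i w ws \<in> fin_vN"
  unfolding dword_def by (intro fin_sum) (auto intro!: fin_minus fin_scaleR fin_compose hom_fin fin_0)

lemma deriv_fin: "deriv_x i w x \<in> fin_vN" unfolding deriv_x_def by (intro lext_fin dword_fin)

lemma deriv_compose:
  "w ~= 0 ==> x \<in> fin_vN ==> y \<in> fin_vN ==>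
    deriv_x i w (x oL y) = (lext hom1 x oL deriv_x i w y) + (deriv_x i w x oL lext (hom2 i w) y)" unfolding deriv_x_def
  by (rule lext_derivation) (simp_all add: dword_mult hom_bounded dword_fin fin_vN vN_bounded)

definition cut_sgn :: "nat letter list => nat => complex" where
  "cut_sgn ws k = (if snd (ws ! k) then 1 else -1)"

definition cut_elt :: "nat => nat letter list => nat => nat free_group" where
  "cut_elt i ws k = lmap let1 (fg (cut_l ws k)) * lmap (let2 i) (fg (cut_r ws k))"

lemma coef_dword:
  "coef (dword i w ws) h = (\<Sum>k\<in>{k. k < length ws & fst (ws ! k) = i}.
     cut_sgn ws k * w powi expo i (fg (cut_r ws k)) * (if h = cut_elt i ws k then 1 else 0))"
proof -
  have "coef (if P then T else 0) h = (if P then coef T h else 0)" for P and T :: "nat free_group op"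
    by (simp add: coef_def zero_ell2.rep_eq)
  hence "coef (dword i w ws) h = (\<Sum>k<length ws. if fst (ws ! k) = i
     then cut_sgn ws k * w powi expo i (fg (cut_r ws k)) * (if h = cut_elt i ws k then 1 else 0) else 0)"
    unfolding dword_def coef_sum
    by (intro sum.cong) (auto simp: hom1_def hom2_def scaleC_op_compose lreg_in_bounded_ops lreg_mult[symmetric]
      coef_scaleR coef_scaleC coef_lreg cut_sgn_def cut_elt_def)
  moreover have "{k. k < length ws & fst (ws ! k) = i} = {k\<in>{..<length ws}. fst (ws ! k) = i}" by auto
  ultimately show ?thesis by (simp only: sum.inter_filter finite_lessThan)
qed

lemma reduced_take_drop:
  assumes "reduced_word ws"
  shows "reduced_word (take k ws)" "reduced_word (drop k ws)"
  using assms successively_append_iff[of "%x y. y ~= inv_letter x" "take k ws" "drop k ws"]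
  by (simp_all add: reduced_word_def)

lemma reduced_cut:
  assumes "reduced_word ws"
  shows "word_of (fg (cut_l ws k)) = cut_l ws k" "word_of (fg (cut_r ws k)) = cut_r ws k"
  using reduced_take_drop[OF assms] by (simp_all add: cut_l_def cut_r_def word_of_fg_reduced)

lemma cut_prod:
  assumes k: "k < length ws" "fst (ws ! k) = i"
  shows "fg (cut_l ws k) * fg [(i, True)] * fg (cut_r ws k) = fg ws"
proof (cases "snd (ws ! k)")
  case True
  hence "ws ! k = (i, True)" using k by (auto simp: prod_eq_iff)
  hence "take k ws @ (i, True) # drop (Suc k) ws = ws" using k by (metis id_take_nth_drop)
  thus ?thesis using True fg_append[of "take k ws @ [(i, True)]" "drop (Suc k) ws"] by (simp add: cut_l_def cut_r_def fg_append)
next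
  case False
  hence l: "ws ! k = (i, False)" using k by (auto simp: prod_eq_iff)
  hence "drop k ws = (i, False) # drop (Suc k) ws" using k by (metis Cons_nth_drop_Suc)
  hence "fg (cut_l ws k) * fg [(i, True)] * fg (cut_r ws k)
    = fg (take (Suc k) ws @ (i, True) # inv_letter (i, True) # drop (Suc k) ws)"
    using False by (simp add: cut_l_def cut_r_def fg_append[symmetric] inv_letter_def)
  also have "... = fg ws" by (simp add: fg_append fg_cancel) (simp add: fg_append[symmetric])
  finally show ?thesis .
qed

text \<open>By \<open>cut_prod\<close> the two pieces determine the group element, and then their
  lengths determine the sign of the letter and its position.\<close>

lemma cut_inj:
  assumes k: "k < word_length g" "fst (word_of g ! k) = i" and k': "k' < word_length g'" "fst (word_of g' ! k') = i"
    and l: "fg (cut_l (word_of g) k) = fg (cut_l (word_of g') k')"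
    and r: "fg (cut_r (word_of g) k) = fg (cut_r (word_of g') k')"
  shows "g = g' & k = k'"
proof -
  have g: "g = g'" using cut_prod[of k "word_of g" i] cut_prod[of k' "word_of g'" i] k k' l r by (simp add: word_length_word_of)
  have "cut_l (word_of g) k = cut_l (word_of g) k'" "cut_r (word_of g) k = cut_r (word_of g) k'"
    using l r g reduced_cut[OF reduced_word_of] by metis+
  hence "length (cut_l (word_of g) k) = length (cut_l (word_of g) k')"
    "length (cut_r (word_of g) k) = length (cut_r (word_of g) k')" by simp_all
  thus ?thesis using k k' g by (auto simp: cut_l_def cut_r_def word_length_word_of split: if_splits)
qed

lemma expo_cut_r: "\<bar>expo i (fg (cut_r (word_of g) k))\<bar> <= int (word_length g)"
proof -
  have "\<bar>expo i (fg (cut_r (word_of g) k))\<bar> <= int (length (cut_r (word_of g) k))"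
    unfolding expo_fg by (rule sum_list_abs_le)
  thus ?thesis by (auto simp: cut_r_def word_length_word_of split: if_splits)
qed

text \<open>The loss of one letter that drives the induction on the degree.\<close>

lemma cut_elt_length:
  assumes k: "k < word_length g" "fst (word_of g ! k) = i"
  shows "word_length (cut_elt i (word_of g) k) <= word_length g - 1"
proof -
  let ?w = "word_of g"
  have "cut_elt i ?w k = lmap let1 (fg (take k ?w)) * lmap (let2 i) (fg (drop (Suc k) ?w))"
  proof (cases "snd (?w ! k)")
    case False
    hence l: "?w ! k = (i, False)" using k by (auto simp: prod_eq_iff)
    have "take (Suc k) ?w = take k ?w @ [(i, False)]" "drop k ?w = (i, False) # drop (Suc k) ?w"
      using k l by (simp_all add: take_Suc_conv_app_nth word_length_word_of Cons_nth_drop_Suc[symmetric])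
    \<comment> \<open>The letter stands on both sides of the cut; since \<open>let2\<close> inverts
      the generator \<open>i\<close>, the two images are inverse to each other and cancel.\<close>
    hence "cut_elt i ?w k = fg (map let1 (take k ?w) @ (2 * i, False) # inv_letter (2 * i, False) # map (let2 i) (drop (Suc k) ?w))"
      using False by (simp add: cut_elt_def cut_l_def cut_r_def e1.lmap_fg e2.lmap_fg fg_append[symmetric] let1_def let2_def inv_letter_def)
    thus ?thesis by (simp add: fg_append fg_cancel e1.lmap_fg e2.lmap_fg)
  qed (simp add: cut_elt_def cut_l_def cut_r_def)
  also have "word_length ... <= length (take k ?w) + length (drop (Suc k) ?w)"
    by (intro order_trans[OF word_length_mult] add_mono) (simp_all add: e1.word_length_lmap e2.word_length_lmap order_trans[OF word_length_fg])
  also have "... = word_length g - 1" using k by (simp add: word_length_word_of)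
  finally show ?thesis .
qed

lemma supp_deriv:
  assumes x: "x \<in> fin_vN" and d: "!!g. g \<in> supp x ==> word_length g <= d" and h: "h \<in> supp (deriv_x i w x)"
  shows "word_length h <= d - 1"
proof -
  have "(\<Sum>g\<in>supp x. coef x g * coef (dword i w (word_of g)) h) ~= 0"
    using h by (simp add: supp_def deriv_x_def coef_lext)
  then obtain g where g: "g \<in> supp x" "coef (dword i w (word_of g)) h ~= 0"
    by (metis (no_types, lifting) mult_eq_0_iff sum.neutral)
  then obtain k where k: "k < word_length g" "fst (word_of g ! k) = i" "h = cut_elt i (word_of g) k"
    unfolding coef_dword by (auto elim!: sum.not_neutral_contains_not_neutral split: if_splits simp: word_length_word_of)
  thus ?thesis using cut_elt_length[OF k(1,2)] d[OF g(1)] by simp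
qed

lemma lext_hom_phi:
  assumes x: "x \<in> fin_vN" and f: "cont0 f"
  shows "phi (lext hom1 x) f = phi x f" "cmod w = 1 ==> phi (lext (hom2 i w) x) f = phi x f"
proof -
  assume w: "cmod w = 1"
  hence w0: "w ~= 0" by auto
  show "phi (lext (hom2 i w) x) f = phi x f"
    by (rule phi_lext[OF hom2_mult[OF w0] hom_vN(2) hom_inverse(2)[OF w] hom_coef1(2) hom_1(2) x f])
qed (rule phi_lext[OF hom1_mult hom_vN(1) hom_inverse(1) hom_coef1(1) hom_1(1) x f])

subsection \<open>Averaging over the twist\<close>

definition uroot :: "nat => nat => complex" where
  "uroot N r = cis (2 * pi * real r / real N)"

lemma cmod_uroot [simp]: "cmod (uroot N r) = 1" by (simp add: uroot_def)

lemma sum_uroot_powi: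
  assumes e: "\<bar>e\<bar> < int N"
  shows "(\<Sum>r<N. uroot N r powi e) = (if e = 0 then of_nat N else 0)"
proof (cases "e = 0")
  case False
  let ?z = "cis (2 * pi * of_int e / real N)"
  have N: "N > 0" using e by auto
  have "uroot N r powi e = ?z ^ r" for r
    unfolding uroot_def cis_power_int Complex.DeMoivre by (rule arg_cong[where f = cis]) simp
  hence "(\<Sum>r<N. uroot N r powi e) = (\<Sum>r<N. ?z ^ r)" by simp
  moreover have "?z ~= 1"
  proof
    assume "?z = 1"
    hence "cos (2 * pi * of_int e / real N) = 1" by (metis cis.simps(1) one_complex.simps(1))
    then obtain m :: int where "2 * pi * of_int e / real N = of_int m * 2 * pi" by (auto simp: cos_one_2pi_int)
    hence "real_of_int e = real_of_int (m * int N)" using N by (simp add: field_simps)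
    hence "e = m * int N" by (simp only: of_int_eq_iff)
    thus False using e False by (simp add: abs_mult)
  qed
  moreover have "?z ^ N = 1"
  proof -
    have "real N * (2 * pi * of_int e / real N) = 2 * pi * of_int e" using N by simp
    thus ?thesis unfolding Complex.DeMoivre by (simp only:) (simp add: complex_eq_iff)
  qed
  ultimately show ?thesis using False geometric_sum[of ?z N] by simp
qed (simp add: )

definition cuts :: "nat => nat free_group => nat set" where
  "cuts i g = {k. k < word_length g & fst (word_of g ! k) = i}"

lemma finite_cuts [simp]: "finite (cuts i g)" by (simp add: cuts_def)

text \<open>Expanding both derivatives gives a double sum over cuts with the twist to the power of a
  difference of exponent sums. The average over roots of unity keeps the pairs with equal exponents,
  and among these only identical cuts give the same group element. The bound on N excludes exponent
  differences that are nonzero multiples of N.\<close>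

lemma avg_lform:
  assumes S: "finite S" "supp x \<subseteq> S" "supp z \<subseteq> S" and N: "!!g. g \<in> S ==> 2 * word_length g < N"
  shows "(\<Sum>r<N. lform c (deriv_x i (uroot N r) z) (deriv_x i (uroot N r) x)) / real N
    = (\<Sum>g\<in>S. \<Sum>k\<in>cuts i g. c (cut_elt i (word_of g) k) * Re (coef z g * cnj (coef x g)))"
proof (cases "S = {}")
  case True
  thus ?thesis using S by (simp add: deriv_x_def lext_def lform_def)
next
  case False
  hence N0: "N > 0" using N by fastforce
  define J where "J = Sigma S (cuts i)"
  define p where "p = (%(g, k). cut_elt i (word_of g) k)"
  define e where "e = (%(g, k). expo i (fg (cut_r (word_of g) k)))"
  define b where "b = (%y (g, k). coef y g * cut_sgn (word_of g) k)"
  have fJ: "finite J" unfolding J_def using S by auto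
  have cd: "coef (deriv_x i w y) h = (\<Sum>j\<in>J. b y j * w powi e j * (if h = p j then 1 else 0))"
    if "supp y \<subseteq> S" for w y h
  proof -
    have "coef (deriv_x i w y) h = (\<Sum>g\<in>S. coef y g * coef (dword i w (word_of g)) h)"
      unfolding deriv_x_def coef_lext using S(1) that by (intro sum.mono_neutral_left) (auto simp: supp_def)
    also have "... = (\<Sum>g\<in>S. \<Sum>k\<in>cuts i g. b y (g, k) * w powi e (g, k) * (if h = p (g, k) then 1 else 0))"
      by (simp add: coef_dword cuts_def word_length_word_of b_def e_def p_def sum_distrib_left mult_ac cong: if_cong)
    also have "... = (\<Sum>j\<in>J. b y j * w powi e j * (if h = p j then 1 else 0))"
      unfolding J_def by (subst sum.Sigma) (use S in auto)
    finally show ?thesis .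
  qed
  have l: "complex_of_real (lform c (deriv_x i w z) (deriv_x i w x)) = of_real (Re
    (\<Sum>j\<in>J. \<Sum>j'\<in>J. if p j = p j' then of_real (c (p j)) * (b z j * cnj (b x j')) * w powi (e j - e j') else 0))"
    if w: "cmod w = 1" for w
  proof -
    have w0: "w ~= 0" using w by auto
    have cw: "cnj w powi m = w powi (- m)" for m
      using complex_div_cnj[of 1 "w powi m"] by (simp add: power_int_minus norm_power_int w field_simps)
    have "supp (deriv_x i w z) \<subseteq> p ` J"
    proof
      fix h assume "h \<in> supp (deriv_x i w z)"
      hence "(\<Sum>j\<in>J. b z j * w powi e j * (if h = p j then 1 else 0)) ~= 0" by (simp add: supp_def cd[OF S(3)])
      moreover have "(\<Sum>j\<in>J. b z j * w powi e j * (if h = p j then 1 else 0)) = 0" if "h \<notin> p ` J"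
        by (rule sum.neutral) (use that in auto)
      ultimately show "h \<in> p ` J" by metis
    qed
    hence "lform c (deriv_x i w z) (deriv_x i w x)
      = (\<Sum>h\<in>p ` J. c h * Re (coef (deriv_x i w z) h * cnj (coef (deriv_x i w x) h)))" using fJ by (intro lform_eq) auto
    also have "... = Re (\<Sum>h\<in>p ` J. of_real (c h) * (coef (deriv_x i w z) h * cnj (coef (deriv_x i w x) h)))" by simp
    also have "(\<Sum>h\<in>p ` J. of_real (c h) * (coef (deriv_x i w z) h * cnj (coef (deriv_x i w x) h)))
      = (\<Sum>h\<in>p ` J. \<Sum>j\<in>J. \<Sum>j'\<in>J. if h = p j then (if p j = p j' then of_real (c (p j)) * (b z j * cnj (b x j')) * w powi (e j - e j') else 0) else 0)"
    proof (rule sum.cong[OF refl])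
      fix h
      have "of_real (c h) * (coef (deriv_x i w z) h * cnj (coef (deriv_x i w x) h))
        = (\<Sum>j\<in>J. \<Sum>j'\<in>J. of_real (c h) * ((b z j * w powi e j * (if h = p j then 1 else 0)) * cnj (b x j' * w powi e j' * (if h = p j' then 1 else 0))))"
        unfolding cd[OF S(3)] cd[OF S(2)] cnj_sum sum_product by (simp add: sum_distrib_left)
      also have "... = (\<Sum>j\<in>J. \<Sum>j'\<in>J. if h = p j then (if p j = p j' then of_real (c (p j)) * (b z j * cnj (b x j')) * w powi (e j - e j') else 0) else 0)"
        by (intro sum.cong refl) (auto simp: cw power_int_add[OF disjI1[OF w0]] diff_conv_add_uminus simp del: add_uminus_conv_diff)
      finally show "of_real (c h) * (coef (deriv_x i w z) h * cnj (coef (deriv_x i w x) h)) = ..." .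
    qed
    also have "... = (\<Sum>j\<in>J. \<Sum>j'\<in>J. \<Sum>h\<in>p ` J. if h = p j then (if p j = p j' then of_real (c (p j)) * (b z j * cnj (b x j')) * w powi (e j - e j') else 0) else 0)"
      by (subst sum.swap, rule sum.cong[OF refl], rule sum.swap)
    also have "... = (\<Sum>j\<in>J. \<Sum>j'\<in>J. if p j = p j' then of_real (c (p j)) * (b z j * cnj (b x j')) * w powi (e j - e j') else 0)"
      using fJ by (intro sum.cong refl) simp
    finally show ?thesis by simp
  qed
  \<comment> \<open>Equality of two cut elements puts the quotient of their left pieces and that of
    their right pieces into the common range of the two embeddings; with equal exponents
    \<open>lmap1_eq_lmap2\<close> makes both quotients trivial, and \<open>cut_inj\<close>
    identifies the cuts.\<close>
  have key: "(\<Sum>r<N. if p j = p j' then a * uroot N r powi (e j - e j') else 0) = (if j = j' then of_nat N * a else 0)"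
    if j: "j \<in> J" "j' \<in> J" for j j' a
  proof -
    obtain g k where gk: "j = (g, k)" "g \<in> S" "k < word_length g" "fst (word_of g ! k) = i"
      using j by (auto simp: J_def cuts_def)
    obtain g' k' where gk': "j' = (g', k')" "g' \<in> S" "k' < word_length g'" "fst (word_of g' ! k') = i"
      using j by (auto simp: J_def cuts_def)
    show ?thesis
    proof (cases "p j = p j'")
      case True
      let ?u = "fg (cut_l (word_of g) k)" and ?v = "fg (cut_r (word_of g) k)"
      let ?u' = "fg (cut_l (word_of g') k')" and ?v' = "fg (cut_r (word_of g') k')"
      have "lmap let1 ?u * lmap (let2 i) ?v = lmap let1 ?u' * lmap (let2 i) ?v'"
        using True by (simp add: p_def gk gk' cut_elt_def)
      hence "lmap let1 (inverse ?u' * ?u) = lmap (let2 i) (?v' * inverse ?v)"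
        unfolding e1.lmap_mult e2.lmap_mult e1.lmap_inverse e2.lmap_inverse
        by (metis free_group_cancel(1) free_group_right_inverse mult.assoc mult.right_neutral)
      hence "e j = e j' ==> inverse ?u' * ?u = 1 & ?v' * inverse ?v = 1"
        by (rule lmap1_eq_lmap2) (simp add: expo_mult expo_inverse e_def gk gk')
      hence "e j = e j' ==> ?u = ?u' & ?v = ?v'"
        by (metis free_group_cancel free_group_inverse_inverse free_group_left_inverse mult.assoc mult.left_neutral mult.right_neutral)
      hence 1: "e j = e j' \<longleftrightarrow> j = j'" using cut_inj[OF gk(3,4) gk'(3,4)] gk gk' by auto
      have "\<bar>e j - e j'\<bar> < int N"
        using expo_cut_r[of i g k] expo_cut_r[of i g' k'] N[OF gk(2)] N[OF gk'(2)] by (simp add: e_def gk gk')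
      thus ?thesis using True 1 by (simp add: sum_distrib_left[symmetric] sum_uroot_powi)
    qed auto
  qed
  have "complex_of_real (\<Sum>r<N. lform c (deriv_x i (uroot N r) z) (deriv_x i (uroot N r) x))
    = of_real (Re (\<Sum>r<N. \<Sum>j\<in>J. \<Sum>j'\<in>J. if p j = p j' then of_real (c (p j)) * (b z j * cnj (b x j')) * uroot N r powi (e j - e j') else 0))"
    unfolding of_real_sum l[OF cmod_uroot] by simp
  also have "(\<Sum>r<N. \<Sum>j\<in>J. \<Sum>j'\<in>J. if p j = p j' then of_real (c (p j)) * (b z j * cnj (b x j')) * uroot N r powi (e j - e j') else 0)
    = (\<Sum>j\<in>J. \<Sum>j'\<in>J. \<Sum>r<N. if p j = p j' then of_real (c (p j)) * (b z j * cnj (b x j')) * uroot N r powi (e j - e j') else 0)"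
    by (subst sum.swap, rule sum.cong[OF refl], rule sum.swap)
  also have "... = (\<Sum>j\<in>J. \<Sum>j'\<in>J. if j = j' then of_nat N * (of_real (c (p j)) * (b z j * cnj (b x j'))) else 0)"
    by (intro sum.cong refl key)
  also have "... = (\<Sum>j\<in>J. of_nat N * (of_real (c (p j)) * (b z j * cnj (b x j))))" using fJ by simp
  also have "... = (\<Sum>g\<in>S. \<Sum>k\<in>cuts i g. of_nat N * (of_real (c (p (g, k))) * (b z (g, k) * cnj (b x (g, k)))))"
    unfolding J_def by (subst sum.Sigma) (use S in auto)
  also have "... = (\<Sum>g\<in>S. \<Sum>k\<in>cuts i g. of_nat N * (of_real (c (cut_elt i (word_of g) k)) * (coef z g * cnj (coef x g))))"
    by (intro sum.cong refl) (auto simp: p_def b_def cut_sgn_def)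
  also have "Re ... = real N * (\<Sum>g\<in>S. \<Sum>k\<in>cuts i g. c (cut_elt i (word_of g) k) * Re (coef z g * cnj (coef x g)))"
    by (simp add: sum_distrib_left)
  finally show ?thesis using N0 by (simp only: of_real_eq_iff) simp
qed

lemma sum_cuts:
  assumes I: "finite I" "fst ` set (word_of g) \<subseteq> I"
  shows "(\<Sum>i\<in>I. real (card (cuts i g))) = real (word_length g)"
proof -
  have "(\<Union>i\<in>I. cuts i g) = {..<word_length g}"
    using I(2) by (auto simp: cuts_def word_length_word_of image_subset_iff)
  moreover have "card (\<Union>i\<in>I. cuts i g) = (\<Sum>i\<in>I. card (cuts i g))"
    using I(1) by (intro card_UN_disjoint) (auto simp: cuts_def)
  ultimately show ?thesis by (metis card_lessThan of_nat_sum)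
qed

definition len :: "'a free_group => real" where
  "len g = real (word_length g)"

text \<open>The carre du champ identity: averaging over the \<open>N\<close>th roots of unity removes the cross terms
  between different cuts.\<close>

lemma avg_inner:
  assumes S: "finite S" "supp x \<subseteq> S" "supp z \<subseteq> S" "z \<in> fin_vN" and N: "!!g. g \<in> S ==> 2 * word_length g < N"
    and I: "finite I" "!!g. g \<in> S ==> fst ` set (word_of g) \<subseteq> I"
  shows "(\<Sum>i\<in>I. (\<Sum>r<N. inner (deriv_x i (uroot N r) z vac) (deriv_x i (uroot N r) x vac)) / real N) = lform len z x"
proof -
  have "(\<Sum>i\<in>I. (\<Sum>r<N. inner (deriv_x i (uroot N r) z vac) (deriv_x i (uroot N r) x vac)) / real N)
    = (\<Sum>i\<in>I. \<Sum>g\<in>S. real (card (cuts i g)) * Re (coef z g * cnj (coef x g)))"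
    by (simp only: inner_lform[OF deriv_fin] avg_lform[OF S(1-3) N]) simp
  also have "... = (\<Sum>g\<in>S. (\<Sum>i\<in>I. real (card (cuts i g))) * Re (coef z g * cnj (coef x g)))"
    by (subst sum.swap) (simp add: sum_distrib_right)
  also have "... = (\<Sum>g\<in>S. len g * Re (coef z g * cnj (coef x g)))"
    by (intro sum.cong refl) (simp add: sum_cuts I len_def)
  also have "... = lform len z x" using S by (simp add: lform_eq)
  finally show ?thesis .
qed

text \<open>A word has \<open>len g\<close> cuts altogether and each leaves length at most
  \<open>len g - 1\<close>. The gain of one \<open>len g\<close> over the square pays for the
  constant 2 in \<open>log_difference_quotient\<close>.\<close>

lemma avg_len_le:
  assumes S: "finite S" "supp x \<subseteq> S" and N: "!!g. g \<in> S ==> 2 * word_length g < N"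
    and I: "finite I" "!!g. g \<in> S ==> fst ` set (word_of g) \<subseteq> I"
  shows "(\<Sum>i\<in>I. (\<Sum>r<N. lform len (deriv_x i (uroot N r) x) (deriv_x i (uroot N r) x)) / real N)
    <= lform (%g. len g * (len g - 1)) x x"
proof -
  have "(\<Sum>i\<in>I. (\<Sum>r<N. lform len (deriv_x i (uroot N r) x) (deriv_x i (uroot N r) x)) / real N)
    = (\<Sum>i\<in>I. \<Sum>g\<in>S. \<Sum>k\<in>cuts i g. len (cut_elt i (word_of g) k) * (cmod (coef x g))^2)"
    by (simp only: avg_lform[OF S(1,2,2) N] complex_norm_square[symmetric] Re_complex_of_real)
  also have "... <= (\<Sum>i\<in>I. \<Sum>g\<in>S. \<Sum>k\<in>cuts i g. (len g - 1) * (cmod (coef x g))^2)"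
  proof (intro sum_mono mult_right_mono)
    fix i g k assume "k \<in> cuts i g"
    hence "word_length (cut_elt i (word_of g) k) <= word_length g - 1" "0 < word_length g"
      using cut_elt_length[of k g i] by (auto simp: cuts_def)
    thus "len (cut_elt i (word_of g) k) <= len g - 1" by (simp add: len_def)
  qed simp
  also have "... = (\<Sum>g\<in>S. (\<Sum>i\<in>I. real (card (cuts i g))) * ((len g - 1) * (cmod (coef x g))^2))"
    by (subst sum.swap) (simp add: sum_distrib_right)
  also have "... = (\<Sum>g\<in>S. (len g * (len g - 1)) * Re (coef x g * cnj (coef x g)))"
    by (intro sum.cong refl) (simp only: sum_cuts I len_def complex_norm_square[symmetric] Re_complex_of_real mult.assoc)
  also have "... = lform (%g. len g * (len g - 1)) x x" using S by (simp add: lform_eq)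
  finally show ?thesis .
qed

subsection \<open>Divided differences of odd polynomials\<close>

text \<open>The divided difference of the odd polynomial s r(s^2), with its derivative on the
  diagonal. Odd polynomials are the right class because x r(adj x x) is the off-diagonal entry of an
  odd polynomial in the selfadjoint matrix of \<open>x\<close>.\<close>

definition dd :: "real poly => real => real => real" where
  "dd r s t = (if s = t then poly r (s^2) + 2 * s^2 * poly (pderiv r) (s^2)
     else (s * poly r (s^2) - t * poly r (t^2)) / (s - t))"

lemma dd_pCons: "dd (pCons a r) s t = a + s * s * dd r s t + (s + t) * (t * poly r (t * t))"
proof (cases "s = t")
  case True
  thus ?thesis by (simp add: dd_def pderiv_pCons power2_eq_square algebra_simps)
next
  case False
  define P Q where "P = poly r (s^2)" and "Q = poly r (t^2)"
  have "(s * (a + s^2 * P) - t * (a + t^2 * Q)) = (a + (s + t) * (t * Q)) * (s - t) + s * s * (s * P - t * Q)"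
    by (simp add: algebra_simps power2_eq_square)
  hence "(s * (a + s^2 * P) - t * (a + t^2 * Q)) / (s - t) = a + s * s * ((s * P - t * Q) / (s - t)) + (s + t) * (t * Q)"
    using False by (simp add: field_simps)
  thus ?thesis using False by (simp add: dd_def P_def Q_def flip: power2_eq_square)
qed

lemma vN_trace_norm: "z \<in> group_vN ==> norm (adj z vac) = norm (z vac)"
  using Jop_inner[of "z vac" "z vac"] by (simp add: Jop_vN norm_eq_sqrt_inner)

lemma lform_adj:
  assumes "z \<in> fin_vN" "x \<in> fin_vN" and c: "!!g. c (inverse g) = c g"
  shows "lform c (adj z) (adj x) = lform c z x"
proof -
  have "supp (adj z) = inverse ` supp z"
    using assms(1) by (auto simp: supp_def coef_adj fin_vN image_iff) (metis free_group_inverse_inverse)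
  moreover have "inj_on inverse (supp z)" by (auto simp: inj_on_def) (metis free_group_inverse_inverse)
  ultimately show ?thesis using assms by (simp add: lform_def sum.reindex coef_adj fin_vN)
qed

lemma len_inverse [simp]: "len (inverse g) = len g" by (simp add: len_def word_length_inverse)

context
  fixes i :: nat and w :: complex
  assumes w: "cmod w = 1"
begin

lemma w0: "w ~= 0" using w by auto

lemma hom_adj:
  assumes "x \<in> fin_vN"
  shows "lext hom1 (adj x) = adj (lext hom1 x)" "lext (hom2 i w) (adj x) = adj (lext (hom2 i w) x)"
  using lext_adj[of hom1, OF hom_inverse(1) hom_bounded(1) assms]
    lext_adj[of "hom2 i w", OF hom_inverse(2)[OF w] hom_bounded(2) assms] by simp_all

lemma lext_hom_vN: "lext hom1 x \<in> group_vN" "lext (hom2 i w) x \<in> group_vN" by (simp_all add: lext_vN hom_vN)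

lemma hom2_hom:
  assumes "x \<in> fin_vN" "y \<in> fin_vN"
  shows "lext (hom2 i w) (x oL y) = lext (hom2 i w) x oL lext (hom2 i w) y"
    "lext (hom2 i w) (pev r x) = pev r (lext (hom2 i w) x)"
  using lext_hom[of "hom2 i w", OF hom2_mult[OF w0] hom_bounded(2) assms]
    lext_pev[of "hom2 i w", OF hom2_mult[OF w0] hom_bounded(2) hom_1(2) assms(1)] by simp_all

text \<open>The Leibniz rule applied twice to x (adj x z) with z = x r(adj x x); factors to the
  right of a derivative are written as right multiplications. It has the shape of
  \<open>dd_pCons\<close>.\<close>

lemma deriv_odd_step:
  assumes x: "x \<in> fin_vN"
  defines "A \<equiv> lext hom1 x" and "B \<equiv> lext (hom2 i w) x"
  shows "deriv_x i w (x oL pev (pCons a r) (adj x oL x)) vac =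
    a *\<^sub>R deriv_x i w x vac + A (adj A (deriv_x i w (x oL pev r (adj x oL x)) vac))
    + A (Rop (B oL pev r (adj B oL B)) (deriv_x i w (adj x) vac))
    + Rop ((adj B oL B) oL pev r (adj B oL B)) (deriv_x i w x vac)"
proof -
  define z where "z = x oL pev r (adj x oL x)"
  have fz: "z \<in> fin_vN" unfolding z_def using x by (intro fin_compose fin_pev fin_self)
  note fa = fin_adj[OF x]
  have "x oL pev (pCons a r) (adj x oL x) = a *\<^sub>R x + (x oL (adj x oL z))"
    by (simp add: z_def pev_pCons compose_linear compose_assoc)
  hence "deriv_x i w (x oL pev (pCons a r) (adj x oL x)) = a *\<^sub>R deriv_x i w x + deriv_x i w (x oL (adj x oL z))"
    using x fa fz by (simp add: deriv_x_def lext_add lext_scaleR fin_scaleR fin_compose)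
  moreover have "deriv_x i w (x oL (adj x oL z)) = (A oL deriv_x i w (adj x oL z)) + (deriv_x i w x oL lext (hom2 i w) (adj x oL z))"
    unfolding A_def by (intro deriv_compose w0 x fin_compose fa fz)
  moreover have "deriv_x i w (adj x oL z) = (adj A oL deriv_x i w z) + (deriv_x i w (adj x) oL lext (hom2 i w) z)"
    unfolding A_def hom_adj(1)[OF x, symmetric] by (intro deriv_compose w0 fa fz)
  moreover have Z: "lext (hom2 i w) z = B oL pev r (adj B oL B)"
    unfolding z_def B_def using x fa by (simp add: hom2_hom hom_adj fin_compose fin_pev fin_self)
  moreover have "lext (hom2 i w) (adj x oL z) = (adj B oL B) oL pev r (adj B oL B)"
    using x fa fz Z by (simp add: hom2_hom hom_adj B_def compose_assoc)
  moreover have "B oL pev r (adj B oL B) \<in> group_vN" "(adj B oL B) oL pev r (adj B oL B) \<in> group_vN"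
    unfolding B_def by (intro vN_compose vN_pev vN_self vN_adj lext_hom_vN)+
  moreover have "deriv_x i w y \<in> group_vN" for y using deriv_fin by auto
  ultimately show ?thesis
    unfolding z_def[symmetric] by (simp add: blinfun.add_left blinfun.add_right blinfun.scaleR_left Rop_vN)
qed

text \<open>The chain rule: the derivative of an odd polynomial of a selfadjoint matrix is the
  divided difference, in left multiplication by one image and right multiplication by the other,
  applied to the derivative of the matrix. The quadruple with entries \<open>a\<close> and
  \<open>b\<close> only is the off-diagonal matrix of the derivatives of \<open>x\<close> and
  \<open>adj x\<close>.\<close>

lemma deriv_hat:
  assumes x: "x \<in> fin_vN"
  defines "A \<equiv> lext hom1 x" and "B \<equiv> lext (hom2 i w) x"
  shows "\<exists>\<Phi>. bip (Lhat A) (Rhat B) (dd r) \<Phi> &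
    ((deriv_x i w (x oL pev r (adj x oL x)) vac, deriv_x i w (adj x oL pev r (x oL adj x)) vac), (0, 0))
      = \<Phi> ((deriv_x i w x vac, deriv_x i w (adj x) vac), (0, 0))"
proof (induction r)
  case 0
  have "dd 0 = (%s t. 0)" by (simp add: dd_def fun_eq_iff)
  hence "bip (Lhat A) (Rhat B) (dd 0) 0" using bip_const[of "Lhat A" "Rhat B" 0] by simp
  thus ?case by (intro exI[of _ 0]) (simp add: deriv_x_def zero_prod_def)
next
  case (pCons a r)
  let ?L = "Lhat A" and ?R = "Rhat B"
  let ?y = "deriv_x i w x vac" and ?y' = "deriv_x i w (adj x) vac"
  from pCons obtain \<Phi> where b: "bip ?L ?R (dd r) \<Phi>" and \<Phi>: "((deriv_x i w (x oL pev r (adj x oL x)) vac,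
      deriv_x i w (adj x oL pev r (x oL adj x)) vac), (0, 0)) = \<Phi> ((?y, ?y'), (0, 0))" by blast
  \<comment> \<open>The recursion \<open>dd_pCons\<close> with s and t replaced by the two
    multiplications.\<close>
  define \<Psi> where "\<Psi> = a *\<^sub>R id_blinfun + ((?L oL ?L) oL \<Phi>) + ((?L + ?R) oL (?R oL pev r (?R oL ?R)))"
  have AB: "A \<in> group_vN" "B \<in> group_vN" by (simp_all add: A_def B_def lext_hom_vN)
  note ab = vN_bounded[OF AB(1)] vN_bounded[OF AB(2)]
  have sb: "sym_op (adj B oL B)" "sym_op (B oL adj B)" by (simp_all add: AB vN_pos_self vN_pos_self2 pos_op_sym)
  have bb: "pev r (adj B oL B) \<in> bounded_ops" "pev r (B oL adj B) \<in> bounded_ops"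
    "adj B oL B \<in> bounded_ops" "B oL adj B \<in> bounded_ops" "adj B \<in> bounded_ops"
    using AB by (auto intro!: vN_bounded vN_pev vN_compose vN_adj)
  have c: "?L oL ?R = ?R oL ?L" by (rule hat_commute[OF AB])
  have "bip ?L ?R (dd (pCons a r)) \<Psi>" unfolding \<Psi>_def dd_pCons[abs_def]
    by (intro bip_add bip_mult bip_const bip_fst bip_snd bip_pev b c)
  moreover have "((deriv_x i w (x oL pev (pCons a r) (adj x oL x)) vac,
      deriv_x i w (adj x oL pev (pCons a r) (x oL adj x)) vac), (0, 0)) = \<Psi> ((?y, ?y'), (0, 0))"
  proof -
    have 1: "pev r (?R oL ?R) ((?y, ?y'), (0, 0)) = ((Rop (pev r (adj B oL B)) ?y, Rop (pev r (B oL adj B)) ?y'), (0, 0))"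
      by (subst pev_block[OF Rhat_sq[OF ab(2)]]) (simp add: pev_Rop sb bb)
    have i1: "pev r (B oL adj B) oL B = B oL pev r (adj B oL B)" by (rule pev_intertwine) (simp add: compose_assoc)
    have i2: "pev r (adj B oL B) oL adj B = adj B oL pev r (B oL adj B)" by (rule pev_intertwine) (simp add: compose_assoc)
    have c1: "pev r (adj B oL B) oL (adj B oL B) = (adj B oL B) oL pev r (adj B oL B)"
      "pev r (B oL adj B) oL (B oL adj B) = (B oL adj B) oL pev r (B oL adj B)" by (rule pev_commute, rule refl)+
    have R2: "Rop B (Rop (pev r (B oL adj B)) v) = Rop (B oL pev r (adj B oL B)) v"
      "Rop (adj B) (Rop (pev r (adj B oL B)) v) = Rop (adj B oL pev r (B oL adj B)) v"
      "Rop B (Rop (adj B) (Rop (pev r (adj B oL B)) v)) = Rop ((adj B oL B) oL pev r (adj B oL B)) v"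
      "Rop (adj B) (Rop B (Rop (pev r (B oL adj B)) v)) = Rop ((B oL adj B) oL pev r (B oL adj B)) v" for v
      using ab bb by (simp_all only: i1[symmetric] i2[symmetric] c1[symmetric] Rop_compose bounded_ops_compose blinfun_apply_blinfun_compose)
    have R3: "Rop B (Rop (adj B oL pev r (B oL adj B)) v) = Rop ((adj B oL B) oL pev r (adj B oL B)) v"
      "Rop (adj B) (Rop (B oL pev r (adj B oL B)) v) = Rop ((B oL adj B) oL pev r (B oL adj B)) v" for v
      using R2(3,4)[of v] by (simp_all only: R2(1,2))
    have \<Phi>': "\<Phi> ((?y, ?y'), (0, 0)) = ((deriv_x i w (x oL pev r (adj x oL x)) vac,
      deriv_x i w (adj x oL pev r (x oL adj x)) vac), (0, 0))" using \<Phi> by simp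
    have "deriv_x i w (adj x oL pev (pCons a r) (x oL adj x)) vac =
      a *\<^sub>R ?y' + adj A (A (deriv_x i w (adj x oL pev r (x oL adj x)) vac))
      + adj A (Rop (adj B oL pev r (B oL adj B)) ?y)
      + Rop ((B oL adj B) oL pev r (B oL adj B)) ?y'" using deriv_odd_step[OF fin_adj[OF x], of a r] x ab
      by (simp add: hom_adj adj_adj fin_vN vN_bounded A_def[symmetric] B_def[symmetric])
    moreover note deriv_odd_step[OF x, of a r, folded A_def B_def]
    ultimately show ?thesis
      unfolding \<Psi>_def blinfun.add_left blinfun_apply_blinfun_compose blinfun.scaleR_left blinfun_apply_id_blinfun 1 \<Phi>'
      by (simp add: Lhat_apply Rhat_apply R2(1,2) R3 add.assoc blinfun.add_right)
  qed
  ultimately show ?case by blast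
qed

end

section \<open>The inequality for the logarithm of an average of two multiplications\<close>

subsection \<open>Spectral functionals depending on a parameter\<close>

text \<open>Differentiation under the spectral integral: the mean value theorem and uniform
  continuity of the derivative on the compact set [0, norm T] x [w/2, 2w] make the difference
  quotients converge uniformly.\<close>

lemma spf_has_derivative:
  fixes g g' :: "real => real => real"
  assumes T: "pos_op T" and c: "!!w. 0 < w ==> cont0 (%u. g u w)" "!!w. 0 < w ==> cont0 (%u. g' u w)"
    and g: "!!u w. 0 <= u ==> 0 < w ==> (g u has_real_derivative g' u w) (at w)"
    and c': "continuous_on ({0..} \<times> {0<..}) (%(u, w). g' u w)" and w: "0 < w"
  shows "((%w. spf T v (%u. g u w)) has_real_derivative spf T v (%u. g' u w)) (at w)"
  unfolding has_field_derivative_iff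
proof (rule LIM_I)
  fix e :: real assume e: "e > 0"
  define e' where "e' = e / ((norm v)^2 + 1) / 2"
  have e': "e' > 0" "e' * (norm v)^2 < e"
  proof -
    have n: "(norm v)^2 + 1 > 0" by (simp add: add_nonneg_pos)
    thus "e' > 0" using e by (simp add: e'_def)
    have "e' * (norm v)^2 <= e' * ((norm v)^2 + 1)" using \<open>e' > 0\<close> by (intro mult_left_mono) auto
    also have "... = e / 2" using n by (simp add: e'_def field_simps)
    finally show "e' * (norm v)^2 < e" using e by simp
  qed
  have "compact ({0..norm T} \<times> {w / 2..2 * w})" by (intro compact_Times compact_Icc)
  moreover have "continuous_on ({0..norm T} \<times> {w / 2..2 * w}) (%(u, w). g' u w)"
    by (rule continuous_on_subset[OF c']) (use w in auto)
  ultimately have "uniformly_continuous_on ({0..norm T} \<times> {w / 2..2 * w}) (%(u, w). g' u w)"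
    by (rule compact_uniformly_continuous[rotated])
  then obtain d where d: "d > 0" "!!p q. p \<in> {0..norm T} \<times> {w / 2..2 * w} ==> q \<in> {0..norm T} \<times> {w / 2..2 * w} ==>
      dist q p < d ==> dist ((%(u, w). g' u w) q) ((%(u, w). g' u w) p) < e'"
    unfolding uniformly_continuous_on_def using e'(1) by metis
  show "\<exists>s>0. \<forall>y. y ~= w & norm (y - w) < s -->
      norm ((spf T v (%u. g u y) - spf T v (%u. g u w)) / (y - w) - spf T v (%u. g' u w)) < e"
  proof (intro exI conjI allI impI)
    show "0 < min d (w / 2)" using d w by simp
    fix y assume y: "y ~= w & norm (y - w) < min d (w / 2)"
    hence y0: "\<bar>y - w\<bar> < d" "\<bar>y - w\<bar> < w / 2" "y ~= w" by auto
    have yp: "0 < y" "w / 2 <= y" "y <= 2 * w" using y0 w unfolding abs_less_iff by linarith+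
    have "\<bar>spf T v (%u. (1 / (y - w)) * (g u y - g u w) - g' u w)\<bar> <= e' * (norm v)^2"
    proof (rule spf_abs_le[OF T])
      show "cont0 (%u. (1 / (y - w)) * (g u y - g u w) - g' u w)"
        by (intro continuous_on_diff continuous_on_mult_left c yp w)
      fix u assume u: "0 <= u" "u <= norm T"
      have "\<exists>z. \<bar>z - w\<bar> <= \<bar>y - w\<bar> & z \<in> {w / 2..2 * w} & g u y - g u w = (y - w) * g' u z"
      proof (cases "w < y")
        case True
        then obtain z where "w < z" "z < y" "g u y - g u w = (y - w) * g' u z"
          using MVT2[OF True, of "g u" "g' u"] g[OF u(1)] w by (metis order_less_le_trans)
        thus ?thesis using yp w by (intro exI[of _ z]) auto
      next
        case False
        hence "y < w" using y0 by simp
        then obtain z where "y < z" "z < w" "g u w - g u y = (w - y) * g' u z"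
          using MVT2[of y w "g u" "g' u"] g[OF u(1)] yp by (metis order_less_le_trans)
        thus ?thesis using yp w by (intro exI[of _ z]) (auto simp: algebra_simps)
      qed
      then obtain z where z: "\<bar>z - w\<bar> <= \<bar>y - w\<bar>" "z \<in> {w / 2..2 * w}" "g u y - g u w = (y - w) * g' u z" by blast
      have "dist (g' u z) (g' u w) < e'" using d(2)[of "(u, w)" "(u, z)"] u w z y0 by (simp add: dist_Pair_Pair dist_real_def)
      moreover have "(1 / (y - w)) * (g u y - g u w) = g' u z" using z(3) y0(3) by simp
      ultimately show "\<bar>(1 / (y - w)) * (g u y - g u w) - g' u w\<bar> <= e'" by (simp add: dist_real_def)
    qed
    also have "spf T v (%u. (1 / (y - w)) * (g u y - g u w) - g' u w)
      = (1 / (y - w)) * (spf T v (%u. g u y) - spf T v (%u. g u w)) - spf T v (%u. g' u w)"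
    proof -
      have "spf T v (%u. (1 / (y - w)) * (g u y - g u w) - g' u w)
        = spf T v (%u. (1 / (y - w)) * (g u y - g u w)) - spf T v (%u. g' u w)"
        by (intro spf_diff T continuous_on_diff continuous_on_mult_left c yp w)
      also have "spf T v (%u. (1 / (y - w)) * (g u y - g u w)) = (1 / (y - w)) * spf T v (%u. g u y - g u w)"
        by (intro spf_scale T continuous_on_diff c yp w)
      also have "spf T v (%u. g u y - g u w) = spf T v (%u. g u y) - spf T v (%u. g u w)"
        by (intro spf_diff T c yp w)
      finally show ?thesis .
    qed
    finally show "norm ((spf T v (%u. g u y) - spf T v (%u. g u w)) / (y - w) - spf T v (%u. g' u w)) < e"
      using e'(2) by simp
  qed
qed

subsection \<open>The resolvent inequality\<close>

lemma cont0_divide: "cont0 f ==> 0 < w ==> cont0 (%u. f u / (u + w))"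
  by (intro continuous_on_divide continuous_on_add continuous_on_id continuous_on_const) auto

text \<open>The variational lower bound for the quadratic form of the resolvent G = (S + w)^(-1):
  expand the nonnegative number <G(v - s), v - s> with s = (S + w) z.\<close>

lemma resolvent_ge:
  assumes S: "pos_op S" and w: "0 < w"
  shows "2 * inner v z - inner (S z) z - w * (norm z)^2 <= spf S v (%u. 1 / (u + w))"
proof -
  let ?\<rho> = "%u. 1 / (u + w)"
  have c: "cont0 ?\<rho>" "cont0 (%u. u + w)" using w by (auto intro!: cont0_divide continuous_intros)
  let ?G = "pos_calc ?\<rho> S"
  have G: "pos_op ?G" using c w by (intro cf_pos S) auto
  have "pos_calc (%u. u + w) S = S + w *\<^sub>R id_blinfun"
    using cf_add[OF S, of "%u. u" "%_. w"] by (simp add: cf_id cf_const S continuous_intros)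
  moreover have "pos_calc (%u. ?\<rho> u * (u + w)) S = ?G oL pos_calc (%u. u + w) S" by (intro cf_mult S c)
  moreover have "pos_calc (%u. ?\<rho> u * (u + w)) S = pos_calc (%_. 1) S" using w by (intro cf_cong) auto
  ultimately have GS: "?G oL (S + w *\<^sub>R id_blinfun) = id_blinfun" using cf_const[OF S, of 1] by simp
  define s where "s = (S + w *\<^sub>R id_blinfun) z"
  have Gs: "?G s = z" unfolding s_def using arg_cong[OF GS, of "%T. blinfun_apply T z"] by simp
  have "0 <= inner (?G (v - s)) (v - s)" by (rule pos_op_nonneg[OF G])
  also have "... = spf S v ?\<rho> - 2 * inner v z + inner z s" using sym_opD[OF pos_op_sym[OF G], of v s]
    by (simp add: blinfun.diff_right inner_diff_left inner_diff_right Gs spf_def inner_commute)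
  also have "inner z s = inner (S z) z + w * (norm z)^2"
    by (simp add: s_def blinfun.add_left blinfun.scaleR_left inner_add_right inner_commute dot_square_norm)
  finally show ?thesis by simp
qed

text \<open>The upper right block of half the sum of the squares of the left and right matrix
  multiplications; it averages left multiplication by A adj A and right multiplication by adj B
  B.\<close>

definition mixed :: "'n free_group op => 'n free_group op => 'n free_group op" where
  "mixed A B = (1 / 2) *\<^sub>R ((A oL adj A) + Rop (adj B oL B))"

lemma mixed_pos: "A \<in> group_vN ==> B \<in> group_vN ==> pos_op (mixed A B)" unfolding mixed_def
  by (intro pos_op_scaleR pos_op_add vN_pos_self2 pos_op_Rop vN_pos_self vN_bounded vN_self) simp_all

text \<open>The trial vector in \<open>resolvent_ge\<close> comes from Z = Y (adj Y Y + w)^(-1),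
  which is optimal when A = B = Y. The trace property then rewrites the terms with \<open>A\<close>
  and \<open>B\<close> as spectral integrals of \<open>Y\<close> at the vectors \<open>A vac\<close>
  and \<open>adj B vac\<close>.\<close>

lemma resolvent_mixed:
  assumes A: "A \<in> group_vN" and B: "B \<in> group_vN" and Y: "Y \<in> group_vN" and w: "0 < w"
  shows "phi Y (%y. 2 * (y / (y + w)) - w * (y / (y + w)^2))
      - 1 / 2 * spf (Y oL adj Y) (A vac) (%y. y / (y + w)^2)
      - 1 / 2 * spf (adj Y oL Y) (adj B vac) (%y. y / (y + w)^2)
    <= spf (mixed A B) (Y vac) (%u. 1 / (u + w))"
proof -
  let ?\<rho> = "%u. 1 / (u + w)"
  have c: "cont0 ?\<rho>" using w by (auto intro!: cont0_divide continuous_intros)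
  have c2: "cont0 (%y. y / (y + w))" using w by (intro cont0_divide continuous_on_id)
  have cf: "cont0 (%y. y / (y + w)^2)" using cont0_divide[OF c2 w] by (simp add: power2_eq_square)
  let ?r = "pos_calc ?\<rho> (adj Y oL Y)" and ?r' = "pos_calc ?\<rho> (Y oL adj Y)"
  define Z where "Z = Y oL ?r"
  have r: "?r \<in> group_vN" "sym_op ?r" "?r' \<in> group_vN" "sym_op ?r'"
    using Y c by (auto intro!: vN_calc cf_sym vN_pos_self vN_pos_self2 vN_compose vN_adj)
  have Z: "Z \<in> group_vN" unfolding Z_def by (intro vN_compose Y r)
  have Z2: "Z = ?r' oL Y" unfolding Z_def
    by (rule cf_intertwine[symmetric]) (simp_all add: Y c vN_pos_self vN_pos_self2 compose_assoc)
  have sq: "pos_calc ?\<rho> T oL (T oL pos_calc ?\<rho> T) = pos_calc (%y. y / (y + w)^2) T" if T: "pos_op T" for T :: "'a free_group op"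
  proof -
    have "pos_calc (%y. y / (y + w)^2) T = pos_calc (%y. ?\<rho> y * (y * ?\<rho> y)) T"
      by (rule cf_cong) (simp add: power2_eq_square)
    also have "... = pos_calc ?\<rho> T oL pos_calc (%y. y * ?\<rho> y) T"
      by (intro cf_mult T c continuous_on_mult continuous_on_id)
    also have "pos_calc (%y. y * ?\<rho> y) T = pos_calc (%y. y) T oL pos_calc ?\<rho> T"
      by (intro cf_mult T c continuous_on_id)
    finally show ?thesis by (simp add: cf_id T)
  qed
  have 3: "adj Z oL Z = pos_calc (%y. y / (y + w)^2) (adj Y oL Y)"
  proof -
    have "adj Z oL Z = ?r oL ((adj Y oL Y) oL ?r)" using Y r by (simp add: Z_def adj_compose vN_bounded adj_sym compose_assoc)
    thus ?thesis by (simp only: sq vN_pos_self[OF Y])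
  qed
  have 4: "Z oL adj Z = pos_calc (%y. y / (y + w)^2) (Y oL adj Y)"
  proof -
    have "Z oL adj Z = ?r' oL ((Y oL adj Y) oL ?r')" using Y r by (simp add: Z2 adj_compose vN_bounded adj_sym compose_assoc)
    thus ?thesis by (simp only: sq vN_pos_self2[OF Y])
  qed
  let ?d = "delta 1 :: 'a free_group ell2"
  let ?z = "Z ?d"
  have i1: "inner (Y ?d) ?z = phi Y (%y. y / (y + w))" using phi_compose_poly(3)[OF Y c c] by (simp add: Z_def)
  have sp: "(norm (Z u))^2 = spf (adj Y oL Y) u (%y. y / (y + w)^2)" for u
  proof -
    have "(norm (Z u))^2 = inner ((adj Z oL Z) u) u" using Z by (simp add: power2_norm_eq_inner adj_inner2 vN_bounded)
    thus ?thesis by (simp only: 3 spf_def)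
  qed
  have sp': "(norm (adj Z u))^2 = spf (Y oL adj Y) u (%y. y / (y + w)^2)" for u
  proof -
    have "(norm (adj Z u))^2 = inner ((Z oL adj Z) u) u" using Z by (simp add: power2_norm_eq_inner adj_inner vN_bounded)
    thus ?thesis by (simp only: 4 spf_def)
  qed
  have i2: "(norm ?z)^2 = phi Y (%y. y / (y + w)^2)" by (simp add: sp phi_def)
  have i3: "inner ((A oL adj A) ?z) ?z = spf (Y oL adj Y) (A ?d) (%y. y / (y + w)^2)"
  proof -
    have "inner ((A oL adj A) ?z) ?z = (norm ((adj A oL Z) ?d))^2"
      using A by (simp add: power2_norm_eq_inner adj_inner vN_bounded)
    also have "norm ((adj A oL Z) ?d) = norm (adj (adj A oL Z) ?d)" using A Z by (simp only: vN_trace_norm vN_compose vN_adj)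
    also have "adj (adj A oL Z) = adj Z oL A" using A Z by (simp add: adj_compose adj_adj vN_bounded vN_adj)
    also have "(norm ((adj Z oL A) ?d))^2 = spf (Y oL adj Y) (A ?d) (%y. y / (y + w)^2)" by (simp add: sp')
    finally show ?thesis .
  qed
  have i4: "inner (Rop (adj B oL B) ?z) ?z = spf (adj Y oL Y) (adj B ?d) (%y. y / (y + w)^2)"
  proof -
    have b: "B \<in> bounded_ops" "adj B \<in> bounded_ops" using B by (auto intro: vN_bounded vN_adj)
    have "inner (Rop (adj B oL B) ?z) ?z = (norm (Rop (adj B) ?z))^2"
      by (simp add: Rop_compose b Rop_inner power2_norm_eq_inner)
    also have "Rop (adj B) ?z = Z (adj B ?d)" using B Z by (intro Rop_vN vN_adj)
    finally show ?thesis by (simp add: sp)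
  qed
  note resolvent_ge[OF mixed_pos[OF A B] w, of "Y ?d" ?z, unfolded i1 i2]
  moreover have "inner (mixed A B ?z) ?z = 1 / 2 * inner ((A oL adj A) ?z) ?z + 1 / 2 * inner (Rop (adj B oL B) ?z) ?z"
    by (simp add: mixed_def blinfun.scaleR_left blinfun.add_left inner_add_left del: blinfun_apply_blinfun_compose)
  moreover have "phi Y (%y. 2 * (y / (y + w)) - w * (y / (y + w)^2))
    = 2 * phi Y (%y. y / (y + w)) - w * phi Y (%y. y / (y + w)^2)"
  proof -
    have "phi Y (%y. 2 * (y / (y + w)) - w * (y / (y + w)^2))
      = phi Y (%y. 2 * (y / (y + w))) - phi Y (%y. w * (y / (y + w)^2))"
      by (intro phi_diff Y continuous_on_mult_left c2 cf)
    thus ?thesis by (simp only: phi_scale[OF Y c2] phi_scale[OF Y cf])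
  qed
  ultimately show ?thesis using i3 i4 by linarith
qed

lemma cont0_ln: "0 < w ==> cont0 (%u. ln (u + w))" by (intro continuous_intros) auto

lemma phi_id: "Y \<in> group_vN ==> phi Y (%s. s) = (norm (Y vac))^2"
  using cf_id[OF vN_pos_self, of Y] by (simp add: phi_def spf_def adj_inner2 vN_bounded dot_square_norm)

text \<open>The logarithm is an integral of resolvents, so \<open>resolvent_mixed\<close> is
  integrated over w from \<open>a\<close> to infinity. In the form used here, the difference F(w) of
  the two sides is nonincreasing and bounded below by a negative constant over w, hence nonnegative
  at \<open>a\<close>.\<close>

theorem log_mixed:
  assumes A: "A \<in> group_vN" and B: "B \<in> group_vN" and Y: "Y \<in> group_vN" and a: "0 < a"
  shows "spf (mixed A B) (Y vac) (%u. ln (u + a)) <= phi Y (%y. y * ln (y + a) - y^2 / (y + a))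
    + 1 / 2 * spf (Y oL adj Y) (A vac) (%y. y / (y + a))
    + 1 / 2 * spf (adj Y oL Y) (adj B vac) (%y. y / (y + a))"
proof -
  let ?d = "delta 1 :: 'a free_group ell2"
  let ?S = "mixed A B"
  let ?v = "Y ?d"
  \<comment> \<open>Antiderivatives in w of the functions in \<open>resolvent_mixed\<close>; the
    derivative of \<open>g1\<close> equals 2y/(y + w) - w y/(y + w)^2.\<close>
  define g1 where "g1 = (%y w :: real. y * ln (y + w) - y^2 / (y + w))"
  define g1' where "g1' = (%y w :: real. y / (y + w) + y^2 / (y + w)^2)"
  define g2 where "g2 = (%y w :: real. y / (y + w))"
  define g2' where "g2' = (%y w :: real. - (y / (y + w)^2))"
  define g0 where "g0 = (%y w :: real. ln (y + w))"
  define g0' where "g0' = (%y w :: real. 1 / (y + w))"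
  note gd = g0_def g0'_def g1_def g1'_def g2_def g2'_def
  define F where "F = (%w. phi Y (%y. g1 y w) + 1 / 2 * spf (Y oL adj Y) (A ?d) (%y. g2 y w)
    + 1 / 2 * spf (adj Y oL Y) (adj B ?d) (%y. g2 y w) - spf ?S ?v (%y. g0 y w))"
  define F' where "F' = (%w. phi Y (%y. g1' y w) + 1 / 2 * spf (Y oL adj Y) (A ?d) (%y. g2' y w)
    + 1 / 2 * spf (adj Y oL Y) (adj B ?d) (%y. g2' y w) - spf ?S ?v (%y. g0' y w))"
  have c: "cont0 (%u. g0 u w)" "cont0 (%u. g0' u w)" "cont0 (%u. g1 u w)" "cont0 (%u. g1' u w)"
    "cont0 (%u. g2 u w)" "cont0 (%u. g2' u w)" if "0 < w" for w
    unfolding gd using that by (intro continuous_intros; force)+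
  have D: "(g0 u has_real_derivative g0' u w) (at w)" "(g1 u has_real_derivative g1' u w) (at w)"
    "(g2 u has_real_derivative g2' u w) (at w)" if "0 <= u" "0 < w" for u w unfolding gd using that
    by (auto intro!: derivative_eq_intros simp: power2_eq_square)
  have cc: "continuous_on ({0..} \<times> {0<..}) (%(u, w). g0' u w)" "continuous_on ({0..} \<times> {0<..}) (%(u, w). g1' u w)"
    "continuous_on ({0..} \<times> {0<..}) (%(u, w). g2' u w)"
    unfolding gd case_prod_unfold by (intro continuous_intros; force)+
  note pos = mixed_pos[OF A B] vN_pos_self[OF Y] vN_pos_self2[OF Y]
  have FD: "(F has_real_derivative F' w) (at w)" if w: "0 < w" for w unfolding F_def F'_def phi_def
    by (intro DERIV_add DERIV_diff DERIV_cmult spf_has_derivative pos c D cc w; assumption)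
  have F'0: "F' w <= 0" if w: "0 < w" for w
  proof -
    have n: "spf T v (%y. g2' y w) = - spf T v (%y. y / (y + w)^2)" if "pos_op T" for T :: "'a free_group op" and v
      using spf_scale[OF that c(6)[OF w], of v "-1"] by (simp add: g2'_def)
    have "phi Y (%y. g1' y w) = phi Y (%y. 2 * (y / (y + w)) - w * (y / (y + w)^2))"
    proof (rule phi_cong)
      fix s :: real assume "0 <= s"
      hence "s + w ~= 0" using w by simp
      hence "s / (s + w) = (s * (s + w)) / (s + w)^2" by (simp add: power2_eq_square)
      thus "g1' s w = 2 * (s / (s + w)) - w * (s / (s + w)^2)"
        unfolding g1'_def by (simp add: add_divide_distrib[symmetric] diff_divide_distrib[symmetric]) (simp add: power2_eq_square algebra_simps)
    qed
    thus ?thesis using resolvent_mixed[OF A B Y w] n[OF pos(3)] n[OF pos(2)] by (simp add: F'_def g0'_def)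
  qed
  have dec: "F w <= F a" if "a <= w" for w
  proof (rule DERIV_nonpos_imp_nonincreasing[OF that])
    fix x assume "a <= x"
    thus "\<exists>y. (F has_real_derivative y) (at x) & y <= 0"
      using FD[of x] F'0[of x] a by (intro exI[of _ "F' x"]) auto
  qed
  \<comment> \<open>For large w both the entropy term and the logarithm of the mixed operator behave
    like ln w times the squared norm of \<open>Y vac\<close>; these cancel and only terms of order
    1/w remain.\<close>
  have lower: "- ((phi Y (%y. y^2) + norm ?S * (norm ?v)^2) / w) <= F w" if w: "0 < w" for w
  proof -
    have 1: "ln w * (norm ?v)^2 - phi Y (%y. y^2) / w <= phi Y (%y. g1 y w)"
    proof -
      have "phi Y (%y. ln w * y - (1 / w) * y^2) <= phi Y (%y. g1 y w)"
      proof (rule phi_mono[OF Y _ c(3)[OF w]])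
        fix y :: real assume y: "0 <= y"
        have "ln w * y <= y * ln (y + w)" using y w by (simp add: mult.commute mult_left_mono)
        moreover have "y^2 / (y + w) <= y^2 / w" using y w by (intro divide_left_mono) auto
        ultimately show "ln w * y - (1 / w) * y^2 <= g1 y w" by (simp add: g1_def)
      qed (intro continuous_intros)
      also have "phi Y (%y. ln w * y - (1 / w) * y^2) = phi Y (%y. ln w * y) - phi Y (%y. (1 / w) * y^2)"
        by (intro phi_diff Y continuous_intros)
      also have "phi Y (%y. ln w * y) = ln w * (norm ?v)^2"
        using phi_scale[OF Y, of "%y. y" "ln w"] by (simp add: phi_id Y continuous_intros)
      also have "phi Y (%y. (1 / w) * y^2) = (1 / w) * phi Y (%y. y^2)" by (intro phi_scale Y continuous_intros)
      finally show ?thesis by simp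
    qed
    have 2: "0 <= spf T v (%y. g2 y w)" if "pos_op T" for T :: "'a free_group op" and v
      using c(5)[OF w] w by (intro spf_nonneg that) (auto simp: g2_def)
    have 3: "spf ?S ?v (%y. g0 y w) <= (ln w + norm ?S / w) * (norm ?v)^2"
    proof -
      have "spf ?S ?v (%y. g0 y w) <= spf ?S ?v (%_. ln w + norm ?S / w)"
      proof (rule spf_mono[OF pos(1) c(1)[OF w]])
        fix s assume s: "0 <= s" "s <= norm ?S"
        have "0 < 1 + s / w" "s + w = w * (1 + s / w)" using s w by (auto simp: field_simps add_pos_nonneg)
        hence "ln (s + w) = ln w + ln (1 + s / w)" using w ln_mult_pos[of w "1 + s / w"] by simp
        also have "ln (1 + s / w) <= s / w" using s w by (intro ln_add_one_self_le_self) auto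
        also have "s / w <= norm ?S / w" using s w by (intro divide_right_mono) auto
        finally show "g0 s w <= ln w + norm ?S / w" by (simp add: g0_def)
      qed simp
      thus ?thesis by (simp add: spf_const pos)
    qed
    have "F w >= ln w * (norm ?v)^2 - phi Y (%y. y^2) / w - (ln w + norm ?S / w) * (norm ?v)^2"
      using 1 2[OF pos(3), of "A ?d"] 2[OF pos(2), of "adj B ?d"] 3 unfolding F_def by linarith
    thus ?thesis by (simp add: algebra_simps add_divide_distrib)
  qed
  have "0 <= F a"
  proof (rule tendsto_le[OF trivial_limit_at_top_linorder tendsto_const])
    show "((%w. - ((phi Y (%y. y^2) + norm ?S * (norm ?v)^2) / w)) \<longlongrightarrow> 0) at_top"
      by (rule tendsto_eq_rhs[OF tendsto_minus[OF tendsto_divide_0[OF tendsto_const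
              filterlim_at_top_imp_at_infinity[OF filterlim_ident]]]]) simp
    show "\<forall>\<^sub>F w in at_top. - ((phi Y (%y. y^2) + norm ?S * (norm ?v)^2) / w) <= F a"
      using eventually_ge_at_top[of a]
    proof eventually_elim
      case (elim w)
      thus ?case using lower[of w] dec[of w] a by simp
    qed
  qed
  thus ?thesis by (simp add: F_def g0_def g1_def g2_def)
qed

lemma norm_adj_le:
  assumes T: "T \<in> bounded_ops"
  shows "norm (adj T) <= norm T"
proof (rule norm_blinfun_bound)
  fix v
  have "(norm (adj T v))^2 = inner (T (adj T v)) v" using T by (simp add: power2_norm_eq_inner adj_inner)
  also have "... <= norm T * norm (adj T v) * norm v"
    by (rule order_trans[OF norm_cauchy_schwarz]) (intro mult_right_mono norm_blinfun norm_ge_zero)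
  finally have "norm (adj T v) * norm (adj T v) <= norm (adj T v) * (norm T * norm v)"
    by (simp add: power2_eq_square mult_ac)
  thus "norm (adj T v) <= norm T * norm v" by (cases "norm (adj T v) = 0") auto
qed simp

lemma norm_lreg_le: "norm (lreg g) <= 1"
proof (rule norm_blinfun_bound)
  fix v :: "'a free_group ell2"
  have "(norm (lreg g v))^2 = (norm v)^2" unfolding norm_ell2_sq lreg_apply by (rule infsum_reindex_bij_betw[OF bij_mult_left])
  thus "norm (lreg g v) <= 1 * norm v" by (simp add: power2_eq_iff_nonneg)
qed simp

lemma norm_scaleC_op: "norm (scaleC_op c T) <= cmod c * norm T"
proof (rule norm_blinfun_bound)
  fix v
  have "norm (scaleC_op c T v) = cmod c * norm (T v)" by (simp add: scaleC_op_apply norm_scaleC)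
  also have "... <= cmod c * (norm T * norm v)" by (intro mult_left_mono norm_blinfun) simp
  finally show "norm (scaleC_op c T v) <= cmod c * norm T * norm v" by (simp add: mult.assoc)
qed simp

text \<open>Bounds the operator norm of every linear extension of maps of norm at most 1, so one
  constant serves both homomorphisms, all twists and the flow for parameters in [-1, 1].\<close>

definition l1norm :: "'a free_group op => real" where
  "l1norm x = (\<Sum>g\<in>supp x. cmod (coef x g))"

lemma l1norm_nonneg: "0 <= l1norm x" by (simp add: l1norm_def sum_nonneg)

lemma norm_lext_le:
  assumes "!!g. norm (\<phi> g) <= 1"
  shows "norm (lext \<phi> x) <= l1norm x" unfolding lext_def l1norm_def
proof (rule sum_norm_le)
  fix g
  have "norm (scaleC_op (coef x g) (\<phi> g)) <= cmod (coef x g) * 1"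
    by (rule order_trans[OF norm_scaleC_op]) (intro mult_left_mono assms norm_ge_zero)
  thus "norm (scaleC_op (coef x g) (\<phi> g)) <= cmod (coef x g)" by simp
qed

lemma norm_hom_le: "norm (hom1 g) <= 1" "cmod w = 1 ==> norm (hom2 i w g) <= 1"
  using norm_lreg_le[of "lmap let1 g"] norm_lreg_le[of "lmap (let2 i) g"]
    norm_scaleC_op[of "w powi expo i g" "lreg (lmap (let2 i) g)"] by (simp_all add: hom1_def hom2_def norm_power_int)

lemma norm_Rop: "norm (Rop x) <= norm (adj x)"
  for x :: "'a free_group op"
proof (rule norm_blinfun_bound)
  fix v :: "'a free_group ell2"
  have "norm (Jop v) = norm v" using Jop_inner[of v v] by (simp add: norm_eq_sqrt_inner)
  thus "norm (Rop x v) <= norm (adj x) * norm v" using norm_blinfun[of "adj x" "Jop v"] by (simp add: norm_Rop_le)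
qed simp

lemma norm_quad_le: "norm ((a, b), (c, d)) <= norm a + norm b + norm c + norm d"
  using norm_Pair_le[of a b] norm_Pair_le[of c d] norm_Pair_le[of "(a, b)" "(c, d)"] by linarith

lemma norm_quad_comp:
  "norm a <= norm ((a, b), (c, d))" "norm b <= norm ((a, b), (c, d))"
  "norm c <= norm ((a, b), (c, d))" "norm d <= norm ((a, b), (c, d))"
  using norm_fst_le[of "(a, b)" "(c, d)"] norm_snd_le[of "(c, d)" "(a, b)"]
    norm_fst_le[of a b] norm_snd_le[of b a] norm_fst_le[of c d] norm_snd_le[of d c] by (auto intro: order_trans)

text \<open>The factor 4 is crude: the norm of a quadruple is bounded by the sum of its four
  entries. It only enlarges the square on which polynomials have to approximate.\<close>

lemma norm_hat_le:
  fixes x :: "'a free_group op"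
  assumes x: "x \<in> bounded_ops"
  shows "norm (Lhat x) <= 4 * norm x" "norm (Rhat x) <= 4 * norm x"
proof -
  have le: "norm (T v) <= norm x * N" if "norm T <= norm x" "norm v <= N" for T :: "'a free_group op" and v N
    using norm_blinfun[of T v] mult_mono[OF that] by simp
  have a: "norm (adj x) <= norm x" by (rule norm_adj_le[OF x])
  have R: "norm (Rop x) <= norm x" "norm (Rop (adj x)) <= norm x"
    using norm_Rop[of x] norm_Rop[of "adj x"] a x by (auto simp: adj_adj)
  show "norm (Lhat x) <= 4 * norm x"
  proof (rule norm_blinfun_bound)
    fix q :: "'a quad" obtain a' b c d where q: "q = ((a', b), (c, d))" by (metis prod.exhaust)
    show "norm (Lhat x q) <= 4 * norm x * norm q"
      using le[OF order_refl norm_quad_comp(4)[of d a' b c]] le[OF a norm_quad_comp(3)[of c a' b d]]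
        le[OF order_refl norm_quad_comp(2)[of b a' c d]] le[OF a norm_quad_comp(1)[of a' b c d]]
        norm_quad_le[of "x d" "adj x c" "x b" "adj x a'"] unfolding q Lhat_apply by linarith
  qed simp
  show "norm (Rhat x) <= 4 * norm x"
  proof (rule norm_blinfun_bound)
    fix q :: "'a quad" obtain a' b c d where q: "q = ((a', b), (c, d))" by (metis prod.exhaust)
    show "norm (Rhat x q) <= 4 * norm x * norm q"
      using le[OF R(2) norm_quad_comp(4)[of d a' b c]] le[OF R(1) norm_quad_comp(3)[of c a' b d]]
        le[OF R(1) norm_quad_comp(2)[of b a' c d]] le[OF R(2) norm_quad_comp(1)[of a' b c d]]
        norm_quad_le[of "Rop x c" "Rop (adj x) d" "Rop (adj x) a'" "Rop x b"] unfolding q Rhat_apply by linarith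
  qed simp
qed

lemma norm_mixed_le:
  assumes A: "A \<in> bounded_ops" "norm A <= m" and B: "B \<in> bounded_ops" "norm B <= m"
  shows "norm (mixed A B) <= m^2"
proof -
  have m: "0 <= m" using A(2) norm_ge_zero order_trans by blast
  have "norm (A oL adj A) <= m * m" by (rule order_trans[OF norm_blinfun_compose])
      (use A m norm_adj_le[OF A(1)] in \<open>intro mult_mono; simp\<close>)
  moreover have "norm (Rop (adj B oL B)) <= norm (adj B oL B)"
    using norm_Rop[of "adj B oL B"] B by (simp add: adj_compose adj_adj adj_props)
  moreover have "norm (adj B oL B) <= m * m" by (rule order_trans[OF norm_blinfun_compose])
      (use B m norm_adj_le[OF B(1)] in \<open>intro mult_mono; simp\<close>)
  ultimately have "norm ((A oL adj A) + Rop (adj B oL B)) <= m * m + m * m"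
    by (intro order_trans[OF norm_triangle_ineq] add_mono) auto
  thus ?thesis by (simp add: mixed_def power2_eq_square)
qed

text \<open>\<open>hat_pos\<close> for U((s^2 + t^2)/2) - dd r s t, evaluated at the off-diagonal
  matrix of derivatives. On that vector the averaged squares act blockwise as
  \<open>mixed\<close>.\<close>

lemma deriv_bound_mixed:
  fixes i :: nat and x :: "nat free_group op"
  assumes w: "cmod w = 1" and x: "x \<in> fin_vN" and c: "4 * l1norm x <= c" "0 < c"
    and U: "!!s t. \<bar>s\<bar> <= c ==> \<bar>t\<bar> <= c ==> dd r s t <= poly U ((s^2 + t^2) / 2)"
  defines "A \<equiv> lext hom1 x" and "B \<equiv> lext (hom2 i w) x"
    and "y \<equiv> deriv_x i w x vac" and "y' \<equiv> deriv_x i w (adj x) vac"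
  shows "inner (deriv_x i w (x oL pev r (adj x oL x)) vac) y
      + inner (deriv_x i w (adj x oL pev r (x oL adj x)) vac) y'
    <= inner (pev U (mixed A B) y) y + inner (pev U (mixed (adj A) (adj B)) y') y'"
proof -
  have AB: "A \<in> group_vN" "B \<in> group_vN" by (simp_all add: A_def B_def lext_hom_vN[OF w])
  have n: "norm (Lhat A) <= c" "norm (Rhat B) <= c"
    using norm_hat_le(1)[OF vN_bounded[OF AB(1)]] norm_hat_le(2)[OF vN_bounded[OF AB(2)]] c
      norm_lext_le[of hom1 x] norm_lext_le[of "hom2 i w" x] norm_hom_le w by (auto simp: A_def B_def)
  obtain \<Phi> where b: "bip (Lhat A) (Rhat B) (dd r) \<Phi>" and \<Phi>: "((deriv_x i w (x oL pev r (adj x oL x)) vac,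
      deriv_x i w (adj x oL pev r (x oL adj x)) vac), (0, 0)) = \<Phi> ((y, y'), (0, 0))"
    using deriv_hat[OF w x, of i r] unfolding A_def B_def y_def y'_def by blast
  let ?T = "(1 / 2) *\<^sub>R ((Lhat A oL Lhat A) + (Rhat B oL Rhat B))"
  have "pos_op (pev U ?T - \<Phi>)"
  proof (rule hat_pos[OF AB n c(2)])
    show "bip (Lhat A) (Rhat B) (%s t. poly U ((1 / 2) * (s * s + t * t)) - dd r s t) (pev U ?T - \<Phi>)"
      by (intro bip_diff bip_pev bip_scaleR bip_add bip_mult bip_fst bip_snd b hat_commute AB)
  qed (use U in \<open>auto simp: power2_eq_square\<close>)
  hence "inner (\<Phi> ((y, y'), (0, 0))) ((y, y'), (0, 0)) <= inner (pev U ?T ((y, y'), (0, 0))) ((y, y'), (0, 0))"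
    using pos_op_nonneg[of "pev U ?T - \<Phi>" "((y, y'), (0, 0))"] by (simp add: blinfun.diff_left inner_diff_left)
  moreover have "?T ((a, b), (c, d)) = ((mixed A B a, mixed (adj A) (adj B) b),
     (((1 / 2) *\<^sub>R ((A oL adj A) + Rop (B oL adj B))) c, ((1 / 2) *\<^sub>R ((adj A oL A) + Rop (adj B oL B))) d))" for a b c d
    using AB by (simp add: mixed_def blinfun.add_left blinfun.scaleR_left Lhat_sq Rhat_sq vN_bounded adj_adj
        del: blinfun_apply_blinfun_compose)
  hence "pev U ?T ((y, y'), (0, 0)) = ((pev U (mixed A B) y, pev U (mixed (adj A) (adj B)) y'), (0, 0))"
    by (subst pev_block, assumption) simp
  ultimately show ?thesis unfolding \<Phi>[symmetric] by (simp add: inner_prod_def)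
qed

text \<open>\<open>hat_pos\<close> for K dd r + e - (dd q)^2: the square of the symmetric operator
  belonging to \<open>dd q\<close> gives the squared norm on the left.\<close>

lemma deriv_bound_square:
  fixes i :: nat and x :: "nat free_group op"
  assumes w: "cmod w = 1" and x: "x \<in> fin_vN" and c: "4 * l1norm x <= c" "0 < c"
    and U: "!!s t. \<bar>s\<bar> <= c ==> \<bar>t\<bar> <= c ==> (dd q s t)^2 <= K * dd r s t + e"
  defines "y \<equiv> deriv_x i w x vac" and "y' \<equiv> deriv_x i w (adj x) vac"
  shows "(norm (deriv_x i w (x oL pev q (adj x oL x)) vac))^2
      + (norm (deriv_x i w (adj x oL pev q (x oL adj x)) vac))^2
    <= K * (inner (deriv_x i w (x oL pev r (adj x oL x)) vac) y
      + inner (deriv_x i w (adj x oL pev r (x oL adj x)) vac) y')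
      + e * ((norm y)^2 + (norm y')^2)"
proof -
  define A where "A = lext hom1 x"
  define B where "B = lext (hom2 i w) x"
  have AB: "A \<in> group_vN" "B \<in> group_vN" by (simp_all add: A_def B_def lext_hom_vN[OF w])
  have n: "norm (Lhat A) <= c" "norm (Rhat B) <= c"
    using norm_hat_le(1)[OF vN_bounded[OF AB(1)]] norm_hat_le(2)[OF vN_bounded[OF AB(2)]] c
      norm_lext_le[of hom1 x] norm_lext_le[of "hom2 i w" x] norm_hom_le w by (auto simp: A_def B_def)
  let ?Y = "((y, y'), (0, 0)) :: nat quad"
  obtain \<Phi> where b: "bip (Lhat A) (Rhat B) (dd r) \<Phi>" and \<Phi>: "((deriv_x i w (x oL pev r (adj x oL x)) vac,
      deriv_x i w (adj x oL pev r (x oL adj x)) vac), (0, 0)) = \<Phi> ?Y"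
    using deriv_hat[OF w x, of i r] unfolding A_def B_def y_def y'_def by blast
  obtain \<Psi> where b': "bip (Lhat A) (Rhat B) (dd q) \<Psi>" and \<Psi>: "((deriv_x i w (x oL pev q (adj x oL x)) vac,
      deriv_x i w (adj x oL pev q (x oL adj x)) vac), (0, 0)) = \<Psi> ?Y"
    using deriv_hat[OF w x, of i q] unfolding A_def B_def y_def y'_def by blast
  have sym: "sym_op \<Psi>" by (rule bip_sym[OF b' sym_op_Lhat sym_op_Rhat hat_commute]) (simp_all add: AB vN_bounded)
  have "pos_op ((K *\<^sub>R \<Phi> + e *\<^sub>R id_blinfun) - (\<Psi> oL \<Psi>))"
  proof (rule hat_pos[OF AB n c(2)])
    show "bip (Lhat A) (Rhat B) (%s t. (K * dd r s t + e) - dd q s t * dd q s t) ((K *\<^sub>R \<Phi> + e *\<^sub>R id_blinfun) - (\<Psi> oL \<Psi>))"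
      by (intro bip_diff bip_scaleR bip_add bip_const bip_mult b b' hat_commute AB)
  qed (use U in \<open>auto simp: power2_eq_square\<close>)
  hence "0 <= inner (((K *\<^sub>R \<Phi> + e *\<^sub>R id_blinfun) - (\<Psi> oL \<Psi>)) ?Y) ?Y" by (rule pos_op_nonneg)
  hence "inner (\<Psi> ?Y) (\<Psi> ?Y) <= K * inner (\<Phi> ?Y) ?Y + e * inner ?Y ?Y"
    using sym_opD[OF sym, of "\<Psi> ?Y" ?Y]
    by (simp add: blinfun.diff_left blinfun.add_left blinfun.scaleR_left inner_diff_left inner_add_left distrib_left)
  thus ?thesis unfolding \<Phi>[symmetric] \<Psi>[symmetric] by (simp add: inner_prod_def dot_square_norm distrib_left)
qed

subsection \<open>Approximation by odd polynomials\<close>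

lemma pderiv_sum: "pderiv (sum f A) = (\<Sum>a\<in>A. pderiv (f a))"
  by (induction A rule: infinite_finite_induct) (simp_all add: pderiv_add)

text \<open>Integrating x^(2k) divides its coefficient by 2k + 1 and leaves an odd
  polynomial.\<close>

lemma odd_primitive:
  fixes g :: "real poly"
  obtains r :: "real poly" where "!!x. ((%x. x * poly r (x^2)) has_real_derivative poly g (x^2)) (at x)"
    "!!x. poly r x + 2 * x * poly (pderiv r) x = poly g x"
proof -
  have ex: "\<exists>r. \<forall>x. poly r x + 2 * x * poly (pderiv r) x = poly g x"
  proof -
    define r where "r = (\<Sum>k\<le>degree g. monom (coeff g k / (2 * real k + 1)) k)"
    have "poly r x + 2 * x * poly (pderiv r) x = poly g x" for x
    proof -
      have p: "poly (pderiv (monom a k)) x * x = real k * a * x ^ k" for a k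
        by (cases k) (simp_all add: pderiv_monom poly_monom)
      have "poly r x + 2 * x * poly (pderiv r) x
        = (\<Sum>k\<le>degree g. coeff g k / (2 * real k + 1) * x ^ k + 2 * (poly (pderiv (monom (coeff g k / (2 * real k + 1)) k)) x * x))"
        by (simp add: r_def pderiv_sum poly_sum poly_monom sum.distrib sum_distrib_left mult_ac)
      also have "... = (\<Sum>k\<le>degree g. coeff g k * x ^ k)"
      proof (rule sum.cong[OF refl])
        fix k
        have "a / (2 * real k + 1) * y + 2 * (real k * (a / (2 * real k + 1)) * y) = a * y" for a y
        proof -
          define b where "b = a / (2 * real k + 1)"
          have "a = b * (2 * real k + 1)" unfolding b_def by (simp add: add_nonneg_eq_0_iff)
          thus ?thesis unfolding b_def[symmetric] by (simp add: algebra_simps)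
        qed
        thus "coeff g k / (2 * real k + 1) * x ^ k + 2 * (poly (pderiv (monom (coeff g k / (2 * real k + 1)) k)) x * x) = coeff g k * x ^ k"
          unfolding p by simp
      qed
      finally show ?thesis by (simp add: poly_altdef)
    qed
    thus ?thesis by blast
  qed
  then obtain r where r: "!!x. poly r x + 2 * x * poly (pderiv r) x = poly g x" by blast
  show ?thesis
  proof (rule that[OF _ r])
    fix x :: real
    have "((%x. x * poly r (x^2)) has_real_derivative 1 * poly r (x^2) + (2 * x * poly (pderiv r) (x^2)) * x) (at x)"
      by (rule derivative_eq_intros DERIV_chain2[OF poly_DERIV] refl | simp)+
    thus "((%x. x * poly r (x^2)) has_real_derivative poly g (x^2)) (at x)"
      using r[of "x^2"] by (simp add: power2_eq_square mult_ac)
  qed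
qed

text \<open>Uniform approximation of \<open>h\<close> alone would not control difference quotients.
  So its derivative, an even function, is approximated and integrated; the mean value theorem then
  bounds all divided differences by the same error.\<close>

lemma odd_approx:
  fixes h G :: "real => real"
  assumes G: "cont0 G" and h: "!!x. (h has_real_derivative G (x^2)) (at x)" and h0: "h 0 = 0" and e: "0 < e"
  obtains r where "!!s t. \<bar>s\<bar> <= c ==> \<bar>t\<bar> <= c ==> s ~= t ==> \<bar>dd r s t - (h s - h t) / (s - t)\<bar> <= e"
    "!!s. \<bar>s\<bar> <= c ==> \<bar>dd r s s - G (s^2)\<bar> <= e"
    "!!s. 0 < s ==> s <= c ==> \<bar>poly r (s^2) - h s / s\<bar> <= e"
    "0 <= c ==> \<bar>poly r 0 - G 0\<bar> <= e"
proof -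
  obtain g where g: "!!u. 0 <= u ==> u <= c^2 ==> \<bar>poly g u - G u\<bar> <= e"
    using poly_approx[OF cont0_Icc[OF G] e, of "c^2"] by blast
  obtain r where r: "!!x. ((%x. x * poly r (x^2)) has_real_derivative poly g (x^2)) (at x)"
    "!!x. poly r x + 2 * x * poly (pderiv r) x = poly g x" using odd_primitive[of g] by blast
  have sq: "x^2 <= c^2" if "\<bar>x\<bar> <= c" for x using that by (simp add: abs_le_square_iff[symmetric])
  have d: "\<bar>(s * poly r (s^2) - h s) - (t * poly r (t^2) - h t)\<bar> <= e * \<bar>s - t\<bar>" if "\<bar>s\<bar> <= c" "\<bar>t\<bar> <= c" for s t
  proof -
    have "norm ((s * poly r (s^2) - h s) - (t * poly r (t^2) - h t)) <= e * norm (s - t)"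
    proof (rule field_differentiable_bound[of "{-c..c}" "%x. x * poly r (x^2) - h x" "%x. poly g (x^2) - G (x^2)"])
      fix z assume "z \<in> {-c..c}"
      hence "\<bar>z\<bar> <= c" by auto
      thus "norm (poly g (z^2) - G (z^2)) <= e" using g[OF _ sq] by simp
      show "((%x. x * poly r (x^2) - h x) has_field_derivative poly g (z^2) - G (z^2)) (at z within {-c..c})"
        using DERIV_diff[OF r(1) h] has_field_derivative_at_within by blast
    qed (use that in auto)
    thus ?thesis by simp
  qed
  show ?thesis
  proof
    fix s t assume st: "\<bar>s\<bar> <= c" "\<bar>t\<bar> <= c" "s ~= t"
    have "dd r s t - (h s - h t) / (s - t) = ((s * poly r (s^2) - h s) - (t * poly r (t^2) - h t)) / (s - t)"
      using st by (simp add: dd_def diff_divide_distrib)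
    thus "\<bar>dd r s t - (h s - h t) / (s - t)\<bar> <= e" using d[OF st(1,2)] st(3) by (simp add: abs_divide divide_le_eq)
  next
    fix s assume s: "\<bar>s\<bar> <= c"
    thus "\<bar>dd r s s - G (s^2)\<bar> <= e" using g[OF _ sq[OF s]] r(2)[of "s^2"] by (simp add: dd_def)
  next
    fix s assume s: "0 < s" "s <= c"
    hence "\<bar>s * poly r (s^2) - h s\<bar> <= e * s" using d[of s 0] h0 by simp
    moreover have "poly r (s^2) - h s / s = (s * poly r (s^2) - h s) / s" using s by (simp add: field_simps)
    ultimately show "\<bar>poly r (s^2) - h s / s\<bar> <= e" using s by (simp add: abs_divide divide_le_eq)
  next
    assume "0 <= c"
    thus "\<bar>poly r 0 - G 0\<bar> <= e" using g[of 0] r(2)[of 0] by simp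
  qed
qed

text \<open>The derivative of x ln(x^2 + a) is at most ln(x^2 + a) + 2. Replace the logarithm by its
  tangent at m = (s^2 + t^2)/2 + a and average over [t, s]: the mean of x^2 there is (s^2 + s t +
  t^2)/3, at most (s^2 + t^2)/2, so the tangent term contributes no more than ln m.\<close>

lemma log_difference_quotient:
  fixes s t a :: real
  assumes a: "0 < a" and st: "s ~= t"
  shows "(s * ln (s^2 + a) - t * ln (t^2 + a)) / (s - t) <= ln ((s^2 + t^2) / 2 + a) + 2"
proof -
  have *: "s * ln (s^2 + a) - t * ln (t^2 + a) <= (ln ((s^2 + t^2) / 2 + a) + 2) * (s - t)" if ts: "t < s" for s t :: real
  proof -
    define m where "m = (s^2 + t^2) / 2 + a"
    have m: "m > 0" unfolding m_def using a by (simp add: add_nonneg_pos)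
    \<comment> \<open>The subtracted function is the antiderivative of the tangent bound plus
      2.\<close>
    define F where "F = (%x. x * ln (x^2 + a) - ((ln m + 1 + a / m) * x + x ^ 3 / (3 * m)))"
    have "F s <= F t"
    proof (rule DERIV_nonpos_imp_nonincreasing[of t s F])
      fix x assume "t <= x" "x <= s"
      have p: "x^2 + a > 0" using a by (simp add: add_nonneg_pos)
      have "(F has_real_derivative (ln (x^2 + a) + 2 * x^2 / (x^2 + a)) - ((ln m + 1 + a / m) + x^2 / m)) (at x)"
        unfolding F_def using p m by (auto intro!: derivative_eq_intros simp: power2_eq_square)
      moreover have "ln (x^2 + a) <= ln m + ((x^2 + a) / m - 1)"
        using ln_le_minus_one[of "(x^2 + a) / m"] p m by (simp add: ln_div)
      moreover have "2 * x^2 / (x^2 + a) <= 2" using p a by (simp add: divide_le_eq)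
      moreover have "(x^2 + a) / m = x^2 / m + a / m" by (rule add_divide_distrib)
      ultimately show "\<exists>y. (F has_real_derivative y) (at x) & y <= 0" by (intro exI conjI) (assumption, linarith)
    qed (use ts in simp)
    hence "s * ln (s^2 + a) - t * ln (t^2 + a) <= (ln m + 1 + a / m) * (s - t) + (s ^ 3 - t ^ 3) / (3 * m)"
      by (simp add: F_def algebra_simps diff_divide_distrib)
    moreover have "s ^ 3 - t ^ 3 <= 3 * (m - a) * (s - t)"
    proof -
      have "3 * (m - a) * (s - t) - (s ^ 3 - t ^ 3) = (s - t) * ((s - t)^2 / 2)"
        by (simp add: m_def power2_eq_square power3_eq_cube field_simps)
      also have "... >= 0" using ts by simp
      finally show ?thesis by simp
    qed
    hence "(s ^ 3 - t ^ 3) / (3 * m) <= 3 * (m - a) * (s - t) / (3 * m)" using m by (intro divide_right_mono) auto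
    moreover have "(ln m + 1 + a / m) * (s - t) + 3 * (m - a) * (s - t) / (3 * m) = (ln m + 2) * (s - t)"
      using m by (simp add: field_simps)
    ultimately show ?thesis unfolding m_def[symmetric] by linarith
  qed
  show ?thesis
  proof (cases "t < s")
    case True
    thus ?thesis using *[OF True] by (simp add: divide_le_eq)
  next
    case False
    hence st': "s < t" using st by simp
    have "(s * ln (s^2 + a) - t * ln (t^2 + a)) / (s - t) = (t * ln (t^2 + a) - s * ln (s^2 + a)) / (t - s)"
      using st by (simp add: field_simps)
    thus ?thesis using *[OF st'] st' by (simp add: divide_le_eq add.commute)
  qed
qed

text \<open>The generator of the semigroup up to sign: multiplication of each coefficient by the
  word length.\<close>

definition num_op :: "'a free_group op => 'a free_group op" where
  "num_op = lext (%g. len g *\<^sub>R lreg g)"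

lemma coef_num_op: "x \<in> fin_vN ==> coef (num_op x) g = of_real (len g) * coef x g"
proof -
  assume x: "x \<in> fin_vN"
  have "coef (num_op x) g = (\<Sum>h\<in>supp x. if h = g then of_real (len g) * coef x g else 0)"
    unfolding num_op_def coef_lext by (intro sum.cong) (auto simp: coef_scaleR coef_lreg)
  also have "... = of_real (len g) * coef x g" using finite_supp[OF x] by (auto simp: supp_def)
  finally show ?thesis .
qed

lemma fin_lreg1: "lreg g \<in> fin_vN" using fin_lreg[of 1 g] by (simp add: scaleC_op_simps)

lemma num_op_fin: "num_op x \<in> fin_vN" unfolding num_op_def by (intro lext_fin fin_scaleR fin_lreg1)

lemma lform_num_op:
  assumes x: "x \<in> fin_vN"
  shows "inner (num_op x vac) (blinfun_apply z vac) = lform len x z"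
proof -
  have "supp (num_op x) \<subseteq> supp x" by (auto simp: supp_def coef_num_op[OF x])
  thus ?thesis unfolding inner_lform[OF num_op_fin] using lform_eq[OF finite_supp[OF x], of "num_op x" "%_. 1" z]
    by (simp add: coef_num_op[OF x] lform_def mult.assoc algebra_simps)
qed

lemma lform_commute:
  assumes "x \<in> fin_vN" "z \<in> fin_vN"
  shows "lform c x z = lform c z x"
  using lform_eq[of "supp x \<union> supp z" x c z] lform_eq[of "supp x \<union> supp z" z c x] assms
  by (simp add: finite_supp mult.commute)

lemma lform_self: "lform c x x = (\<Sum>g\<in>supp x. c g * (cmod (coef x g))^2)"
  by (simp only: lform_def complex_norm_square[symmetric] Re_complex_of_real)

lemma lform_self_nonneg: "(!!g. 0 <= c g) ==> 0 <= lform c x x"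
  unfolding lform_self by (intro sum_nonneg mult_nonneg_nonneg) auto

lemma lform_scaleR_self:
  assumes x: "x \<in> fin_vN"
  shows "lform c (k *\<^sub>R x) (k *\<^sub>R x) = k^2 * lform c x x"
proof -
  have "lform c (k *\<^sub>R x) (k *\<^sub>R x) = (\<Sum>g\<in>supp x. c g * Re (coef (k *\<^sub>R x) g * cnj (coef (k *\<^sub>R x) g)))"
    by (rule lform_eq[OF finite_supp[OF x]]) (auto simp: supp_def coef_scaleR)
  thus ?thesis by (simp add: coef_scaleR lform_def sum_distrib_left power2_eq_square algebra_simps)
qed

lemma lform_nonneg_len: "0 <= lform len x x" by (rule lform_self_nonneg) (simp add: len_def)

subsection \<open>One step of the logarithmic Sobolev inequality\<close>

lemma cont0_xlnx: "cont0 (%u. u * ln u)"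
proof -
  have "isCont (%u :: real. u * ln u) x" if "x > 0" for x using that by (intro continuous_intros) auto
  moreover have "((%u :: real. u * ln u) \<longlongrightarrow> 0 * ln 0) (at 0 within {0..})"
  proof -
    have "((%u :: real. u * ln u) \<longlongrightarrow> 0) (at_right 0)" by real_asymp
    moreover have "at 0 within {0 :: real..} = at_right 0" by (rule at_within_Ici_at_right)
    ultimately show ?thesis by simp
  qed
  ultimately show ?thesis
    unfolding continuous_on_def by (metis atLeast_iff continuous_within isCont_def less_eq_real_def continuous_at_imp_continuous_at_within)
qed

text \<open>After \<open>Y\<close> is scaled to the squared norm \<open>n\<close> of
  \<open>A vac\<close> and \<open>adj B vac\<close>, the two halves of \<open>n\<close> from
  \<open>log_mixed\<close> cancel against the term -y in its entropy part. What remains is the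
  entropy of the scaled \<open>Y\<close>, to which the assumed inequality applies.\<close>

lemma log_mixed_lsi:
  assumes A: "A \<in> group_vN" and B: "B \<in> group_vN" and Y: "Y \<in> fin_vN" and a: "0 < a" and n: "0 < n"
    and nA: "(norm (A vac))^2 = n" and nB: "(norm (adj B vac))^2 = n"
    and lsi: "!!k. phi (k *\<^sub>R Y) (%u. u * ln u) - (norm ((k *\<^sub>R Y) vac))^2 * ln ((norm ((k *\<^sub>R Y) vac))^2)
      <= 2 * lform len (k *\<^sub>R Y) (k *\<^sub>R Y)"
  shows "spf (mixed A B) (Y vac) (%u. ln (u + a)) <= (norm (Y vac))^2 * (ln n + 2 * a / n) + 2 * lform len Y Y"
proof (cases "Y vac = 0")
  case True
  thus ?thesis by (simp add: spf_def lform_nonneg_len)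
next
  case False
  let ?N = "(norm (Y vac))^2"
  have N: "?N > 0" using False by simp
  \<comment> \<open>This factor gives \<open>Z\<close> the squared norm \<open>n\<close>.\<close>
  define k where "k = sqrt (n / ?N)"
  have k2: "k^2 = n / ?N" using n N by (simp add: k_def)
  define Z where "Z = k *\<^sub>R Y"
  have Z: "Z \<in> group_vN" using Y by (auto simp: Z_def intro: vN_scaleR)
  have nZ: "(norm (Z vac))^2 = n" using k2 N by (simp add: Z_def blinfun.scaleR_left power_mult_distrib)
  have c1: "cont0 (%y. y / (y + a))" using a by (intro cont0_divide continuous_on_id)
  have le1: "spf T v (%y. y / (y + a)) <= (norm v)^2" if T: "pos_op T" for T :: "'a free_group op" and v
  proof -
    have "spf T v (%y. y / (y + a)) <= spf T v (%_. 1)"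
      using a by (intro spf_mono T c1 continuous_on_const) (simp add: divide_le_eq)
    thus ?thesis using T by (simp add: spf_const)
  qed
  have "k^2 * spf (mixed A B) (Y vac) (%u. ln (u + a)) = spf (mixed A B) (Z vac) (%u. ln (u + a))"
    by (simp add: Z_def blinfun.scaleR_left spf_scaleR_vec)
  also have "... <= phi Z (%y. y * ln (y + a) - y^2 / (y + a)) + 1 / 2 * n + 1 / 2 * n"
    using log_mixed[OF A B Z a] le1[OF vN_pos_self2[OF Z], of "A vac"] le1[OF vN_pos_self[OF Z], of "adj B vac"]
    unfolding nA nB by linarith
  also have "phi Z (%y. y * ln (y + a) - y^2 / (y + a)) <= phi Z (%y. y * ln y + (2 * a - y))"
  proof (rule phi_mono[OF Z])
    show "cont0 (%y. y * ln (y + a) - y^2 / (y + a))" using a by (intro continuous_intros) auto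
    show "cont0 (%y. y * ln y + (2 * a - y))" by (intro continuous_on_add cont0_xlnx continuous_intros)
    fix y :: real assume y: "0 <= y"
    have "y * ln (y + a) <= y * ln y + a"
    proof (cases "y = 0")
      case False
      have "ln ((y + a) / y) <= (y + a) / y - 1" using y a False by (intro ln_le_minus_one) auto
      hence "y * (ln (y + a) - ln y) <= y * ((y + a) / y - 1)" using y a False by (intro mult_left_mono) (auto simp: ln_div)
      also have "... = a" using False by (simp add: field_simps)
      finally show ?thesis by (simp add: algebra_simps)
    qed (use a in simp)
    moreover have "y - a <= y^2 / (y + a)" using y a by (simp add: le_divide_eq power2_eq_square algebra_simps)
    ultimately show "y * ln (y + a) - y^2 / (y + a) <= y * ln y + (2 * a - y)" by linarith
  qed
  also have "... = phi Z (%y. y * ln y) + (2 * a - n)"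
  proof -
    have "phi Z (%y. y * ln y + (2 * a - y)) = phi Z (%y. y * ln y) + phi Z (%y. 2 * a - y)"
      by (intro phi_add Z cont0_xlnx continuous_intros)
    also have "phi Z (%y. 2 * a - y) = phi Z (%y. 2 * a) - phi Z (%y. y)"
      by (intro phi_diff Z continuous_intros)
    finally show ?thesis using Z by (simp add: phi_const phi_id nZ)
  qed
  also have "phi Z (%y. y * ln y) <= n * ln n + 2 * (k^2 * lform len Y Y)"
    using lsi[of k] nZ by (simp add: Z_def[symmetric]) (simp add: Z_def lform_scaleR_self Y)
  finally have "k^2 * spf (mixed A B) (Y vac) (%u. ln (u + a)) <= n * ln n + 2 * a + 2 * (k^2 * lform len Y Y)"
    by simp
  hence "spf (mixed A B) (Y vac) (%u. ln (u + a)) <= (n * ln n + 2 * a + 2 * (k^2 * lform len Y Y)) / k^2"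
    using k2 n N by (subst pos_le_divide_eq) (simp_all add: mult.commute)
  also have "... = ?N * (ln n + 2 * a / n) + 2 * lform len Y Y" using n N by (simp add: k2 field_simps)
  finally show ?thesis .
qed

text \<open>The generators are indexed by \<open>nat\<close> because derivations enlarge the
  generating set; with infinitely many generators the induction on \<open>d\<close> stays within one
  type.\<close>

definition lsi_upto :: "nat => bool" where
  "lsi_upto d \<longleftrightarrow> (\<forall>z :: nat free_group op. z \<in> fin_vN --> (\<forall>g\<in>supp z. word_length g <= d) -->
     phi z (%u. u * ln u) - (norm (z vac))^2 * ln ((norm (z vac))^2) <= 2 * lform len z z)"

lemma hom_norm:
  assumes "x \<in> fin_vN"
  shows "norm (lext hom1 x vac) = norm (x vac)"
    "cmod w = 1 ==> norm (lext (hom2 i w) x vac) = norm (x vac)"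
proof -
  have id: "cont0 (%s. s)" by (rule continuous_on_id)
  have "(norm (lext hom1 x vac))^2 = (norm (x vac))^2"
    using lext_hom_phi(1)[OF assms id] assms by (simp add: phi_id lext_vN hom_vN fin_vN)
  thus "norm (lext hom1 x vac) = norm (x vac)" by (simp add: power2_eq_iff_nonneg)
  assume "cmod w = 1"
  hence "(norm (lext (hom2 i w) x vac))^2 = (norm (x vac))^2"
    using lext_hom_phi(2)[OF assms id] assms by (simp add: phi_id lext_vN hom_vN fin_vN)
  thus "norm (lext (hom2 i w) x vac) = norm (x vac)" by (simp add: power2_eq_iff_nonneg)
qed

lemma supp_adj: "x \<in> group_vN ==> g \<in> supp (adj x) \<longleftrightarrow> inverse g \<in> supp x"
  by (simp add: supp_def coef_adj)

lemma adj_odd: "x \<in> group_vN ==> adj (x oL pev r (adj x oL x)) = adj x oL pev r (x oL adj x)"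
proof -
  assume x: "x \<in> group_vN"
  have "adj (x oL pev r (adj x oL x)) = pev r (adj x oL x) oL adj x"
    using x by (simp add: adj_compose vN_bounded vN_pev vN_self adj_sym sym_op_pev pos_op_sym vN_pos_self)
  also have "... = adj x oL pev r (x oL adj x)" by (rule pev_intertwine) (simp add: compose_assoc)
  finally show ?thesis .
qed

lemma avg_setup:
  fixes x z :: "nat free_group op"
  assumes x: "x \<in> fin_vN" and z: "z \<in> fin_vN"
  obtains S I N where "finite S" "supp x \<subseteq> S" "supp z \<subseteq> S" "supp (adj x) \<subseteq> S" "supp (adj z) \<subseteq> S"
    "finite I" "!!g. g \<in> S ==> 2 * word_length g < N" "!!g. g \<in> S ==> fst ` set (word_of g) \<subseteq> I"
proof -
  define S where "S = supp x \<union> supp z \<union> supp (adj x) \<union> supp (adj z)"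
  have S: "finite S" unfolding S_def using x z by (auto intro: finite_supp fin_adj)
  have "2 * word_length g < Suc (2 * Max (word_length ` S))" if "g \<in> S" for g
    using Max_ge[of "word_length ` S" "word_length g"] S that by (simp add: less_Suc_eq_le)
  moreover have "fst ` set (word_of g) \<subseteq> (\<Union>g\<in>S. fst ` set (word_of g))" if "g \<in> S" for g using that by auto
  ultimately show ?thesis using S by (intro that[of S "\<Union>g\<in>S. fst ` set (word_of g)"]) (auto simp: S_def)
qed

definition avg :: "nat set => nat => (nat => complex => real) => real" where
  "avg I N F = (\<Sum>i\<in>I. (\<Sum>k<N. F i (uroot N k)) / real N)"

lemma avg_add: "avg I N (%i w. F i w + G i w) = avg I N F + avg I N G"
  by (simp add: avg_def sum.distrib add_divide_distrib)

lemma avg_scale: "avg I N (%i w. c * F i w) = c * avg I N F"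
  unfolding avg_def sum_distrib_left[symmetric] times_divide_eq_right[symmetric] by simp

lemma avg_mono: "(!!i w. cmod w = 1 ==> F i w <= G i w) ==> avg I N F <= avg I N G"
  unfolding avg_def by (intro sum_mono divide_right_mono) auto

text \<open>Up to approximation the left side is the Dirichlet form of x ln(\<bar>x\<bar>^2 + a) and
  \<open>x\<close>, an average of pairings of derivatives. The chain rule and
  \<open>log_difference_quotient\<close> bound these by ln(mixed) + 2, and
  \<open>log_mixed_lsi\<close> applies to derivatives, whose degree is at most \<open>d\<close>. On
  average 2 times the form of the derivatives costs at most twice the squared generator form minus
  twice the Dirichlet form; the latter cancels the + 2.\<close>

lemma lsi_step:
  fixes x :: "nat free_group op"
  assumes lsi: "lsi_upto d" and x: "x \<in> fin_vN" and d: "!!g. g \<in> supp x ==> word_length g <= Suc d" and a: "0 < a"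
    and n: "n = (norm (x vac))^2" "0 < n"
  shows "inner (num_op x vac) ((x oL pos_calc (%u. ln (u + a)) (adj x oL x)) vac)
    <= 2 * lform (%g. len g * len g) x x + (ln n + 2 * a / n) * lform len x x"
    (is "?lhs <= ?rhs")
proof -
  let ?E = "lform len x x"
  define K where "K = 3 * ?E + norm (num_op x vac) * norm x"
  have K0: "0 <= K" unfolding K_def using lform_nonneg_len[of x] by simp
  have main: "?lhs <= ?rhs + e * K" if e: "0 < e" for e
  proof -
    \<comment> \<open>Large enough for the norms of both matrix multiplications and for the singular
      values of \<open>x\<close>, and positive.\<close>
    define c where "c = 4 * l1norm x + sqrt (norm (adj x oL x)) + 1"
    have c: "4 * l1norm x <= c" "0 < c" "l1norm x <= c" "sqrt (norm (adj x oL x)) <= c"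
      unfolding c_def using l1norm_nonneg[of x] real_sqrt_ge_zero[OF norm_ge_zero[of "adj x oL x"]] by linarith+
    define G where "G = (%u. ln (u + a) + 2 * u / (u + a))"
    define h where "h = (%t. t * ln (t^2 + a))"
    have pos: "t^2 + a > 0" for t using a by (simp add: add_nonneg_pos)
    have G: "cont0 G" unfolding G_def using a by (intro continuous_intros) auto
    have hd: "(h has_real_derivative G (t^2)) (at t)" for t
      unfolding h_def G_def using pos[of t] by (auto intro!: derivative_eq_intros simp: power2_eq_square)
    obtain r where r: "!!s t. \<bar>s\<bar> <= c ==> \<bar>t\<bar> <= c ==> s ~= t ==> \<bar>dd r s t - (h s - h t) / (s - t)\<bar> <= e"
      "!!s. \<bar>s\<bar> <= c ==> \<bar>dd r s s - G (s^2)\<bar> <= e"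
      "!!s. 0 < s ==> s <= c ==> \<bar>poly r (s^2) - h s / s\<bar> <= e"
      "\<bar>poly r 0 - G 0\<bar> <= e" using odd_approx[OF G hd _ e, of c] c by (auto simp: h_def)
    have ru: "\<bar>poly r u - ln (u + a)\<bar> <= e" if "0 <= u" "u <= norm (adj x oL x)" for u
    proof (cases "u = 0")
      case False
      hence "0 < sqrt u" "sqrt u <= c" using that c(4) by (auto intro: order_trans[OF real_sqrt_le_mono])
      from r(3)[OF this] show ?thesis using that False by (simp add: h_def)
    qed (use r(4) in \<open>simp add: G_def\<close>)
    \<comment> \<open>The target carries 2e of slack: one e absorbs the error of \<open>r\<close> in
      the divided difference, the other the error of \<open>U\<close> itself. Hence \<open>U\<close>
      dominates \<open>dd r\<close> and exceeds ln(u + a) + 2 by at most 3e.\<close>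
    have "continuous_on {0..c^2} (%u. ln (u + a) + (2 + 2 * e))"
      by (intro cont0_Icc continuous_on_add cont0_ln a continuous_on_const)
    from poly_approx[OF this e] obtain U where U: "!!u. 0 <= u ==> u <= c^2 ==> \<bar>poly U u - (ln (u + a) + (2 + 2 * e))\<bar> <= e" by blast
    have dU: "dd r s t <= poly U ((s^2 + t^2) / 2)" if st: "\<bar>s\<bar> <= c" "\<bar>t\<bar> <= c" for s t
    proof -
      have "s^2 <= c^2" "t^2 <= c^2" using st by (simp_all add: abs_le_square_iff[symmetric])
      hence m: "0 <= (s^2 + t^2) / 2" "(s^2 + t^2) / 2 <= c^2" by simp_all
      have "dd r s t <= ln ((s^2 + t^2) / 2 + a) + 2 + e"
      proof (cases "s = t")
        case True
        have "2 * s^2 / (s^2 + a) <= 2" using pos[of s] a by (simp add: divide_le_eq)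
        thus ?thesis using r(2)[OF st(1)] True by (simp add: G_def abs_le_iff)
      next
        case False
        show ?thesis using r(1)[OF st False] log_difference_quotient[OF a False] by (simp add: h_def abs_le_iff)
      qed
      thus ?thesis using U[OF m] unfolding abs_le_iff by linarith
    qed
    define z where "z = x oL pev r (adj x oL x)"
    have z: "z \<in> fin_vN" unfolding z_def using x by (intro fin_compose fin_pev fin_self)
    have az: "adj z = adj x oL pev r (x oL adj x)" unfolding z_def using x by (intro adj_odd) auto
    obtain S I N where S: "finite S" "supp x \<subseteq> S" "supp z \<subseteq> S" "supp (adj x) \<subseteq> S" "supp (adj z) \<subseteq> S"
      and I: "finite I" and N: "!!g. g \<in> S ==> 2 * word_length g < N"
      and gI: "!!g. g \<in> S ==> fst ` set (word_of g) \<subseteq> I" using avg_setup[OF x z] by metis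
    note fa = fin_adj[OF x] fin_adj[OF z]
    let ?nn = "%x i w. (norm (deriv_x i w x vac))^2"
    let ?ee = "%x i w. lform len (deriv_x i w x) (deriv_x i w x)"
    have nn: "avg I N (?nn v) = lform len v v" if "supp v \<subseteq> S" "v \<in> fin_vN" for v
      using avg_inner[OF S(1) that(1,1) that(2) N I gI] by (simp add: avg_def dot_square_norm)
    have ee: "avg I N (?ee v) <= lform (%g. len g * len g) v v - lform len v v" if "supp v \<subseteq> S" for v
    proof -
      have "lform (%g. len g * (len g - 1)) v v = lform (%g. len g * len g) v v - lform len v v"
        by (simp add: lform_def sum_subtractf algebra_simps)
      thus ?thesis using avg_len_le[OF S(1) that N I gI] by (simp add: avg_def)
    qed
    have xa: "lform c (adj x) (adj x) = lform c x x" if "!!g. c (inverse g) = c g" for c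
      by (rule lform_adj[where c = c, OF x x that])
    define k where "k = ln n + 2 * a / n + 2 + 3 * e"
    \<comment> \<open>The adjoints are included because the chain rule treats \<open>x\<close> and
      \<open>adj x\<close> together, as entries of one matrix.\<close>
    have "2 * lform len z x = lform len z x + lform len (adj z) (adj x)" using lform_adj[OF z x, of len] by simp
    also have "... = avg I N (%i w. inner (deriv_x i w z vac) (deriv_x i w x vac)
      + inner (deriv_x i w (adj z) vac) (deriv_x i w (adj x) vac))"
      using avg_inner[OF S(1,2,3) z N I gI] avg_inner[OF S(1,4,5) fa(2) N I gI] by (simp add: avg_add) (simp add: avg_def)
    also have "... <= avg I N (%i w. k * ?nn x i w + 2 * ?ee x i w + (k * ?nn (adj x) i w + 2 * ?ee (adj x) i w))"
    proof (rule avg_mono)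
      fix i w assume w: "cmod w = 1"
      define A where "A = lext hom1 x"
      define B where "B = lext (hom2 i w) x"
      have AB: "A \<in> group_vN" "B \<in> group_vN" by (simp_all add: A_def B_def lext_hom_vN[OF w])
      have nA: "norm A <= c" "norm B <= c" "norm (adj A) <= c" "norm (adj B) <= c"
        using norm_lext_le[of hom1 x] norm_lext_le[of "hom2 i w" x] norm_hom_le w c(3)
          norm_adj_le[OF vN_bounded[OF AB(1)]] norm_adj_le[OF vN_bounded[OF AB(2)]] by (auto simp: A_def B_def)
      have nv: "(norm (A vac))^2 = n" "(norm (B vac))^2 = n"
        "(norm (adj A vac))^2 = n" "(norm (adj B vac))^2 = n"
        using AB hom_norm[OF x] w by (simp_all add: vN_trace_norm) (simp_all add: A_def B_def n)
      have one: "inner (pev U (mixed P Q) (deriv_x i w v vac)) (deriv_x i w v vac) <= k * ?nn v i w + 2 * ?ee v i w"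
        if P: "P \<in> group_vN" "norm P <= c" "(norm (P vac))^2 = n"
          and Q: "Q \<in> group_vN" "norm Q <= c" "(norm (adj Q vac))^2 = n"
          and v: "v \<in> fin_vN" "!!g. g \<in> supp v ==> word_length g <= Suc d" for P Q v
      proof -
        let ?S = "mixed P Q" and ?Y = "deriv_x i w v"
        have pS: "pos_op ?S" by (rule mixed_pos[OF P(1) Q(1)])
        have nS: "norm ?S <= c^2" by (rule norm_mixed_le) (use P Q vN_bounded in auto)
        have "inner (pev U ?S (?Y vac)) (?Y vac) = spf ?S (?Y vac) (poly U)" by (simp add: spf_def cf_poly pS)
        also have "... <= spf ?S (?Y vac) (%u. ln (u + a) + (2 + 3 * e))"
        proof (rule spf_mono[OF pS cont0_poly])
          show "cont0 (%u. ln (u + a) + (2 + 3 * e))" by (intro continuous_on_add cont0_ln a continuous_on_const)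
          fix s assume "0 <= s" "s <= norm ?S"
          thus "poly U s <= ln (s + a) + (2 + 3 * e)" using U[of s] nS unfolding abs_le_iff by linarith
        qed
        also have "... = spf ?S (?Y vac) (%u. ln (u + a)) + (2 + 3 * e) * (norm (?Y vac))^2"
          by (simp add: spf_add[OF pS cont0_ln[OF a] continuous_on_const] spf_const pS)
        also have "spf ?S (?Y vac) (%u. ln (u + a)) <= (norm (?Y vac))^2 * (ln n + 2 * a / n) + 2 * lform len ?Y ?Y"
        proof (rule log_mixed_lsi[OF P(1) Q(1) deriv_fin a n(2) P(3) Q(3)])
          fix j
          have "word_length g <= d" if "g \<in> supp (j *\<^sub>R ?Y)" for g
            using supp_deriv[OF v, of g i w] that by (auto simp: supp_def coef_scaleR)
          thus "phi (j *\<^sub>R ?Y) (%u. u * ln u) - (norm ((j *\<^sub>R ?Y) vac))^2 * ln ((norm ((j *\<^sub>R ?Y) vac))^2)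
            <= 2 * lform len (j *\<^sub>R ?Y) (j *\<^sub>R ?Y)"
            using lsi fin_scaleR[OF deriv_fin[of i w v], of j] unfolding lsi_upto_def by blast
        qed
        finally show ?thesis by (simp add: k_def algebra_simps)
      qed
      have "inner (deriv_x i w z vac) (deriv_x i w x vac) + inner (deriv_x i w (adj z) vac) (deriv_x i w (adj x) vac)
        <= inner (pev U (mixed A B) (deriv_x i w x vac)) (deriv_x i w x vac)
          + inner (pev U (mixed (adj A) (adj B)) (deriv_x i w (adj x) vac)) (deriv_x i w (adj x) vac)"
        unfolding az unfolding z_def A_def B_def by (rule deriv_bound_mixed[OF w x c(1,2) dU])
      also have "... <= (k * ?nn x i w + 2 * ?ee x i w) + (k * ?nn (adj x) i w + 2 * ?ee (adj x) i w)"
      proof (rule add_mono)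
        show "inner (pev U (mixed A B) (deriv_x i w x vac)) (deriv_x i w x vac) <= k * ?nn x i w + 2 * ?ee x i w"
          by (rule one[OF AB(1) nA(1) nv(1) AB(2) nA(2) nv(4) x d])
        show "inner (pev U (mixed (adj A) (adj B)) (deriv_x i w (adj x) vac)) (deriv_x i w (adj x) vac)
          <= k * ?nn (adj x) i w + 2 * ?ee (adj x) i w"
        proof (rule one[OF vN_adj[OF AB(1)] nA(3) nv(3) vN_adj[OF AB(2)] nA(4) _ fa(1)])
          show "(norm (adj (adj B) vac))^2 = n" using AB nv by (simp add: adj_adj vN_bounded)
          fix g assume "g \<in> supp (adj x)"
          thus "word_length g <= Suc d" using d[of "inverse g"] x by (simp add: supp_adj fin_vN word_length_inverse)
        qed
      qed
      finally show "inner (deriv_x i w z vac) (deriv_x i w x vac) + inner (deriv_x i w (adj z) vac) (deriv_x i w (adj x) vac)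
        <= k * ?nn x i w + 2 * ?ee x i w + (k * ?nn (adj x) i w + 2 * ?ee (adj x) i w)" .
    qed
    also have "... = k * ?E + 2 * avg I N (?ee x) + (k * ?E + 2 * avg I N (?ee (adj x)))"
      unfolding avg_add avg_scale nn[OF S(2) x] nn[OF S(4) fa(1)] by (simp add: xa)
    also have "... <= 2 * (k * ?E + 2 * (lform (%g. len g * len g) x x - ?E))"
      using ee[OF S(2)] ee[OF S(4)] by (simp add: xa)
    finally have 1: "lform len z x <= k * ?E + 2 * (lform (%g. len g * len g) x x - ?E)" by simp
    have k: "k * ?E + 2 * (lform (%g. len g * len g) x x - ?E) = ?rhs + 3 * e * ?E" by (simp add: k_def algebra_simps)
    have 2: "?lhs - lform len z x <= e * (norm (num_op x vac) * norm x)"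
    proof -
      let ?c = "pos_calc (%u. ln (u + a)) (adj x oL x)"
      have px: "pos_op (adj x oL x)" using x by (intro vN_pos_self) auto
      have "lform len z x = inner (num_op x vac) ((x oL pev r (adj x oL x)) vac)"
        using lform_commute[OF z x] lform_num_op[OF x, of z] by (simp add: z_def)
      hence "?lhs - lform len z x = inner (num_op x vac) (x ((?c - pev r (adj x oL x)) vac))"
        by (simp add: inner_diff_right blinfun.diff_left blinfun.diff_right)
      also have "... <= norm (num_op x vac) * norm (x ((?c - pev r (adj x oL x)) vac))" by (rule norm_cauchy_schwarz)
      also have "... <= norm (num_op x vac) * (norm x * e)"
      proof (intro mult_left_mono)
        have "?c - pev r (adj x oL x) = pos_calc (%u. ln (u + a) - poly r u) (adj x oL x)"
          using cf_diff[OF px cont0_ln[OF a] cont0_poly[of r]] by (simp add: cf_poly px)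
        moreover have "norm (pos_calc (%u. ln (u + a) - poly r u) (adj x oL x)) <= e"
          by (rule cf_norm_le[OF px continuous_on_diff[OF cont0_ln[OF a] cont0_poly]]) (use ru in \<open>simp add: abs_minus_commute\<close>)
        ultimately have "norm ((?c - pev r (adj x oL x)) vac) <= e"
          using norm_blinfun[of "?c - pev r (adj x oL x)" "delta 1"] by simp
        thus "norm (x ((?c - pev r (adj x oL x)) vac)) <= norm x * e"
          by (rule order_trans[OF norm_blinfun mult_left_mono]) simp
      qed simp
      finally show ?thesis by (simp add: mult_ac)
    qed
    show ?thesis using 1 2 k by (simp add: K_def algebra_simps)
  qed
  show ?thesis
  proof (rule field_le_epsilon)
    fix e :: real assume e: "0 < e"
    have "?lhs <= ?rhs + e / (K + 1) * K" using e K0 by (intro main) simp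
    also have "e / (K + 1) * K <= e" using e K0 by (simp add: divide_le_eq algebra_simps)
    finally show "?lhs <= ?rhs + e" by simp
  qed
qed

section \<open>The flow and the induction for the logarithmic Sobolev inequality\<close>

subsection \<open>The flow on elements of finite support\<close>

text \<open>The Poisson semigroup at time -ln s. The multiplicative parameter makes the flow
  polynomial in \<open>s\<close> and brings the projection to the scalars, s = 0, to a finite
  endpoint.\<close>

definition flow :: "real => 'a free_group op => 'a free_group op" where
  "flow s = lext (%g. (s ^ word_length g) *\<^sub>R lreg g)"

definition flow' :: "real => 'a free_group op => 'a free_group op" where
  "flow' s = lext (%g. (real (word_length g) * s ^ (word_length g - 1)) *\<^sub>R lreg g)"

lemma flow_fin: "flow s x \<in> fin_vN" "flow' s x \<in> fin_vN"
  unfolding flow_def flow'_def by (intro lext_fin fin_scaleR fin_lreg1)+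

lemma coef_lext_diag:
  assumes x: "x \<in> fin_vN"
  shows "coef (lext (%g. c g *\<^sub>R lreg g) x) g = of_real (c g) * coef x g"
proof -
  have "coef (lext (%g. c g *\<^sub>R lreg g) x) g = (\<Sum>h\<in>supp x. if h = g then of_real (c g) * coef x g else 0)"
    unfolding coef_lext by (intro sum.cong) (auto simp: coef_scaleR coef_lreg)
  also have "... = of_real (c g) * coef x g" using finite_supp[OF x] by (auto simp: supp_def)
  finally show ?thesis .
qed

lemma coef_flow:
  "x \<in> fin_vN ==> coef (flow s x) g = of_real (s ^ word_length g) * coef x g"
  "x \<in> fin_vN ==> coef (flow' s x) g = of_real (real (word_length g) * s ^ (word_length g - 1)) * coef x g"
  by (simp_all only: flow_def flow'_def coef_lext_diag)

lemma adj_diag: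
  assumes x: "x \<in> fin_vN" and c: "!!g. c (inverse g) = c g"
  shows "adj (lext (%g. c g *\<^sub>R lreg g) x) = lext (%g. c g *\<^sub>R lreg g) (adj x)"
proof -
  have "lext (%g. c g *\<^sub>R lreg g) y \<in> group_vN" for y by (intro lext_vN vN_scaleR vN_lreg)
  thus ?thesis by (intro vN_eqI_coef) (simp_all add: vN_adj coef_adj coef_lext_diag x fin_adj fin_vN c)
qed

lemma adj_flow: "x \<in> fin_vN ==> adj (flow s x) = flow s (adj x)" "x \<in> fin_vN ==> adj (flow' s x) = flow' s (adj x)"
  unfolding flow_def flow'_def by (intro adj_diag; simp add: word_length_inverse)+

lemma flow_1 [simp]: "x \<in> fin_vN ==> flow 1 x = x" by (rule vN_eqI_coef) (simp_all add: flow_fin fin_vN coef_flow)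

lemma flow_0: "x \<in> fin_vN ==> flow 0 x = scaleC_op (coef x 1) id_blinfun"
  for x :: "'a free_group op"
proof (rule vN_eqI_coef)
  fix g :: "'a free_group" assume x: "x \<in> fin_vN"
  have "word_length g = 0 \<longleftrightarrow> g = 1"
    by (simp add: word_length_word_of word_of_inject[symmetric] one_free_group.rep_eq)
  moreover have "coef id_blinfun g = (if g = 1 then 1 else 0)" using coef_lreg[of 1 g] by simp
  ultimately show "coef (flow 0 x) g = coef (scaleC_op (coef x 1) id_blinfun) g"
    using x by (auto simp: coef_flow coef_scaleC power_0_left)
qed (simp_all add: flow_fin fin_vN vN_scaleC vN_id)

lemma flow_num: "x \<in> fin_vN ==> s *\<^sub>R flow' s x = num_op (flow s x)"
  for x :: "'a free_group op"
proof (rule vN_eqI_coef)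
  fix g :: "'a free_group" assume x: "x \<in> fin_vN"
  have "s * (real n * s ^ (n - 1)) = real n * s ^ n" for n by (cases n) auto
  hence "complex_of_real s * of_real (real (word_length g) * s ^ (word_length g - 1)) = of_real (len g * s ^ word_length g)"
    by (simp only: of_real_mult[symmetric] len_def)
  thus "coef (s *\<^sub>R flow' s x) g = coef (num_op (flow s x)) g"
    using x by (simp only: coef_scaleR coef_flow coef_num_op flow_fin mult.assoc[symmetric] of_real_mult)
qed (simp_all add: flow_fin fin_vN vN_scaleR num_op_fin)

lemma scaleC_op_scaleR: "scaleC_op c (r *\<^sub>R T) = r *\<^sub>R scaleC_op c T"
  by (rule blinfun_eqI) (simp add: scaleC_op_apply blinfun.scaleR_left scaleC_linear)

lemma flow_deriv: "((%s. flow s x) has_vector_derivative flow' s x) (at s within T)"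
proof -
  have d: "((%s. s ^ n) has_vector_derivative (real n * s ^ (n - 1))) (at s within T)" for n
    unfolding has_real_derivative_iff_has_vector_derivative[symmetric] by (auto intro!: derivative_eq_intros)
  show ?thesis unfolding flow_def flow'_def lext_def scaleC_op_scaleR
    by (intro has_vector_derivative_sum bounded_linear.has_vector_derivative[OF bounded_linear_scaleR_left d])
qed

lemma has_vector_derivative_compose_op:
  fixes S U :: "real => 'a op"
  assumes "(S has_vector_derivative S') (at s within A)" "(U has_vector_derivative U') (at s within A)"
  shows "((%s. S s oL U s) has_vector_derivative (S s oL U') + (S' oL U s)) (at s within A)"
  using bounded_bilinear.has_vector_derivative[OF bounded_bilinear_blinfun_compose assms] .

lemma bounded_linear_tr: "bounded_linear tr" unfolding tr_def
  by (intro bounded_linear_compose[OF bounded_linear_inner_left] blinfun.bounded_linear_left)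

text \<open>\<open>D\<close> itself is not r'(a) a', as \<open>a\<close> and a' need not commute;
  only under the trace against polynomials in \<open>a\<close> can the factors be reordered. The
  arbitrary polynomial \<open>q\<close> makes the induction go through.\<close>

lemma pev_deriv_trace:
  fixes a :: "real => 'a free_group op"
  assumes a: "(a has_vector_derivative a') (at s within T)" and v: "a s \<in> group_vN" "a' \<in> group_vN"
  shows "\<exists>D. ((%s. pev r (a s)) has_vector_derivative D) (at s within T) & D \<in> group_vN &
    (\<forall>q. tr (pev q (a s) oL D) = tr (pev (q * pderiv r) (a s) oL a'))"
proof (induction r)
  case 0
  show ?case by (intro exI[of _ 0]) (simp add: vN_0 tr_def)
next
  case (pCons c r)
  then obtain D where D: "((%s. pev r (a s)) has_vector_derivative D) (at s within T)" "D \<in> group_vN"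
    "!!q. tr (pev q (a s) oL D) = tr (pev (q * pderiv r) (a s) oL a')" by blast
  let ?D = "(a s oL D) + (a' oL pev r (a s))"
  have 1: "((%s. pev (pCons c r) (a s)) has_vector_derivative ?D) (at s within T)" unfolding pev_pCons
    using has_vector_derivative_add[OF has_vector_derivative_const has_vector_derivative_compose_op[OF a D(1)]] by simp
  have 2: "?D \<in> group_vN" by (intro vN_add vN_compose vN_pev v D(2))
  have tadd: "tr (x + y) = tr x + tr y" for x y :: "'a free_group op"
    using bounded_linear_tr by (rule bounded_linear.linear[THEN linear_add])
  have "tr (pev q (a s) oL ?D) = tr (pev (q * pderiv (pCons c r)) (a s) oL a')" for q
  proof -
    have "pev q (a s) oL (a s oL D) = pev (q * [:0, 1:]) (a s) oL D" by (simp only: pev_mult pev_X compose_assoc)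
    hence A: "tr (pev q (a s) oL (a s oL D)) = tr (pev (q * [:0, 1:] * pderiv r) (a s) oL a')" using D(3) by simp
    have "tr (pev q (a s) oL (a' oL pev r (a s))) = tr (pev r (a s) oL (pev q (a s) oL a'))"
      using tr_commute[of "pev q (a s) oL a'" "pev r (a s)"] v by (simp add: vN_compose vN_pev compose_assoc)
    also have "pev r (a s) oL (pev q (a s) oL a') = pev (q * r) (a s) oL a'"
      by (simp add: pev_mult[symmetric] compose_assoc[symmetric] mult.commute)
    finally have B: "tr (pev q (a s) oL (a' oL pev r (a s))) = tr (pev (q * r) (a s) oL a')" .
    have "q * pderiv (pCons c r) = q * [:0, 1:] * pderiv r + q * r" by (simp add: pderiv_pCons algebra_simps)
    thus ?thesis by (simp only: compose_linear tadd A B pev_add)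
  qed
  thus ?case using 1 2 by blast
qed

lemma phi_flow_deriv_poly:
  fixes x :: "'a free_group op"
  assumes x: "x \<in> fin_vN" and s: "s ~= 0"
  defines "y \<equiv> flow s x"
  shows "((%s. phi (flow s x) (poly F)) has_real_derivative
    2 / s * inner (num_op y vac) ((y oL pev (pderiv F) (adj y oL y)) vac)) (at s within T)"
proof -
  let ?a = "%s. flow s (adj x) oL flow s x"
  let ?y' = "flow' s x"
  define a' where "a' = (flow s (adj x) oL ?y') + (flow' s (adj x) oL y)"
  have yv: "y \<in> group_vN" "?y' \<in> group_vN" "adj y \<in> group_vN" "adj ?y' \<in> group_vN"
    unfolding y_def by (auto intro: vN_adj flow_fin)
  have ay: "flow s (adj x) = adj y" "flow' s (adj x) = adj ?y'" using x by (simp_all add: y_def adj_flow)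
  have a'v: "a' \<in> group_vN" unfolding a'_def ay by (intro vN_add vN_compose yv)
  have "(?a has_vector_derivative a') (at s within T)"
    unfolding a'_def y_def by (intro has_vector_derivative_compose_op flow_deriv)
  moreover have "?a s \<in> group_vN" unfolding ay y_def[symmetric] by (intro vN_compose yv)
  ultimately obtain D where D: "((%s. pev F (?a s)) has_vector_derivative D) (at s within T)"
    and Dq: "\<forall>q. tr (pev q (?a s) oL D) = tr (pev (q * pderiv F) (?a s) oL a')"
    using pev_deriv_trace[OF _ _ a'v, of ?a s T F] by blast
  have "((%s. tr (pev F (?a s))) has_vector_derivative tr D) (at s within T)"
    by (rule bounded_linear.has_vector_derivative[OF bounded_linear_tr D])
  moreover have "phi (flow s x) (poly F) = tr (pev F (?a s))" for s
    using x flow_fin[of s x] by (simp add: phi_poly adj_flow fin_vN)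
  moreover have "tr D = 2 / s * inner (num_op y vac) ((y oL pev (pderiv F) (adj y oL y)) vac)"
  proof -
    let ?P = "pev (pderiv F) (adj y oL y)"
    have P: "?P \<in> group_vN" by (intro vN_pev vN_compose yv)
    have P': "adj ?P = ?P" by (rule adj_sym[OF vN_bounded[OF P] sym_op_pev[OF pos_op_sym[OF vN_pos_self[OF yv(1)]]]])
    have tadd: "tr (u + v) = tr u + tr v" for u v :: "'a free_group op"
      using bounded_linear_tr by (rule bounded_linear.linear[THEN linear_add])
    have "tr D = tr (?P oL a')" using spec[OF Dq, of 1] by (simp add: ay y_def[symmetric])
    also have "... = tr (?P oL (adj y oL ?y')) + tr (?P oL (adj ?y' oL y))" by (simp add: a'_def ay compose_linear tadd)
    also have "?P oL (adj y oL ?y') = adj (y oL ?P) oL ?y'" using yv P P' by (simp add: adj_compose vN_bounded compose_assoc)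
    also have "tr ... = inner (?y' vac) ((y oL ?P) vac)" by (intro tr_adj_compose vN_compose yv P)
    also have "tr (?P oL (adj ?y' oL y)) = tr (adj ?y' oL (y oL ?P))"
      using tr_commute[of ?P "adj ?y' oL y"] yv P by (simp add: vN_compose compose_assoc)
    also have "... = inner ((y oL ?P) vac) (?y' vac)" by (intro tr_adj_compose yv)
    finally have "tr D = 2 * inner (?y' vac) ((y oL ?P) vac)" by (simp add: inner_commute)
    also have "?y' = (1 / s) *\<^sub>R num_op y" using flow_num[OF x, of s] s by (simp add: y_def flip: flow_num[OF x])
    finally show ?thesis by (simp add: blinfun.scaleR_left)
  qed
  ultimately show ?thesis by (simp add: has_real_derivative_iff_has_vector_derivative)
qed

lemma norm_flow_le:
  assumes "\<bar>s\<bar> <= 1"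
  shows "norm (flow s x) <= l1norm x" unfolding flow_def
proof (rule norm_lext_le)
  fix g :: "'a free_group"
  have "\<bar>s ^ word_length g\<bar> * norm (lreg g) <= 1 * 1"
    using assms norm_lreg_le[of g] by (intro mult_mono) (auto simp: power_abs power_le_one)
  thus "norm ((s ^ word_length g) *\<^sub>R lreg g) <= 1" by simp
qed

lemma norm_flow_sq_le:
  assumes "\<bar>s\<bar> <= 1"
  shows "norm (adj (flow s x) oL flow s x) <= (l1norm x)^2"
proof -
  have "norm (adj (flow s x) oL flow s x) <= norm (adj (flow s x)) * norm (flow s x)" by (rule norm_blinfun_compose)
  also have "... <= l1norm x * l1norm x"
    using norm_flow_le[OF assms, of x] norm_adj_le[OF vN_bounded[OF fin_vN[OF flow_fin(1)]], of s x] l1norm_nonneg[of x]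
    by (intro mult_mono) auto
  finally show ?thesis by (simp add: power2_eq_square)
qed

lemma phi_flow_continuous:
  assumes x: "x \<in> fin_vN" and F: "cont0 F"
  shows "continuous_on {0..1} (%s. phi (flow s x) F)"
proof -
  obtain r where r: "approx_seq ((l1norm x)^2) F r" using approx_seq_ex[OF F] by blast
  have "uniform_limit {0..1} (%k s. phi (flow s x) (poly (r k))) (%s. phi (flow s x) F) sequentially"
  proof (rule uniform_limitI)
    fix e :: real assume e: "e > 0"
    have "\<forall>\<^sub>F k in sequentially. \<forall>u\<in>{0..(l1norm x)\<^sup>2}. \<bar>poly (r k) u - F u\<bar> <= e / 2"
      by (rule approx_seqD[OF r]) (use e in simp)
    thus "\<forall>\<^sub>F k in sequentially. \<forall>s\<in>{0..1}. dist (phi (flow s x) (poly (r k))) (phi (flow s x) F) < e"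
    proof eventually_elim
      case (elim k)
      show ?case
      proof
        fix s :: real assume s: "s \<in> {0..1}"
        have "\<bar>phi (flow s x) (poly (r k)) - phi (flow s x) F\<bar> <= e / 2"
        proof (rule phi_close[OF fin_vN[OF flow_fin(1)] cont0_poly F])
          fix u assume "0 <= u" "u <= norm (adj (flow s x) oL flow s x)"
          thus "\<bar>poly (r k) u - F u\<bar> <= e / 2" using elim norm_flow_sq_le[of s x] s by auto
        qed
        thus "dist (phi (flow s x) (poly (r k))) (phi (flow s x) F) < e" using e by (simp add: dist_real_def)
      qed
    qed
  qed
  moreover have "continuous_on {0..1} (%s. phi (flow s x) (poly p))" for p
  proof -
    have "continuous_on {0..1} (%s. tr (pev p (flow s (adj x) oL flow s x)))"
    proof -
      have c: "continuous_on {0..1} (%s. flow s y)" for y :: "'a free_group op"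
        unfolding continuous_on_eq_continuous_within using flow_deriv has_vector_derivative_continuous by blast
      have "continuous_on {0..1} (%s. pev p (flow s (adj x) oL flow s x))"
      proof (induction p)
        case (pCons a p)
        show ?case unfolding pev_pCons by (intro continuous_on_add continuous_on_const
              bounded_bilinear.continuous_on[OF bounded_bilinear_blinfun_compose] c pCons)
      qed simp
      thus ?thesis by (rule bounded_linear.continuous_on[OF bounded_linear_tr])
    qed
    thus ?thesis using x by (simp add: phi_poly adj_flow fin_vN flow_fin)
  qed
  ultimately show ?thesis by (intro uniform_limit_theorem[of _ "%k s. phi (flow s x) (poly (r k))" sequentially]) auto
qed

lemma poly_primitive: "\<exists>R :: real poly. pderiv R = r & poly R 0 = c"
proof -
  define R where "R = [:c:] + (\<Sum>k\<le>degree r. monom (coeff r k / (real k + 1)) (Suc k))"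
  have "pderiv (monom (coeff r k / (real k + 1)) (Suc k)) = monom (coeff r k) k" for k by (simp add: pderiv_monom field_simps)
  hence "pderiv R = r" by (simp add: R_def pderiv_add pderiv_sum poly_as_sum_of_monoms pderiv_pCons del: of_nat_Suc)
  moreover have "poly R 0 = c" by (simp add: R_def poly_sum poly_monom)
  ultimately show ?thesis by blast
qed

text \<open>The derivative \<open>f\<close> of \<open>F\<close> is approximated uniformly by
  polynomials, and their primitives with the value F 0 at 0 then converge to \<open>F\<close>;
  derivatives along the flow converge uniformly on an interval, so the limit may be
  differentiated.\<close>

lemma phi_flow_deriv:
  fixes x :: "'a free_group op"
  assumes x: "x \<in> fin_vN" and f: "cont0 f" and F: "!!u. 0 <= u ==> (F has_real_derivative f u) (at u within {0..})"
    and s: "0 < s" "s < 1"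
  defines "y \<equiv> %s. flow s x"
  shows "((%s. phi (y s) F) has_real_derivative
    2 / s * inner (num_op (y s) vac) ((y s oL pos_calc f (adj (y s) oL y s)) vac)) (at s)"
proof -
  let ?M = "(l1norm x)^2"
  define d where "d = (%f s. 2 / s * inner (num_op (y s) vac) ((y s oL pos_calc f (adj (y s) oL y s)) vac))"
  have cF: "cont0 F" by (rule DERIV_continuous_on) (use F in auto)
  have "\<exists>r. \<forall>u\<in>{0..?M}. \<bar>poly r u - f u\<bar> <= 1 / real (Suc k)" for k
    using poly_approx[OF cont0_Icc[OF f], of "1 / real (Suc k)" ?M] by (metis atLeastAtMost_iff of_nat_0_less_iff zero_less_Suc zero_less_divide_1_iff)
  then obtain r where r: "!!k u. 0 <= u ==> u <= ?M ==> \<bar>poly (r k) u - f u\<bar> <= 1 / real (Suc k)" by (metis atLeastAtMost_iff)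
  have "\<forall>k. \<exists>R. pderiv R = r k & poly R 0 = F 0" using poly_primitive by blast
  from choice[OF this] obtain R where R: "!!k. pderiv (R k) = r k" "!!k. poly (R k) 0 = F 0" by blast
  have RF: "\<bar>poly (R k) u - F u\<bar> <= 1 / real (Suc k) * ?M" if u: "0 <= u" "u <= ?M" for k u
  proof -
    have "norm ((poly (R k) u - F u) - (poly (R k) 0 - F 0)) <= 1 / real (Suc k) * norm (u - 0)"
    proof (rule field_differentiable_bound[of "{0..?M}" "%u. poly (R k) u - F u" "%u. poly (r k) u - f u"])
      fix z assume z: "z \<in> {0..?M}"
      have "(F has_field_derivative f z) (at z within {0..?M})" by (rule has_field_derivative_subset[OF F]) (use z in auto)
      thus "((%u. poly (R k) u - F u) has_field_derivative poly (r k) z - f z) (at z within {0..?M})"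
        using poly_DERIV[of "R k" z] unfolding R by (intro DERIV_diff) (auto intro: has_field_derivative_at_within)
      show "norm (poly (r k) z - f z) <= 1 / real (Suc k)" using r z by simp
    qed (use u in auto)
    also have "1 / real (Suc k) * norm (u - 0) <= 1 / real (Suc k) * ?M" using u by (intro mult_left_mono) auto
    finally show ?thesis by (simp add: R)
  qed
  have yv: "y s \<in> group_vN" for s unfolding y_def using flow_fin by auto
  have lim0: "(%k. 1 / real (Suc k) * c) \<longlonglongrightarrow> 0" for c
    using tendsto_mult_left_zero[OF LIMSEQ_inverse_real_of_nat, of c] by (simp add: inverse_eq_divide)
  have conv: "(%k. phi (y s) (poly (R k))) \<longlonglongrightarrow> phi (y s) F" if s: "0 < s" "s < 1" for s
  proof (rule Lim_null_comparison[where g = "%k. 1 / real (Suc k) * ?M", THEN LIM_zero_cancel, OF _ lim0])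
    have "\<bar>phi (y s) (poly (R k)) - phi (y s) F\<bar> <= 1 / real (Suc k) * ?M" for k
      by (rule phi_close[OF yv cont0_poly cF]) (rule RF, use norm_flow_sq_le[of s x] s in \<open>auto simp: y_def\<close>)
    thus "\<forall>\<^sub>F k in sequentially. norm (phi (y s) (poly (R k)) - phi (y s) F) <= 1 / real (Suc k) * ?M" by simp
  qed
  \<comment> \<open>Staying above s/2 keeps the factor 2/t of the derivative below 4/s.\<close>
  define I where "I = {s / 2<..<1}"
  have I: "open I" "convex I" "s \<in> I" "!!t. t \<in> I ==> 0 < t & t < 1 & s / 2 < t" using s by (auto simp: I_def)
  define B where "B = 4 / s * (l1norm (num_op x) * l1norm x)"
  have dd: "\<bar>d (poly (r k)) t - d f t\<bar> <= 1 / real (Suc k) * B" if t: "t \<in> I" for k t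
  proof -
    have t0: "0 < t" "t < 1" "s / 2 < t" using I(4)[OF t] by auto
    let ?a = "adj (y t) oL y t"
    have a: "pos_op ?a" by (rule vN_pos_self[OF yv])
    have na: "norm ?a <= ?M" using norm_flow_sq_le[of t x] t0 by (simp add: y_def)
    have "pos_calc (poly (r k)) ?a - pos_calc f ?a = pos_calc (%u. poly (r k) u - f u) ?a"
      by (rule cf_diff[OF a cont0_poly f, symmetric])
    hence nd: "norm (pos_calc (poly (r k)) ?a - pos_calc f ?a) <= 1 / real (Suc k)"
      using r na by (auto intro!: cf_norm_le[OF a] continuous_on_diff cont0_poly f)
    have nn: "norm (num_op (y t) vac) <= l1norm (num_op x)"
    proof -
      have "num_op (y t) = flow t (num_op x)"
        by (rule vN_eqI_coef) (simp_all add: y_def x flow_fin num_op_fin fin_vN coef_flow coef_num_op)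
      thus ?thesis using norm_flow_le[of t "num_op x"] t0 norm_blinfun[of "num_op (y t)" "delta 1"] by simp
    qed
    have "d (poly (r k)) t - d f t = 2 / t * inner (num_op (y t) vac) (y t ((pos_calc (poly (r k)) ?a - pos_calc f ?a) vac))"
      by (simp add: d_def blinfun.diff_left blinfun.diff_right inner_diff_right algebra_simps)
    also have "\<bar>...\<bar> <= 2 / t * (norm (num_op (y t) vac) * norm (y t ((pos_calc (poly (r k)) ?a - pos_calc f ?a) vac)))"
      using t0 by (simp add: abs_mult Cauchy_Schwarz_ineq2 divide_right_mono)
    also have "... <= 4 / s * (l1norm (num_op x) * (l1norm x * (1 / real (Suc k))))"
    proof (intro mult_mono)
      show "2 / t <= 4 / s" using t0 s by (simp add: field_simps)
      have "norm (y t ((pos_calc (poly (r k)) ?a - pos_calc f ?a) vac)) <= norm (y t) * norm ((pos_calc (poly (r k)) ?a - pos_calc f ?a) vac)"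
        by (rule norm_blinfun)
      also have "... <= l1norm x * (1 / real (Suc k))"
        using norm_flow_le[of t x] t0 norm_blinfun[of "pos_calc (poly (r k)) ?a - pos_calc f ?a" "delta 1"] nd
        by (intro mult_mono) (auto simp: y_def l1norm_nonneg)
      finally show "norm (y t ((pos_calc (poly (r k)) ?a - pos_calc f ?a) vac)) <= l1norm x * (1 / real (Suc k))" .
    qed (use s nn l1norm_nonneg in auto)
    also have "... = 1 / real (Suc k) * B" by (simp add: B_def mult.commute)
    finally show ?thesis .
  qed
  have pd: "((%s. phi (y s) (poly (R k))) has_derivative (*) (d (poly (r k)) t)) (at t within I)" if t: "t \<in> I" for k t
  proof -
    have "t ~= 0" using I(4)[OF t] by simp
    from phi_flow_deriv_poly[OF x this, of "R k" I]
    have "((%s. phi (y s) (poly (R k))) has_real_derivative d (poly (r k)) t) (at t within I)"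
      unfolding d_def cf_poly[OF vN_pos_self[OF yv]] unfolding R y_def .
    thus ?thesis by (simp only: has_field_derivative_def)
  qed
  have "\<exists>g. \<forall>t\<in>I. (%k. phi (y t) (poly (R k))) \<longlonglongrightarrow> g t & (g has_derivative (*) (d f t)) (at t within I)"
  proof (rule has_derivative_sequence[OF I(2) pd _ I(3) conv[OF s]])
    fix e :: real assume e: "e > 0"
    have "\<forall>\<^sub>F k in sequentially. 1 / real (Suc k) * B < e" using order_tendstoD(2)[OF lim0 e] .
    thus "\<forall>\<^sub>F k in sequentially. \<forall>t\<in>I. \<forall>h. norm (d (poly (r k)) t * h - d f t * h) <= e * norm h"
    proof eventually_elim
      case (elim k)
      show ?case
      proof (intro ballI allI)
        fix t h assume "t \<in> I"
        hence "\<bar>d (poly (r k)) t - d f t\<bar> <= e" using dd[of t k] elim by linarith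
        hence "\<bar>d (poly (r k)) t - d f t\<bar> * \<bar>h\<bar> <= e * \<bar>h\<bar>" by (intro mult_right_mono) auto
        thus "norm (d (poly (r k)) t * h - d f t * h) <= e * norm h" by (simp add: abs_mult[symmetric] left_diff_distrib)
      qed
    qed
  qed
  then obtain g where g: "!!t. t \<in> I ==> (%k. phi (y t) (poly (R k))) \<longlonglongrightarrow> g t"
    "!!t. t \<in> I ==> (g has_derivative (*) (d f t)) (at t within I)" by blast
  have "g t = phi (y t) F" if "t \<in> I" for t using LIMSEQ_unique[OF g(1)[OF that] conv] I(4)[OF that] by blast
  hence "((%t. phi (y t) F) has_derivative (*) (d f s)) (at s within I)"
    by (intro has_derivative_transform[OF I(3) _ g(2)[OF I(3)]]) simp
  thus ?thesis unfolding at_within_open[OF I(3,1)] by (simp only: has_field_derivative_def d_def)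
qed

subsection \<open>The logarithmic Sobolev inequality\<close>

lemma phi_scalar:
  assumes f: "cont0 f"
  shows "phi (scaleC_op c id_blinfun :: 'a free_group op) f = f ((cmod c)^2)"
proof -
  let ?k = "(cmod c)^2" and ?x = "scaleC_op c id_blinfun :: 'a free_group op"
  have "adj ?x oL ?x = scaleC_op (cnj c * c) id_blinfun"
    by (simp add: adj_scaleC bounded_ops_id scaleC_op_simps scaleC_op_compose)
  also have "cnj c * c = of_real ?k" by (simp only: complex_norm_square mult.commute)
  finally have "adj ?x oL ?x = pos_calc (%_. ?k) id_blinfun" unfolding scaleC_op_of_real by (simp add: cf_const)
  hence "phi ?x f = spf (id_blinfun :: 'a free_group op) vac (%_. f ?k)"
    unfolding phi_def spf_def by (simp add: cf_compose f continuous_on_const)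
  thus ?thesis by (simp add: spf_const)
qed

lemma norm_sq_lform: "x \<in> fin_vN ==> (norm (x vac))^2 = lform (%_. 1) x x"
  using inner_lform[of x x] by (simp add: dot_square_norm)

lemma lform_flow:
  assumes x: "x \<in> fin_vN"
  shows "lform c (flow s x) (flow s x) = (\<Sum>g\<in>supp x. c g * (s ^ (2 * word_length g) * (cmod (coef x g))^2))"
proof -
  have "lform c (flow s x) (flow s x) = (\<Sum>g\<in>supp x. c g * Re (coef (flow s x) g * cnj (coef (flow s x) g)))"
    using x by (intro lform_eq finite_supp) (auto simp: supp_def coef_flow)
  also have "... = (\<Sum>g\<in>supp x. c g * (cmod (coef (flow s x) g))^2)"
    by (simp only: complex_norm_square[symmetric] Re_complex_of_real)
  also have "... = (\<Sum>g\<in>supp x. c g * (s ^ (2 * word_length g) * (cmod (coef x g))^2))"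
  proof (intro sum.cong refl)
    fix g
    have "(cmod (of_real r * z))^2 = r^2 * (cmod z)^2" for r z by (simp add: norm_mult power_mult_distrib)
    thus "c g * (cmod (coef (flow s x) g))^2 = c g * (s ^ (2 * word_length g) * (cmod (coef x g))^2)"
      unfolding coef_flow(1)[OF x] by (simp only: power_mult[symmetric] mult.commute[of 2])
  qed
  finally show ?thesis .
qed

lemma lform_flow_deriv:
  assumes x: "x \<in> fin_vN" and s: "0 < s"
  shows "((%s. lform c (flow s x) (flow s x)) has_real_derivative 2 / s * lform (%g. c g * len g) (flow s x) (flow s x)) (at s within T)"
proof -
  have "((%s. \<Sum>g\<in>supp x. c g * (s ^ (2 * word_length g) * (cmod (coef x g))^2)) has_real_derivative
    (\<Sum>g\<in>supp x. c g * (real (2 * word_length g) * s ^ (2 * word_length g - 1) * (cmod (coef x g))^2))) (at s within T)"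
    by (intro DERIV_sum DERIV_cmult DERIV_cmult_right) (auto intro!: derivative_eq_intros)
  also have "(\<Sum>g\<in>supp x. c g * (real (2 * word_length g) * s ^ (2 * word_length g - 1) * (cmod (coef x g))^2))
    = 2 / s * (\<Sum>g\<in>supp x. c g * len g * (s ^ (2 * word_length g) * (cmod (coef x g))^2))" unfolding sum_distrib_left
  proof (intro sum.cong refl)
    fix g
    have "real (2 * n) * s ^ (2 * n - 1) = 2 / s * (real n * s ^ (2 * n))" for n
      using s by (cases n) (simp_all add: field_simps)
    thus "c g * (real (2 * word_length g) * s ^ (2 * word_length g - 1) * (cmod (coef x g))^2)
      = 2 / s * (c g * len g * (s ^ (2 * word_length g) * (cmod (coef x g))^2))" by (simp only: len_def) (simp add: mult_ac)
  qed
  finally show ?thesis by (simp only: lform_flow[OF x])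
qed

lemma lform_flow_mono:
  assumes x: "x \<in> fin_vN" and s: "0 <= s" "s <= t" and c: "!!g. 0 <= c g"
  shows "lform c (flow s x) (flow s x) <= lform c (flow t x) (flow t x)"
  unfolding lform_flow[OF x] using s c by (intro sum_mono mult_left_mono mult_right_mono power_mono) auto

lemma xlnx_shift:
  assumes "e > 0"
  obtains a :: real where "0 < a" "a < 1" "!!u. 0 <= u ==> u <= M ==> \<bar>(u + a) * ln (u + a) - u * ln u\<bar> <= e"
    "a * K < e"
proof -
  have "uniformly_continuous_on {0..M + 1} (%u. u * ln u)"
    using cont0_Icc[OF cont0_xlnx] by (rule compact_uniformly_continuous) auto
  then obtain d where d: "d > 0" "!!s t. s \<in> {0..M + 1} ==> t \<in> {0..M + 1} ==> dist t s < d ==> dist (t * ln t) (s * ln s) < e"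
    using assms unfolding uniformly_continuous_on_def by metis
  define a where "a = min (1 / 2) (min (d / 2) (e / (\<bar>K\<bar> + 1) / 2))"
  have pos: "0 < e / (\<bar>K\<bar> + 1) / 2" using assms by simp
  have a: "0 < a" "a < 1" "a < d" "a <= e / (\<bar>K\<bar> + 1) / 2" unfolding a_def using d(1) pos by auto
  have "a * K <= a * (\<bar>K\<bar> + 1)" using a by (intro mult_left_mono) auto
  also have "... <= e / (\<bar>K\<bar> + 1) / 2 * (\<bar>K\<bar> + 1)" using a by (intro mult_right_mono) auto
  also have "... = e / 2" by (simp add: field_simps add_nonneg_eq_0_iff)
  finally have "a * K < e" using assms by simp
  moreover have "\<bar>(u + a) * ln (u + a) - u * ln u\<bar> <= e" if "0 <= u" "u <= M" for u
    using d(2)[of u "u + a"] a that by (simp add: dist_real_def)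
  ultimately show ?thesis using that a by blast
qed

text \<open>The deficit W(s) of the inequality along the flow vanishes at s = 0, where the element
  is scalar. Its formal derivative is 2/s times the two sides of \<open>lsi_step\<close> (with a =
  0) subtracted, so W is nondecreasing and W(1) is nonnegative.\<close>

lemma lsi_upto_Suc:
  assumes lsi: "lsi_upto d"
  shows "lsi_upto (Suc d)" unfolding lsi_upto_def
proof (intro allI impI)
  fix x :: "nat free_group op" assume x: "x \<in> fin_vN" and deg: "\<forall>g\<in>supp x. word_length g <= Suc d"
  let ?n = "%s. lform (%_. 1) (flow s x) (flow s x)"
  let ?E = "%s. lform len (flow s x) (flow s x)"
  let ?E2 = "%s. lform (%g. len g * len g) (flow s x) (flow s x)"
  let ?f = "%u :: real. u * ln u"
  define W where "W = (%s. 2 * ?E s - phi (flow s x) ?f + ?f (?n s))"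
  have nn: "?n s = (norm (flow s x vac))^2" for s by (simp add: norm_sq_lform flow_fin)
  have n0: "0 <= ?n s" for s unfolding nn by simp
  have cl: "continuous_on T (%s. lform c (flow s x) (flow s x))" for c T
    unfolding lform_flow[OF x] by (intro continuous_intros)
  have cW: "continuous_on {0..1} W" unfolding W_def
    by (intro continuous_on_add continuous_on_diff continuous_on_mult_left cl phi_flow_continuous x cont0_xlnx
        continuous_on_compose2[OF cont0_xlnx cl]) (use n0 in auto)
  have W0: "W 0 = 0"
  proof -
    have "?n 0 = (cmod (coef x 1))^2" by (subst nn) (simp add: flow_0[OF x] scaleC_op_apply norm_scaleC)
    moreover have "?E 0 = 0" unfolding lform_flow[OF x] by (intro sum.neutral) (auto simp: len_def power_0_left)
    ultimately show ?thesis unfolding W_def by (simp add: flow_0[OF x] phi_scalar cont0_xlnx)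
  qed
  \<comment> \<open>Away from 0, since the error caused by the shift \<open>a\<close> carries the
    factor 1/(s0 * n(s0)); continuity of W covers s0 -> 0 afterwards.\<close>
  have mono: "W s0 <= W 1" if s0: "0 < s0" "s0 < 1" and npos: "0 < ?n s0" for s0
  proof (rule field_le_epsilon)
    fix e :: real assume e: "0 < e"
    let ?M = "(l1norm x)^2"
    let ?K = "4 * ?E 1 / (s0 * ?n s0)"
    obtain a where a: "0 < a" "a < 1" "!!u. 0 <= u ==> u <= ?M ==> \<bar>(u + a) * ln (u + a) - u * ln u\<bar> <= e / 3" "a * ?K < e / 3"
      using xlnx_shift[of "e / 3" ?M ?K] e by (metis divide_pos_pos zero_less_numeral)
    \<comment> \<open>The primitive of ln(u + a). For small \<open>a\<close> it is close to u ln u -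
      u, whose linear part is compensated by the extra \<open>- ?n s\<close> in V.\<close>
    define F where "F = (%u. (u + a) * ln (u + a) - u)"
    have F: "(F has_real_derivative ln (u + a)) (at u within {0..})" if "0 <= u" for u
      unfolding F_def using a that by (auto intro!: derivative_eq_intros)
    have cF: "cont0 F" by (rule DERIV_continuous_on) (use F in auto)
    define V where "V = (%s. 2 * ?E s - phi (flow s x) F + (?f (?n s) - ?n s))"
    have VW: "\<bar>V s - W s\<bar> <= e / 3" if s: "0 <= s" "s <= 1" for s
    proof -
      have fv: "flow s x \<in> group_vN" using flow_fin by auto
      have "\<bar>phi (flow s x) F - phi (flow s x) (%u. u * ln u - u)\<bar> <= e / 3"
      proof (rule phi_close[OF fv cF])
        show "cont0 (%u. u * ln u - u)" by (intro continuous_on_diff cont0_xlnx continuous_on_id)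
        fix u assume "0 <= u" "u <= norm (adj (flow s x) oL flow s x)"
        thus "\<bar>F u - (u * ln u - u)\<bar> <= e / 3" using a(3)[of u] norm_flow_sq_le[of s x] s by (simp add: F_def)
      qed
      moreover have "phi (flow s x) (%u. u * ln u - u) = phi (flow s x) ?f - ?n s"
        using phi_diff[OF fv cont0_xlnx continuous_on_id] by (simp add: phi_id fv nn)
      ultimately show ?thesis by (simp add: V_def W_def abs_minus_commute)
    qed
    have cV: "continuous_on {s0..1} V" unfolding V_def by (intro continuous_on_add continuous_on_diff continuous_on_mult_left cl
          continuous_on_subset[OF phi_flow_continuous[OF x cF]] continuous_on_compose2[OF cont0_xlnx cl]) (use n0 s0 in auto)
    have "\<exists>D. (V has_real_derivative D) (at s) & - (a * ?K) <= D" if s: "s0 < s" "s < 1" for s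
    proof -
      have sp: "0 < s" using s s0 by simp
      have ns: "?n s0 <= ?n s" using s s0 by (intro lform_flow_mono x) auto
      hence nsp: "0 < ?n s" using npos by simp
      have Es: "?E s <= ?E 1" using s sp by (intro lform_flow_mono x) (auto simp: len_def)
      let ?I = "inner (num_op (flow s x) vac) ((flow s x oL pos_calc (%u. ln (u + a)) (adj (flow s x) oL flow s x)) vac)"
      let ?D = "2 * (2 / s * ?E2 s) - 2 / s * ?I + ln (?n s) * (2 / s * ?E s)"
      have "((%s. ?n s) has_real_derivative 2 / s * ?E s) (at s)"
        using lform_flow_deriv[OF x sp, of "%_. 1" UNIV] by simp
      hence "((%s. ?f (?n s) - ?n s) has_real_derivative ln (?n s) * (2 / s * ?E s)) (at s)"
        using nsp by (auto intro!: derivative_eq_intros simp: algebra_simps)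
      hence "(V has_real_derivative ?D) (at s)" unfolding V_def
        by (intro DERIV_add DERIV_diff DERIV_cmult lform_flow_deriv x sp phi_flow_deriv cont0_ln a F s)
      moreover have "- (a * ?K) <= ?D"
      proof -
        have "supp (flow s x) \<subseteq> supp x" by (auto simp: supp_def coef_flow[OF x])
        hence "?I <= 2 * ?E2 s + (ln (?n s) + 2 * a / ?n s) * ?E s"
          using deg by (intro lsi_step[OF lsi flow_fin(1) _ a(1) nn nsp]) auto
        hence "2 / s * ?I <= 2 / s * (2 * ?E2 s + (ln (?n s) + 2 * a / ?n s) * ?E s)" using sp by (intro mult_left_mono) auto
        hence "- (2 / s * (2 * a / ?n s * ?E s)) <= ?D" by (simp add: algebra_simps)
        moreover have "2 / s * (2 * a / ?n s * ?E s) <= 2 / s0 * (2 * a / ?n s0 * ?E 1)"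
          using s s0 sp a npos ns Es lform_nonneg_len by (intro mult_mono frac_le) auto
        ultimately show ?thesis by (simp add: mult_ac)
      qed
      ultimately show ?thesis by blast
    qed
    then obtain D where D: "!!s. s0 < s ==> s < 1 ==> (V has_real_derivative D s) (at s) & - (a * ?K) <= D s" by metis
    obtain l z where z: "s0 < z" "z < 1" "(V has_real_derivative l) (at z)" "V 1 - V s0 = (1 - s0) * l"
      using MVT[OF s0(2) cV] D real_differentiable_def by metis
    have "l = D z" using DERIV_unique[OF z(3)] D z by blast
    hence "(1 - s0) * l >= (1 - s0) * (- (a * ?K))" using D[OF z(1,2)] s0 by (intro mult_left_mono) auto
    moreover have "(1 - s0) * (a * ?K) <= 1 * (a * ?K)"
      using s0 a npos lform_nonneg_len[of "flow 1 x"] by (intro mult_right_mono) auto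
    ultimately have "V s0 - a * ?K <= V 1" using z(4) by simp
    thus "W s0 <= W 1 + e" using VW[of s0] VW[of 1] s0 a(4) unfolding abs_le_iff by linarith
  qed
  have "0 <= W 1"
  proof (cases "supp x = {}")
    case True
    hence "x = 0" using fin_eq_sum[OF x finite_supp[OF x] order_refl] by simp
    hence "flow s x = 0" for s by (simp add: flow_def)
    hence "W 1 = W 0" by (simp add: W_def)
    thus ?thesis using W0 by simp
  next
    case False
    have npos: "0 < ?n s" if "0 < s" for s
      unfolding lform_flow[OF x] using that False finite_supp[OF x] by (intro sum_pos) (auto simp: supp_def)
    have "(W \<longlongrightarrow> W 0) (at_right 0)" by (rule continuous_on_Icc_at_rightD[OF cW]) simp
    hence "W 0 <= W 1"
    proof (rule tendsto_upperbound)
      show "\<forall>\<^sub>F s in at_right 0. W s <= W 1"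
        by (rule eventually_mono[OF eventually_at_right_real[OF zero_less_one]]) (use mono npos in auto)
    qed simp
    thus ?thesis using W0 by simp
  qed
  thus "phi x ?f - (norm (x vac))^2 * ln ((norm (x vac))^2) <= 2 * lform len x x" using x nn[of 1] by (simp add: W_def)
qed

text \<open>Every finitely supported element has a maximal word length. In degree 0 the element is
  scalar and its entropy vanishes.\<close>

theorem lsi:
  fixes x :: "nat free_group op"
  assumes x: "x \<in> fin_vN"
  shows "phi x (%u. u * ln u) - (norm (x vac))^2 * ln ((norm (x vac))^2) <= 2 * lform len x x"
proof -
  have "lsi_upto 0" unfolding lsi_upto_def
  proof (intro allI impI)
    fix z :: "nat free_group op" assume z: "z \<in> fin_vN" "\<forall>g\<in>supp z. word_length g <= 0"
    hence "flow 0 z = z" by (intro vN_eqI_coef) (auto simp: flow_fin fin_vN coef_flow supp_def power_0_left)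
    hence eq: "z = scaleC_op (coef z 1) id_blinfun" using flow_0[OF z(1)] by simp
    have "phi z (%u. u * ln u) = (norm (z vac))^2 * ln ((norm (z vac))^2)"
      by (subst eq, subst (2 3) eq) (simp only: phi_scalar[OF cont0_xlnx], simp add: scaleC_op_apply norm_scaleC)
    thus "phi z (%u. u * ln u) - (norm (z vac))^2 * ln ((norm (z vac))^2) <= 2 * lform len z z"
      using lform_nonneg_len by simp
  qed
  hence "lsi_upto d" for d by (induction d) (auto intro: lsi_upto_Suc)
  moreover have "\<forall>g\<in>supp x. word_length g <= Max (word_length ` supp x)" using finite_supp[OF x] by simp
  ultimately show ?thesis using x unfolding lsi_upto_def by blast
qed

section \<open>From the logarithmic Sobolev inequality to hypercontractivity\<close>

subsection \<open>The Stroock--Varopoulos inequality\<close>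

definition odd_powr :: "real => real => real" where
  "odd_powr b x = x * \<bar>x\<bar> powr b"

lemma odd_powr_deriv:
  assumes b: "0 < b"
  shows "(odd_powr b has_real_derivative (b + 1) * (x^2) powr (b / 2)) (at x)"
proof -
  have sq: "(x^2) powr (b / 2) = \<bar>x\<bar> powr b" for x :: real
    using powr_powr[of "\<bar>x\<bar>" 2 "b / 2"] by (cases "x = 0") (auto simp: powr_numeral)
  consider "x > 0" | "x < 0" | "x = 0" by linarith
  thus ?thesis
  proof cases
    case 1
    have "((%x. x * x powr b) has_real_derivative (b + 1) * x powr b) (at x)"
      using 1 by (auto intro!: derivative_eq_intros simp: powr_diff field_simps)
    hence "(odd_powr b has_real_derivative (b + 1) * x powr b) (at x)"
      by (rule has_field_derivative_transform_within[where d = x]) (use 1 in \<open>auto simp: odd_powr_def dist_real_def abs_if\<close>)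
    thus ?thesis using 1 by (simp add: sq)
  next
    case 2
    have "((%x. x * (- x) powr b) has_real_derivative (b + 1) * (- x) powr b) (at x)"
      using 2 by (auto intro!: derivative_eq_intros simp: powr_diff field_simps)
    hence "(odd_powr b has_real_derivative (b + 1) * (- x) powr b) (at x)"
      by (rule has_field_derivative_transform_within[where d = "- x"]) (use 2 in \<open>auto simp: odd_powr_def dist_real_def abs_if\<close>)
    thus ?thesis using 2 by (simp add: sq)
  next
    case 3
    have "((%h. \<bar>h\<bar> powr b) \<longlongrightarrow> \<bar>0\<bar> powr b) (at 0)"
      using b by (intro tendsto_powr' tendsto_rabs tendsto_const tendsto_ident_at) auto
    moreover have "\<forall>\<^sub>F h in at 0. (odd_powr b (0 + h) - odd_powr b 0) / h = \<bar>h\<bar> powr b"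
      by (auto simp: odd_powr_def eventually_at_filter)
    ultimately have "((%h. (odd_powr b (0 + h) - odd_powr b 0) / h) \<longlongrightarrow> 0) (at 0)"
      using b by (simp add: filterlim_cong)
    thus ?thesis using 3 b by (simp add: DERIV_def)
  qed
qed

text \<open>A Cauchy-Schwarz inequality for derivatives: the constant K = (p/2)^2/(p - 1) is the one
  with w'^2 = K h', and (w' - c)^2 >= 0 is integrated with c the mean slope of w.\<close>

lemma odd_powr_quotient:
  fixes s t p :: real
  assumes p: "2 < p" and st: "s ~= t"
  shows "((odd_powr (p / 2 - 1) s - odd_powr (p / 2 - 1) t) / (s - t))^2
    <= p^2 / (4 * (p - 1)) * ((odd_powr (p - 2) s - odd_powr (p - 2) t) / (s - t))"
proof -
  let ?w = "odd_powr (p / 2 - 1)" and ?h = "odd_powr (p - 2)"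
  define K where "K = p^2 / (4 * (p - 1))"
  have *: "((?w s - ?w t) / (s - t))^2 <= K * ((?h s - ?h t) / (s - t))" if ts: "t < s" for s t
  proof -
    define c where "c = (?w s - ?w t) / (s - t)"
    define F where "F = (%x. K * ?h x - (2 * c * ?w x - c^2 * x))"
    have "F t <= F s"
    proof (rule DERIV_nonneg_imp_nondecreasing[of t s F])
      fix x
      let ?v = "(x^2) powr ((p - 2) / 4)"
      have d: "(?w has_real_derivative p / 2 * ?v) (at x)"
        using odd_powr_deriv[of "p / 2 - 1" x] p by (simp add: diff_divide_distrib)
      have v2: "(x^2) powr ((p - 2) / 2) = ?v^2" by (simp add: power2_eq_square powr_add[symmetric])
      have d': "(?h has_real_derivative (p - 1) * ?v^2) (at x)" using odd_powr_deriv[of "p - 2" x] p by (simp add: v2)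
      have "(F has_real_derivative K * ((p - 1) * ?v^2) - (2 * c * (p / 2 * ?v) - c^2)) (at x)"
        unfolding F_def using d d' by (auto intro!: derivative_eq_intros)
      moreover have "K * ((p - 1) * ?v^2) - (2 * c * (p / 2 * ?v) - c^2) = (p / 2 * ?v - c)^2"
        using p by (simp add: K_def power2_eq_square field_simps)
      ultimately show "\<exists>y. (F has_real_derivative y) (at x) & 0 <= y" by (metis zero_le_power2)
    qed (use ts in simp)
    hence "2 * c * (?w s - ?w t) - c^2 * (s - t) <= K * (?h s - ?h t)" by (simp add: F_def algebra_simps)
    moreover have "?w s - ?w t = c * (s - t)" using ts by (simp add: c_def)
    ultimately have "c^2 * (s - t) <= K * (?h s - ?h t)" by (simp add: power2_eq_square algebra_simps)
    thus ?thesis using ts by (simp add: c_def[symmetric] le_divide_eq)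
  qed
  show ?thesis
  proof (cases "t < s")
    case True
    thus ?thesis using * by (simp add: K_def)
  next
    case False
    hence "s < t" using st by simp
    have e: "(f s - f t) / (s - t) = (f t - f s) / (t - s)" for f :: "real => real"
      using minus_divide_divide[of "f t - f s" "t - s"] by simp
    show ?thesis using *[OF \<open>s < t\<close>] unfolding e[of ?w] e[of ?h] by (simp add: K_def)
  qed
qed

lemma powr_approx:
  fixes p c e :: real
  assumes p: "2 < p" and c: "0 < c" and e: "0 < e"
  obtains q r where "!!s t. \<bar>s\<bar> <= c ==> \<bar>t\<bar> <= c ==> (dd q s t)^2 <= p^2 / (4 * (p - 1)) * dd r s t + e"
    "!!u. 0 <= u ==> u <= c^2 ==> \<bar>poly q u - u powr ((p - 2) / 4)\<bar> <= e"
    "!!u. 0 <= u ==> u <= c^2 ==> \<bar>poly r u - u powr ((p - 2) / 2)\<bar> <= e"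
proof -
  let ?w = "odd_powr (p / 2 - 1)" and ?h = "odd_powr (p - 2)"
  define K where "K = p^2 / (4 * (p - 1))"
  have K0: "0 <= K" using p by (simp add: K_def)
  define G where "G = (%u :: real. p / 2 * u powr ((p - 2) / 4))"
  define H where "H = (%u :: real. (p - 1) * u powr ((p - 2) / 2))"
  have cG: "cont0 G" "cont0 H" unfolding G_def H_def by (intro continuous_on_mult_left cont0_powr; use p in simp)+
  have dw: "(?w has_real_derivative G (x^2)) (at x)" for x
    using odd_powr_deriv[of "p / 2 - 1" x] p by (simp add: G_def diff_divide_distrib)
  have dh: "(?h has_real_derivative H (x^2)) (at x)" for x using odd_powr_deriv[of "p - 2" x] p by (simp add: H_def)
  have GH: "(G (s^2))^2 = K * H (s^2)" for s
  proof -
    have "((s^2) powr ((p - 2) / 4))^2 = (s^2) powr ((p - 2) / 2)" by (simp add: power2_eq_square powr_add[symmetric])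
    thus ?thesis using p by (simp add: G_def H_def K_def power_mult_distrib power2_eq_square field_simps)
  qed
  define B where "B = p / 2 * (c^2) powr ((p - 2) / 4)"
  have B0: "0 <= B" using p by (simp add: B_def)
  have GB: "\<bar>G (z^2)\<bar> <= B" if "\<bar>z\<bar> <= c" for z
  proof -
    have "z^2 <= c^2" using that by (simp add: abs_le_square_iff[symmetric])
    thus ?thesis using p by (simp add: G_def B_def abs_mult powr_mono2)
  qed
  have wB: "\<bar>(?w s - ?w t) / (s - t)\<bar> <= B" if st: "\<bar>s\<bar> <= c" "\<bar>t\<bar> <= c" "s ~= t" for s t
  proof -
    have "norm (?w s - ?w t) <= B * norm (s - t)" by (rule field_differentiable_bound[of "{-c..c}" ?w "%x. G (x^2)"])
        (use st GB dw in \<open>auto intro: has_field_derivative_at_within\<close>)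
    thus ?thesis using st by (simp add: abs_divide divide_le_eq)
  qed
  \<comment> \<open>The error in the square is at most d (2B + 1), and replacing the quotient of
    \<open>h\<close> by that of its approximation costs K d; together they stay below
    \<open>e\<close>.\<close>
  define d where "d = min 1 (e / (K + 2 * B + 1))"
  have KB: "K + 2 * B + 1 > 0" using K0 B0 by simp
  have d: "0 < d" "d <= 1" "(K + 2 * B + 1) * d <= e"
  proof -
    show "0 < d" using e KB by (simp add: d_def)
    have "(K + 2 * B + 1) * d <= (K + 2 * B + 1) * (e / (K + 2 * B + 1))"
      using KB by (intro mult_left_mono) (auto simp: d_def)
    thus "(K + 2 * B + 1) * d <= e" using KB by simp
  qed (simp add: d_def)
  have de: "d <= e"
  proof -
    have "1 * d <= (K + 2 * B + 1) * d" using K0 B0 d by (intro mult_right_mono) auto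
    thus ?thesis using d(3) by simp
  qed
  have 00: "?w 0 = 0" "?h 0 = 0" by (simp_all add: odd_powr_def)
  obtain q where q: "!!s t. \<bar>s\<bar> <= c ==> \<bar>t\<bar> <= c ==> s ~= t ==> \<bar>dd q s t - (?w s - ?w t) / (s - t)\<bar> <= d"
    "!!s. \<bar>s\<bar> <= c ==> \<bar>dd q s s - G (s^2)\<bar> <= d"
    "!!s. 0 < s ==> s <= c ==> \<bar>poly q (s^2) - ?w s / s\<bar> <= d" "\<bar>poly q 0 - G 0\<bar> <= d"
    using odd_approx[OF cG(1) dw 00(1) d(1), of c] c by auto
  obtain r where r: "!!s t. \<bar>s\<bar> <= c ==> \<bar>t\<bar> <= c ==> s ~= t ==> \<bar>dd r s t - (?h s - ?h t) / (s - t)\<bar> <= d"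
    "!!s. \<bar>s\<bar> <= c ==> \<bar>dd r s s - H (s^2)\<bar> <= d"
    "!!s. 0 < s ==> s <= c ==> \<bar>poly r (s^2) - ?h s / s\<bar> <= d" "\<bar>poly r 0 - H 0\<bar> <= d"
    using odd_approx[OF cG(2) dh 00(2) d(1), of c] c by auto
  have sq: "a^2 <= K * b + e" if "\<bar>a - w\<bar> <= d" "\<bar>b - h\<bar> <= d" "\<bar>w\<bar> <= B" "w^2 <= K * h" for a b w h
  proof -
    have "a^2 - w^2 = (a - w) * (a + w)" by (simp add: power2_eq_square algebra_simps)
    also have "... <= \<bar>a - w\<bar> * \<bar>a + w\<bar>" by (simp flip: abs_mult)
    also have "... <= d * (2 * B + 1)" using that d by (intro mult_mono) auto
    finally have "a^2 <= K * h + d * (2 * B + 1)" using that(4) by simp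
    also have "K * h <= K * (b + d)" using that(2) K0 by (intro mult_left_mono) auto
    finally show ?thesis using d(3) by (simp add: algebra_simps)
  qed
  have root: "sqrt u <= c" if "u <= c^2" for u using that c real_sqrt_le_mono[OF that] by simp
  show ?thesis
  proof (rule that[of q r])
    fix s t assume st: "\<bar>s\<bar> <= c" "\<bar>t\<bar> <= c"
    show "(dd q s t)^2 <= p^2 / (4 * (p - 1)) * dd r s t + e" unfolding K_def[symmetric]
    proof (cases "s = t")
      case True
      thus "(dd q s t)^2 <= K * dd r s t + e" using sq[OF q(2)[OF st(1)] r(2)[OF st(1)] GB[OF st(1)]] GH by simp
    next
      case False
      show "(dd q s t)^2 <= K * dd r s t + e"
        using sq[OF q(1)[OF st False] r(1)[OF st False] wB[OF st False]] odd_powr_quotient[OF p False] by (simp add: K_def)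
    qed
  next
    fix u :: real assume u: "0 <= u" "u <= c^2"
    show "\<bar>poly q u - u powr ((p - 2) / 4)\<bar> <= e"
    proof (cases "u = 0")
      case False
      have "sqrt u powr (p / 2 - 1) = u powr ((p - 2) / 4)"
        using u False by (simp add: powr_half_sqrt[symmetric] powr_powr diff_divide_distrib)
      thus ?thesis using q(3)[of "sqrt u"] u False root[OF u(2)] de by (simp add: odd_powr_def)
    qed (use q(4) de in \<open>simp add: G_def\<close>)
    show "\<bar>poly r u - u powr ((p - 2) / 2)\<bar> <= e"
    proof (cases "u = 0")
      case False
      have "sqrt u powr (p - 2) = u powr ((p - 2) / 2)" using u False by (simp add: powr_half_sqrt[symmetric] powr_powr)
      thus ?thesis using r(3)[of "sqrt u"] u False root[OF u(2)] de by (simp add: odd_powr_def)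
    qed (use r(4) de in \<open>simp add: H_def\<close>)
  qed
qed

text \<open>The pointwise bound \<open>deriv_bound_square\<close> is averaged over generators and
  twists, which turns squared norms and pairings of derivatives into Dirichlet forms; the
  contributions of adjoints equal those of the elements.\<close>

lemma stroock_varopoulos_poly:
  fixes x :: "nat free_group op"
  assumes x: "x \<in> fin_vN" and c: "4 * l1norm x <= c" "0 < c"
    and U: "!!s t. \<bar>s\<bar> <= c ==> \<bar>t\<bar> <= c ==> (dd q s t)^2 <= K * dd r s t + e"
  shows "lform len (x oL pev q (adj x oL x)) (x oL pev q (adj x oL x))
    <= K * inner (num_op x vac) ((x oL pev r (adj x oL x)) vac) + e * lform len x x"
proof -
  define z where "z = x oL pev r (adj x oL x)"
  define v where "v = x oL pev q (adj x oL x)"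
  have zv: "z \<in> fin_vN" "v \<in> fin_vN" unfolding z_def v_def using x by (auto intro!: fin_compose fin_pev fin_self)
  have az: "adj z = adj x oL pev r (x oL adj x)" "adj v = adj x oL pev q (x oL adj x)"
    unfolding z_def v_def using x by (auto intro!: adj_odd)
  note f = x zv fin_adj[OF x] fin_adj[OF zv(1)] fin_adj[OF zv(2)]
  obtain S1 I1 N1 where 1: "finite S1" "supp x \<subseteq> S1" "supp z \<subseteq> S1" "supp (adj x) \<subseteq> S1" "supp (adj z) \<subseteq> S1"
    "finite I1" "!!g. g \<in> S1 ==> 2 * word_length g < N1" "!!g. g \<in> S1 ==> fst ` set (word_of g) \<subseteq> I1"
    using avg_setup[OF x zv(1)] by metis
  obtain S2 I2 N2 where 2: "finite S2" "supp x \<subseteq> S2" "supp v \<subseteq> S2" "supp (adj x) \<subseteq> S2" "supp (adj v) \<subseteq> S2"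
    "finite I2" "!!g. g \<in> S2 ==> 2 * word_length g < N2" "!!g. g \<in> S2 ==> fst ` set (word_of g) \<subseteq> I2"
    using avg_setup[OF x zv(2)] by metis
  define S I N where "S = S1 \<union> S2" and "I = I1 \<union> I2" and "N = max N1 N2"
  have S: "finite S" and I: "finite I" using 1 2 by (auto simp: S_def I_def)
  have N: "2 * word_length g < N" if "g \<in> S" for g using that 1(7) 2(7) by (auto simp: S_def N_def less_max_iff_disj)
  have gI: "fst ` set (word_of g) \<subseteq> I" if "g \<in> S" for g using that 1(8) 2(8) unfolding S_def I_def by blast
  have sub: "supp x \<subseteq> S" "supp (adj x) \<subseteq> S" "supp z \<subseteq> S" "supp (adj z) \<subseteq> S" "supp v \<subseteq> S" "supp (adj v) \<subseteq> S"
    using 1 2 by (auto simp: S_def)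
  let ?d = "%y i w. deriv_x i w y vac"
  have A: "avg I N (%i w. inner (?d a i w) (?d b i w)) = lform len a b" if "supp a \<subseteq> S" "supp b \<subseteq> S" "a \<in> fin_vN" for a b
    using avg_inner[OF S that(2,1,3) N I gI] by (simp add: avg_def)
  have An: "avg I N (%i w. (norm (?d a i w))^2) = lform len a a" if "supp a \<subseteq> S" "a \<in> fin_vN" for a
    using A[OF that(1,1,2)] by (simp add: dot_square_norm)
  have "avg I N (%i w. (norm (?d v i w))^2 + (norm (?d (adj v) i w))^2)
    <= avg I N (%i w. K * (inner (?d z i w) (?d x i w) + inner (?d (adj z) i w) (?d (adj x) i w))
      + e * ((norm (?d x i w))^2 + (norm (?d (adj x) i w))^2))"
    by (rule avg_mono) (unfold az, unfold z_def v_def, rule deriv_bound_square[OF _ x c U])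
  hence "lform len v v + lform len (adj v) (adj v) <= K * (lform len z x + lform len (adj z) (adj x))
      + e * (lform len x x + lform len (adj x) (adj x))"
    unfolding avg_add avg_scale An[OF sub(1) f(1)] An[OF sub(2) f(4)] An[OF sub(5) f(3)] An[OF sub(6) f(6)]
      A[OF sub(3,1) f(2)] A[OF sub(4,2) f(5)] .
  hence "lform len v v <= K * lform len z x + e * lform len x x"
    using lform_adj[of v v len] lform_adj[of z x len] lform_adj[of x x len] x zv by (simp add: algebra_simps)
  moreover have "lform len z x = inner (num_op x vac) (z vac)" using lform_commute[OF zv(1) x] lform_num_op[OF x, of z] by simp
  ultimately show ?thesis by (simp add: z_def v_def)
qed

text \<open>Apply \<open>lsi\<close> to approximations of x \<bar>x\<bar>^(p/2 - 1), whose squared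
  modulus is \<bar>x\<bar>^p, and bound their Dirichlet form by K times the pairing with x
  \<bar>x\<bar>^(p - 2). The factor p^2/(2(p - 1)) is 2K.\<close>

theorem stroock_varopoulos:
  fixes x :: "nat free_group op" and p :: real
  assumes x: "x \<in> fin_vN" and p: "2 < p"
  defines "N \<equiv> phi x (%u. u powr (p / 2))"
    and "I \<equiv> inner (num_op x vac) ((x oL pos_calc (%u. u powr ((p - 2) / 2)) (adj x oL x)) vac)"
  shows "phi x (%u. u powr (p / 2) * ln (u powr (p / 2))) - N * ln N <= p^2 / (2 * (p - 1)) * I"
    and "0 <= I"
proof -
  let ?a = "adj x oL x"
  let ?m = "norm ?a"
  define K where "K = p^2 / (4 * (p - 1))"
  have K: "0 < K" using p by (simp add: K_def)
  define c where "c = 4 * l1norm x + sqrt ?m + 1"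
  have c: "4 * l1norm x <= c" "0 < c" "sqrt ?m <= c"
    unfolding c_def using l1norm_nonneg[of x] real_sqrt_ge_zero[OF norm_ge_zero[of ?a]] by linarith+
  have mc: "?m <= c^2" using c(3) by (metis norm_ge_zero real_sqrt_ge_zero real_sqrt_pow2 power_mono)
  have xv: "x \<in> group_vN" using x by auto
  have a: "pos_op ?a" by (rule vN_pos_self[OF xv])
  let ?P = "%k q r. (\<forall>s t. \<bar>s\<bar> <= c --> \<bar>t\<bar> <= c --> (dd q s t)\<^sup>2 <= K * dd r s t + 1 / real (Suc k)) &
      (\<forall>u. 0 <= u --> u <= c^2 --> \<bar>poly q u - u powr ((p - 2) / 4)\<bar> <= 1 / real (Suc k)) &
      (\<forall>u. 0 <= u --> u <= c^2 --> \<bar>poly r u - u powr ((p - 2) / 2)\<bar> <= 1 / real (Suc k))"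
  have "\<exists>qr. ?P k (fst qr) (snd qr)" for k
  proof -
    have "0 < 1 / real (Suc k)" by simp
    show ?thesis
    proof (rule powr_approx[OF p c(2) \<open>0 < 1 / real (Suc k)\<close>])
      fix q r
      assume 1: "!!s t. \<bar>s\<bar> <= c ==> \<bar>t\<bar> <= c ==> (dd q s t)^2 <= p^2 / (4 * (p - 1)) * dd r s t + 1 / real (Suc k)"
        and 2: "!!u. 0 <= u ==> u <= c^2 ==> \<bar>poly q u - u powr ((p - 2) / 4)\<bar> <= 1 / real (Suc k)"
        and 3: "!!u. 0 <= u ==> u <= c^2 ==> \<bar>poly r u - u powr ((p - 2) / 2)\<bar> <= 1 / real (Suc k)"
      have "?P k q r" unfolding K_def by (intro conjI allI impI 1 2 3)
      thus ?thesis by (intro exI[of _ "(q, r)"]) (simp only: fst_conv snd_conv)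
    qed
  qed
  hence "\<forall>k. \<exists>qr. ?P k (fst qr) (snd qr)" by blast
  from choice[OF this] obtain qr where qr: "\<forall>k. ?P k (fst (qr k)) (snd (qr k))" ..
  define q r where "q = (%k. fst (qr k))" and "r = (%k. snd (qr k))"
  have q: "!!k s t. \<bar>s\<bar> <= c ==> \<bar>t\<bar> <= c ==> (dd (q k) s t)^2 <= K * dd (r k) s t + 1 / real (Suc k)"
    "!!k u. 0 <= u ==> u <= c^2 ==> \<bar>poly (q k) u - u powr ((p - 2) / 4)\<bar> <= 1 / real (Suc k)"
    "!!k u. 0 <= u ==> u <= c^2 ==> \<bar>poly (r k) u - u powr ((p - 2) / 2)\<bar> <= 1 / real (Suc k)"
    using qr unfolding q_def r_def by blast+
  have lim1: "(%k. 1 / real (Suc k)) \<longlonglongrightarrow> 0"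
    using LIMSEQ_inverse_real_of_nat by (simp add: inverse_eq_divide)
  have ap: "approx_seq ?m g s" if "!!k u. 0 <= u ==> u <= c^2 ==> \<bar>poly (s k) u - g u\<bar> <= 1 / real (Suc k)" for g s
    unfolding approx_seq_def
  proof (rule uniform_limitI)
    fix e :: real assume "0 < e"
    from order_tendstoD(2)[OF lim1 this]
    show "\<forall>\<^sub>F k in sequentially. \<forall>u\<in>{0..?m}. dist (poly (s k) u) (g u) < e"
    proof eventually_elim
      case (elim k)
      show ?case using that[of _ k] mc elim by (fastforce simp: dist_real_def)
    qed
  qed
  have cg: "cont0 (%u. u powr ((p - 2) / 4))" "cont0 (%u. u powr ((p - 2) / 2))" "cont0 (%u. u powr (p / 2))"
    using p by (auto intro: cont0_powr)
  have aq: "approx_seq ?m (%u. u powr ((p - 2) / 4)) q" and ar: "approx_seq ?m (%u. u powr ((p - 2) / 2)) r"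
    by (rule ap[OF q(2)], assumption+) (rule ap[OF q(3)], assumption+)
  have "poly [:0, 1:] = (%s :: real. s)" by (simp add: fun_eq_iff)
  hence X: "approx_seq ?m (%s. s) (%_. [:0, 1:])" by (simp only: approx_seq_def uniform_limit_const)
  have "approx_seq ?m (%u. u * (u powr ((p - 2) / 4) * u powr ((p - 2) / 4))) (%k. [:0, 1:] * (q k * q k))"
    by (intro approx_seq_mult X aq cg continuous_on_mult continuous_on_id)
  moreover have pw: "u * (u powr ((p - 2) / 4) * u powr ((p - 2) / 4)) = u powr (p / 2)" if "0 <= u" for u
  proof (cases "u = 0")
    case False
    have "u powr (p / 2) = u powr (1 + ((p - 2) / 4 + (p - 2) / 4))" by (simp add: field_simps)
    also have "... = u powr 1 * (u powr ((p - 2) / 4) * u powr ((p - 2) / 4))" by (simp only: powr_add)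
    finally show ?thesis using that by simp
  qed simp
  ultimately have aw: "uniform_limit {0..?m} (%k. poly ([:0, 1:] * (q k * q k))) (%u. u powr (p / 2)) sequentially"
    unfolding approx_seq_def by (subst uniform_limit_cong'[OF refl, symmetric]) auto
  define v where "v = (%k. x oL pev (q k) ?a)"
  have v: "v k \<in> fin_vN" for k unfolding v_def using x by (intro fin_compose fin_pev fin_self)
  define Ik where "Ik = (%k. inner (num_op x vac) ((x oL pev (r k) ?a) vac))"
  have sv: "lform len (v k) (v k) <= K * Ik k + 1 / real (Suc k) * lform len x x" for k
    unfolding v_def Ik_def by (rule stroock_varopoulos_poly[OF x c(1,2) q(1)])
  have pv: "phi (v k) f = phi x (%u. f (poly ([:0, 1:] * (q k * q k)) u))" if "cont0 f" for f k
    using phi_compose_poly(2)[OF xv that cont0_poly, of "q k"] by (simp add: v_def cf_poly a power2_eq_square)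
  have LI: "Ik \<longlonglongrightarrow> I"
  proof -
    have "(%k. pev (r k) ?a) \<longlonglongrightarrow> pos_calc (%u. u powr ((p - 2) / 2)) ?a"
      by (rule approx_seq_calc[OF ar cg(2) a order_refl])
    hence "(%k. inner (num_op x vac) (x (pev (r k) ?a vac))) \<longlonglongrightarrow>
      inner (num_op x vac) (x (pos_calc (%u. u powr ((p - 2) / 2)) ?a vac))"
      by (intro tendsto_inner tendsto_const blinfun.tendsto)
    thus ?thesis by (simp add: Ik_def[abs_def] I_def)
  qed
  have R: "(%k. K * Ik k + 1 / real (Suc k) * lform len x x) \<longlonglongrightarrow> K * I + 0 * lform len x x"
    by (intro tendsto_add tendsto_mult tendsto_const LI lim1)
  show "0 <= I"
  proof -
    have "0 <= K * I + 0 * lform len x x" by (rule LIMSEQ_le_const[OF R]) (use sv lform_nonneg_len order_trans in blast)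
    thus ?thesis using K by (simp add: zero_le_mult_iff)
  qed
  have Ln: "(%k. phi (v k) (%u. u)) \<longlonglongrightarrow> N" unfolding N_def pv[OF continuous_on_id]
    by (rule phi_uniform_limit[OF xv cg(3) cont0_poly aw])
  have pp: "0 <= poly ([:0, 1:] * (q k * q k)) s" if "0 <= s" for k s using that by simp
  have Le: "(%k. phi (v k) (%u. u * ln u)) \<longlonglongrightarrow> phi x (%u. u powr (p / 2) * ln (u powr (p / 2)))"
    unfolding pv[OF cont0_xlnx]
  proof (rule phi_uniform_limit[OF xv])
    show "cont0 (%u. u powr (p / 2) * ln (u powr (p / 2)))" by (rule continuous_on_compose2[OF cont0_xlnx cg(3)]) auto
    show "cont0 (%u. poly ([:0, 1:] * (q k * q k)) u * ln (poly ([:0, 1:] * (q k * q k)) u))" for k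
      by (rule continuous_on_compose2[OF cont0_xlnx cont0_poly]) (use pp in auto)
    show "uniform_limit {0..?m} (%k u. poly ([:0, 1:] * (q k * q k)) u * ln (poly ([:0, 1:] * (q k * q k)) u))
      (%u. u powr (p / 2) * ln (u powr (p / 2))) sequentially"
      by (rule uniform_compose_cont0[OF aw cont0_xlnx cg(3) pp])
  qed
  have N0: "0 <= N" unfolding N_def using p by (intro phi_powr_nonneg xv) simp
  have n0: "0 <= phi (v k) (%u. u)" for k using v by (intro phi_nonneg continuous_on_id) auto
  have Ll: "(%k. phi (v k) (%u. u) * ln (phi (v k) (%u. u))) \<longlonglongrightarrow> N * ln N"
    by (rule continuous_on_tendsto_compose[OF cont0_xlnx Ln]) (use N0 n0 in auto)
  have "phi x (%u. u powr (p / 2) * ln (u powr (p / 2))) - N * ln N <= 2 * (K * I + 0 * lform len x x)"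
  proof (rule LIMSEQ_le[OF tendsto_diff[OF Le Ll] tendsto_mult[OF tendsto_const R]])
    have "phi (v k) (%u. u * ln u) - phi (v k) (%u. u) * ln (phi (v k) (%u. u))
        <= 2 * (K * Ik k + 1 / real (Suc k) * lform len x x)" for k
      using lsi[OF v[of k]] sv[of k] phi_id[OF fin_vN[OF v[of k]]] by simp
    thus "\<exists>N. \<forall>n\<ge>N. phi (v n) (%u. u * ln u) - phi (v n) (%u. u) * ln (phi (v n) (%u. u))
        <= 2 * (K * Ik n + 1 / real (Suc n) * lform len x x)" by blast
  qed
  moreover have "2 * (K * I + 0 * lform len x x) = p^2 / (2 * (p - 1)) * I" using p by (simp add: K_def field_simps)
  ultimately show "phi x (%u. u powr (p / 2) * ln (u powr (p / 2))) - N * ln N <= p^2 / (2 * (p - 1)) * I"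
    by (simp only:)
qed

subsection \<open>Differentiation along the flow with a varying exponent\<close>

lemma phi_flow_continuous2:
  fixes F :: "real => real => real"
  assumes x: "x \<in> fin_vN" and F: "continuous_on ({a..1} \<times> {0..}) (%(b, u). F b u)" and a: "0 <= a"
  shows "continuous_on {a..1} (%s. phi (flow s x) (F s))" unfolding continuous_on_iff
proof (intro ballI allI impI)
  fix s e :: real assume s: "s \<in> {a..1}" and e: "0 < e"
  let ?M = "(l1norm x)^2"
  have cF: "cont0 (F b)" if "b \<in> {a..1}" for b
    using continuous_on_compose2[OF F continuous_on_Pair[OF continuous_on_const[of "{0..}" b] continuous_on_id]] that by (simp add: image_subset_iff)
  have "uniformly_continuous_on ({a..1} \<times> {0..?M}) (%(b, u). F b u)"
    by (intro compact_uniformly_continuous continuous_on_subset[OF F] compact_Times compact_Icc) auto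
  then obtain d where d: "0 < d" "!!p q. p \<in> {a..1} \<times> {0..?M} ==> q \<in> {a..1} \<times> {0..?M} ==> dist q p < d ==>
      dist ((%(b, u). F b u) q) ((%(b, u). F b u) p) < e / 2"
    unfolding uniformly_continuous_on_def using e by (metis half_gt_zero)
  have "continuous_on {0..1} (%t. phi (flow t x) (F s))" by (rule phi_flow_continuous[OF x cF[OF s]])
  hence "continuous_on {a..1} (%t. phi (flow t x) (F s))" by (rule continuous_on_subset) (use a in auto)
  then obtain d' where d': "0 < d'" "!!t. t \<in> {a..1} ==> dist t s < d' ==> dist (phi (flow t x) (F s)) (phi (flow s x) (F s)) < e / 2"
    unfolding continuous_on_iff using s e by (metis half_gt_zero)
  show "\<exists>d>0. \<forall>t\<in>{a..1}. dist t s < d --> dist (phi (flow t x) (F t)) (phi (flow s x) (F s)) < e"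
  proof (intro exI[of _ "min d d'"] conjI ballI impI)
    fix t assume t: "t \<in> {a..1}" "dist t s < min d d'"
    have "\<bar>phi (flow t x) (F t) - phi (flow t x) (F s)\<bar> <= e / 2"
    proof (rule phi_close[OF fin_vN[OF flow_fin(1)] cF[OF t(1)] cF[OF s]])
      fix u assume u: "0 <= u" "u <= norm (adj (flow t x) oL flow t x)"
      hence "u <= ?M" using norm_flow_sq_le[of t x] t(1) a by auto
      thus "\<bar>F t u - F s u\<bar> <= e / 2"
        using d(2)[of "(s, u)" "(t, u)"] u t s by (simp add: dist_Pair_Pair dist_real_def)
    qed
    moreover have "\<bar>phi (flow t x) (F s) - phi (flow s x) (F s)\<bar> < e / 2"
      using d'(2)[OF t(1)] t(2) by (simp add: dist_real_def)
    ultimately show "dist (phi (flow t x) (F t)) (phi (flow s x) (F s)) < e" unfolding dist_real_def by linarith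
  qed (use d d' in auto)
qed

text \<open>The difference quotient is split into the change of the function at a moving element,
  handled by the mean value theorem uniformly on the spectrum, and the change of the element for a
  fixed function, which is \<open>phi_flow_deriv\<close>.\<close>

lemma phi_flow_deriv2:
  fixes x :: "'a free_group op" and F g :: "real => real => real"
  assumes x: "x \<in> fin_vN" and s: "0 < s" "s < 1"
    and f: "cont0 f" "!!u. 0 <= u ==> (F s has_real_derivative f u) (at u within {0..})"
    and F: "!!b. 0 < b ==> b < 1 ==> cont0 (F b)"
    and g: "!!b u. 0 < b ==> b < 1 ==> 0 <= u ==> ((%b. F b u) has_real_derivative g b u) (at b)"
    and cg: "continuous_on ({0<..<1} \<times> {0..}) (%(b, u). g b u)"
  defines "y \<equiv> flow s x"
  shows "((%b. phi (flow b x) (F b)) has_real_derivative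
    phi y (g s) + 2 / s * inner (num_op y vac) ((y oL pos_calc f (adj y oL y)) vac)) (at s)"
proof -
  let ?M = "(l1norm x)^2"
  let ?D = "2 / s * inner (num_op y vac) ((y oL pos_calc f (adj y oL y)) vac)"
  have fv: "flow b x \<in> group_vN" for b using flow_fin by auto
  have cgs: "cont0 (g s)"
    using continuous_on_compose2[OF cg continuous_on_Pair[OF continuous_on_const[of "{0..}" s] continuous_on_id]] s by (simp add: image_subset_iff)
  have "((%b. phi (flow b x) (F s)) has_real_derivative ?D) (at s)" unfolding y_def by (rule phi_flow_deriv[OF x f s])
  hence A: "((%b. (phi (flow b x) (F s) - phi (flow s x) (F s)) / (b - s)) \<longlongrightarrow> ?D) (at s)"
    by (simp add: has_field_derivative_iff)
  have B: "((%b. phi (flow b x) (g s)) \<longlongrightarrow> phi y (g s)) (at s)"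
  proof -
    have "continuous_on {0<..<1} (%b. phi (flow b x) (g s))"
      by (rule continuous_on_subset[OF phi_flow_continuous[OF x cgs]]) auto
    hence "isCont (%b. phi (flow b x) (g s)) s" using s by (simp add: continuous_on_eq_continuous_at)
    thus ?thesis by (simp add: isCont_def y_def)
  qed
  have C: "((%b. (phi (flow b x) (F b) - phi (flow b x) (F s)) / (b - s) - phi (flow b x) (g s)) \<longlongrightarrow> 0) (at s)"
  proof (rule LIM_I)
    fix e :: real assume e: "0 < e"
    define \<eta> where "\<eta> = min (s / 2) ((1 - s) / 2)"
    have \<eta>: "0 < \<eta>" "\<eta> <= s / 2" "\<eta> <= (1 - s) / 2" unfolding \<eta>_def using s by (simp_all only: min.cobounded1 min.cobounded2, simp)
    have sub: "{s - \<eta>..s + \<eta>} \<subseteq> {0<..<1}" using \<eta> s by auto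
    have "uniformly_continuous_on ({s - \<eta>..s + \<eta>} \<times> {0..?M}) (%(b, u). g b u)"
      by (intro compact_uniformly_continuous continuous_on_subset[OF cg] compact_Times compact_Icc) (use sub in auto)
    then obtain d where d: "0 < d" "!!p q. p \<in> {s - \<eta>..s + \<eta>} \<times> {0..?M} ==> q \<in> {s - \<eta>..s + \<eta>} \<times> {0..?M} ==>
        dist q p < d ==> dist ((%(b, u). g b u) q) ((%(b, u). g b u) p) < e / 2"
      unfolding uniformly_continuous_on_def using e by (metis half_gt_zero)
    show "\<exists>d>0. \<forall>b. b ~= s & norm (b - s) < d -->
      norm ((phi (flow b x) (F b) - phi (flow b x) (F s)) / (b - s) - phi (flow b x) (g s) - 0) < e"
    proof (intro exI[of _ "min d \<eta>"] conjI allI impI)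
      fix b assume b: "b ~= s & norm (b - s) < min d \<eta>"
      hence b0: "b ~= s" "\<bar>b - s\<bar> < d" "\<bar>b - s\<bar> < \<eta>" by auto
      hence bI: "b \<in> {s - \<eta>..s + \<eta>}" by (auto simp: abs_if split: if_splits)
      have b1: "0 < b" "b < 1" using sub bI by auto
      have "\<bar>phi (flow b x) (%u. (1 / (b - s)) * (F b u - F s u)) - phi (flow b x) (g s)\<bar> <= e / 2"
      proof (rule phi_close[OF fv _ cgs])
        show "cont0 (%u. (1 / (b - s)) * (F b u - F s u))" by (intro continuous_on_mult_left continuous_on_diff F b1 s)
        fix u assume u: "0 <= u" "u <= norm (adj (flow b x) oL flow b x)"
        hence uM: "u <= ?M" using norm_flow_sq_le[of b x] b1 by auto
        have "\<exists>z. \<bar>z - s\<bar> <= \<bar>b - s\<bar> & F b u - F s u = (b - s) * g z u"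
        proof (cases "s < b")
          case True
          have "((%b. F b u) has_real_derivative g z u) (at z)" if "s <= z" "z <= b" for z
            using that s b1 u by (intro g) auto
          from MVT2[OF True this] obtain z where "s < z" "z < b" "F b u - F s u = (b - s) * g z u" by auto
          thus ?thesis by (intro exI[of _ z]) auto
        next
          case False
          hence bs: "b < s" using b0 by simp
          have "((%b. F b u) has_real_derivative g z u) (at z)" if "b <= z" "z <= s" for z
            using that s b1 u by (intro g) auto
          from MVT2[OF bs this] obtain z where "b < z" "z < s" "F s u - F b u = (s - b) * g z u" by auto
          thus ?thesis by (intro exI[of _ z]) (auto simp: algebra_simps)
        qed
        then obtain z where z: "\<bar>z - s\<bar> <= \<bar>b - s\<bar>" "F b u - F s u = (b - s) * g z u" by blast
        have zI: "z \<in> {s - \<eta>..s + \<eta>}" using z(1) b0(3) by (auto simp: abs_le_iff)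
        have "dist (g z u) (g s u) < e / 2"
          using d(2)[of "(s, u)" "(z, u)"] u uM zI z(1) b0(2) \<eta>(1) by (simp add: dist_Pair_Pair dist_real_def)
        moreover have "(1 / (b - s)) * (F b u - F s u) = g z u" using z(2) b0(1) by simp
        ultimately show "\<bar>(1 / (b - s)) * (F b u - F s u) - g s u\<bar> <= e / 2" by (simp add: dist_real_def)
      qed
      moreover have "phi (flow b x) (%u. (1 / (b - s)) * (F b u - F s u))
        = (1 / (b - s)) * (phi (flow b x) (F b) - phi (flow b x) (F s))"
      proof -
        have "phi (flow b x) (%u. (1 / (b - s)) * (F b u - F s u)) = (1 / (b - s)) * phi (flow b x) (%u. F b u - F s u)"
          by (intro phi_scale fv continuous_on_diff F b1 s)
        also have "phi (flow b x) (%u. F b u - F s u) = phi (flow b x) (F b) - phi (flow b x) (F s)"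
          by (intro phi_diff fv F b1 s)
        finally show ?thesis .
      qed
      ultimately show "norm ((phi (flow b x) (F b) - phi (flow b x) (F s)) / (b - s) - phi (flow b x) (g s) - 0) < e"
        using e by simp
    qed (use d \<eta> in auto)
  qed
  have "((%b. ((phi (flow b x) (F b) - phi (flow b x) (F s)) / (b - s) - phi (flow b x) (g s)) + phi (flow b x) (g s)
      + (phi (flow b x) (F s) - phi (flow s x) (F s)) / (b - s)) \<longlongrightarrow> 0 + phi y (g s) + ?D) (at s)"
    by (intro tendsto_add C B A)
  moreover have "((phi (flow b x) (F b) - phi (flow b x) (F s)) / (b - s) - phi (flow b x) (g s)) + phi (flow b x) (g s)
      + (phi (flow b x) (F s) - phi (flow s x) (F s)) / (b - s) = (phi (flow b x) (F b) - phi (flow s x) (F s)) / (b - s)" for b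
    by (simp add: diff_divide_distrib)
  ultimately show ?thesis by (simp add: has_field_derivative_iff)
qed

subsection \<open>Hypercontractivity on elements of finite support\<close>

lemma powr_deriv_within:
  fixes e u :: real
  assumes e: "1 < e" and u: "0 <= u"
  shows "((%u. u powr e) has_real_derivative e * u powr (e - 1)) (at u within {0..})"
proof (cases "u = 0")
  case True
  have "((%h. h powr (e - 1)) \<longlongrightarrow> 0 powr (e - 1)) (at 0 within {0..})"
  proof -
    have "cont0 (%h. h powr (e - 1))" using e by (intro cont0_powr) simp
    thus ?thesis unfolding continuous_on_def by blast
  qed
  moreover have "\<forall>\<^sub>F h in at 0 within {0..}. h powr (e - 1) = (h powr e - 0 powr e) / (h - 0)"
    by (auto simp: eventually_at_filter powr_diff)
  ultimately have "((%h. (h powr e - 0 powr e) / (h - 0)) \<longlongrightarrow> 0 powr (e - 1)) (at 0 within {0..})"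
    by (rule Lim_transform_eventually)
  thus ?thesis using True by (simp add: has_field_derivative_iff)
next
  case False
  hence "((%u. u powr e) has_real_derivative e * u powr (e - 1)) (at u)" using u by (auto intro!: derivative_eq_intros)
  thus ?thesis by (rule has_field_derivative_at_within)
qed

lemma flow_mult: "x \<in> fin_vN ==> flow s (flow t x) = flow (s * t) x"
  by (rule vN_eqI_coef) (simp_all add: flow_fin fin_vN coef_flow power_mult_distrib)

lemma flow_symmetric:
  assumes "x \<in> fin_vN" "z \<in> fin_vN"
  shows "inner (flow s x vac) (z vac) = inner (x vac) (flow s z vac)"
proof -
  have "supp (flow s x) \<subseteq> supp x" using assms by (auto simp: supp_def coef_flow)
  thus ?thesis using assms unfolding inner_lform[OF flow_fin(1)] inner_lform[OF assms(1)]
    by (simp add: lform_eq[OF finite_supp[OF assms(1)]] coef_flow mult_ac)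
qed

lemma flow_zero: "flow s 0 = 0" by (simp add: flow_def)

lemma norm_flow_mono:
  assumes x: "x \<in> fin_vN" and s: "0 <= s" "s <= 1"
  shows "norm (flow s x vac) <= norm (x vac)"
proof -
  have "(norm (flow s x vac))^2 <= (norm (flow 1 x vac))^2"
    unfolding norm_sq_lform[OF flow_fin(1)] using s by (intro lform_flow_mono x) auto
  thus ?thesis using x by (simp add: power2_le_iff_abs_le)
qed

lemma phi_powr_pos:
  assumes x: "x \<in> group_vN" "x ~= 0" and p: "2 <= p"
  shows "0 < phi x (%u. u powr (p / 2))"
proof -
  have "x vac ~= 0" using vN_eqI_delta[OF x(1) vN_0] x(2) by auto
  hence "0 < pnorm 2 x" using x by (simp add: pnorm_2)
  also have "... <= pnorm p x" using x p by (intro pnorm_mono) auto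
  finally have "pnorm p x ~= 0" by simp
  hence "phi x (%u. u powr (p / 2)) ~= 0" using x p by (auto simp: pnorm_eq)
  thus ?thesis using phi_powr_nonneg[OF x(1), of "p / 2"] p by simp
qed

text \<open>The logarithm A(t) of the Q(t)-norm of \<open>flow t x\<close> is nondecreasing on
  [s, 1]. Its derivative combines Q' times the entropy with the derivative of the flow, and
  \<open>stroock_varopoulos\<close> compares the two.\<close>

theorem gross:
  fixes x :: "nat free_group op"
  assumes x: "x \<in> fin_vN" and p: "2 <= p" "p <= q" and s: "0 < s" "s <= 1" "(q - 1) * s^2 <= p - 1"
  shows "pnorm q (flow s x) <= pnorm p x"
proof -
  have fv: "flow t x \<in> group_vN" for t using flow_fin by auto
  have xv: "x \<in> group_vN" using x by auto
  \<comment> \<open>In the cases q = 2 and s = 1 the hypotheses force p = q; removing them leaves a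
    path of exponents above 2 in its interior.\<close>
  consider "x = 0" | "q = 2" | "s = 1" | "x ~= 0" "2 < q" "s < 1" using p s by linarith
  thus ?thesis
  proof cases
    case 1
    thus ?thesis using p by (simp add: flow_zero)
  next
    case 2
    hence "p = 2" using p by simp
    thus ?thesis using 2 norm_flow_mono[OF x, of s] s by (simp add: pnorm_2 fv xv)
  next
    case 3
    hence "p = q" using s p by simp
    thus ?thesis using 3 x by simp
  next
    case 4
    note x0 = 4(1) and q2 = 4(2) and s1 = 4(3)
    \<comment> \<open>Solves s^(-2c) = (q - 1)/(p - 1). The condition c <= 1 is exactly (q - 1) s^2
      <= p - 1.\<close>
    define c where "c = ln ((q - 1) / (p - 1)) / (- 2 * ln s)"
    have ls: "ln s < 0" using s s1 by simp
    have c01: "0 <= c" "c <= 1"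
    proof -
      show "0 <= c" unfolding c_def using ls p by (intro divide_nonneg_pos) auto
      have "(q - 1) / (p - 1) <= 1 / s^2" using s p by (simp add: field_simps)
      hence "ln ((q - 1) / (p - 1)) <= ln (1 / s^2)" using s p by (intro ln_mono) auto
      also have "... = - 2 * ln s" using s by (simp add: ln_div ln_realpow)
      finally show "c <= 1" unfolding c_def using ls by (subst pos_divide_le_eq) auto
    qed
    \<comment> \<open>The path from p at t = 1 to q at t = s with Q' = -2c (Q - 1)/t. Then Q' times
      Q^2/(2(Q - 1)) is -c Q^2/t, which the flow term Q^2/t outweighs because c <= 1.\<close>
    define Q where "Q = (%t. 1 + (p - 1) * t powr (- 2 * c))"
    define Q' where "Q' = (%t. - 2 * c * (Q t - 1) / t)"
    have Q1: "Q 1 = p" by (simp add: Q_def)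
    have Qs: "Q s = q"
    proof -
      have "s powr (- 2 * c) = exp (ln ((q - 1) / (p - 1)))" using s ls by (simp add: powr_def c_def)
      also have "... = (q - 1) / (p - 1)" using p by (intro exp_ln) auto
      finally show ?thesis using p by (simp add: Q_def)
    qed
    have Qge: "p <= Q t" if "0 < t" "t <= 1" for t
    proof -
      have "t powr 0 <= t powr (- 2 * c)" using that c01 by (intro powr_mono') auto
      hence "(p - 1) * 1 <= (p - 1) * t powr (- 2 * c)" using p that by (intro mult_left_mono) auto
      thus ?thesis by (simp add: Q_def)
    qed
    have Q2: "2 < Q t" if "0 < t" "t < 1" for t
    proof (cases "p = 2")
      case True
      hence "0 < c" unfolding c_def using q2 ls by (intro divide_pos_pos) auto
      hence "t powr 0 < t powr (- 2 * c)" using that by (intro powr_less_mono') auto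
      thus ?thesis using True that by (simp add: Q_def)
    next
      case False
      thus ?thesis using Qge[of t] p that by simp
    qed
    have Q2': "2 <= Q t" if "0 < t" "t <= 1" for t using Qge[OF that] p by simp
    have dQ: "(Q has_real_derivative Q' t) (at t)" if "0 < t" for t
      unfolding Q_def Q'_def using that by (auto intro!: derivative_eq_intros simp: powr_diff)
    have cQ: "continuous_on {0<..} Q" unfolding Q_def by (intro continuous_intros) auto
    have cQ': "continuous_on {0<..} Q'" unfolding Q'_def by (intro continuous_intros cQ) auto
    define F where "F = (%b u :: real. u powr (Q b / 2))"
    define g where "g = (%b u :: real. u powr (Q b / 2) * (Q' b / 2 * ln u))"
    define \<Phi> where "\<Phi> = (%t. phi (flow t x) (F t))"
    have cF: "cont0 (F b)" if "0 < b" "b <= 1" for b unfolding F_def using Q2'[OF that] by (intro cont0_powr) simp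
    have c\<Phi>: "continuous_on {s..1} \<Phi>" unfolding \<Phi>_def
    proof (rule phi_flow_continuous2[OF x])
      show "continuous_on ({s..1} \<times> {0..}) (%(b, u). F b u)" unfolding F_def case_prod_unfold
      proof (rule continuous_on_powr')
        show "continuous_on ({s..1} \<times> {0 :: real..}) (%x. Q (fst x) / 2)"
          by (intro continuous_on_divide continuous_on_const continuous_on_compose2[OF cQ continuous_on_fst[OF continuous_on_id]])
            (use s in auto)
        show "\<forall>x\<in>{s..1} \<times> {0 :: real..}. 0 <= snd x & (snd x = 0 --> 0 < Q (fst x) / 2)"
        proof
          fix x assume "x \<in> {s..1} \<times> {0 :: real..}"
          hence "2 <= Q (fst x)" "0 <= snd x" using Q2'[of "fst x"] s by auto
          thus "0 <= snd x & (snd x = 0 --> 0 < Q (fst x) / 2)" by simp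
        qed
      qed (intro continuous_intros)
    qed (use s in simp)
    \<comment> \<open>Continuity at u = 0: split off the factor u ln u, which is continuous there,
      and note that the remaining exponent Q/2 - 1 is positive.\<close>
    have cg: "continuous_on ({0<..<1} \<times> {0..}) (%(b, u). g b u)"
    proof -
      have "continuous_on ({0<..<1} \<times> {0..}) (%x. snd x powr (Q (fst x) / 2 - 1) * (Q' (fst x) / 2 * (snd x * ln (snd x))))"
      proof (rule continuous_on_mult[OF continuous_on_powr' continuous_on_mult])
        show "continuous_on ({0<..<1 :: real} \<times> {0 :: real..}) (%x. Q (fst x) / 2 - 1)"
          by (intro continuous_on_diff continuous_on_divide continuous_on_const continuous_on_compose2[OF cQ continuous_on_fst[OF continuous_on_id]]) auto
        show "continuous_on ({0<..<1 :: real} \<times> {0 :: real..}) (%x. Q' (fst x) / 2)"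
          by (intro continuous_on_divide continuous_on_const continuous_on_compose2[OF cQ' continuous_on_fst[OF continuous_on_id]]) auto
        have "continuous_on ({0<..<1} \<times> {0..}) (%x :: real \<times> real. (%u. u * ln u) (snd x))"
          by (rule continuous_on_compose2[OF cont0_xlnx continuous_on_snd[OF continuous_on_id]]) auto
        thus "continuous_on ({0<..<1} \<times> {0..}) (%x :: real \<times> real. snd x * ln (snd x))" by simp
        show "\<forall>x\<in>{0<..<1 :: real} \<times> {0 :: real..}. 0 <= snd x & (snd x = 0 --> 0 < Q (fst x) / 2 - 1)"
        proof
          fix x assume "x \<in> {0<..<1 :: real} \<times> {0 :: real..}"
          hence "2 < Q (fst x)" "0 <= snd x" using Q2[of "fst x"] by auto
          thus "0 <= snd x & (snd x = 0 --> 0 < Q (fst x) / 2 - 1)" by simp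
        qed
      qed (intro continuous_intros)
      thus ?thesis
      proof (rule continuous_on_eq)
        fix x assume "x \<in> {0<..<1 :: real} \<times> {0 :: real..}"
        hence "0 <= snd x" by auto
        thus "snd x powr (Q (fst x) / 2 - 1) * (Q' (fst x) / 2 * (snd x * ln (snd x))) = (case x of (b, u) => g b u)"
          by (cases "snd x = 0") (auto simp: g_def case_prod_unfold powr_diff)
      qed
    qed
    have dF: "((%b. F b u) has_real_derivative g b u) (at b)" if "0 < b" "0 <= u" for b u
    proof (cases "u = 0")
      case False
      have "((%b. exp (Q b / 2 * ln u)) has_real_derivative exp (Q b / 2 * ln u) * (Q' b / 2 * ln u)) (at b)"
        by (auto intro!: derivative_eq_intros dQ that)
      thus ?thesis using False that by (simp add: F_def g_def powr_def)
    qed (simp add: F_def g_def)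
    define I where "I = (%t. inner (num_op (flow t x) vac) ((flow t x oL pos_calc (%u. u powr ((Q t - 2) / 2)) (adj (flow t x) oL flow t x)) vac))"
    define Ent where "Ent = (%t. phi (flow t x) (%u. u powr (Q t / 2) * ln (u powr (Q t / 2))))"
    have d\<Phi>: "(\<Phi> has_real_derivative Q' t / Q t * Ent t + Q t / t * I t) (at t)" if t: "0 < t" "t < 1" for t
    proof -
      let ?f = "%u. Q t / 2 * u powr (Q t / 2 - 1)"
      have e: "0 < Q t / 2 - 1" "1 < Q t / 2" using Q2[OF t] by auto
      have cf: "cont0 ?f" by (intro continuous_on_mult_left cont0_powr e)
      have a: "pos_op (adj (flow t x) oL flow t x)" by (rule vN_pos_self[OF fv])
      have "(\<Phi> has_real_derivative phi (flow t x) (g t) + 2 / t * inner (num_op (flow t x) vac)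
          ((flow t x oL pos_calc ?f (adj (flow t x) oL flow t x)) vac)) (at t)" unfolding \<Phi>_def
      proof (rule phi_flow_deriv2[OF x t cf _ cF dF cg])
        show "(F t has_real_derivative ?f u) (at u within {0..})" if "0 <= u" for u
          unfolding F_def by (rule powr_deriv_within[OF e(2) that])
      qed (use t in auto)
      also have "pos_calc ?f (adj (flow t x) oL flow t x) = (Q t / 2) *\<^sub>R pos_calc (%u. u powr ((Q t - 2) / 2)) (adj (flow t x) oL flow t x)"
        using cf_scale[OF a cont0_powr[OF e(1)], of "Q t / 2"] by (simp add: diff_divide_distrib)
      also have "phi (flow t x) (g t) = phi (flow t x) (%u. Q' t / Q t * (u powr (Q t / 2) * ln (u powr (Q t / 2))))"
        using Q2[OF t] by (intro phi_cong) (simp add: g_def)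
      also have "... = Q' t / Q t * Ent t" unfolding Ent_def
        by (intro phi_scale fv continuous_on_compose2[OF cont0_xlnx cont0_powr]) (use e in auto)
      finally show ?thesis by (simp add: I_def compose_linear blinfun.scaleR_left)
    qed
    have fx0: "flow t x ~= 0" if "0 < t" for t
    proof
      assume "flow t x = 0"
      hence "coef (flow t x) g = 0" for g by (simp add: coef_def zero_ell2.rep_eq)
      hence "coef x g = 0" for g using coef_flow(1)[OF x, of t g] that by simp
      hence "x = 0" by (intro vN_eqI_coef xv vN_0) (simp add: coef_def zero_ell2.rep_eq)
      thus False using x0 by simp
    qed
    have \<Phi>0: "0 < \<Phi> t" if "0 < t" "t <= 1" for t
      unfolding \<Phi>_def F_def by (rule phi_powr_pos[OF fv fx0[OF that(1)] Q2'[OF that]])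
    define A where "A = (%t. ln (\<Phi> t) / Q t)"
    have cA: "continuous_on {s..1} A" unfolding A_def
    proof (intro continuous_on_divide continuous_on_ln c\<Phi> continuous_on_subset[OF cQ] ballI)
      fix t assume "t \<in> {s..1}"
      hence t: "0 < t" "t <= 1" using s by auto
      show "\<Phi> t ~= 0" using \<Phi>0[OF t] by simp
      show "Q t ~= 0" using Q2'[OF t] by simp
    qed (use s in auto)
    have dA: "\<exists>D. (A has_real_derivative D) (at t) & 0 <= D" if t: "0 < t" "t < 1" for t
    proof -
      let ?d\<Phi> = "Q' t / Q t * Ent t + Q t / t * I t"
      have P: "0 < \<Phi> t" using \<Phi>0[of t] t by simp
      have q: "2 < Q t" by (rule Q2[OF t])
      have "(A has_real_derivative (?d\<Phi> / \<Phi> t * Q t - ln (\<Phi> t) * Q' t) / (Q t * Q t)) (at t)"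
        unfolding A_def using d\<Phi>[OF t] dQ[OF t(1)] P q by (auto intro!: derivative_eq_intros)
      moreover have "0 <= (?d\<Phi> / \<Phi> t * Q t - ln (\<Phi> t) * Q' t) / (Q t * Q t)"
      proof -
        note sv = stroock_varopoulos[OF flow_fin(1) q, of t x]
        have Ent: "Ent t - \<Phi> t * ln (\<Phi> t) <= (Q t)^2 / (2 * (Q t - 1)) * I t" and I0: "0 <= I t"
          using sv by (simp_all only: Ent_def \<Phi>_def F_def I_def)
        have Q'0: "Q' t <= 0" unfolding Q'_def using c01 q t by (intro divide_nonpos_pos) (auto simp: mult_nonneg_nonneg)
        have "Q' t * ((Q t)^2 / (2 * (Q t - 1)) * I t) <= Q' t * (Ent t - \<Phi> t * ln (\<Phi> t))"
          by (rule mult_left_mono_neg[OF Ent Q'0])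
        moreover have "Q' t * ((Q t)^2 / (2 * (Q t - 1)) * I t) = - c * ((Q t)^2 / t * I t)"
          using q t by (simp add: Q'_def field_simps)
        moreover have "c * ((Q t)^2 / t * I t) <= 1 * ((Q t)^2 / t * I t)" using c01 I0 t by (intro mult_right_mono) auto
        ultimately have "0 <= Q' t * (Ent t - \<Phi> t * ln (\<Phi> t)) + (Q t)^2 / t * I t" by linarith
        also have "... = (?d\<Phi> / \<Phi> t * Q t - ln (\<Phi> t) * Q' t) * \<Phi> t"
          using P q t by (simp add: field_simps power2_eq_square)
        finally show ?thesis using P q by (simp add: zero_le_mult_iff)
      qed
      ultimately show ?thesis by blast
    qed
    have "A s <= A 1"
    proof (rule DERIV_nonneg_imp_increasing_open[of s 1 A])
      fix t assume "s < t" "t < 1"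
      thus "\<exists>y. (A has_real_derivative y) (at t) & 0 <= y" using dA[of t] s by simp
    qed (use s cA in auto)
    moreover have "exp (A t) = pnorm (Q t) (flow t x)" if "0 < t" "t <= 1" for t
      using \<Phi>0[OF that] Q2'[OF that] unfolding pnorm_eq[OF fv, of "Q t" t] by (subst pnorm_eq[OF fv]) (auto simp: A_def \<Phi>_def F_def powr_def)
    ultimately have "pnorm (Q s) (flow s x) <= pnorm (Q 1) (flow 1 x)"
      using s by (metis exp_le_cancel_iff order_refl zero_less_one)
    thus ?thesis by (simp add: Q1 Qs x)
  qed
qed

text \<open>Passing to conjugate exponents inverts p - 1 and q - 1, so the time condition is the
  same for the pair (q', p'), which lies above 2; the flow is symmetric for the pairing.\<close>

lemma gross_dual:
  fixes x :: "nat free_group op"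
  assumes x: "x \<in> fin_vN" and p: "1 < p" "p <= q" "q <= 2" and s: "0 < s" "s <= 1" "(q - 1) * s^2 <= p - 1"
  shows "pnorm q (flow s x) <= pnorm p x"
proof -
  obtain q' where q': "q' > 1" "1 / q + 1 / q' = 1" using conj_exp_ex[of q] p by auto
  obtain p' where p': "p' > 1" "1 / p + 1 / p' = 1" using conj_exp_ex[of p] p by auto
  have q1: "q > 1" using p by simp
  have e: "(q - 1) * (q' - 1) = 1" "(p - 1) * (p' - 1) = 1" using conj_exp(3)[OF q1 q'] conj_exp(3)[OF p(1) p'] by auto
  have q'1: "q' - 1 = 1 / (q - 1)" "p' - 1 = 1 / (p - 1)" using e p by (simp_all add: field_simps)
  have q2: "2 <= q'"
  proof -
    have "1 <= q' - 1" unfolding q'1 using p by simp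
    thus ?thesis by simp
  qed
  have qp: "q' <= p'"
  proof -
    have "q' - 1 <= p' - 1" unfolding q'1 using p by (intro divide_left_mono) auto
    thus ?thesis by simp
  qed
  have s': "(p' - 1) * s^2 <= q' - 1" unfolding q'1 using s(3) p by (simp add: field_simps)
  let ?y = "flow s x"
  have y: "?y \<in> fin_vN" by (rule flow_fin)
  show ?thesis
  proof (rule dual_pnorm[OF fin_vN[OF y] q1 q'])
    show "0 <= pnorm p x" using x p by (intro pnorm_nonneg) auto
    fix r
    let ?z = "?y oL pev r (adj ?y oL ?y)"
    have z: "?z \<in> fin_vN" using y by (intro fin_compose fin_pev fin_self)
    have "inner (?y vac) (?z vac) = inner (x vac) (flow s ?z vac)" by (rule flow_symmetric[OF x z])
    also have "... = inner (flow s ?z vac) (x vac)" by (rule inner_commute)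
    also have "... <= pnorm p x * pnorm p' (flow s ?z)" by (rule holder[OF fin_vN[OF x] fin_vN[OF flow_fin(1)] p(1) p'])
    also have "... <= pnorm p x * pnorm q' ?z"
      using x p by (intro mult_left_mono gross[OF z q2 qp s(1,2) s'] pnorm_nonneg) auto
    finally show "inner (?y vac) (?z vac) <= pnorm p x * pnorm q' ?z" .
  qed
qed

theorem hypercontractive_nat:
  fixes x :: "nat free_group op"
  assumes x: "x \<in> fin_vN" and p: "1 < p" "p <= q" and s: "0 < s" "s <= 1" "(q - 1) * s^2 <= p - 1"
  shows "pnorm q (flow s x) <= pnorm p x"
proof -
  consider "2 <= p" | "q <= 2" | "p < 2" "2 < q" by linarith
  thus ?thesis
  proof cases
    case 3
    \<comment> \<open>The flow parameter that leads from exponent p exactly to 2; the remaining s /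
      s1 suffices for the way from 2 to q.\<close>
    define s1 where "s1 = sqrt (p - 1)"
    have s1: "0 < s1" "s1 <= 1" "s1^2 = p - 1" using p 3 by (auto simp: s1_def)
    have "1 * s^2 <= (q - 1) * s^2" using 3 by (intro mult_right_mono) auto
    hence "s^2 <= s1^2" using s(3) s1(3) by linarith
    hence ss: "s <= s1" by (rule power2_le_imp_le) (use s1 in simp)
    have "flow s x = flow (s / s1) (flow s1 x)" using s1 x by (simp add: flow_mult)
    moreover have "pnorm q (flow (s / s1) (flow s1 x)) <= pnorm 2 (flow s1 x)"
    proof (rule gross[OF flow_fin(1)])
      show "(q - 1) * (s / s1)^2 <= 2 - 1" using p s(3) by (simp add: power_divide s1(3))
    qed (use 3 s s1 ss in auto)
    moreover have "pnorm 2 (flow s1 x) <= pnorm p x" using 3 p s1 by (intro gross_dual x) auto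
    ultimately show ?thesis by simp
  qed (use assms gross gross_dual in auto)
qed

text \<open>An injection of the finite generating set into \<open>nat\<close> induces a trace
  preserving homomorphism that keeps word lengths, hence preserves all norms and commutes with the
  flow.\<close>

theorem hypercontractive_fin:
  fixes x :: "'n::finite free_group op"
  assumes x: "x \<in> fin_vN" and p: "1 < p" "p <= q" and s: "0 < s" "s <= 1" "(q - 1) * s^2 <= p - 1"
  shows "pnorm q (flow s x) <= pnorm p x"
proof -
  obtain \<iota> :: "'n => nat" where \<iota>: "inj \<iota>" using finite_imp_inj_to_nat_seg[of "UNIV :: 'n set"] by auto
  define f where "f = (%l :: 'n letter. (\<iota> (fst l), snd l))"
  interpret letter_map f using \<iota> by unfold_locales (auto simp: f_def inv_letter_def inj_def prod_eq_iff)
  define \<phi> where "\<phi> = (%g. lreg (lmap f g))"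
  have h: "\<phi> (g * h) = \<phi> g oL \<phi> h" for g h by (simp add: \<phi>_def lmap_mult lreg_mult)
  have v: "\<phi> g \<in> fin_vN" for g by (simp add: \<phi>_def fin_lreg1)
  have a: "\<phi> (inverse g) = adj (\<phi> g)" for g by (simp add: \<phi>_def lmap_inverse adj_lreg)
  have t: "coef (\<phi> g) 1 = (if g = 1 then 1 else 0)" for g using lmap_eq_iff[of 1 g] by (auto simp: \<phi>_def coef_lreg)
  have 1: "\<phi> 1 = id_blinfun" by (simp add: \<phi>_def)
  have pn: "pnorm r (lext \<phi> y) = pnorm r y" if "y \<in> fin_vN" "r > 0" for r y
    using phi_lext[where \<phi> = \<phi>, OF h fin_vN[OF v] a t 1 that(1) cont0_powr, of "r / 2"] that
    by (simp add: pnorm_eq lext_vN v fin_vN)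
  have fl: "lext \<phi> (flow s y) = flow s (lext \<phi> y)" if "y \<in> fin_vN" for y using that
  proof (induction rule: fin_induct)
    case (lreg c g)
    have fl: "flow s (scaleC_op c (lreg h)) = scaleC_op (c * of_real (s ^ word_length h)) (lreg h)" for h :: "'z free_group"
      unfolding flow_def lext_lreg scaleC_op_of_real[symmetric] scaleC_op_simps by simp
    show ?case unfolding fl lext_lreg \<phi>_def by (simp add: fl word_length_lmap)
  next
    case (add y z)
    have fl: "flow s (y + z) = flow s y + flow s z" if "y \<in> fin_vN" "z \<in> fin_vN" for y z :: "'z free_group op"
      unfolding flow_def by (rule lext_add[OF that])
    show ?case using add by (simp add: lext_add flow_fin lext_fin v fl)
  qed
  have "pnorm q (flow s (lext \<phi> x)) <= pnorm p (lext \<phi> x)" by (rule hypercontractive_nat[OF lext_fin[OF v] p s])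
  thus ?thesis using p by (simp add: fl[OF x, symmetric] pn flow_fin x)
qed

section \<open>Extension to the von Neumann algebra and its completions\<close>

subsection \<open>The Poisson semigroup on the von Neumann algebra\<close>

lemma pnorm_le_norm:
  assumes x: "x \<in> group_vN" and p: "0 < p"
  shows "pnorm p x <= norm x"
proof (rule pnorm_leI[OF x p norm_ge_zero])
  have "\<bar>phi x (%s. s powr (p / 2))\<bar> <= norm x powr p * (norm (delta 1 :: 'a free_group ell2))^2"
    unfolding phi_def
  proof (rule spf_abs_le[OF vN_pos_self[OF x] cont0_powr])
    fix s assume s: "0 <= s" "s <= norm (adj x oL x)"
    have "norm (adj x oL x) <= norm x * norm x"
      by (rule order_trans[OF norm_blinfun_compose]) (intro mult_right_mono norm_adj_le vN_bounded x norm_ge_zero)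
    hence "s powr (p / 2) <= ((norm x)^2) powr (p / 2)" using s p by (intro powr_mono2) (auto simp: power2_eq_square)
    also have "... = norm x powr p" by (cases "norm x = 0") (simp_all add: powr_powr flip: powr_numeral)
    finally show "\<bar>s powr (p / 2)\<bar> <= norm x powr p" by simp
  qed (use p in simp)
  thus "phi x (%s. s powr (p / 2)) <= norm x powr p" by simp
qed

text \<open>The Cauchy-Schwarz bound for the trace norm of z = C adj D: a regularised polar
  decomposition gives a contraction W for which tr(adj W z) is close to the trace norm, and the
  trace property moves \<open>adj W\<close> next to \<open>C\<close>.\<close>

lemma phi_sqrt_le:
  assumes C: "C \<in> group_vN" and D: "D \<in> group_vN"
  shows "phi (C oL adj D) (%u. u powr (1 / 2)) <= norm (C vac) * norm (D vac)"
proof (rule field_le_epsilon)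
  fix e0 :: real assume e0: "0 < e0"
  define e where "e = e0^2"
  have e: "0 < e" "sqrt e = e0" using e0 by (auto simp: e_def)
  define z where "z = C oL adj D"
  have zv: "z \<in> group_vN" unfolding z_def by (intro vN_compose vN_adj C D)
  \<comment> \<open>Stands for the inverse of \<bar>z\<bar>, which need not exist; the shift by e
    costs at most \<open>e0 = sqrt e\<close> in the end.\<close>
  let ?\<rho> = "%u. (u + e) powr (- 1 / 2)"
  let ?r = "pos_calc ?\<rho> (adj z oL z)"
  have c: "cont0 ?\<rho>" by (rule cont0_powr_shift[OF e(1)])
  define W where "W = z oL ?r"
  have a: "pos_op (adj z oL z)" by (rule vN_pos_self[OF zv])
  have r: "?r \<in> group_vN" by (rule vN_calc[OF a vN_self[OF zv] c])
  have W: "W \<in> group_vN" unfolding W_def by (intro vN_compose zv r)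
  have rs: "adj ?r = ?r" by (rule adj_sym[OF vN_bounded[OF r] cf_sym[OF a c]])
  have WW: "adj W oL W = pos_calc (%u. ?\<rho> u * (u * ?\<rho> u)) (adj z oL z)"
  proof -
    have "adj W oL W = ?r oL ((adj z oL z) oL ?r)" unfolding W_def by (simp only: adj_compose vN_bounded zv r rs compose_assoc)
    also have "(adj z oL z) oL ?r = pos_calc (%u. u * ?\<rho> u) (adj z oL z)"
      using cf_mult[OF a continuous_on_id c] by (simp only: cf_id[OF a])
    finally show ?thesis using cf_mult[OF a c continuous_on_mult[OF continuous_on_id c]] by simp
  qed
  have "norm (adj W oL W) <= 1" unfolding WW
  proof (rule cf_norm_le[OF a])
    show "cont0 (%u. ?\<rho> u * (u * ?\<rho> u))" by (intro continuous_on_mult continuous_on_id c)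
    fix s :: real assume s: "0 <= s"
    have "?\<rho> s * ?\<rho> s = 1 / (s + e)" using s e by (simp add: powr_add[symmetric] powr_minus_divide)
    hence "?\<rho> s * (s * ?\<rho> s) = s / (s + e)" by (metis mult.assoc mult.commute mult.right_neutral times_divide_eq_right)
    thus "\<bar>?\<rho> s * (s * ?\<rho> s)\<bar> <= 1" using s e by (simp add: divide_le_eq)
  qed
  have nW: "norm (adj W v) <= norm v" for v
  proof -
    have "(norm (W u))^2 <= (norm u)^2" for u
    proof -
      have "(norm (W u))^2 = inner ((adj W oL W) u) u" using W by (simp add: power2_norm_eq_inner adj_inner2 vN_bounded)
      also have "... <= norm ((adj W oL W) u) * norm u" by (rule norm_cauchy_schwarz)
      also have "... <= (norm (adj W oL W) * norm u) * norm u" by (intro mult_right_mono norm_blinfun norm_ge_zero)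
      also have "... <= (1 * norm u) * norm u" by (intro mult_right_mono \<open>norm (adj W oL W) <= 1\<close> norm_ge_zero)
      finally show ?thesis by (simp add: power2_eq_square)
    qed
    hence "norm (W u) <= 1 * norm u" for u using power2_le_imp_le[of "norm (W u)" "norm u"] by simp
    hence "norm W <= 1" by (intro norm_blinfun_bound) auto
    hence "norm (adj W) <= 1" using norm_adj_le[OF vN_bounded[OF W]] by simp
    thus ?thesis using norm_blinfun[of "adj W" v] mult_right_mono[of "norm (adj W)" 1 "norm v"] by simp
  qed
  have "phi z (%u. u * ?\<rho> u) = inner (z vac) (W vac)"
    unfolding W_def by (rule phi_compose_poly(3)[OF zv c c, symmetric])
  also have "... = tr (adj W oL z)" by (rule tr_adj_compose[OF W, symmetric])
  also have "adj W oL z = (adj W oL C) oL adj D" by (simp only: z_def compose_assoc)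
  also have "tr ... = tr (adj D oL (adj W oL C))" by (intro tr_commute vN_compose vN_adj W C D)
  also have "... = inner ((adj W oL C) vac) (D vac)" by (rule tr_adj_compose[OF D])
  also have "... <= norm (adj W (C vac)) * norm (D vac)" using norm_cauchy_schwarz by simp
  also have "... <= norm (C vac) * norm (D vac)" by (intro mult_right_mono nW norm_ge_zero)
  finally have 1: "phi z (%u. u * ?\<rho> u) <= norm (C vac) * norm (D vac)" .
  have ch: "cont0 (%u. u powr (1 / 2))" by (rule cont0_powr) simp
  have "\<bar>phi z (%u. u powr (1 / 2)) - phi z (%u. u * ?\<rho> u)\<bar> <= e0"
  proof (rule phi_close[OF zv ch continuous_on_mult[OF continuous_on_id c]])
    fix u :: real assume u: "0 <= u"
    have r: "?\<rho> u = 1 / sqrt (u + e)" using u e by (simp add: powr_minus_divide powr_half_sqrt)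
    have se: "sqrt u <= sqrt (u + e)" "0 < sqrt (u + e)" using u e by auto
    have "sqrt (u + e) <= sqrt u + sqrt e" using u e by (intro sqrt_add_le_add_sqrt) auto
    have "u / sqrt (u + e) <= sqrt u"
    proof -
      have "sqrt u * sqrt u <= sqrt u * sqrt (u + e)" using se u by (intro mult_left_mono) auto
      thus ?thesis using u se by (simp add: divide_le_eq)
    qed
    moreover have "sqrt u - u / sqrt (u + e) <= e0"
    proof -
      have "sqrt u * sqrt (u + e) - u = sqrt u * (sqrt (u + e) - sqrt u)" using u by (simp add: right_diff_distrib)
      also have "... <= sqrt (u + e) * e0"
        using se u \<open>sqrt (u + e) <= sqrt u + sqrt e\<close> e by (intro mult_mono) auto
      finally have "(sqrt u * sqrt (u + e) - u) / sqrt (u + e) <= e0" using se by (simp add: divide_le_eq mult.commute)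
      thus ?thesis using se by (simp add: diff_divide_distrib)
    qed
    moreover have "u * ?\<rho> u = u / sqrt (u + e)" unfolding r by simp
    moreover have "u powr (1 / 2) = sqrt u" using u by (simp add: powr_half_sqrt)
    ultimately show "\<bar>u powr (1 / 2) - u * ?\<rho> u\<bar> <= e0" by linarith
  qed
  thus "phi (C oL adj D) (%u. u powr (1 / 2)) <= norm (C vac) * norm (D vac) + e0" using 1 unfolding z_def by linarith
qed

text \<open>Hypercontractivity with equal exponents p > 1 is contractivity on L_p; with Hoelder
  against \<open>x\<close> and p -> 1 it becomes contractivity for the trace norm, which
  \<open>phi_sqrt_le\<close> bounds. This is the estimate from which the multiplier is
  constructed.\<close>

lemma L1_contraction:
  fixes x :: "'n::finite free_group op"
  assumes x: "x \<in> group_vN" and C: "C \<in> fin_vN" and D: "D \<in> fin_vN" and s: "0 < s" "s <= 1"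
  shows "inner (flow s (C oL adj D) vac) (x vac) <= norm x * (norm (C vac) * norm (D vac))"
proof -
  let ?z = "C oL adj D"
  have z: "?z \<in> fin_vN" by (intro fin_compose fin_adj C D)
  have zv: "?z \<in> group_vN" using z by auto
  let ?M = "norm (adj ?z oL ?z)"
  define p where "p = (%k. 1 + 1 / real (Suc k))"
  have p: "1 < p k" "p k <= 2" for k by (auto simp: p_def)
  have lp: "p \<longlonglongrightarrow> 1"
    unfolding p_def using LIMSEQ_inverse_real_of_nat_add[of 1] by (simp add: inverse_eq_divide)
  have "uniformly_continuous_on ({1..2} \<times> {0..?M}) (%(b, u). u powr (b / 2))" unfolding case_prod_unfold
    by (intro compact_uniformly_continuous compact_Times compact_Icc continuous_on_powr' continuous_intros) auto
  note uc = this[unfolded uniformly_continuous_on_def]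
  have "uniform_limit {0..?M} (%k u. u powr (p k / 2)) (%u. u powr (1 / 2)) sequentially"
  proof (rule uniform_limitI)
    fix e :: real assume "0 < e"
    then obtain d where d: "0 < d" "!!p q. p \<in> {1..2} \<times> {0..?M} ==> q \<in> {1..2} \<times> {0..?M} ==> dist q p < d ==>
      dist ((%(b, u). u powr (b / 2)) q) ((%(b, u). u powr (b / 2)) p) < e" using uc by meson
    have "\<forall>\<^sub>F k in sequentially. dist (p k) 1 < d" by (rule tendstoD[OF lp d(1)])
    thus "\<forall>\<^sub>F k in sequentially. \<forall>u\<in>{0..?M}. dist (u powr (p k / 2)) (u powr (1 / 2)) < e"
    proof eventually_elim
      case (elim k)
      show ?case
      proof
        fix u assume "u \<in> {0..?M}"
        thus "dist (u powr (p k / 2)) (u powr (1 / 2)) < e"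
          using d(2)[of "(1, u)" "(p k, u)"] elim p[of k] by (simp add: dist_Pair_Pair dist_real_def)
      qed
    qed
  qed
  hence "(%k. phi ?z (%u. u powr (p k / 2))) \<longlonglongrightarrow> phi ?z (%u. u powr (1 / 2))"
    by (intro phi_uniform_limit[OF zv] cont0_powr) (use p in \<open>auto intro: less_trans[OF zero_less_one]\<close>)
  hence "(%k. phi ?z (%u. u powr (p k / 2)) powr (1 / p k)) \<longlonglongrightarrow> phi ?z (%u. u powr (1 / 2)) powr (1 / 1)"
  proof (intro tendsto_powr' tendsto_divide lp tendsto_const)
    have "0 <= phi ?z (%u. u powr (p k / 2))" for k using p[of k] by (intro phi_powr_nonneg zv) simp
    thus "phi ?z (%u. u powr (1 / 2)) ~= 0 \<or> (0 < 1 / (1 :: real) & (\<forall>\<^sub>F k in sequentially. 0 <= phi ?z (%u. u powr (p k / 2))))"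
      by simp
  qed simp_all
  moreover have "pnorm (p k) ?z = phi ?z (%u. u powr (p k / 2)) powr (1 / p k)" for k
    using p[of k] by (intro pnorm_eq zv) simp
  moreover have "0 <= phi ?z (%u. u powr (1 / 2))" by (intro phi_powr_nonneg zv) simp
  ultimately have L: "(%k. norm x * pnorm (p k) ?z) \<longlonglongrightarrow> norm x * phi ?z (%u. u powr (1 / 2))"
    by (intro tendsto_mult tendsto_const) simp
  have "inner (flow s ?z vac) (x vac) <= norm x * pnorm (p k) ?z" for k
  proof -
    obtain p' where p': "p' > 1" "1 / p k + 1 / p' = 1" using conj_exp_ex[OF p(1)[of k]] .
    have "inner (flow s ?z vac) (x vac) <= pnorm p' x * pnorm (p k) (flow s ?z)"
      by (rule holder[OF x fin_vN[OF flow_fin(1)] p'(1) p(1)]) (use p' in simp)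
    also have "... <= norm x * pnorm (p k) ?z"
    proof (intro mult_mono)
      show "pnorm p' x <= norm x" using p' by (intro pnorm_le_norm x) simp
      have "s^2 <= 1" using s by (simp add: power_le_one)
      hence "(p k - 1) * s^2 <= (p k - 1) * 1" using p[of k] by (intro mult_left_mono) auto
      thus "pnorm (p k) (flow s ?z) <= pnorm (p k) ?z" by (intro hypercontractive_fin z p(1) order_refl s) simp
      show "0 <= pnorm (p k) (flow s ?z)" using p[of k] flow_fin by (intro pnorm_nonneg) auto
    qed simp
    finally show ?thesis .
  qed
  hence "inner (flow s ?z vac) (x vac) <= norm x * phi ?z (%u. u powr (1 / 2))" by (intro LIMSEQ_le_const[OF L]) auto
  also have "... <= norm x * (norm (C vac) * norm (D vac))" using C D by (intro mult_left_mono phi_sqrt_le) auto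
  finally show ?thesis .
qed

text \<open>Commuting with right translations makes the matrix of \<open>T\<close> depend on g
  h^(-1) only; commuting with left ones makes that of \<open>S\<close> depend on h^(-1) g. The
  substitution g |-> k g^(-1) h identifies the matrix entries of the two products.\<close>

lemma vN_if_commutes_rreg:
  assumes T: "T \<in> bounded_ops" and c: "!!g v. T (rreg g v) = rreg g (T v)"
  shows "T \<in> group_vN"
proof -
  have "T oL S = S oL T" if S: "S \<in> commutant (range lreg)" for S
  proof (rule op_eqI_delta)
    have Sb: "S \<in> bounded_ops" using S by (simp add: commutant_iff)
    have Sl: "S (lreg g v) = lreg g (S v)" for g v
      using S unfolding commutant_iff by (metis blinfun_apply_blinfun_compose rangeI)
    show "T oL S \<in> bounded_ops" "S oL T \<in> bounded_ops" using T Sb by (auto intro: bounded_ops_compose)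
    have Sd: "Rep_ell2 (S (delta h)) g = Rep_ell2 (S vac) (inverse h * g)" for g h
      using Sl[of h "delta 1"] by (simp add: lreg_delta lreg_apply)
    have Td: "Rep_ell2 (T (delta h)) g = Rep_ell2 (T vac) (g * inverse h)" for g h
    proof -
      have "rreg (inverse h) vac = delta h"
      proof (rule ell2_eqI)
        fix k
        have "k * inverse h = 1 \<longleftrightarrow> k = h"
          by (metis free_group_left_inverse free_group_right_inverse mult.assoc mult.right_neutral mult_1)
        thus "Rep_ell2 (rreg (inverse h) vac) k = Rep_ell2 (delta h) k"
          by (simp add: rreg.rep_eq translate_right.rep_eq delta.rep_eq)
      qed
      thus ?thesis using c[of "inverse h" "delta 1"] by (simp add: rreg.rep_eq translate_right.rep_eq)
    qed
    have ad: "cnj (Rep_ell2 (adj R (delta k)) g) = Rep_ell2 (R (delta g)) k" if "R \<in> bounded_ops" for R :: "'a free_group op" and g k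
      using adj_props(2)[OF that, of "delta g" "delta k"] cinner_commute[of "delta g" "adj R (delta k)"]
      by (simp add: cinner_delta)
    fix h
    show "(T oL S) (delta h) = (S oL T) (delta h)"
    proof (rule ell2_eqI)
      fix k
      let ?F = "%g. Rep_ell2 (T vac) (g * inverse h) * Rep_ell2 (S vac) (inverse g * k)"
      have "Rep_ell2 ((T oL S) (delta h)) k = cinner (S (delta h)) (adj T (delta k))"
        by (simp add: adj_props(2)[OF T, symmetric] cinner_delta)
      also have "... = (\<Sum>\<^sub>\<infinity>g. Rep_ell2 (S vac) (inverse h * g) * Rep_ell2 (T vac) (k * inverse g))"
        unfolding cinner.rep_eq ad[OF T] by (simp add: Sd[of h] Td[symmetric])
      also have "... = (\<Sum>\<^sub>\<infinity>g. ?F (k * inverse g * h))"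
        by (intro infsum_cong) (simp add: mult.assoc free_inverse_mult mult.commute)
      also have "... = (\<Sum>\<^sub>\<infinity>g. ?F g)"
      proof (rule infsum_reindex_bij_betw)
        show "bij (%g. k * inverse g * h)"
          by (rule bij_betw_byWitness[where f' = "%g. h * inverse g * k"]) (auto simp: free_inverse_mult mult.assoc)
      qed
      also have "... = cinner (T (delta h)) (adj S (delta k))"
        unfolding cinner.rep_eq ad[OF Sb] by (simp add: Sd[symmetric] Td[of h])
      also have "... = Rep_ell2 ((S oL T) (delta h)) k" by (simp add: adj_props(2)[OF Sb, symmetric] cinner_delta)
      finally show "Rep_ell2 ((T oL S) (delta h)) k = Rep_ell2 ((S oL T) (delta h)) k" .
    qed
  qed
  thus ?thesis using T by (simp add: group_vN_def commutant_iff[of T])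
qed

lemma inner_fin_vec:
  assumes z: "z \<in> fin_vN"
  shows "inner (z vac) v = (\<Sum>g\<in>supp z. Re (coef z g * cnj (Rep_ell2 v g)))"
proof -
  have "z vac = (\<Sum>g\<in>supp z. scaleC_op (coef z g) (lreg g)) vac"
    using fin_eq_sum[OF z finite_supp[OF z] order_refl] by simp
  also have "... = (\<Sum>g\<in>supp z. scaleC (coef z g) (delta g))"
    by (simp add: blinfun.sum_left scaleC_op_apply lreg_delta)
  finally have "inner (z vac) v = (\<Sum>g\<in>supp z. inner (scaleC (coef z g) (delta g)) v)" by (simp add: inner_sum_left)
  moreover have "inner (scaleC c (delta g)) v = Re (c * cnj (Rep_ell2 v g))" for c g
    using cinner_commute[of "delta g" v] by (simp add: inner_ell2_def cinner_scaleC_left cinner_delta)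
  ultimately show ?thesis by simp
qed

lemma flow_inner_vec:
  assumes z: "z \<in> fin_vN" and v: "!!g. Rep_ell2 v g = of_real (s ^ word_length g) * coef x g"
  shows "inner (z vac) v = inner (flow s z vac) (x vac)"
proof -
  have "supp (flow s z) \<subseteq> supp z" using z by (auto simp: supp_def coef_flow)
  hence "inner (flow s z vac) (x vac) = (\<Sum>g\<in>supp z. 1 * Re (coef (flow s z) g * cnj (coef x g)))"
    unfolding inner_lform[OF flow_fin(1)] by (rule lform_eq[OF finite_supp[OF z]])
  also have "... = inner (z vac) v"
    unfolding inner_fin_vec[OF z] by (intro sum.cong refl) (simp add: coef_flow[OF z] v mult_ac)
  finally show ?thesis by simp
qed

text \<open>\<open>poisson\<close> is a definite description, so a bounded operator with the damped
  coefficients must be exhibited. Its form at \<open>C vac\<close> and \<open>D vac\<close> is the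
  pairing of the flow of C adj D with \<open>x\<close>, which \<open>L1_contraction\<close>
  bounds.\<close>

theorem poisson_multiplier_ex:
  fixes x :: "'n::finite free_group op"
  assumes x: "x \<in> group_vN" and s: "0 < s" "s <= 1"
  shows "\<exists>y\<in>group_vN. \<forall>g. coef y g = of_real (s ^ word_length g) * coef x g"
proof -
  define f where "f = (%g. complex_of_real (s ^ word_length g) * coef x g)"
  obtain v where v: "Rep_ell2 v = f"
  proof (rule ell2_of_bounded[of f "norm (x vac)"])
    fix F :: "'n free_group set" assume F: "finite F"
    have "(\<Sum>g\<in>F. (cmod (f g))^2) <= (\<Sum>g\<in>F. (cmod (Rep_ell2 (x vac) g))^2)"
    proof (intro sum_mono power_mono)
      fix g
      have "s ^ word_length g * cmod (coef x g) <= 1 * cmod (coef x g)" using s by (intro mult_right_mono power_le_one) auto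
      thus "cmod (f g) <= cmod (Rep_ell2 (x vac) g)" using s by (simp add: f_def norm_mult norm_power coef_def)
    qed simp
    also have "... <= (norm (x vac))^2" by (rule ell2_partial_le[OF F])
    finally show "(\<Sum>g\<in>F. (cmod (f g))^2) <= (norm (x vac))^2" .
  qed auto
  \<comment> \<open>Rows of the convolution matrix: the entry at h is the conjugate of f(g
    h^(-1)).\<close>
  define row where "row = (%g. rreg (inverse g) (Jop v))"
  have rowc: "Rep_ell2 (row g) h = cnj (f (g * inverse h))" for g h
    by (simp add: row_def rreg.rep_eq translate_right.rep_eq Jop_Rep v free_inverse_mult)
  obtain T where T: "T \<in> bounded_ops" "!!u g. Rep_ell2 (T u) g = cinner u (row g)"
  proof (rule op_of_rows[of "norm x" row])
    fix G :: "'n free_group set" and c assume G: "finite G"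
    define u where "u = (\<Sum>g\<in>G. scaleC (c g) (row g))"
    define C where "C = (\<Sum>g\<in>G. scaleC_op (c g) (lreg g))"
    have C: "C \<in> fin_vN" unfolding C_def by (intro fin_sum fin_lreg)
    have Cd: "C vac = (\<Sum>g\<in>G. scaleC (c g) (delta g))" by (simp add: C_def blinfun.sum_left scaleC_op_apply lreg_delta)
    have nC: "norm (C vac) = sqrt (\<Sum>g\<in>G. (cmod (c g))^2)"
      using norm_delta_sum[OF G, of c] unfolding Cd by (metis norm_ge_zero real_sqrt_unique)
    have uD: "inner u (D vac) = inner ((C oL adj D) vac) v" if "D \<in> fin_vN" for D using that
    proof (induction rule: fin_induct)
      case (lreg d h)
      have "inner (scaleC (c g) (row g)) (scaleC d (delta h)) = inner (scaleC (c g * cnj d) (delta (g * inverse h))) v" for g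
      proof -
        have "inner (scaleC (c g) (row g)) (scaleC d (delta h)) = Re (c g * cnj d * cnj (f (g * inverse h)))"
          by (simp add: inner_ell2_def cinner_scaleC_left cinner_scaleC_right cinner_delta rowc scaleC.rep_eq mult_ac)
        also have "... = inner (scaleC (c g * cnj d) (delta (g * inverse h))) v"
          using cinner_commute[of "delta (g * inverse h)" v] by (simp add: inner_ell2_def cinner_scaleC_left cinner_delta v)
        finally show ?thesis .
      qed
      thus ?case
        by (simp add: u_def C_def inner_sum_left blinfun.sum_left scaleC_op_apply adj_scaleC lreg_in_bounded_ops adj_lreg
            lreg_delta bounded_opsD scaleC_scaleC)
    next
      case (add D E)
      thus ?case by (simp add: blinfun.add_left blinfun.add_right inner_add_left inner_add_right adj_add fin_vN vN_bounded)
    qed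
    have le: "inner u (D vac) <= norm x * (norm (C vac) * norm (D vac))" if D: "D \<in> fin_vN" for D
    proof -
      have "inner ((C oL adj D) vac) v = inner (flow s (C oL adj D) vac) (x vac)"
        by (rule flow_inner_vec[OF fin_compose[OF C fin_adj[OF D]]]) (simp add: v f_def)
      thus ?thesis using uD[OF D] L1_contraction[OF x C D s] by simp
    qed
    let ?K = "norm x * norm (C vac)"
    have "(\<Sum>h\<in>F. (cmod (Rep_ell2 u h))^2) <= ?K^2" if F: "finite F" for F
    proof -
      define D where "D = (\<Sum>h\<in>F. scaleC_op (Rep_ell2 u h) (lreg h))"
      have D: "D \<in> fin_vN" unfolding D_def by (intro fin_sum fin_lreg)
      have Dd: "D vac = (\<Sum>h\<in>F. scaleC (Rep_ell2 u h) (delta h))"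
        by (simp add: D_def blinfun.sum_left scaleC_op_apply lreg_delta)
      have nD: "(norm (D vac))^2 = (\<Sum>h\<in>F. (cmod (Rep_ell2 u h))^2)" unfolding Dd by (rule norm_delta_sum[OF F])
      have "inner u (D vac) = (\<Sum>h\<in>F. Re (cnj (Rep_ell2 u h) * Rep_ell2 u h))"
        unfolding Dd inner_sum_right by (simp add: inner_ell2_def cinner_scaleC_right cinner_delta)
      also have "... = (norm (D vac))^2"
        unfolding nD by (simp only: mult.commute[of "cnj _"] complex_norm_square[symmetric] Re_complex_of_real)
      finally have "norm (D vac) * norm (D vac) <= ?K * norm (D vac)"
        using le[OF D] by (simp add: power2_eq_square mult.assoc)
      hence "norm (D vac) <= ?K" by (cases "norm (D vac) = 0") auto
      hence "(norm (D vac))^2 <= ?K^2" by (intro power_mono) auto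
      thus ?thesis by (simp add: nD)
    qed
    hence "(norm u)^2 <= ?K^2" unfolding norm_ell2_sq using Rep_ell2[of u] by (intro infsum_le_finite_sums) auto
    hence "norm u <= ?K" by (rule power2_le_imp_le) simp
    thus "norm (\<Sum>g\<in>G. scaleC (c g) (row g)) <= norm x * sqrt (\<Sum>g\<in>G. (cmod (c g))^2)"
      by (simp add: u_def nC)
  qed auto
  have "T \<in> group_vN"
  proof (rule vN_if_commutes_rreg[OF T(1)])
    fix k u
    show "T (rreg k u) = rreg k (T u)"
    proof (rule ell2_eqI)
      fix g
      have "cinner (rreg k u) (row g) = (\<Sum>\<^sub>\<infinity>h. (%h. Rep_ell2 u h * cnj (cnj (f (g * k * inverse h)))) (h * k))"
        by (simp add: cinner.rep_eq rowc rreg.rep_eq translate_right.rep_eq free_inverse_mult mult.assoc)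
      also have "... = cinner u (row (g * k))"
        unfolding cinner.rep_eq rowc by (rule infsum_reindex_bij_betw[OF bij_mult_right])
      finally show "Rep_ell2 (T (rreg k u)) g = Rep_ell2 (rreg k (T u)) g"
        by (simp add: T(2) rreg.rep_eq translate_right.rep_eq)
    qed
  qed
  moreover have "coef T g = of_real (s ^ word_length g) * coef x g" for g
  proof -
    have "coef T g = cnj (cinner (row g) vac)" by (simp add: coef_def T(2) cinner_commute[of "delta 1"])
    moreover have "inverse (1 :: 'n free_group) = 1" by transfer simp
    ultimately show ?thesis by (simp add: cinner_delta rowc f_def)
  qed
  ultimately show ?thesis by blast
qed

lemma fourier_coef: "fourier_coeff x g = coef x g" by (simp add: fourier_coeff_eq coef_def)

lemma poisson_props:
  fixes x :: "'n::finite free_group op"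
  assumes x: "x \<in> group_vN" and t: "0 <= t"
  shows "poisson t x \<in> group_vN" "coef (poisson t x) g = of_real (exp (- t) ^ word_length g) * coef x g"
proof -
  have e: "exp (- t * real (word_length g)) = exp (- t) ^ word_length g" for g :: "'n free_group"
    using exp_of_nat_mult[of "word_length g" "- t"] by (simp add: mult.commute)
  obtain y where y: "y \<in> group_vN" "!!g. coef y g = of_real (exp (- t) ^ word_length g) * coef x g"
    using poisson_multiplier_ex[OF x, of "exp (- t)"] t by auto
  have "poisson t x \<in> group_vN & (\<forall>g. fourier_coeff (poisson t x) g = of_real (exp (- t * real (word_length g))) * fourier_coeff x g)"
    unfolding poisson_def fourier_coef e
  proof (rule theI[of _ y])
    show "y \<in> group_vN & (\<forall>g. coef y g = of_real (exp (- t) ^ word_length g) * coef x g)" using y by simp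
    show "y' = y" if "y' \<in> group_vN & (\<forall>g. coef y' g = of_real (exp (- t) ^ word_length g) * coef x g)" for y'
      using that y by (intro vN_eqI_coef) auto
  qed
  thus "poisson t x \<in> group_vN" "coef (poisson t x) g = of_real (exp (- t) ^ word_length g) * coef x g"
    by (simp_all only: fourier_coef e)
qed

lemma poisson_eqI:
  fixes x :: "'n::finite free_group op"
  assumes "x \<in> group_vN" "0 <= t" "y \<in> group_vN" "!!g. coef y g = of_real (exp (- t) ^ word_length g) * coef x g"
  shows "poisson t x = y" by (rule vN_eqI_coef) (simp_all only: assms poisson_props)

lemma poisson_diff:
  fixes x y :: "'n::finite free_group op"
  assumes "x \<in> group_vN" "y \<in> group_vN" "0 <= t"
  shows "poisson t (x - y) = poisson t x - poisson t y"
proof (rule poisson_eqI)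
  have d: "coef (a - b) g = coef a g - coef b g" for a b :: "'n free_group op" and g
    by (simp add: coef_def blinfun.diff_left minus_ell2.rep_eq)
  show "coef (poisson t x - poisson t y) g = of_real (exp (- t) ^ word_length g) * coef (x - y) g" for g
    by (simp only: d poisson_props assms right_diff_distrib)
qed (simp_all add: assms vN_diff poisson_props)

definition trunc :: "'n free_group set => 'n free_group op => 'n free_group op" where
  "trunc F x = (\<Sum>g\<in>F. scaleC_op (coef x g) (lreg g))"

lemma trunc_fin: "trunc F x \<in> fin_vN" unfolding trunc_def by (intro fin_sum fin_lreg)

lemma coef_trunc: "finite F ==> coef (trunc F x) g = (if g \<in> F then coef x g else 0)"
  by (auto simp: trunc_def coef_sum coef_scaleC coef_lreg if_distrib cong: if_cong)

lemma trunc_tendsto: "((%F. trunc F x vac) \<longlongrightarrow> x vac) (finite_subsets_at_top UNIV)"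
proof -
  have "trunc F x vac = (\<Sum>g\<in>F. scaleC (Rep_ell2 (x vac) g) (delta g))" for F
    by (simp add: trunc_def blinfun.sum_left scaleC_op_apply lreg_delta coef_def)
  thus ?thesis using ell2_delta_tendsto[of "x vac"] by simp
qed

text \<open>For p <= 2 the p-norm is dominated by the 2-norm, in which truncations converge. The
  bound in L_q passes to the limit weakly, through pairings with elements of the algebra.\<close>

theorem hypercontractive_vN_le2:
  fixes x :: "'n::finite free_group op"
  assumes x: "x \<in> group_vN" and p: "1 < p" "p <= q" "p <= 2" and t: "0 <= t" "(q - 1) * (exp (- t))^2 <= p - 1"
  shows "pnorm q (poisson t x) <= pnorm p x"
proof -
  have q: "1 < q" using p by simp
  obtain q' where q': "q' > 1" "1 / q + 1 / q' = 1" using conj_exp_ex[OF q] .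
  note y = poisson_props[OF x t(1)]
  show ?thesis
  proof (rule dual_pnorm_vN[OF y(1) q q'])
    show "0 <= pnorm p x" using x p by (intro pnorm_nonneg) auto
    fix z :: "'n free_group op" assume z: "z \<in> group_vN"
    let ?F = "finite_subsets_at_top (UNIV :: 'n free_group set)"
    have L: "((%F. inner (trunc F (poisson t x) vac) (z vac)) \<longlongrightarrow> inner (poisson t x vac) (z vac)) ?F"
      by (intro tendsto_inner trunc_tendsto tendsto_const)
    have R: "((%F. (pnorm p x + norm (x vac - trunc F x vac)) * pnorm q' z) \<longlongrightarrow> (pnorm p x + norm (x vac - x vac)) * pnorm q' z) ?F"
      by (intro tendsto_mult tendsto_add tendsto_norm tendsto_diff trunc_tendsto tendsto_const)
    have "inner (poisson t x vac) (z vac) <= (pnorm p x + norm (x vac - x vac)) * pnorm q' z"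
    proof (rule tendsto_le[OF finite_subsets_at_top_neq_bot R L])
      show "\<forall>\<^sub>F F in ?F. inner (trunc F (poisson t x) vac) (z vac) <= (pnorm p x + norm (x vac - trunc F x vac)) * pnorm q' z"
      proof (rule eventually_finite_subsets_at_top_weakI)
        fix F :: "'n free_group set" assume F: "finite F"
        have tv: "trunc F x \<in> group_vN" using trunc_fin by auto
        have eq: "trunc F (poisson t x) = flow (exp (- t)) (trunc F x)"
          by (rule vN_eqI_coef) (simp_all add: fin_vN trunc_fin flow_fin coef_flow coef_trunc F y)
        have "inner (trunc F (poisson t x) vac) (z vac) <= pnorm q' z * pnorm q (trunc F (poisson t x))"
          by (rule holder[OF z fin_vN[OF trunc_fin] q'(1) q]) (use q' in simp)
        also have "... <= pnorm q' z * (pnorm p x + norm (x vac - trunc F x vac))"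
        proof (intro mult_left_mono)
          have "pnorm q (trunc F (poisson t x)) <= pnorm p (trunc F x)"
            unfolding eq by (rule hypercontractive_fin[OF trunc_fin p(1,2)]) (use t in auto)
          also have "... <= pnorm p x + pnorm p (x - trunc F x)"
            using pnorm_triangle_diff[OF x tv p(1)] unfolding abs_le_iff by linarith
          also have "pnorm p (x - trunc F x) <= pnorm 2 (x - trunc F x)" using p by (intro pnorm_mono vN_diff x tv) auto
          also have "... = norm (x vac - trunc F x vac)" by (simp add: pnorm_2 vN_diff x tv blinfun.diff_left)
          finally show "pnorm q (trunc F (poisson t x)) <= pnorm p x + norm (x vac - trunc F x vac)" by simp
          show "0 <= pnorm q' z" using z q' by (intro pnorm_nonneg) auto
        qed
        finally show "inner (trunc F (poisson t x) vac) (z vac) <= (pnorm p x + norm (x vac - trunc F x vac)) * pnorm q' z"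
          by (simp add: mult.commute)
      qed
    qed
    thus "inner (poisson t x vac) (z vac) <= pnorm p x * pnorm q' z" by simp
  qed
qed

lemma poisson_symmetric:
  fixes x z :: "'n::finite free_group op"
  assumes x: "x \<in> group_vN" and z: "z \<in> group_vN" and t: "0 <= t"
  shows "inner (poisson t x vac) (z vac) = inner (x vac) (poisson t z vac)"
proof -
  let ?F = "finite_subsets_at_top (UNIV :: 'n free_group set)"
  let ?s = "exp (- t)"
  have L: "((%F. inner (trunc F (poisson t x) vac) (z vac)) \<longlongrightarrow> inner (poisson t x vac) (z vac)) ?F"
    by (intro tendsto_inner trunc_tendsto tendsto_const)
  have R: "((%F. inner (trunc F x vac) (poisson t z vac)) \<longlongrightarrow> inner (x vac) (poisson t z vac)) ?F"
    by (intro tendsto_inner trunc_tendsto tendsto_const)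
  have "inner (trunc F (poisson t x) vac) (z vac) = inner (trunc F x vac) (poisson t z vac)" if F: "finite F" for F
  proof -
    have eq: "trunc F (poisson t x) = flow ?s (trunc F x)"
      by (rule vN_eqI_coef) (simp_all add: fin_vN trunc_fin flow_fin coef_flow coef_trunc F poisson_props x t)
    have "inner (trunc F x vac) (poisson t z vac) = inner (flow ?s (trunc F x) vac) (z vac)"
      by (rule flow_inner_vec[OF trunc_fin]) (simp only: coef_def[symmetric] poisson_props z t)
    thus ?thesis by (simp add: eq)
  qed
  hence "\<forall>\<^sub>F F in ?F. inner (trunc F x vac) (poisson t z vac) = inner (trunc F (poisson t x) vac) (z vac)"
    by (intro eventually_finite_subsets_at_top_weakI) simp
  from Lim_transform_eventually[OF R this] show ?thesis using tendsto_unique[OF finite_subsets_at_top_neq_bot L] by simp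
qed

text \<open>For p > 2 the truncations need not approximate in the p-norm. The conjugate exponents
  are then below 2 and satisfy the same time condition, so symmetry of \<open>poisson\<close>
  reduces this to the previous case.\<close>

theorem hypercontractive_vN:
  fixes x :: "'n::finite free_group op"
  assumes x: "x \<in> group_vN" and p: "1 < p" "p <= q" and t: "0 <= t" "(q - 1) * (exp (- t))^2 <= p - 1"
  shows "pnorm q (poisson t x) <= pnorm p x"
proof (cases "p <= 2")
  case True
  thus ?thesis using hypercontractive_vN_le2 assms by blast
next
  case False
  have q: "1 < q" using p by simp
  obtain q' where q': "q' > 1" "1 / q + 1 / q' = 1" using conj_exp_ex[OF q] .
  obtain p' where p': "p' > 1" "1 / p + 1 / p' = 1" using conj_exp_ex[OF p(1)] .
  have e: "(q - 1) * (q' - 1) = 1" "(p - 1) * (p' - 1) = 1" using conj_exp(3)[OF q q'] conj_exp(3)[OF p(1) p'] by auto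
  have q'1: "q' - 1 = 1 / (q - 1)" "p' - 1 = 1 / (p - 1)" using e p by (simp_all add: field_simps)
  have q2: "q' <= 2"
  proof -
    have "q' - 1 <= 1" unfolding q'1 using p False by simp
    thus ?thesis by simp
  qed
  have qp: "q' <= p'"
  proof -
    have "q' - 1 <= p' - 1" unfolding q'1 using p by (intro divide_left_mono) auto
    thus ?thesis by simp
  qed
  have t': "(p' - 1) * (exp (- t))^2 <= q' - 1" unfolding q'1 using t(2) p by (simp add: field_simps)
  show ?thesis
  proof (rule dual_pnorm_vN[OF poisson_props(1)[OF x t(1)] q q'])
    show "0 <= pnorm p x" using x p by (intro pnorm_nonneg) auto
    fix z :: "'n free_group op" assume z: "z \<in> group_vN"
    have "inner (poisson t x vac) (z vac) = inner (poisson t z vac) (x vac)"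
      using poisson_symmetric[OF x z t(1)] by (simp add: inner_commute)
    also have "... <= pnorm p x * pnorm p' (poisson t z)" by (rule holder[OF x poisson_props(1)[OF z t(1)] p(1) p'])
    also have "... <= pnorm p x * pnorm q' z"
      using x p by (intro mult_left_mono hypercontractive_vN_le2[OF z q'(1) qp q2 t(1) t'] pnorm_nonneg) auto
    finally show "inner (poisson t x vac) (z vac) <= pnorm p x * pnorm q' z" .
  qed
qed

subsection \<open>The spaces \<open>L\<^sub>p\<close>\<close>

lemma Lp_CauchyD: "X \<in> Lp_Cauchy p ==> X k \<in> group_vN" by (auto simp: Lp_Cauchy_def)

lemma pnorm_triangle3:
  assumes "x \<in> group_vN" "y \<in> group_vN" "z \<in> group_vN" "1 < p"
  shows "pnorm p (x - z) <= pnorm p (x - y) + pnorm p (y - z)"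
  using pnorm_triangle[of "x - y" "y - z" p] assms by (simp add: vN_diff)

lemma Lp_Cauchy_close:
  assumes X: "X \<in> Lp_Cauchy p" and p: "1 < p" and Y: "!!k. Y k \<in> group_vN"
    and le: "!!j k. pnorm q (Y j - Y k) <= pnorm p (X j - X k)"
  shows "Y \<in> Lp_Cauchy q" unfolding Lp_Cauchy_def
proof (intro CollectI conjI allI impI)
  show "range Y \<subseteq> group_vN" using Y by auto
  fix e :: real assume "0 < e"
  then obtain N where "\<forall>j\<ge>N. \<forall>k\<ge>N. pnorm p (X j - X k) < e" using X unfolding Lp_Cauchy_def by auto
  hence "\<forall>j\<ge>N. \<forall>k\<ge>N. pnorm q (Y j - Y k) < e" using le by (meson order_le_less_trans)
  thus "\<exists>N. \<forall>j\<ge>N. \<forall>k\<ge>N. pnorm q (Y j - Y k) < e" ..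
qed

lemma Lp_equiv_iff:
  "(X, Y) \<in> Lp_equiv p \<longleftrightarrow> X \<in> Lp_Cauchy p & Y \<in> Lp_Cauchy p & (%k. pnorm p (X k - Y k)) \<longlonglongrightarrow> 0"
  by (simp add: Lp_equiv_def)

lemma equiv_Lp:
  assumes p: "1 < p"
  shows "equiv (Lp_Cauchy p) (Lp_equiv p :: ((nat => 'n free_group op) \<times> _) set)"
proof (rule equivI)
  show "(Lp_equiv p :: ((nat => 'n free_group op) \<times> _) set) \<subseteq> Lp_Cauchy p \<times> Lp_Cauchy p" by (auto simp: Lp_equiv_def)
  show "refl_on (Lp_Cauchy p) (Lp_equiv p :: ((nat => 'n free_group op) \<times> _) set)" using p by (auto simp: refl_on_def Lp_equiv_def)
  show "sym (Lp_equiv p :: ((nat => 'n free_group op) \<times> _) set)"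
  proof (rule symI)
    fix X Y :: "nat => 'n free_group op" assume a: "(X, Y) \<in> Lp_equiv p"
    hence "pnorm p (X k - Y k) = pnorm p (Y k - X k)" for k
      using p by (intro pnorm_diff_commute) (auto simp: Lp_equiv_iff Lp_CauchyD)
    thus "(Y, X) \<in> Lp_equiv p" using a by (simp add: Lp_equiv_iff)
  qed
  show "trans (Lp_equiv p :: ((nat => 'n free_group op) \<times> _) set)"
  proof (rule transI)
    fix X Y Z :: "nat => 'n free_group op" assume a: "(X, Y) \<in> Lp_equiv p" "(Y, Z) \<in> Lp_equiv p"
    have v: "X k \<in> group_vN" "Y k \<in> group_vN" "Z k \<in> group_vN" for k using a by (auto simp: Lp_equiv_iff Lp_CauchyD)
    have "(%k. pnorm p (X k - Y k) + pnorm p (Y k - Z k)) \<longlonglongrightarrow> 0 + 0"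
      using a by (intro tendsto_add) (auto simp: Lp_equiv_iff)
    hence s: "(%k. pnorm p (X k - Y k) + pnorm p (Y k - Z k)) \<longlonglongrightarrow> 0" by simp
    have "(%k. pnorm p (X k - Z k)) \<longlonglongrightarrow> 0" by (rule Lim_null_comparison[OF always_eventually s])
        (use v p in \<open>auto simp: abs_of_nonneg pnorm_nonneg vN_diff intro: pnorm_triangle3\<close>)
    thus "(X, Z) \<in> Lp_equiv p" using a by (simp add: Lp_equiv_iff)
  qed
qed

lemma Lp_class:
  assumes p: "1 < p" and x: "x \<in> Lp p" and X: "X \<in> x"
  shows "x = Lp_equiv p `` {X}" "X \<in> Lp_Cauchy p"
proof -
  obtain Y where Y: "Y \<in> Lp_Cauchy p" "x = Lp_equiv p `` {Y}" using x unfolding Lp_def by (rule quotientE)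
  have "(Y, X) \<in> Lp_equiv p" using X Y by simp
  thus "x = Lp_equiv p `` {X}" using Y(2) equiv_class_eq[OF equiv_Lp[OF p]] by blast
  show "X \<in> Lp_Cauchy p" using \<open>(Y, X) \<in> Lp_equiv p\<close> by (simp add: Lp_equiv_iff)
qed

lemma Lp_classI:
  assumes p: "1 < p" and X: "X \<in> Lp_Cauchy p"
  shows "Lp_equiv p `` {X} \<in> Lp p" "X \<in> Lp_equiv p `` {X}"
  using X equiv_class_self[OF equiv_Lp[OF p] X] unfolding Lp_def by (auto intro: quotientI)

lemma Lp_nonempty: "1 < p ==> x \<in> Lp p ==> \<exists>X. X \<in> x"
  unfolding Lp_def by (elim quotientE) (use equiv_class_self[OF equiv_Lp] in blast)

lemma Lp_norm_tendsto:
  assumes p: "1 < p" and x: "x \<in> Lp p" and X: "X \<in> x"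
  shows "(%k. pnorm p (X k)) \<longlonglongrightarrow> Lp_norm p x"
proof -
  have c: "\<bar>pnorm p a - pnorm p b\<bar> <= pnorm p (a - b)" if "a \<in> group_vN" "b \<in> group_vN" for a b :: "'a free_group op"
    using pnorm_triangle_diff[OF that p] .
  note XC = Lp_class(2)[OF p x X]
  have "Cauchy (%k. pnorm p (X k))"
  proof (rule metric_CauchyI)
    fix e :: real assume "0 < e"
    then obtain N where "\<forall>j\<ge>N. \<forall>k\<ge>N. pnorm p (X j - X k) < e" using XC unfolding Lp_Cauchy_def by auto
    thus "\<exists>N. \<forall>m\<ge>N. \<forall>n\<ge>N. dist (pnorm p (X m)) (pnorm p (X n)) < e"
      unfolding dist_real_def using c[OF Lp_CauchyD[OF XC] Lp_CauchyD[OF XC]] by (meson order_le_less_trans)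
  qed
  then obtain r where r: "(%k. pnorm p (X k)) \<longlonglongrightarrow> r" by (auto simp: Cauchy_convergent_iff convergent_def)
  have all: "(%k. pnorm p (Y k)) \<longlonglongrightarrow> r" if Y: "Y \<in> x" for Y
  proof -
    have "(X, Y) \<in> Lp_equiv p" using Y Lp_class(1)[OF p x X] by simp
    hence Y0: "(%k. pnorm p (X k - Y k)) \<longlonglongrightarrow> 0" and YC: "Y \<in> Lp_Cauchy p" by (auto simp: Lp_equiv_iff)
    have "(%k. pnorm p (X k) - pnorm p (Y k)) \<longlonglongrightarrow> 0"
      by (rule Lim_null_comparison[OF _ Y0]) (use c Lp_CauchyD[OF XC] Lp_CauchyD[OF YC] in simp)
    from tendsto_diff[OF r this] show ?thesis by simp
  qed
  have "Lp_norm p x = r" unfolding Lp_norm_def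
  proof (rule the_equality)
    fix r' assume "\<forall>X\<in>x. (%k. pnorm p (X k)) \<longlonglongrightarrow> r'"
    thus "r' = r" using X r LIMSEQ_unique by blast
  qed (use all in blast)
  thus ?thesis using r by simp
qed

lemma Lp_incl_eq:
  assumes p: "1 < p" "p <= q" and y: "y \<in> Lp q" and Y: "Y \<in> y"
  shows "Y \<in> Lp_Cauchy p" "Lp_incl p y = Lp_equiv p `` {Y}"
proof -
  have q: "1 < q" using p by simp
  have mono: "pnorm p (a - b) <= pnorm q (a - b)" if "a \<in> group_vN" "b \<in> group_vN" for a b :: "'a free_group op"
    using p that by (intro pnorm_mono vN_diff) auto
  have C: "Z \<in> Lp_Cauchy p" if "Z \<in> Lp_Cauchy q" for Z :: "nat => 'a free_group op"
    using that Lp_CauchyD[OF that] by (intro Lp_Cauchy_close[OF that q] mono)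
  note YC = Lp_class(2)[OF q y Y]
  show Yp: "Y \<in> Lp_Cauchy p" by (rule C[OF YC])
  have sub: "y \<subseteq> Lp_equiv p `` {Y}"
  proof
    fix Z assume "Z \<in> y"
    hence Z: "(Y, Z) \<in> Lp_equiv q" using Lp_class(1)[OF q y Y] by simp
    hence ZC: "Z \<in> Lp_Cauchy q" and Z0: "(%k. pnorm q (Y k - Z k)) \<longlonglongrightarrow> 0" by (auto simp: Lp_equiv_iff)
    have "(%k. pnorm p (Y k - Z k)) \<longlonglongrightarrow> 0" by (rule Lim_null_comparison[OF _ Z0])
        (use mono Lp_CauchyD[OF YC] Lp_CauchyD[OF ZC] p in \<open>simp add: pnorm_nonneg vN_diff\<close>)
    thus "Z \<in> Lp_equiv p `` {Y}" using Yp C[OF ZC] by (simp add: Lp_equiv_iff)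
  qed
  show "Lp_incl p y = Lp_equiv p `` {Y}" unfolding Lp_incl_def
  proof (rule the_equality)
    show "Lp_equiv p `` {Y} \<in> Lp p & y \<subseteq> Lp_equiv p `` {Y}" using Lp_classI[OF p(1) Yp] sub by simp
    fix x assume "x \<in> Lp p & y \<subseteq> x"
    thus "x = Lp_equiv p `` {Y}" using Lp_class(1)[OF p(1)] Y by blast
  qed
qed

lemma poisson_contraction:
  fixes x :: "'n::finite free_group op"
  assumes "x \<in> group_vN" "1 < p" "0 <= t"
  shows "pnorm p (poisson t x) <= pnorm p x"
proof (rule hypercontractive_vN[OF assms(1,2) order_refl assms(3)])
  have "(exp (- t))^2 <= 1" using assms by (intro power_le_one) auto
  hence "(p - 1) * (exp (- t))^2 <= (p - 1) * 1" using assms by (intro mult_left_mono) auto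
  thus "(p - 1) * (exp (- t))^2 <= p - 1" by simp
qed

lemma Lp_poisson_eq:
  fixes X :: "nat => 'n::finite free_group op"
  assumes p: "1 < p" and t: "0 <= t" and x: "x \<in> Lp p" and X: "X \<in> x"
  defines "Y \<equiv> %k. poisson t (X k)"
  shows "Y \<in> Lp_Cauchy p" "Lp_poisson p t x = Lp_equiv p `` {Y}"
proof -
  have le: "pnorm p (poisson t a - poisson t b) <= pnorm p (a - b)" if "a \<in> group_vN" "b \<in> group_vN" for a b :: "'n free_group op"
    using poisson_contraction[OF vN_diff[OF that] p t] by (simp add: poisson_diff that t)
  have C: "(%k. poisson t (Z k)) \<in> Lp_Cauchy p" if Z: "Z \<in> Lp_Cauchy p" for Z :: "nat => 'n free_group op"
    using Lp_CauchyD[OF Z] by (intro Lp_Cauchy_close[OF Z p] le poisson_props t)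
  note XC = Lp_class(2)[OF p x X]
  show Yp: "Y \<in> Lp_Cauchy p" unfolding Y_def by (rule C[OF XC])
  show "Lp_poisson p t x = Lp_equiv p `` {Y}" unfolding Lp_poisson_def
  proof (rule the_equality)
    have "(%k. poisson t (Z k)) \<in> Lp_equiv p `` {Y}" if "Z \<in> x" for Z
    proof -
      have "(X, Z) \<in> Lp_equiv p" using that Lp_class(1)[OF p x X] by simp
      hence ZC: "Z \<in> Lp_Cauchy p" and Z0: "(%k. pnorm p (X k - Z k)) \<longlonglongrightarrow> 0" by (auto simp: Lp_equiv_iff)
      have "(%k. pnorm p (Y k - poisson t (Z k))) \<longlonglongrightarrow> 0" by (rule Lim_null_comparison[OF _ Z0])
          (use le Lp_CauchyD[OF XC] Lp_CauchyD[OF ZC] p t in \<open>simp add: Y_def pnorm_nonneg vN_diff poisson_props\<close>)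
      thus ?thesis using Yp C[OF ZC] by (simp add: Lp_equiv_iff)
    qed
    thus "Lp_equiv p `` {Y} \<in> Lp p & (\<forall>X\<in>x. (%k. poisson t (X k)) \<in> Lp_equiv p `` {Y})"
      using Lp_classI[OF p Yp] by simp
    fix y assume "y \<in> Lp p & (\<forall>X\<in>x. (%k. poisson t (X k)) \<in> y)"
    thus "y = Lp_equiv p `` {Y}" using Lp_class(1)[OF p] X unfolding Y_def by blast
  qed
qed

text \<open>Applied to differences, the bound on the algebra makes the image of a p-Cauchy sequence
  q-Cauchy; its q-class is the required element.\<close>

theorem hypercontractive_Lp:
  fixes x :: "'n::finite Lp_elem"
  assumes x: "x \<in> Lp p" and p: "1 < p" "p <= q" and t: "0 <= t" "(q - 1) * (exp (- t))^2 <= p - 1"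
  shows "\<exists>y\<in>Lp q. Lp_incl p y = Lp_poisson p t x & Lp_norm q y <= Lp_norm p x"
proof -
  have q: "1 < q" using p by simp
  obtain X where X: "X \<in> x" using Lp_nonempty[OF p(1) x] by blast
  note XC = Lp_class(2)[OF p(1) x X]
  define Y where "Y = (%k. poisson t (X k))"
  have le: "pnorm q (poisson t a) <= pnorm p a" if "a \<in> group_vN" for a :: "'n free_group op"
    by (rule hypercontractive_vN[OF that p t])
  have YC: "Y \<in> Lp_Cauchy q"
  proof (rule Lp_Cauchy_close[OF XC p(1)])
    show "Y k \<in> group_vN" for k unfolding Y_def by (intro poisson_props t Lp_CauchyD[OF XC])
    show "pnorm q (Y j - Y k) <= pnorm p (X j - X k)" for j k
      unfolding Y_def using le[OF vN_diff[OF Lp_CauchyD[OF XC] Lp_CauchyD[OF XC]]]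
      by (simp add: poisson_diff Lp_CauchyD[OF XC] t)
  qed
  define y where "y = Lp_equiv q `` {Y}"
  have y: "y \<in> Lp q" "Y \<in> y" using Lp_classI[OF q YC] by (simp_all add: y_def)
  have "Lp_incl p y = Lp_poisson p t x" using Lp_incl_eq(2)[OF p y] Lp_poisson_eq(2)[OF p(1) t(1) x X] by (simp add: Y_def)
  moreover have "Lp_norm q y <= Lp_norm p x" by (rule LIMSEQ_le[OF Lp_norm_tendsto[OF q y] Lp_norm_tendsto[OF p(1) x X]])
      (use le Lp_CauchyD[OF XC] in \<open>auto simp: Y_def\<close>)
  ultimately show ?thesis using y by blast
qed

text \<open>An element of the algebra is represented by a constant sequence. The representative Y of
  the L_q element approaches P_t x only in the p-norm, but pairing with a fixed element shows that
  the q-norm is lower semicontinuous along it.\<close>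

lemma hypercontractive_vN_of_Lp:
  fixes x :: "'n::finite free_group op"
  assumes H: "\<forall>x :: 'n Lp_elem \<in> Lp p. \<exists>y\<in>Lp q. Lp_incl p y = Lp_poisson p t x & Lp_norm q y <= Lp_norm p x"
    and p: "1 < p" "p <= q" and t: "0 <= t" and x: "x \<in> group_vN"
  shows "pnorm q (poisson t x) <= pnorm p x"
proof -
  have q: "1 < q" using p by simp
  define X where "X = (%_ :: nat. x)"
  have XC: "X \<in> Lp_Cauchy p" using x p by (auto simp: Lp_Cauchy_def X_def)
  note cl = Lp_classI[OF p(1) XC]
  obtain y where y: "y \<in> Lp q" "Lp_incl p y = Lp_poisson p t (Lp_equiv p `` {X})" "Lp_norm q y <= Lp_norm p (Lp_equiv p `` {X})"
    using H cl(1) by blast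
  have "Lp_norm p (Lp_equiv p `` {X}) = pnorm p x"
    using Lp_norm_tendsto[OF p(1) cl] by (intro LIMSEQ_unique[OF _ tendsto_const]) (simp add: X_def)
  hence ny: "Lp_norm q y <= pnorm p x" using y(3) by simp
  obtain Y where Y: "Y \<in> y" using Lp_nonempty[OF q y(1)] by blast
  note Yv = Lp_CauchyD[OF Lp_class(2)[OF q y(1) Y]]
  have "Y \<in> Lp_equiv p `` {%k. poisson t (X k)}"
    using y(2) Lp_incl_eq[OF p y(1) Y] Lp_poisson_eq(2)[OF p(1) t cl] Lp_classI(2)[OF p(1)] by metis
  hence Y0: "(%k. pnorm p (poisson t x - Y k)) \<longlonglongrightarrow> 0" by (simp add: Lp_equiv_iff X_def)
  have LY: "(%k. pnorm q (Y k)) \<longlonglongrightarrow> Lp_norm q y" by (rule Lp_norm_tendsto[OF q y(1) Y])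
  obtain q' where q': "q' > 1" "1 / q + 1 / q' = 1" using conj_exp_ex[OF q] .
  obtain p' where p': "p' > 1" "1 / p + 1 / p' = 1" using conj_exp_ex[OF p(1)] .
  have Pv: "poisson t x \<in> group_vN" by (rule poisson_props(1)[OF x t])
  have n0: "0 <= Lp_norm q y" by (rule LIMSEQ_le_const[OF LY]) (use Yv q in \<open>auto intro!: pnorm_nonneg\<close>)
  have "pnorm q (poisson t x) <= Lp_norm q y"
  proof (rule dual_pnorm_vN[OF Pv q q' n0])
    fix z :: "'n free_group op" assume z: "z \<in> group_vN"
    have "(%k. pnorm q (Y k) * pnorm q' z + pnorm p (poisson t x - Y k) * pnorm p' z) \<longlonglongrightarrow> Lp_norm q y * pnorm q' z + 0 * pnorm p' z"
      by (intro tendsto_add tendsto_mult LY Y0 tendsto_const)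
    moreover have "inner (poisson t x vac) (z vac) <= pnorm q (Y k) * pnorm q' z + pnorm p (poisson t x - Y k) * pnorm p' z" for k
    proof -
      have "inner (z vac) (Y k vac) <= pnorm q (Y k) * pnorm q' z" by (rule holder[OF Yv z q q'])
      moreover have "inner (z vac) ((poisson t x - Y k) vac) <= pnorm p (poisson t x - Y k) * pnorm p' z"
        by (rule holder[OF vN_diff[OF Pv Yv] z p(1) p'])
      ultimately show ?thesis by (simp add: blinfun.diff_left inner_diff_right inner_commute)
    qed
    ultimately show "inner (poisson t x vac) (z vac) <= Lp_norm q y * pnorm q' z" using LIMSEQ_le_const by fastforce
  qed
  thus ?thesis using ny by simp
qed

section \<open>Sharpness of the time\<close>

subsection \<open>Necessity\<close>

text \<open>Near 1 this is Taylor's formula. Below 1/2 the third derivative may be unbounded, but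
  there \<bar>s - 1\<bar>^3 is at least 1/8, so 8 times a bound for the remainder serves as the
  constant.\<close>

lemma powr_taylor:
  fixes p :: real
  assumes p: "1 < p"
  obtains K where "0 <= K" "!!s. 0 <= s ==> s <= 2 ==> \<bar>s powr p - (1 + p * (s - 1) + p * (p - 1) / 2 * (s - 1)^2)\<bar> <= K * \<bar>s - 1\<bar> ^ 3"
proof -
  define D where "D = (%s. s powr p - (1 + p * (s - 1) + p * (p - 1) / 2 * (s - 1)^2))"
  have cD: "continuous_on {0..2} D" unfolding D_def using p by (intro continuous_intros continuous_on_powr') auto
  obtain M where M: "!!s. s \<in> {0..2} ==> \<bar>D s\<bar> <= M"
    using compact_imp_bounded[OF compact_continuous_image[OF cD compact_Icc]] by (fastforce simp: bounded_iff)
  have "continuous_on {1 / 2..2} (%s :: real. s powr (p - 3))" by (intro continuous_intros) auto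
  then obtain L where L: "!!s. s \<in> {1 / 2..2} ==> \<bar>s powr (p - 3)\<bar> <= L"
    using compact_imp_bounded[OF compact_continuous_image[OF _ compact_Icc]] by (fastforce simp: bounded_iff)
  have M0: "0 <= M" using M[of 0] by auto
  have L0: "0 <= L" using L[of 1] by auto
  define B where "B = \<bar>p * (p - 1) * (p - 2)\<bar> * L"
  have B0: "0 <= B" using L0 by (simp add: B_def)
  have near: "\<bar>D s\<bar> <= B * \<bar>s - 1\<bar> ^ 3" if s: "1 / 2 <= s" "s <= 2" for s
  proof (cases "s = 1")
    case False
    define df where "df = (%(m :: nat) (s :: real). (if m = 0 then s powr p else if m = 1 then p * s powr (p - 1)
      else if m = 2 then p * (p - 1) * s powr (p - 2) else p * (p - 1) * (p - 2) * s powr (p - 3)))"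
    have "\<exists>t. (if s < 1 then s < t & t < 1 else 1 < t & t < s) &
        s powr p = (\<Sum>m<3. (df m 1 / fact m) * (s - 1) ^ m) + (df 3 t / fact 3) * (s - 1) ^ 3"
    proof (rule Taylor[of 3 df "%s. s powr p" "1 / 2" 2])
      show "\<forall>m t. m < 3 & 1 / 2 <= t & t <= 2 --> (df m has_real_derivative df (Suc m) t) (at t)"
      proof (intro allI impI)
        fix m :: nat and t :: real assume a: "m < 3 & 1 / 2 <= t & t <= 2"
        have d: "((%t. c * t powr e) has_real_derivative c * (e * t powr (e - 1))) (at t)" for c e
          using a by (auto intro!: derivative_eq_intros)
        consider "m = 0" | "m = 1" | "m = 2" using a by linarith
        thus "(df m has_real_derivative df (Suc m) t) (at t)"
          using d[of 1 p] d[of p "p - 1"] d[of "p * (p - 1)" "p - 2"] by cases (simp_all add: df_def mult.assoc)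
      qed
    qed (use s False in \<open>auto simp: df_def\<close>)
    then obtain t where t: "if s < 1 then s < t & t < 1 else 1 < t & t < s"
      "s powr p = (\<Sum>m<3. (df m 1 / fact m) * (s - 1) ^ m) + (df 3 t / fact 3) * (s - 1) ^ 3" by blast
    have ti: "t \<in> {1 / 2..2}" using t(1) s by (auto split: if_splits)
    have "\<bar>D s\<bar> = \<bar>(df 3 t / 6) * (s - 1) ^ 3\<bar>" unfolding D_def t(2) by (simp add: df_def numeral_eq_Suc)
    also have "\<bar>(df 3 t / 6) * (s - 1) ^ 3\<bar> = \<bar>p * (p - 1) * (p - 2)\<bar> * \<bar>t powr (p - 3)\<bar> / 6 * \<bar>s - 1\<bar> ^ 3"
      by (simp add: df_def abs_mult power_abs)
    also have "... <= B * \<bar>s - 1\<bar> ^ 3"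
    proof (rule mult_right_mono)
      have "\<bar>p * (p - 1) * (p - 2)\<bar> * \<bar>t powr (p - 3)\<bar> <= B" unfolding B_def using L[OF ti] by (intro mult_left_mono) auto
      thus "\<bar>p * (p - 1) * (p - 2)\<bar> * \<bar>t powr (p - 3)\<bar> / 6 <= B" using B0 by simp
    qed simp
    finally show ?thesis .
  qed (simp add: D_def)
  show ?thesis
  proof (rule that[of "B + 8 * M"])
    show "0 <= B + 8 * M" using B0 M0 by simp
    fix s :: real assume s: "0 <= s" "s <= 2"
    have "\<bar>D s\<bar> <= (B + 8 * M) * \<bar>s - 1\<bar> ^ 3"
    proof (cases "1 / 2 <= s")
      case True
      have "B * \<bar>s - 1\<bar> ^ 3 <= (B + 8 * M) * \<bar>s - 1\<bar> ^ 3" using M0 by (intro mult_right_mono) auto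
      thus ?thesis using near[OF True s(2)] by simp
    next
      case False
      have "(1 / 2) ^ 3 <= \<bar>s - 1\<bar> ^ 3" using False by (intro power_mono) auto
      hence "(B + 8 * M) * (1 / 2) ^ 3 <= (B + 8 * M) * \<bar>s - 1\<bar> ^ 3" using B0 M0 by (intro mult_left_mono) auto
      moreover have "M <= (B + 8 * M) * (1 / 2) ^ 3" using B0 by (simp add: power3_eq_cube)
      ultimately show ?thesis using M[of s] s by simp
    qed
    thus "\<bar>s powr p - (1 + p * (s - 1) + p * (p - 1) / 2 * (s - 1)^2)\<bar> <= (B + 8 * M) * \<bar>s - 1\<bar> ^ 3"
      by (simp add: D_def)
  qed
qed

definition gen :: "'n => 'n free_group" where
  "gen a = fg [(a, True)]"

lemma gen_props: "word_of (gen a) = [(a, True)]" "word_of (inverse (gen a)) = [(a, False)]"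
  "gen a ~= 1" "inverse (gen a) ~= 1" "gen a ~= inverse (gen a)"
proof -
  show 1: "word_of (gen a) = [(a, True)]" by (simp add: gen_def word_of_fg cons_red_def)
  show 2: "word_of (inverse (gen a)) = [(a, False)]" by (simp add: inverse_free_group.rep_eq 1 inv_letter_def)
  show "gen a ~= 1" "inverse (gen a) ~= 1" "gen a ~= inverse (gen a)"
    by (simp_all add: word_of_inject[symmetric] 1 2 one_free_group.rep_eq del: word_of_inject)
qed

definition gen_sum :: "'n => 'n free_group op" where
  "gen_sum a = lreg (gen a) + lreg (inverse (gen a))"

lemma gen_sum_vN: "gen_sum a \<in> group_vN" by (simp add: gen_sum_def vN_add vN_lreg)

lemma gen_sum_sym: "sym_op (gen_sum a)"
proof -
  have "adj (gen_sum a) = gen_sum a" by (simp add: gen_sum_def adj_add lreg_in_bounded_ops adj_lreg add.commute)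
  thus ?thesis unfolding sym_op_def by (metis adj_inner vN_bounded gen_sum_vN)
qed

lemma gen_sum_moments:
  "inner (gen_sum a vac) vac = 0" "inner (gen_sum a (gen_sum a vac)) vac = 2"
  "norm (gen_sum a v) <= 2 * norm v"
proof -
  have d: "inner (delta g) (delta h) = (if g = h then 1 else 0)" for g h :: "'a free_group"
    by (auto simp: inner_ell2_def cinner_delta delta.rep_eq)
  show "inner (gen_sum a vac) vac = 0" by (simp add: gen_sum_def blinfun.add_left lreg_delta inner_add_left d gen_props)
  have "inner (gen_sum a (gen_sum a vac)) vac = inner (gen_sum a vac) (gen_sum a vac)" by (rule sym_opD[OF gen_sum_sym])
  also have "... = 2"
    using gen_props(5)[of a] by (simp add: gen_sum_def blinfun.add_left lreg_delta inner_add_left inner_add_right d)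
  finally show "inner (gen_sum a (gen_sum a vac)) vac = 2" .
  have "norm (lreg g v) <= norm v" for g
    using norm_blinfun[of "lreg g" v] mult_right_mono[OF norm_lreg_le norm_ge_zero, of g v] by simp
  hence "norm (lreg (gen a) v + lreg (inverse (gen a)) v) <= norm v + norm v"
    by (intro order_trans[OF norm_triangle_ineq] add_mono)
  thus "norm (gen_sum a v) <= 2 * norm v" by (simp add: gen_sum_def blinfun.add_left)
qed

definition test_elt :: "'n => real => 'n free_group op" where
  "test_elt a e = id_blinfun + e *\<^sub>R gen_sum a"

lemma test_elt_vN: "test_elt a e \<in> group_vN" by (simp add: test_elt_def vN_add vN_id vN_scaleR gen_sum_vN)

text \<open>As \<open>gen_sum a\<close> has norm at most 2, \<open>e <= 1 / 2\<close> makes the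
  element positive, so that the function is evaluated on it directly. First and second moments 0 and
  2 give the main term; the constant 9 is 1 + 8, from the second moment 2 and the bound 16 for the
  fourth.\<close>

lemma test_elt_expansion:
  fixes a :: 'n
  assumes e: "0 < e" "e <= 1 / 2" and p: "1 < p"
    and K: "0 <= K" "!!s. 0 <= s ==> s <= 2 ==> \<bar>s powr p - (1 + p * (s - 1) + p * (p - 1) / 2 * (s - 1)^2)\<bar> <= K * \<bar>s - 1\<bar> ^ 3"
  shows "\<bar>phi (test_elt a e) (%u. u powr (p / 2)) - (1 + p * (p - 1) * e^2)\<bar> <= 9 * K * e ^ 3"
proof -
  let ?X = "test_elt a e" and ?h = "gen_sum a" and ?d = "delta 1 :: 'n free_group ell2"
  have sX: "sym_op ?X" unfolding test_elt_def by (intro sym_op_add sym_op_scaleR sym_op_id gen_sum_sym)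
  have pX: "pos_op ?X" unfolding pos_op_def
  proof (intro conjI allI sX)
    fix v :: "'n free_group ell2"
    have "\<bar>inner (?h v) v\<bar> <= norm (?h v) * norm v" by (rule Cauchy_Schwarz_ineq2)
    also have "... <= 2 * norm v * norm v" by (intro mult_right_mono gen_sum_moments(3) norm_ge_zero)
    finally have "e * \<bar>inner (?h v) v\<bar> <= e * (2 * norm v * norm v)" using e by (intro mult_left_mono) auto
    also have "... <= 1 / 2 * (2 * norm v * norm v)" using e by (intro mult_right_mono) auto
    finally have "\<bar>e * inner (?h v) v\<bar> <= norm v * norm v" using e by (simp add: abs_mult)
    thus "0 <= inner (?X v) v"
      by (simp add: test_elt_def blinfun.add_left blinfun.scaleR_left inner_add_left dot_square_norm power2_eq_square abs_le_iff)
  qed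
  have nX: "norm ?X <= 2"
  proof (rule norm_blinfun_bound)
    fix v :: "'n free_group ell2"
    have "norm (?X v) <= norm v + e * norm (?h v)"
      using norm_triangle_ineq[of v "e *\<^sub>R ?h v"] e by (simp add: test_elt_def blinfun.add_left blinfun.scaleR_left)
    also have "e * norm (?h v) <= 1 / 2 * (2 * norm v)" using e by (intro mult_mono gen_sum_moments(3)) auto
    finally show "norm (?X v) <= 2 * norm v" by simp
  qed simp
  have aX: "adj ?X = ?X" by (rule adj_sym[OF vN_bounded[OF test_elt_vN] sX])
  have c: "cont0 (%s. s powr p)" "cont0 (%s. s powr (p / 2))" using p by (auto intro: cont0_powr)
  have phi: "phi ?X (%u. u powr (p / 2)) = spf ?X ?d (%s. s powr p)"
  proof -
    have "?X oL ?X = pos_calc (%s. s * s) ?X"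
      using cf_mult[OF pX continuous_on_id continuous_on_id] by (simp add: cf_id pX)
    hence "pos_calc (%u. u powr (p / 2)) (?X oL ?X) = pos_calc (%s. (s * s) powr (p / 2)) ?X"
      by (simp add: cf_compose[OF pX c(2)] continuous_intros)
    also have "... = pos_calc (%s. s powr p) ?X" by (rule cf_cong) (simp add: powr_mult powr_add[symmetric])
    finally show ?thesis by (simp add: phi_def spf_def aX)
  qed
  let ?l = "[:-1, 1:] :: real poly"
  have l: "pev ?l ?X = e *\<^sub>R ?h" by (simp add: pev_pCons compose_linear test_elt_def)
  define m4 where "m4 = (norm (?h (?h ?d)))^2"
  have m4: "0 <= m4" "m4 <= 16"
  proof -
    have "norm (?h (?h ?d)) <= 4" using gen_sum_moments(3)[of a "?h ?d"] gen_sum_moments(3)[of a ?d] by simp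
    hence "m4 <= 4^2" unfolding m4_def by (intro power_mono) auto
    thus "m4 <= 16" by simp
  qed (simp add: m4_def)
  have ev: "spf ?X ?d (%s. c0 + c1 * (s - 1) + c2 * (s - 1)^2 + c4 * (s - 1) ^ 4) = c0 + c2 * (2 * e^2) + c4 * (e ^ 4 * m4)" for c0 c1 c2 c4
  proof -
    let ?r = "[:c0:] + smult c1 ?l + smult c2 (?l * ?l) + smult c4 ((?l * ?l) * (?l * ?l))"
    have "spf ?X ?d (%s. c0 + c1 * (s - 1) + c2 * (s - 1)^2 + c4 * (s - 1) ^ 4) = spf ?X ?d (poly ?r)"
      by (rule spf_cong) (simp add: power2_eq_square power4_eq_xxxx algebra_simps)
    also have "... = inner (pev ?r ?X ?d) ?d" by (simp add: spf_def cf_poly pX)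
    also have "pev ?r ?X ?d = c0 *\<^sub>R ?d + (c1 * e) *\<^sub>R ?h ?d + (c2 * e^2) *\<^sub>R ?h (?h ?d) + (c4 * e ^ 4) *\<^sub>R ?h (?h (?h (?h ?d)))"
      unfolding pev_add pev_smult pev_mult l pev_const
      by (simp add: compose_linear blinfun.add_left blinfun.scaleR_left power2_eq_square power4_eq_xxxx mult_ac)
    also have "inner ... ?d = c0 + c2 * (2 * e^2) + c4 * (e ^ 4 * m4)"
    proof -
      have "inner (?h (?h (?h (?h ?d)))) ?d = inner (?h (?h ?d)) (?h (?h ?d))" using sym_opD[OF gen_sum_sym] by metis
      thus ?thesis by (simp add: inner_add_left gen_sum_moments dot_square_norm m4_def)
    qed
    finally show ?thesis .
  qed
  \<comment> \<open>The absolute third moment is not polynomial; the mean of its neighbours with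
    weights e and 1/e replaces it by even moments of the same order in e.\<close>
  have cub: "K * \<bar>s - 1\<bar> ^ 3 <= K / 2 * e * (s - 1)^2 + K / 2 / e * (s - 1) ^ 4" for s :: real
  proof -
    have *: "w ^ 3 <= (e * w^2 + w ^ 4 / e) / 2" for w :: real
    proof -
      have "0 <= w^2 * (e - w)^2" by simp
      also have "w^2 * (e - w)^2 = ((e * w^2 + w ^ 4 / e) / 2 - w ^ 3) * (2 * e)"
        using e by (simp add: field_simps power2_eq_square power3_eq_cube power4_eq_xxxx)
      finally show ?thesis using e by (simp add: zero_le_mult_iff)
    qed
    have "\<bar>s - 1\<bar> ^ 3 <= (e * (s - 1)^2 + (s - 1) ^ 4 / e) / 2"
      using *[of "\<bar>s - 1\<bar>"] by (simp only: power2_abs power_even_abs_numeral even_numeral)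
    hence "K * \<bar>s - 1\<bar> ^ 3 <= K * ((e * (s - 1)^2 + (s - 1) ^ 4 / e) / 2)" using K(1) by (rule mult_left_mono)
    thus ?thesis by (simp add: algebra_simps add_divide_distrib)
  qed
  have err: "K / 2 * e * (2 * e^2) + K / 2 / e * (e ^ 4 * m4) <= 9 * K * e ^ 3"
  proof -
    have "K / 2 / e * (e ^ 4 * m4) <= K / 2 / e * (e ^ 4 * 16)" using m4 K(1) e by (intro mult_left_mono) auto
    also have "... = 8 * K * e ^ 3" using e by (simp add: field_simps power4_eq_xxxx power3_eq_cube)
    finally show ?thesis by (simp add: power2_eq_square power3_eq_cube)
  qed
  have cp: "cont0 (%s. c0 + c1 * (s - 1) + c2 * (s - 1)^2 + c4 * (s - 1) ^ 4)" for c0 c1 c2 c4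
    by (intro continuous_intros)
  let ?c = "p * (p - 1) / 2"
  have ce: "(?c + K / 2 * e) * (2 * e^2) = p * (p - 1) * e^2 + K / 2 * e * (2 * e^2)"
    "(?c - K / 2 * e) * (2 * e^2) = p * (p - 1) * e^2 - K / 2 * e * (2 * e^2)" by (simp_all add: field_simps)
  have "spf ?X ?d (%s. s powr p) <= spf ?X ?d (%s. 1 + p * (s - 1) + (?c + K / 2 * e) * (s - 1)^2 + K / 2 / e * (s - 1) ^ 4)"
  proof (rule spf_mono[OF pX c(1) cp])
    fix s assume "0 <= s" "s <= norm ?X"
    thus "s powr p <= 1 + p * (s - 1) + (?c + K / 2 * e) * (s - 1)^2 + K / 2 / e * (s - 1) ^ 4"
      using K(2)[of s] cub[of s] nX unfolding abs_le_iff distrib_right by linarith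
  qed
  moreover have "spf ?X ?d (%s. 1 + p * (s - 1) + (?c - K / 2 * e) * (s - 1)^2 + - (K / 2 / e) * (s - 1) ^ 4) <= spf ?X ?d (%s. s powr p)"
  proof (rule spf_mono[OF pX cp c(1)])
    fix s assume "0 <= s" "s <= norm ?X"
    thus "1 + p * (s - 1) + (?c - K / 2 * e) * (s - 1)^2 + - (K / 2 / e) * (s - 1) ^ 4 <= s powr p"
      using K(2)[of s] cub[of s] nX unfolding abs_le_iff left_diff_distrib by linarith
  qed
  ultimately show ?thesis using err unfolding ev phi abs_le_iff ce by (auto simp only: mult_minus_left)
qed

lemma poisson_test_elt:
  fixes a :: "'n::finite"
  assumes t: "0 <= t"
  shows "poisson t (test_elt a e) = test_elt a (exp (- t) * e)"
proof (rule poisson_eqI[OF test_elt_vN t test_elt_vN])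
  fix g :: "'n free_group"
  have c: "coef (test_elt a r) g = (if g = 1 then 1 else 0) + of_real r * ((if g = gen a then 1 else 0) + (if g = inverse (gen a) then 1 else 0))" for r
    using coef_lreg[of 1 g] by (simp add: test_elt_def gen_sum_def coef_add coef_scaleR coef_lreg)
  have w: "word_length (1 :: 'n free_group) = 0" "word_length (gen a) = 1" "word_length (inverse (gen a)) = 1"
    by (simp_all add: word_length_word_of one_free_group.rep_eq gen_props)
  show "coef (test_elt a (exp (- t) * e)) g = of_real (exp (- t) ^ word_length g) * coef (test_elt a e) g"
    unfolding c using gen_props(3-5)[of a] by (auto simp: w)
qed

text \<open>\<open>poisson t\<close> multiplies the parameter of the test element by exp(-t).
  Raising the inequality of norms to the power q and comparing the coefficients of e^2 gives q (q -
  1) exp(-t)^2 <= q (p - 1).\<close>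

theorem hypercontractive_necessary:
  assumes H: "!!x :: 'n::finite free_group op. x \<in> group_vN ==> pnorm q (poisson t x) <= pnorm p x"
    and p: "1 < p" "p <= q" and t: "0 <= t"
  shows "(q - 1) * (exp (- t))^2 <= p - 1"
proof -
  have q: "1 < q" using p by simp
  fix a :: 'n
  let ?s = "exp (- t)"
  have s: "0 < ?s" "?s <= 1" using t by auto
  obtain K where K: "0 <= K" "!!s. 0 <= s ==> s <= 2 ==> \<bar>s powr p - (1 + p * (s - 1) + p * (p - 1) / 2 * (s - 1)^2)\<bar> <= K * \<bar>s - 1\<bar> ^ 3"
    using powr_taylor[OF p(1)] by blast
  obtain M where M: "0 <= M" "!!s. 0 <= s ==> s <= 2 ==> \<bar>s powr q - (1 + q * (s - 1) + q * (q - 1) / 2 * (s - 1)^2)\<bar> <= M * \<bar>s - 1\<bar> ^ 3"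
    using powr_taylor[OF q] by blast
  define C where "C = 9 * K / p"
  have key: "(q * (q - 1) * (?s * e)^2 - 9 * M * (?s * e) ^ 3) / e^2 <= ((1 + (p - 1) * e^2 + C * e ^ 3) powr q - 1) / e^2"
    if e: "0 < e" "e < 1 / 2" for e
  proof -
    have se: "0 < ?s * e" "?s * e <= 1 / 2"
    proof -
      have "?s * e <= 1 * e" using s e by (intro mult_right_mono) auto
      thus "?s * e <= 1 / 2" using e by linarith
    qed (use s e in simp)
    define P where "P = phi (test_elt a e) (%u. u powr (p / 2))"
    define R where "R = phi (test_elt a (?s * e)) (%u. u powr (q / 2))"
    have P: "P <= 1 + p * (p - 1) * e^2 + 9 * K * e ^ 3" "0 <= P"
      using test_elt_expansion[OF _ _ p(1) K, of e a] e p test_elt_vN[of a e]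
      by (auto simp: P_def abs_le_iff intro!: phi_powr_nonneg)
    have R: "1 + q * (q - 1) * (?s * e)^2 - 9 * M * (?s * e) ^ 3 <= R" "0 <= R"
      using test_elt_expansion[OF se q M, of a] q test_elt_vN[of a "?s * e"]
      by (auto simp: R_def abs_le_iff intro!: phi_powr_nonneg)
    have "R powr (1 / q) <= P powr (1 / p)"
      using H[OF test_elt_vN, of a e] p q by (simp add: poisson_test_elt t pnorm_eq test_elt_vN P_def R_def)
    also have "... <= 1 + (p - 1) * e^2 + C * e ^ 3"
    \<comment> \<open>Only an upper bound for the p-th root is wanted; concavity, (1 + v)^(1/p) <= 1
      + v/p, supplies it and accounts for \<open>C = 9 * K / p\<close>.\<close>
    proof -
      let ?v = "p * (p - 1) * e^2 + 9 * K * e ^ 3"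
      have eq: "(1 / p) * (1 + v) + (1 - 1 / p) * 1 = 1 + v / p" for v by (simp add: algebra_simps add_divide_distrib)
      have v: "0 <= ?v" using p e K(1) by simp
      have "P powr (1 / p) <= (1 + ?v) powr (1 / p)" using P p by (intro powr_mono2) (auto simp: add.assoc)
      also have "... <= (1 / p) * (1 + ?v) + (1 - 1 / p) * 1"
        using Youngs_inequality_0[of "1 / p" "1 - 1 / p" "1 + ?v" 1] p v by simp
      also have "... = 1 + ?v / p" unfolding eq ..
      also have "?v / p = (p - 1) * e^2 + C * e ^ 3" using p by (simp add: C_def add_divide_distrib)
      finally show ?thesis by simp
    qed
    finally have "(R powr (1 / q)) powr q <= (1 + (p - 1) * e^2 + C * e ^ 3) powr q" using q by (intro powr_mono2) auto
    moreover have "(R powr (1 / q)) powr q = R" using R(2) q by (simp add: powr_powr)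
    ultimately have "q * (q - 1) * (?s * e)^2 - 9 * M * (?s * e) ^ 3 <= (1 + (p - 1) * e^2 + C * e ^ 3) powr q - 1"
      using R(1) by linarith
    thus ?thesis using e by (intro divide_right_mono) auto
  qed
  have "q * (q - 1) * ?s^2 <= q * (p - 1)"
  proof (rule tendsto_le[of "at_right (0 :: real)"])
    have p1: "p - 1 > 0" using p by simp
    show "((%e. ((1 + (p - 1) * e^2 + C * e ^ 3) powr q - 1) / e^2) \<longlongrightarrow> q * (p - 1)) (at_right 0)"
      using p1 q by real_asymp
    show "((%e. (q * (q - 1) * (?s * e)^2 - 9 * M * (?s * e) ^ 3) / e^2) \<longlongrightarrow> q * (q - 1) * ?s^2) (at_right 0)"
    proof (rule Lim_transform_eventually)
      show "((%e. q * (q - 1) * ?s^2 - 9 * M * ?s ^ 3 * e) \<longlongrightarrow> q * (q - 1) * ?s^2) (at_right 0)"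
        by (auto intro!: tendsto_eq_intros)
      show "\<forall>\<^sub>F e in at_right 0. q * (q - 1) * ?s^2 - 9 * M * ?s ^ 3 * e = (q * (q - 1) * (?s * e)^2 - 9 * M * (?s * e) ^ 3) / e^2"
        by (rule eventually_mono[OF eventually_at_right_less]) (simp add: field_simps power2_eq_square power3_eq_cube)
    qed
    show "\<forall>\<^sub>F e in at_right 0. (q * (q - 1) * (?s * e)^2 - 9 * M * (?s * e) ^ 3) / e^2 <= ((1 + (p - 1) * e^2 + C * e ^ 3) powr q - 1) / e^2"
      by (rule eventually_mono[OF eventually_at_right_real[of 0 "1 / 2"]]) (use key in auto)
  qed simp
  hence "q * ((q - 1) * ?s^2) <= q * (p - 1)" by (simp only: mult.assoc)
  thus ?thesis using q by simp
qed

theorem theorem1p1: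
  fixes p q t :: real
  assumes "CARD('n::finite) \<ge> 2"
    and "1 < p" and "p \<le> q" and "0 \<le> t"
  shows "(\<forall>x :: 'n Lp_elem \<in> Lp p.
           \<exists>y \<in> Lp q. Lp_incl p y = Lp_poisson p t x \<and> Lp_norm q y \<le> Lp_norm p x)
         \<longleftrightarrow> t \<ge> 1 / 2 * ln ((q - 1) / (p - 1))"
proof -
  have "t >= 1 / 2 * ln ((q - 1) / (p - 1)) \<longleftrightarrow> ln ((q - 1) / (p - 1)) <= 2 * t" by linarith
  also have "... \<longleftrightarrow> (q - 1) / (p - 1) <= exp (2 * t)"
    using assms by (subst exp_le_cancel_iff[symmetric], subst exp_ln) auto
  also have "exp (2 * t) = inverse ((exp (- t))^2)" by (simp add: exp_minus exp_double power_inverse)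
  also have "(q - 1) / (p - 1) <= inverse ((exp (- t))^2) \<longleftrightarrow> (q - 1) * (exp (- t))^2 <= p - 1"
    using assms by (simp add: field_simps)
  finally have iff: "t >= 1 / 2 * ln ((q - 1) / (p - 1)) \<longleftrightarrow> (q - 1) * (exp (- t))^2 <= p - 1" .
  show ?thesis unfolding iff
  proof
    assume "\<forall>x :: 'n Lp_elem \<in> Lp p. \<exists>y \<in> Lp q. Lp_incl p y = Lp_poisson p t x \<and> Lp_norm q y <= Lp_norm p x"
    from hypercontractive_vN_of_Lp[OF this assms(2-4)]
    show "(q - 1) * (exp (- t))^2 <= p - 1" by (rule hypercontractive_necessary[OF _ assms(2-4)])
  next
    assume "(q - 1) * (exp (- t))^2 <= p - 1"
    thus "\<forall>x :: 'n Lp_elem \<in> Lp p. \<exists>y \<in> Lp q. Lp_incl p y = Lp_poisson p t x \<and> Lp_norm q y <= Lp_norm p x"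
      using hypercontractive_Lp assms by blast
  qed
qed

end
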